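(* Let $p:(\Sigma,\pi_\Sigma)\to(M,\pi_M)$ be a Poisson submersion with Poisson fibres, with vertical bundle $V=\ker p_*$. The following assertions are equivalent: (i) $p:(\Sigma,\pi_\Sigma)\to(M,\pi_M)$ is an orthogonal pencil; (ii) there is a Poisson structure $\pi_H$ on $\Sigma$ whose symplectic leaves are those of the singular foliation $\mathcal S_H$ (with their canonical symplectic forms); (iii) the Poisson structures on the fibres assemble into a vertical Poisson structure: there is a smooth Poisson bivector $\pi_V\in\Gamma(\wedge^2V)$ whose restriction to each fibre $p^{-1}(x)$ is the Poisson structure induced on $p^{-1}(x)$ by $\pi_\Sigma$; (iv) the linear family $\mathrm{Gr}(\pi_\Sigma)\cap(V\oplus T^*\Sigma)+V^\circ\subset T\Sigma\oplus T^*\Sigma$ is a (smooth) vector bundle.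
   Context: Everything is smooth. For a Poisson manifold $(M,\pi_M)$, $\pi_M^\sharp:T^*M\to TM$ is contraction with $\pi_M$, $\mathrm{Gr}(\pi_M)=\{\pi_M^\sharp(\xi)+\xi : \xi\in T^*M\}\subset TM\oplus T^*M$, and $\mathrm H_f=\pi_M^\sharp(df)$ is the Hamiltonian vector field of a (possibly time-dependent) function $f$, with local flow $\phi^{t,s}_{\mathrm H_f}$. $V^\circ\subset T^*\Sigma$ is the annihilator of $V$. A Poisson submersion is a submersion between Poisson manifolds which is a Poisson map. An embedded submanifold $i:X\to M$ is a Poisson-Dirac submanifold of $(M,\pi_M)$ if $i^!\mathrm{Gr}(\pi_M):=\{u+i^*\xi : i_*u=\pi_M^\sharp(\xi)\}$ equals $\mathrm{Gr}(\pi_X)$ for a (unique, automatically Poisson) smooth bivector $\pi_X$ on $X$, called the induced Poisson structure. A submersion $p:(\Sigma,\pi_\Sigma)\to M$ has Poisson fibres if each fibre is a Poisson-Dirac submanifold of $(\Sigma,\pi_\Sigma)$. Orthogonal pencil: a Poisson submersion $p:(\Sigma,\pi_\Sigma)\to(M,\pi_M)$ such that $\pi_\Sigma=\pi_V+\pi_H$ with $\pi_V,\pi_H$ commuting Poisson structures on $\Sigma$ (i.e. $[\pi_V,\pi_V]=[\pi_V,\pi_H]=[\pi_H,\pi_H]=0$ for the Schouten bracket), $\pi_V\in\Gamma(\wedge^2V)$, and $\pi_H^\sharp(T^*\Sigma)\cap V=0$. Singular foliation $\mathcal S_H$: for a Poisson submersion with Poisson fibres, two points $x_0,x_1\in\Sigma$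 lie in the same leaf of $\mathcal S_H$ iff there is a time-dependent function $f\in C^\infty_c(M\times I)$, $I=[0,1]$, with $\phi^{1,0}_{\mathrm H_{f\circ p}}(x_0)=x_1$. This is a singular foliation with tangent spaces $\pi_\Sigma^\sharp(V^\circ)$; each leaf is a submanifold of a symplectic leaf of $(\Sigma,\pi_\Sigma)$, and its canonical symplectic form is the restriction of the symplectic form of that leaf. *)

theory Defs
  imports "HOL-Analysis.Analysis"
begin

section \<open>Smooth manifolds\<close>

text \<open>On open sets: the Frechet derivative in every direction can be taken arbitrarily often
  (in finite dimension this is the usual class $C^k$).\<close>

primrec Ck_on_open :: "nat \<Rightarrow> ('e::euclidean_space \<Rightarrow> 'r::real_normed_vector) \<Rightarrow> 'e set \<Rightarrow> bool" where
  "Ck_on_open 0 f U \<longleftrightarrow> continuous_on U f"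
| "Ck_on_open (Suc k) f U \<longleftrightarrow>
     (\<forall>z\<in>U. f differentiable (at z)) \<and> (\<forall>v. Ck_on_open k (\<lambda>z. frechet_derivative f (at z) v) U)"

text \<open>On arbitrary sets: locally the restriction of a smooth map. This covers open subsets of a
  linear subspace and products of these with the closed interval $[0,1]$.\<close>

definition smooth_on :: "'e::euclidean_space set \<Rightarrow> ('e \<Rightarrow> 'r::real_normed_vector) \<Rightarrow> bool" where
  "smooth_on S f \<longleftrightarrow>
     (\<forall>z\<in>S. \<exists>U g. open U \<and> z \<in> U \<and> (\<forall>k. Ck_on_open k g U) \<and> (\<forall>y\<in>S \<inter> U. f y = g y))"

text \<open>The model space is a linear subspace of \<open>'e\<close>, not \<open>'e\<close> itself. So dimension 0 is allowed,
  and submanifolds of lower dimension are again objects of the same type.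
  A chart is a pair of its domain and its coordinate map.\<close>

record ('a, 'e) mfd =
  Top :: "'a topology"
  Model :: "'e set"
  Atlas :: "('a set \<times> ('a \<Rightarrow> 'e)) set"

abbreviation pts :: "('a, 'e) mfd \<Rightarrow> 'a set" where
  "pts M \<equiv> topspace (Top M)"

definition smooth_manifold :: "('a, 'e::euclidean_space) mfd \<Rightarrow> bool" where
  "smooth_manifold M \<longleftrightarrow>
     Hausdorff_space (Top M) \<and> second_countable (Top M) \<and> subspace (Model M) \<and>
     (\<Union>(U, \<phi>)\<in>Atlas M. U) = pts M \<and>
     (\<forall>(U, \<phi>)\<in>Atlas M.
        openin (Top M) U \<and> openin (top_of_set (Model M)) (\<phi> ` U) \<and>
        homeomorphic_map (subtopology (Top M) U) (top_of_set (\<phi> ` U)) \<phi>) \<and>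
     (\<forall>(U, \<phi>)\<in>Atlas M. \<forall>(V, \<psi>)\<in>Atlas M. smooth_on (\<phi> ` (U \<inter> V)) (\<psi> \<circ> inv_into U \<phi>))"

definition smooth_fun_on :: "('a, 'e::euclidean_space) mfd \<Rightarrow> 'a set \<Rightarrow> ('a \<Rightarrow> real) \<Rightarrow> bool" where
  "smooth_fun_on M W f \<longleftrightarrow> (\<forall>(U, \<phi>)\<in>Atlas M. smooth_on (\<phi> ` (U \<inter> W)) (f \<circ> inv_into U \<phi>))"

text \<open>Functions on \<open>M\<close> are normalised to be 0 outside \<open>M\<close>, so that equality is equality on \<open>M\<close>.\<close>

definition Cinf :: "('a, 'e::euclidean_space) mfd \<Rightarrow> ('a \<Rightarrow> real) set" where
  "Cinf M = {f. smooth_fun_on M (pts M) f \<and> (\<forall>x. x \<notin> pts M \<longrightarrow> f x = 0)}"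

definition smooth_map ::
    "('a, 'e::euclidean_space) mfd \<Rightarrow> ('b, 'f::euclidean_space) mfd \<Rightarrow> ('a \<Rightarrow> 'b) \<Rightarrow> bool" where
  "smooth_map M N p \<longleftrightarrow>
     continuous_map (Top M) (Top N) p \<and>
     (\<forall>(U, \<phi>)\<in>Atlas M. \<forall>(V, \<psi>)\<in>Atlas N.
        smooth_on (\<phi> ` {x \<in> U. p x \<in> V}) (\<psi> \<circ> p \<circ> inv_into U \<phi>))"

definition pullback_fun :: "('a, 'e) mfd \<Rightarrow> ('a \<Rightarrow> 'b) \<Rightarrow> ('b \<Rightarrow> real) \<Rightarrow> 'a \<Rightarrow> real" where
  "pullback_fun M p h = (\<lambda>x. if x \<in> pts M then h (p x) else 0)"


section \<open>Tangent and cotangent spaces\<close>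

text \<open>Tangent vectors are derivations of $C^\infty(M)$ at a point, covectors are linear functionals on
  the tangent space; both are normalised to be 0 outside their domain.\<close>

type_synonym 'a tvec = "('a \<Rightarrow> real) \<Rightarrow> real"
type_synonym 'a covec = "'a tvec \<Rightarrow> real"

definition tangent :: "('a, 'e::euclidean_space) mfd \<Rightarrow> 'a \<Rightarrow> 'a tvec set" where
  "tangent M x = {v.
     (\<forall>f\<in>Cinf M. \<forall>g\<in>Cinf M. v (\<lambda>y. f y + g y) = v f + v g) \<and>
     (\<forall>f\<in>Cinf M. \<forall>c. v (\<lambda>y. c * f y) = c * v f) \<and>
     (\<forall>f\<in>Cinf M. \<forall>g\<in>Cinf M. v (\<lambda>y. f y * g y) = f x * v g + g x * v f) \<and>
     (\<forall>f. f \<notin> Cinf M \<longrightarrow> v f = 0)}"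

definition cotangent :: "('a, 'e::euclidean_space) mfd \<Rightarrow> 'a \<Rightarrow> 'a covec set" where
  "cotangent M x = {\<xi>.
     (\<forall>v\<in>tangent M x. \<forall>w\<in>tangent M x. \<xi> (\<lambda>f. v f + w f) = \<xi> v + \<xi> w) \<and>
     (\<forall>v\<in>tangent M x. \<forall>c. \<xi> (\<lambda>f. c * v f) = c * \<xi> v) \<and>
     (\<forall>v. v \<notin> tangent M x \<longrightarrow> \<xi> v = 0)}"

definition dif :: "('a, 'e::euclidean_space) mfd \<Rightarrow> ('a \<Rightarrow> real) \<Rightarrow> 'a \<Rightarrow> 'a covec" where
  "dif M f x = (\<lambda>v. if v \<in> tangent M x then v f else 0)"

definition push ::
    "('a, 'e::euclidean_space) mfd \<Rightarrow> ('b, 'f::euclidean_space) mfd \<Rightarrow> ('a \<Rightarrow> 'b) \<Rightarrow> 'a tvec \<Rightarrow> 'b tvec" where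
  "push M N p v = (\<lambda>h. if h \<in> Cinf N then v (pullback_fun M p h) else 0)"

definition pull_covec ::
    "('a, 'e::euclidean_space) mfd \<Rightarrow> ('b, 'f::euclidean_space) mfd \<Rightarrow> ('a \<Rightarrow> 'b) \<Rightarrow> 'a \<Rightarrow> 'b covec \<Rightarrow> 'a covec" where
  "pull_covec M N p x \<xi> = (\<lambda>v. if v \<in> tangent M x then \<xi> (push M N p v) else 0)"

definition submersion ::
    "('a, 'e::euclidean_space) mfd \<Rightarrow> ('b, 'f::euclidean_space) mfd \<Rightarrow> ('a \<Rightarrow> 'b) \<Rightarrow> bool" where
  "submersion S M p \<longleftrightarrow>
     smooth_manifold S \<and> smooth_manifold M \<and> smooth_map S M p \<and>
     (\<forall>x\<in>pts S. push S M p ` tangent S x = tangent M (p x))"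

definition embedded_submanifold ::
    "('a, 'e::euclidean_space) mfd \<Rightarrow> ('a, 'f::euclidean_space) mfd \<Rightarrow> bool" where
  "embedded_submanifold X M \<longleftrightarrow>
     smooth_manifold X \<and> smooth_manifold M \<and> pts X \<subseteq> pts M \<and>
     Top X = subtopology (Top M) (pts X) \<and> smooth_map X M id \<and>
     (\<forall>x\<in>pts X. inj_on (push X M id) (tangent X x))"

definition vert ::
    "('a, 'e::euclidean_space) mfd \<Rightarrow> ('b, 'f::euclidean_space) mfd \<Rightarrow> ('a \<Rightarrow> 'b) \<Rightarrow> 'a \<Rightarrow> 'a tvec set" where
  "vert S M p x = {v \<in> tangent S x. push S M p v = (\<lambda>h. 0)}"

definition vert_ann ::
    "('a, 'e::euclidean_space) mfd \<Rightarrow> ('b, 'f::euclidean_space) mfd \<Rightarrow> ('a \<Rightarrow> 'b) \<Rightarrow> 'a \<Rightarrow> 'a covec set" where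
  "vert_ann S M p x = {\<xi> \<in> cotangent S x. \<forall>v\<in>vert S M p x. \<xi> v = 0}"


section \<open>Bivectors and Poisson structures\<close>

text \<open>An element of $\wedge^2 T_xM$ is regarded as a skew form on $T^*_xM$, with
  $(u\wedge w)(\xi,\eta)=\xi(u)\eta(w)-\xi(w)\eta(u)$; only its values on $T^*_xM$ matter.\<close>

type_synonym 'a bivector = "'a \<Rightarrow> 'a covec \<Rightarrow> 'a covec \<Rightarrow> real"

definition wedge2 ::
    "('a, 'e::euclidean_space) mfd \<Rightarrow> 'a \<Rightarrow> 'a tvec set \<Rightarrow> ('a covec \<Rightarrow> 'a covec \<Rightarrow> real) set" where
  "wedge2 M x W = {b. \<exists>ps. set ps \<subseteq> W \<times> W \<and>
     (\<forall>\<xi>\<in>cotangent M x. \<forall>\<eta>\<in>cotangent M x.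
        b \<xi> \<eta> = (\<Sum>(u, w)\<leftarrow>ps. \<xi> u * \<eta> w - \<xi> w * \<eta> u))}"

definition bracket ::
    "('a, 'e::euclidean_space) mfd \<Rightarrow> 'a bivector \<Rightarrow> ('a \<Rightarrow> real) \<Rightarrow> ('a \<Rightarrow> real) \<Rightarrow> 'a \<Rightarrow> real" where
  "bracket M \<pi> f g = (\<lambda>x. if x \<in> pts M then \<pi> x (dif M f x) (dif M g x) else 0)"

definition smooth_bivector :: "('a, 'e::euclidean_space) mfd \<Rightarrow> 'a bivector \<Rightarrow> bool" where
  "smooth_bivector M \<pi> \<longleftrightarrow>
     (\<forall>x\<in>pts M. \<pi> x \<in> wedge2 M x (tangent M x)) \<and>
     (\<forall>f\<in>Cinf M. \<forall>g\<in>Cinf M. bracket M \<pi> f g \<in> Cinf M)"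

text \<open>The Schouten bracket of two bivectors is a trivector; this is its value on $(df,dg,dh)$
  (up to a nonzero constant factor, which depends on conventions).\<close>

definition schouten ::
    "('a, 'e::euclidean_space) mfd \<Rightarrow> 'a bivector \<Rightarrow> 'a bivector \<Rightarrow>
     ('a \<Rightarrow> real) \<Rightarrow> ('a \<Rightarrow> real) \<Rightarrow> ('a \<Rightarrow> real) \<Rightarrow> 'a \<Rightarrow> real" where
  "schouten M P Q f g h x =
     bracket M P (bracket M Q f g) h x + bracket M P (bracket M Q g h) f x + bracket M P (bracket M Q h f) g x +
     bracket M Q (bracket M P f g) h x + bracket M Q (bracket M P g h) f x + bracket M Q (bracket M P h f) g x"

definition schouten_vanishes :: "('a, 'e::euclidean_space) mfd \<Rightarrow> 'a bivector \<Rightarrow> 'a bivector \<Rightarrow> bool" where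
  "schouten_vanishes M P Q \<longleftrightarrow>
     (\<forall>f\<in>Cinf M. \<forall>g\<in>Cinf M. \<forall>h\<in>Cinf M. \<forall>x\<in>pts M. schouten M P Q f g h x = 0)"

definition poisson_structure :: "('a, 'e::euclidean_space) mfd \<Rightarrow> 'a bivector \<Rightarrow> bool" where
  "poisson_structure M \<pi> \<longleftrightarrow> smooth_bivector M \<pi> \<and> schouten_vanishes M \<pi> \<pi>"

definition poisson_manifold :: "('a, 'e::euclidean_space) mfd \<Rightarrow> 'a bivector \<Rightarrow> bool" where
  "poisson_manifold M \<pi> \<longleftrightarrow> smooth_manifold M \<and> poisson_structure M \<pi>"

text \<open>$\pi^\sharp(\xi)=\pi(\xi,\cdot)$.\<close>

definition sharp :: "('a, 'e::euclidean_space) mfd \<Rightarrow> 'a bivector \<Rightarrow> 'a \<Rightarrow> 'a covec \<Rightarrow> 'a tvec" where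
  "sharp M \<pi> x \<xi> = (\<lambda>f. if f \<in> Cinf M then \<pi> x \<xi> (dif M f x) else 0)"

definition Gr :: "('a, 'e::euclidean_space) mfd \<Rightarrow> 'a bivector \<Rightarrow> 'a \<Rightarrow> ('a tvec \<times> 'a covec) set" where
  "Gr M \<pi> x = (\<lambda>\<xi>. (sharp M \<pi> x \<xi>, \<xi>)) ` cotangent M x"

definition poisson_submersion ::
    "('a, 'e::euclidean_space) mfd \<Rightarrow> 'a bivector \<Rightarrow> ('b, 'f::euclidean_space) mfd \<Rightarrow> 'b bivector \<Rightarrow>
     ('a \<Rightarrow> 'b) \<Rightarrow> bool" where
  "poisson_submersion S \<pi>S M \<pi>M p \<longleftrightarrow>
     poisson_manifold S \<pi>S \<and> poisson_manifold M \<pi>M \<and> submersion S M p \<and>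
     (\<forall>x\<in>pts S. \<forall>\<xi>\<in>cotangent M (p x). \<forall>\<eta>\<in>cotangent M (p x).
        \<pi>S x (pull_covec S M p x \<xi>) (pull_covec S M p x \<eta>) = \<pi>M (p x) \<xi> \<eta>)"

text \<open>\<open>X\<close> is a Poisson-Dirac submanifold with induced bivector \<open>\<pi>X\<close>: the pullback of the graph
  under the inclusion is the graph of \<open>\<pi>X\<close>.\<close>

definition Gr_restrict ::
    "('a, 'e::euclidean_space) mfd \<Rightarrow> ('a, 'f::euclidean_space) mfd \<Rightarrow> 'a bivector \<Rightarrow> 'a \<Rightarrow>
     ('a tvec \<times> 'a covec) set" where
  "Gr_restrict X M \<pi> x = {(u, pull_covec X M id x \<xi>) | u \<xi>.
     u \<in> tangent X x \<and> \<xi> \<in> cotangent M x \<and> push X M id u = sharp M \<pi> x \<xi>}"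

definition poisson_dirac ::
    "('a, 'e::euclidean_space) mfd \<Rightarrow> 'a bivector \<Rightarrow> ('a, 'f::euclidean_space) mfd \<Rightarrow> 'a bivector \<Rightarrow> bool" where
  "poisson_dirac X \<pi>X M \<pi> \<longleftrightarrow>
     embedded_submanifold X M \<and> smooth_bivector X \<pi>X \<and>
     (\<forall>x\<in>pts X. Gr_restrict X M \<pi> x = Gr X \<pi>X x)"

definition fibre :: "('a, 'e) mfd \<Rightarrow> ('a \<Rightarrow> 'b) \<Rightarrow> 'b \<Rightarrow> 'a set" where
  "fibre S p b = {x \<in> pts S. p x = b}"

definition poisson_fibres ::
    "('a, 'e::euclidean_space) mfd \<Rightarrow> 'a bivector \<Rightarrow> ('b, 'f::euclidean_space) mfd \<Rightarrow> ('a \<Rightarrow> 'b) \<Rightarrow> bool" where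
  "poisson_fibres S \<pi>S M p \<longleftrightarrow>
     (\<forall>b\<in>pts M. \<exists>(X :: ('a, 'e) mfd) \<pi>X. pts X = fibre S p b \<and> poisson_dirac X \<pi>X S \<pi>S)"


section \<open>Hamiltonian flows and leaves\<close>

text \<open>$C^\infty_c(M\times I)$ with $I=[0,1]$; only the values on $M\times I$ matter.\<close>

definition Cc_time :: "('a, 'e::euclidean_space) mfd \<Rightarrow> ('a \<Rightarrow> real \<Rightarrow> real) set" where
  "Cc_time M = {f.
     (\<forall>(U, \<phi>)\<in>Atlas M. smooth_on (\<phi> ` U \<times> {0..1}) (\<lambda>(z, t). f (inv_into U \<phi> z) t)) \<and>
     compactin (prod_topology (Top M) (top_of_set {0..1}))
       (prod_topology (Top M) (top_of_set {0..1}) closure_of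
          {(x, t). x \<in> pts M \<and> t \<in> {0..1} \<and> f x t \<noteq> 0})}"

text \<open>\<open>flows_to M Y x0 x1\<close> means $\phi^{1,0}_Y(x_0)=x_1$: the integral curve of the time-dependent vector field
  \<open>Y\<close> starting at \<open>x0\<close> at time 0 is defined on $[0,1]$ and is at \<open>x1\<close> at time 1.\<close>

definition flows_to :: "('a, 'e::euclidean_space) mfd \<Rightarrow> (real \<Rightarrow> 'a \<Rightarrow> 'a tvec) \<Rightarrow> 'a \<Rightarrow> 'a \<Rightarrow> bool" where
  "flows_to M Y x0 x1 \<longleftrightarrow> (\<exists>c. pathin (Top M) c \<and> c 0 = x0 \<and> c 1 = x1 \<and>
     (\<forall>t\<in>{0..1}. \<forall>h\<in>Cinf M.
        ((\<lambda>s. h (c s)) has_real_derivative Y t (c t) h) (at t within {0..1})))"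

definition ham :: "('a, 'e::euclidean_space) mfd \<Rightarrow> 'a bivector \<Rightarrow> ('a \<Rightarrow> real) \<Rightarrow> 'a \<Rightarrow> 'a tvec" where
  "ham M \<pi> f x = sharp M \<pi> x (dif M f x)"

definition SH_leaf ::
    "('a, 'e::euclidean_space) mfd \<Rightarrow> 'a bivector \<Rightarrow> ('b, 'f::euclidean_space) mfd \<Rightarrow> ('a \<Rightarrow> 'b) \<Rightarrow> 'a \<Rightarrow> 'a set" where
  "SH_leaf S \<pi>S M p x0 = {x1. \<exists>f\<in>Cc_time M.
     flows_to S (\<lambda>t. ham S \<pi>S (pullback_fun S p (\<lambda>b. f b t))) x0 x1}"

definition SH_tangent ::
    "('a, 'e::euclidean_space) mfd \<Rightarrow> 'a bivector \<Rightarrow> ('b, 'f::euclidean_space) mfd \<Rightarrow> ('a \<Rightarrow> 'b) \<Rightarrow> 'a \<Rightarrow> 'a tvec set" where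
  "SH_tangent S \<pi>S M p x = sharp S \<pi>S x ` vert_ann S M p x"

text \<open>The symplectic leaves of a Poisson manifold are the orbits of its time-dependent compactly
  supported Hamiltonians.\<close>

definition symplectic_leaf :: "('a, 'e::euclidean_space) mfd \<Rightarrow> 'a bivector \<Rightarrow> 'a \<Rightarrow> 'a set" where
  "symplectic_leaf M \<pi> x0 = {x1. \<exists>f\<in>Cc_time M.
     flows_to M (\<lambda>t. ham M \<pi> (pullback_fun M id (\<lambda>y. f y t))) x0 x1}"

definition leaf_tangent :: "('a, 'e::euclidean_space) mfd \<Rightarrow> 'a bivector \<Rightarrow> 'a \<Rightarrow> 'a tvec set" where
  "leaf_tangent M \<pi> x = sharp M \<pi> x ` cotangent M x"

text \<open>$\omega(\pi^\sharp\xi,\pi^\sharp\eta)=\pi(\xi,\eta)$. The opposite sign convention changes all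
  these forms by the same sign.\<close>

definition leaf_form :: "('a, 'e::euclidean_space) mfd \<Rightarrow> 'a bivector \<Rightarrow> 'a \<Rightarrow> 'a tvec \<Rightarrow> 'a tvec \<Rightarrow> real" where
  "leaf_form M \<pi> x u w = (THE r. \<exists>\<xi>\<in>cotangent M x. \<exists>\<eta>\<in>cotangent M x.
     u = sharp M \<pi> x \<xi> \<and> w = sharp M \<pi> x \<eta> \<and> r = \<pi> x \<xi> \<eta>)"

text \<open>Leaves are weakly embedded, so the smooth structure of a leaf is determined by the underlying
  set; two symplectic foliations are compared through their leaves as sets, the
  tangent spaces of these, and the leafwise forms. The canonical form on a leaf of
  $\mathcal S_H$ is the restriction of \<open>leaf_form S \<pi>S\<close>.\<close>

definition leaves_are_SH ::
    "('a, 'e::euclidean_space) mfd \<Rightarrow> 'a bivector \<Rightarrow> ('b, 'f::euclidean_space) mfd \<Rightarrow> ('a \<Rightarrow> 'b) \<Rightarrow>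
     'a bivector \<Rightarrow> bool" where
  "leaves_are_SH S \<pi>S M p \<pi>H \<longleftrightarrow>
     (\<forall>x\<in>pts S.
        symplectic_leaf S \<pi>H x = SH_leaf S \<pi>S M p x \<and>
        leaf_tangent S \<pi>H x = SH_tangent S \<pi>S M p x \<and>
        (\<forall>u\<in>SH_tangent S \<pi>S M p x. \<forall>w\<in>SH_tangent S \<pi>S M p x.
           leaf_form S \<pi>H x u w = leaf_form S \<pi>S x u w))"


section \<open>Orthogonal pencils and vertical Poisson structures\<close>

definition vertical_bivector ::
    "('a, 'e::euclidean_space) mfd \<Rightarrow> ('b, 'f::euclidean_space) mfd \<Rightarrow> ('a \<Rightarrow> 'b) \<Rightarrow> 'a bivector \<Rightarrow> bool" where
  "vertical_bivector S M p \<pi>V \<longleftrightarrow>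
     smooth_bivector S \<pi>V \<and> (\<forall>x\<in>pts S. \<pi>V x \<in> wedge2 S x (vert S M p x))"

definition orthogonal_pencil ::
    "('a, 'e::euclidean_space) mfd \<Rightarrow> 'a bivector \<Rightarrow> ('b, 'f::euclidean_space) mfd \<Rightarrow> 'b bivector \<Rightarrow>
     ('a \<Rightarrow> 'b) \<Rightarrow> bool" where
  "orthogonal_pencil S \<pi>S M \<pi>M p \<longleftrightarrow>
     poisson_submersion S \<pi>S M \<pi>M p \<and>
     (\<exists>\<pi>V \<pi>H.
        poisson_structure S \<pi>V \<and> poisson_structure S \<pi>H \<and> schouten_vanishes S \<pi>V \<pi>H \<and>
        (\<forall>x\<in>pts S. \<forall>\<xi>\<in>cotangent S x. \<forall>\<eta>\<in>cotangent S x. \<pi>S x \<xi> \<eta> = \<pi>V x \<xi> \<eta> + \<pi>H x \<xi> \<eta>) \<and>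
        vertical_bivector S M p \<pi>V \<and>
        (\<forall>x\<in>pts S. sharp S \<pi>H x ` cotangent S x \<inter> vert S M p x = {\<lambda>f. 0}))"

text \<open>The restriction of a vertical bivector \<open>\<pi>V\<close> to a fibre \<open>X\<close> is \<open>\<pi>X\<close>: the inclusion pushes
  \<open>\<pi>X\<close> forward to \<open>\<pi>V\<close>.\<close>

definition restricts_to_fibres ::
    "('a, 'e::euclidean_space) mfd \<Rightarrow> 'a bivector \<Rightarrow> ('b, 'f::euclidean_space) mfd \<Rightarrow> ('a \<Rightarrow> 'b) \<Rightarrow>
     'a bivector \<Rightarrow> bool" where
  "restricts_to_fibres S \<pi>S M p \<pi>V \<longleftrightarrow>
     (\<forall>b\<in>pts M. \<exists>(X :: ('a, 'e) mfd) \<pi>X. pts X = fibre S p b \<and> poisson_dirac X \<pi>X S \<pi>S \<and>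
        (\<forall>x\<in>pts X. \<forall>\<xi>\<in>cotangent S x. \<forall>\<eta>\<in>cotangent S x.
           \<pi>V x \<xi> \<eta> = \<pi>X x (pull_covec X S id x \<xi>) (pull_covec X S id x \<eta>)))"


section \<open>Smooth subbundles of $TM\oplus T^*M$\<close>

definition smooth_vector_field ::
    "('a, 'e::euclidean_space) mfd \<Rightarrow> 'a set \<Rightarrow> ('a \<Rightarrow> 'a tvec) \<Rightarrow> bool" where
  "smooth_vector_field M U Y \<longleftrightarrow>
     (\<forall>x\<in>U. Y x \<in> tangent M x) \<and> (\<forall>f\<in>Cinf M. smooth_fun_on M U (\<lambda>x. Y x f))"

definition smooth_covector_field ::
    "('a, 'e::euclidean_space) mfd \<Rightarrow> 'a set \<Rightarrow> ('a \<Rightarrow> 'a covec) \<Rightarrow> bool" where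
  "smooth_covector_field M U \<xi> \<longleftrightarrow>
     (\<forall>x\<in>U. \<xi> x \<in> cotangent M x) \<and>
     (\<forall>Y. smooth_vector_field M U Y \<longrightarrow> smooth_fun_on M U (\<lambda>x. \<xi> x (Y x)))"

text \<open>A family of subspaces is a smooth vector bundle if it has a smooth frame near every point.\<close>

definition smooth_subbundle ::
    "('a, 'e::euclidean_space) mfd \<Rightarrow> ('a \<Rightarrow> ('a tvec \<times> 'a covec) set) \<Rightarrow> bool" where
  "smooth_subbundle M L \<longleftrightarrow>
     (\<forall>x0\<in>pts M. \<exists>U k Y \<xi>. openin (Top M) U \<and> x0 \<in> U \<and>
        (\<forall>i<k::nat. smooth_vector_field M U (Y i) \<and> smooth_covector_field M U (\<xi> i)) \<and>
        (\<forall>x\<in>U.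
           (\<forall>c. (\<lambda>f. \<Sum>i<k. c i * Y i x f) = (\<lambda>f. 0) \<and> (\<lambda>v. \<Sum>i<k. c i * \<xi> i x v) = (\<lambda>v. 0)
              \<longrightarrow> (\<forall>i<k. c i = 0)) \<and>
           L x = {((\<lambda>f. \<Sum>i<k. c i * Y i x f), (\<lambda>v. \<Sum>i<k. c i * \<xi> i x v)) | c :: nat \<Rightarrow> real. True}))"

text \<open>$\mathrm{Gr}(\pi_\Sigma)\cap(V\oplus T^*\Sigma)+V^\circ$\<close>

definition vert_family ::
    "('a, 'e::euclidean_space) mfd \<Rightarrow> 'a bivector \<Rightarrow> ('b, 'f::euclidean_space) mfd \<Rightarrow> ('a \<Rightarrow> 'b) \<Rightarrow> 'a \<Rightarrow>
     ('a tvec \<times> 'a covec) set" where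
  "vert_family S \<pi>S M p x = {(u, \<lambda>v. \<xi> v + \<alpha> v) | u \<xi> \<alpha>.
     (u, \<xi>) \<in> Gr S \<pi>S x \<inter> (vert S M p x \<times> cotangent S x) \<and> \<alpha> \<in> vert_ann S M p x}"

end

theory Submission
  imports Defs
begin

text \<open>Since the fibres are Poisson-Dirac, every covector $\xi$ at $x$ has a splitting $\xi=\zeta+\alpha$ with
  $\pi_\Sigma^\sharp\zeta\in V$ and $\alpha\in V^\circ$, and $\pi_\Sigma^\sharp\zeta$ depends only on $\xi$. This
  decomposes $\pi_\Sigma=\pi_V+\pi_H$ pointwise, where $\pi_V(\xi,\eta)=\pi_\Sigma(\zeta,\eta)$ restricts to the
  induced Poisson structures of the fibres and $\pi_H^\sharp(T^*\Sigma)=\pi_\Sigma^\sharp(V^\circ)$. Any bivector as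
  in (i), (ii) or (iii) agrees with $\pi_V$ or $\pi_H$, and the family in (iv) is the graph of $\pi_V$; so each
  assertion implies that $\pi_V$ is smooth.

  Conversely, let $\pi_V$ be smooth. The set of points near which $\pi_H$ has constant rank is dense. There $\pi_H$ is
  spanned by Hamiltonian vector fields $X_a$ of basic functions $a$, and modulo basic functions every function can be
  replaced by one whose differential lies in the kernel of $\pi_H^\sharp$; for such $f,g$ the function $\{f,g\}_H$
  vanishes to second order. Together with the Jacobi identity of $\pi_\Sigma$ this gives $L_{X_a}\pi_H=0$ and
  then the vanishing of all three Schouten brackets, everywhere by density. Finally, a Hamiltonian curve of $\pi_H$
  is also a Hamiltonian curve of basic functions: by Gronwall's inequality the rank of $\pi_H$ is constant along the curve,
  so its velocity is locally $\sum_i\lambda_i(t)X_{a_i}$ with smooth $\lambda_i$, and these local expressions are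
  glued by a partition of unity in $t$.\<close>

section \<open>Smooth maps between Euclidean spaces\<close>

text \<open>The rank of \<pi>_H may jump, so there is in general no smooth horizontal distribution,
  and the splitting covectors \<zeta> need not admit a smooth choice. This is why smoothness is
  phrased through the brackets {f,g}_V alone, and why identities are verified where the rank is
  locally constant and then extended by continuity. Density does not control the leaves: a leaf may
  consist entirely of points where the rank jumps. There only the rank along one given curve is
  accessible; the Schur complement of a nondegenerate Gram matrix satisfies a homogeneous linear
  differential equation along the curve, by the Jacobi identity of \<pi>_H, which must therefore be
  available beforehand. Inverse matrices come from adjugates, whose entries are again smooth
  functions. Tangent vectors are derivations of globally defined functions, so coordinates are cut
  off to global functions, and Hadamard's lemma yields the coordinate expansion. That V is the
  tangent space of the fibre is proved with curves: a vertical vector is the velocity of a curve in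
  the level set, and the subspace topology makes that curve continuous in the fibre.\<close>

lemma frechet_derivative_eq_open:
  assumes "open U" "z \<in> U" "\<And>y. y \<in> U \<Longrightarrow> f y = g y" "f differentiable (at z)"
  shows "g differentiable (at z)" "frechet_derivative g (at z) = frechet_derivative f (at z)"
proof -
  have "(f has_derivative frechet_derivative f (at z)) (at z)"
    using assms(4) frechet_derivative_works by blast
  then have "(g has_derivative frechet_derivative f (at z)) (at z)"
    by (rule has_derivative_transform_within_open[OF _ assms(1,2)]) (use assms(3) in auto)
  then show "g differentiable (at z)" "frechet_derivative g (at z) = frechet_derivative f (at z)"
    by (auto simp: differentiable_def frechet_derivative_at[symmetric])
qed

lemma Ck_on_open_cong:
  assumes "open U" "\<And>z. z \<in> U \<Longrightarrow> f z = g z" "Ck_on_open k f U"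
  shows "Ck_on_open k g U"
  using assms(2,3)
proof (induction k arbitrary: f g)
  case 0
  then show ?case by (auto cong: continuous_on_cong)
next
  case (Suc k)
  have "g differentiable (at z)" "frechet_derivative g (at z) = frechet_derivative f (at z)" if "z \<in> U" for z
    using frechet_derivative_eq_open[of U z f g] assms(1) that Suc.prems by auto
  moreover have "Ck_on_open k (\<lambda>z. frechet_derivative g (at z) v) U" for v
    using Suc.IH[of "\<lambda>z. frechet_derivative f (at z) v" "\<lambda>z. frechet_derivative g (at z) v"]
      calculation Suc.prems by simp
  ultimately show ?case by simp
qed

lemma Ck_on_open_subset:
  "Ck_on_open k f U \<Longrightarrow> W \<subseteq> U \<Longrightarrow> Ck_on_open k f W"
proof (induction k arbitrary: f)
  case 0
  then show ?case using continuous_on_subset by auto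
next
  case (Suc k)
  then show ?case by auto
qed

lemma Ck_on_open_SucD: "Ck_on_open (Suc k) f U \<Longrightarrow> Ck_on_open k f U"
proof (induction k arbitrary: f)
  case 0
  then show ?case
    by (auto intro!: continuous_at_imp_continuous_on differentiable_imp_continuous_within)
next
  case (Suc k)
  have "Ck_on_open k (\<lambda>z. frechet_derivative f (at z) v) U" for v
    using Suc.prems by (intro Suc.IH) (metis Ck_on_open.simps(2))
  moreover have "\<forall>z\<in>U. f differentiable (at z)" using Suc.prems by simp
  ultimately show ?case by simp
qed

lemma Ck_on_open_Suc_derivative:
  assumes "Ck_on_open (Suc k) f U"
  shows "z \<in> U \<Longrightarrow> (f has_derivative frechet_derivative f (at z)) (at z)"
    and "Ck_on_open k (\<lambda>z. frechet_derivative f (at z) v) U"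
  using assms frechet_derivative_works by auto

text \<open>Allows any formula \<open>f'\<close> for the derivative, so that its smoothness is
  checked on that formula instead of on \<open>frechet_derivative\<close>.\<close>

lemma Ck_on_open_SucI:
  assumes "open U" "\<And>z. z \<in> U \<Longrightarrow> (f has_derivative f' z) (at z)"
    "\<And>v. Ck_on_open k (\<lambda>z. f' z v) U"
  shows "Ck_on_open (Suc k) f U"
proof -
  have "frechet_derivative f (at z) = f' z" if "z \<in> U" for z
    using frechet_derivative_at[OF assms(2)[OF that]] by simp
  then have "Ck_on_open k (\<lambda>z. frechet_derivative f (at z) v) U" for v
    using Ck_on_open_cong[OF assms(1) _ assms(3)[of v], of "\<lambda>z. frechet_derivative f (at z) v"] by simp
  then show ?thesis using assms(2) by (auto simp: differentiable_def)
qed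

lemma Ck_on_open_const: "open U \<Longrightarrow> Ck_on_open k (\<lambda>z. c) U"
proof (induction k arbitrary: c)
  case (Suc k)
  show ?case
    by (rule Ck_on_open_SucI[where f'="\<lambda>z v. 0"]) (use Suc in \<open>auto intro!: derivative_eq_intros\<close>)
qed auto

lemma Ck_on_open_add:
  assumes "open U"
  shows "Ck_on_open k f U \<Longrightarrow> Ck_on_open k g U \<Longrightarrow> Ck_on_open k (\<lambda>z. f z + g z) U"
proof (induction k arbitrary: f g)
  case 0
  then show ?case by (auto intro: continuous_on_add)
next
  case (Suc k)
  show ?case
    by (rule Ck_on_open_SucI[OF assms, where
        f'="\<lambda>z v. frechet_derivative f (at z) v + frechet_derivative g (at z) v"])
      (intro has_derivative_add Suc.IH Ck_on_open_Suc_derivative[OF Suc.prems(1)]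
        Ck_on_open_Suc_derivative[OF Suc.prems(2)]; assumption)+
qed

lemma Ck_on_open_bounded_linear:
  assumes "open U" "bounded_linear L"
  shows "Ck_on_open k f U \<Longrightarrow> Ck_on_open k (\<lambda>z. L (f z)) U"
proof (induction k arbitrary: f)
  case 0
  then show ?case using bounded_linear.continuous_on[OF assms(2)] by auto
next
  case (Suc k)
  show ?case
    by (rule Ck_on_open_SucI[OF assms(1), where f'="\<lambda>z v. L (frechet_derivative f (at z) v)"])
      (intro bounded_linear.has_derivative[OF assms(2)] Suc.IH Ck_on_open_Suc_derivative[OF Suc.prems]; assumption)+
qed

lemma Ck_on_open_id: "open U \<Longrightarrow> Ck_on_open k (\<lambda>z. z) U"
proof (cases k)
  case (Suc n)
  assume "open U"
  then show ?thesis unfolding Suc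
    by (intro Ck_on_open_SucI[where f'="\<lambda>z v. v"]) (auto intro!: Ck_on_open_const)
qed auto

lemma Ck_on_open_scaleR:
  assumes "open U"
  shows "Ck_on_open k f U \<Longrightarrow> Ck_on_open k g U \<Longrightarrow> Ck_on_open k (\<lambda>z. f z *\<^sub>R g z) U"
proof (induction k arbitrary: f g)
  case 0
  then show ?case by (auto intro: continuous_on_scaleR)
next
  case (Suc k)
  note D = Ck_on_open_SucD[OF Suc.prems(1)] Ck_on_open_SucD[OF Suc.prems(2)]
  show ?case
    by (rule Ck_on_open_SucI[OF assms, where
        f'="\<lambda>z v. f z *\<^sub>R frechet_derivative g (at z) v + frechet_derivative f (at z) v *\<^sub>R g z"])
      (intro has_derivative_scaleR Ck_on_open_add assms Suc.IH D Ck_on_open_Suc_derivative[OF Suc.prems(1)]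
        Ck_on_open_Suc_derivative[OF Suc.prems(2)]; assumption)+
qed

text \<open>The derivative of 1/f is -(1/f) Df (1/f), so order k + 1 follows from order k of 1/f and
  of Df.\<close>

lemma Ck_on_open_inverse:
  fixes f :: "'e::euclidean_space \<Rightarrow> real"
  assumes "open U" "\<And>z. z \<in> U \<Longrightarrow> f z \<noteq> 0"
  shows "Ck_on_open k f U \<Longrightarrow> Ck_on_open k (\<lambda>z. inverse (f z)) U"
proof (induction k)
  case 0
  then show ?case using assms by (auto intro: continuous_on_inverse)
next
  case (Suc k)
  note IH = Suc.IH[OF Ck_on_open_SucD[OF Suc.prems]]
  have 1: "Ck_on_open k (\<lambda>z. (inverse (f z) *\<^sub>R frechet_derivative f (at z) v) *\<^sub>R inverse (f z)) U" for v
    by (intro Ck_on_open_scaleR assms IH Ck_on_open_Suc_derivative[OF Suc.prems])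
  have 2: "Ck_on_open k (\<lambda>z. - (inverse (f z) * frechet_derivative f (at z) v * inverse (f z))) U" for v
    using Ck_on_open_bounded_linear[OF assms(1) bounded_linear_minus[OF bounded_linear_ident] 1[of v]]
    by simp
  show ?case
    by (rule Ck_on_open_SucI[OF assms(1), where
          f'="\<lambda>z v. - (inverse (f z) * frechet_derivative f (at z) v * inverse (f z))"])
      (use 2 in \<open>auto intro!: Deriv.has_derivative_inverse assms(2) Ck_on_open_Suc_derivative(1)[OF Suc.prems]\<close>)
qed

lemma Ck_on_open_sum:
  assumes "open U" "\<And>i. i \<in> I \<Longrightarrow> Ck_on_open k (f i) U"
  shows "Ck_on_open k (\<lambda>z. \<Sum>i\<in>I. f i z) U"
  using assms(2)
  by (induction I rule: infinite_finite_induct)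
    (auto intro!: Ck_on_open_const Ck_on_open_add assms(1))

text \<open>\<open>Ck_on_open\<close> only controls derivatives in fixed directions, while the chain
  rule evaluates Dg in the direction Df(z)v, which moves with z. Expanding that direction in
  \<open>Basis\<close> gives a finite sum of products, to which the induction hypothesis applies
  with g replaced by its partial derivatives.\<close>

lemma Ck_on_open_compose:
  fixes f :: "'e::euclidean_space \<Rightarrow> 'f::euclidean_space"
  assumes "open U" "open W" "f ` U \<subseteq> W"
  shows "Ck_on_open k f U \<Longrightarrow> Ck_on_open k g W \<Longrightarrow> Ck_on_open k (\<lambda>z. g (f z)) U"
proof (induction k arbitrary: g)
  case 0
  then show ?case using continuous_on_compose2[OF _ _ assms(3), of g] by simp
next
  case (Suc k)
  have d: "((\<lambda>z. g (f z)) has_derivative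
      (\<lambda>v. \<Sum>b\<in>Basis. (frechet_derivative f (at z) v \<bullet> b) *\<^sub>R frechet_derivative g (at (f z)) b)) (at z)"
    if "z \<in> U" for z
  proof -
    have f: "(f has_derivative frechet_derivative f (at z)) (at z)"
      by (rule Ck_on_open_Suc_derivative(1)[OF Suc.prems(1) that])
    have g: "(g has_derivative frechet_derivative g (at (f z))) (at (f z))"
      using that assms(3) by (intro Ck_on_open_Suc_derivative(1)[OF Suc.prems(2)]) auto
    interpret g: bounded_linear "frechet_derivative g (at (f z))" by (rule has_derivative_bounded_linear[OF g])
    have e: "frechet_derivative g (at (f z)) w = (\<Sum>b\<in>Basis. (w \<bullet> b) *\<^sub>R frechet_derivative g (at (f z)) b)" for w
      by (subst euclidean_representation[of w, symmetric], subst g.sum) (simp add: g.scaleR)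
    have "(g \<circ> f has_derivative frechet_derivative g (at (f z)) \<circ> frechet_derivative f (at z)) (at z)"
      by (rule diff_chain_at[OF f g])
    moreover have "frechet_derivative g (at (f z)) \<circ> frechet_derivative f (at z) =
      (\<lambda>v. \<Sum>b\<in>Basis. (frechet_derivative f (at z) v \<bullet> b) *\<^sub>R frechet_derivative g (at (f z)) b)"
      unfolding o_def by (rule ext) (rule e)
    ultimately show ?thesis unfolding o_def by metis
  qed
  have "Ck_on_open k (\<lambda>z. \<Sum>b\<in>Basis. (frechet_derivative f (at z) v \<bullet> b) *\<^sub>R frechet_derivative g (at (f z)) b) U" for v
    by (rule Ck_on_open_sum[OF assms(1)], rule Ck_on_open_scaleR[OF assms(1)
          Ck_on_open_bounded_linear[OF assms(1) bounded_linear_inner_left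
            Ck_on_open_Suc_derivative(2)[OF Suc.prems(1)]]
          Suc.IH[OF Ck_on_open_SucD[OF Suc.prems(1)] Ck_on_open_Suc_derivative(2)[OF Suc.prems(2)]]])
  then show ?case
    by (intro Ck_on_open_SucI[OF assms(1), where f'="\<lambda>z v. \<Sum>b\<in>Basis. (frechet_derivative f (at z) v \<bullet> b) *\<^sub>R
        frechet_derivative g (at (f z)) b"] d)
qed

text \<open>Openness is part of the predicate, so that most closure rules compose without side
  conditions on the domain.\<close>

definition smooth_open :: "'e::euclidean_space set \<Rightarrow> ('e \<Rightarrow> 'r::real_normed_vector) \<Rightarrow> bool" where
  "smooth_open U f \<longleftrightarrow> open U \<and> (\<forall>k. Ck_on_open k f U)"

named_theorems smooth_intros

lemma smooth_openD: "smooth_open U f \<Longrightarrow> open U" by (simp add: smooth_open_def)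

lemma smooth_open_cong: "smooth_open U f \<Longrightarrow> (\<And>z. z \<in> U \<Longrightarrow> f z = g z) \<Longrightarrow> smooth_open U g"
  unfolding smooth_open_def using Ck_on_open_cong by blast

lemma smooth_open_subset: "smooth_open U f \<Longrightarrow> W \<subseteq> U \<Longrightarrow> open W \<Longrightarrow> smooth_open W f"
  unfolding smooth_open_def using Ck_on_open_subset by blast

lemma smooth_open_const [smooth_intros]: "open U \<Longrightarrow> smooth_open U (\<lambda>z. c)"
  by (simp add: smooth_open_def Ck_on_open_const)

lemma smooth_open_id [smooth_intros]: "open U \<Longrightarrow> smooth_open U (\<lambda>z. z)"
  by (simp add: smooth_open_def Ck_on_open_id)

lemma smooth_open_add [smooth_intros]:
  "smooth_open U f \<Longrightarrow> smooth_open U g \<Longrightarrow> smooth_open U (\<lambda>z. f z + g z)"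
  by (simp add: smooth_open_def Ck_on_open_add)

lemma smooth_open_scaleR [smooth_intros]:
  "smooth_open U f \<Longrightarrow> smooth_open U g \<Longrightarrow> smooth_open U (\<lambda>z. f z *\<^sub>R g z)"
  by (simp add: smooth_open_def Ck_on_open_scaleR)

lemma smooth_open_mult [smooth_intros]:
  fixes f g :: "'e::euclidean_space \<Rightarrow> real"
  shows "smooth_open U f \<Longrightarrow> smooth_open U g \<Longrightarrow> smooth_open U (\<lambda>z. f z * g z)"
  using smooth_open_scaleR[of U f g] by simp

lemma smooth_open_bounded_linear:
  "bounded_linear L \<Longrightarrow> smooth_open U f \<Longrightarrow> smooth_open U (\<lambda>z. L (f z))"
  by (simp add: smooth_open_def Ck_on_open_bounded_linear)

lemmas smooth_open_linear_map = smooth_open_bounded_linear[OF _ smooth_open_id]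

lemma smooth_open_minus [smooth_intros]: "smooth_open U f \<Longrightarrow> smooth_open U (\<lambda>z. - f z)"
  by (rule smooth_open_bounded_linear[OF bounded_linear_minus[OF bounded_linear_ident]])

lemma smooth_open_diff [smooth_intros]:
  "smooth_open U f \<Longrightarrow> smooth_open U g \<Longrightarrow> smooth_open U (\<lambda>z. f z - g z)"
  using smooth_open_add[OF _ smooth_open_minus, of U f g] by simp

lemma smooth_open_inner_left [smooth_intros]: "smooth_open U f \<Longrightarrow> smooth_open U (\<lambda>z. f z \<bullet> b)"
  by (rule smooth_open_bounded_linear[OF bounded_linear_inner_left])

lemma smooth_open_fst [smooth_intros]: "smooth_open U f \<Longrightarrow> smooth_open U (\<lambda>z. fst (f z))"
  by (rule smooth_open_bounded_linear[OF bounded_linear_fst])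

lemma smooth_open_snd [smooth_intros]: "smooth_open U f \<Longrightarrow> smooth_open U (\<lambda>z. snd (f z))"
  by (rule smooth_open_bounded_linear[OF bounded_linear_snd])

lemma smooth_open_inverse [smooth_intros]:
  fixes f :: "'e::euclidean_space \<Rightarrow> real"
  shows "smooth_open U f \<Longrightarrow> (\<And>z. z \<in> U \<Longrightarrow> f z \<noteq> 0) \<Longrightarrow> smooth_open U (\<lambda>z. inverse (f z))"
  by (simp add: smooth_open_def Ck_on_open_inverse)

lemma smooth_open_divide [smooth_intros]:
  fixes f :: "'e::euclidean_space \<Rightarrow> real"
  shows "smooth_open U f \<Longrightarrow> smooth_open U g \<Longrightarrow> (\<And>z. z \<in> U \<Longrightarrow> g z \<noteq> 0) \<Longrightarrow> smooth_open U (\<lambda>z. f z / g z)"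
  unfolding divide_inverse by (intro smooth_intros)

lemma smooth_open_sum [smooth_intros]:
  "open U \<Longrightarrow> (\<And>i. i \<in> I \<Longrightarrow> smooth_open U (f i)) \<Longrightarrow> smooth_open U (\<lambda>z. \<Sum>i\<in>I. f i z)"
  by (simp add: smooth_open_def Ck_on_open_sum)

lemma smooth_open_Pair [smooth_intros]:
  assumes "smooth_open U f" "smooth_open U g"
  shows "smooth_open U (\<lambda>z. (f z, g z))"
proof -
  have "smooth_open U (\<lambda>z. (f z, 0) + (0, g z))"
    by (intro smooth_open_add
        smooth_open_bounded_linear[OF bounded_linear_Pair[OF bounded_linear_ident bounded_linear_zero] assms(1)]
        smooth_open_bounded_linear[OF bounded_linear_Pair[OF bounded_linear_zero bounded_linear_ident] assms(2)])
  then show ?thesis by simp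
qed

lemma smooth_open_compose:
  fixes f :: "'e::euclidean_space \<Rightarrow> 'f::euclidean_space"
  assumes "smooth_open U f" "smooth_open W g" "\<And>z. z \<in> U \<Longrightarrow> f z \<in> W"
  shows "smooth_open U (\<lambda>z. g (f z))"
  using assms Ck_on_open_compose[of U W f] unfolding smooth_open_def by blast

lemma smooth_open_has_derivative:
  assumes "smooth_open U f" "z \<in> U"
  shows "(f has_derivative frechet_derivative f (at z)) (at z)"
proof -
  have "Ck_on_open (Suc 0) f U" using assms(1) by (simp add: smooth_open_def del: Ck_on_open.simps)
  then show ?thesis using assms(2) frechet_derivative_works by auto
qed

lemma smooth_open_derivative:
  assumes "smooth_open U f" shows "smooth_open U (\<lambda>z. frechet_derivative f (at z) v)"
proof -
  have "Ck_on_open (Suc k) f U" for k using assms(1) by (simp add: smooth_open_def del: Ck_on_open.simps)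
  then show ?thesis using smooth_openD[OF assms] by (auto simp: smooth_open_def)
qed

lemma smooth_open_continuous_on: "smooth_open U f \<Longrightarrow> continuous_on U f"
  unfolding smooth_open_def by (metis Ck_on_open.simps(1))

lemma frechet_derivative_euclidean_sum:
  assumes "(f has_derivative frechet_derivative f (at z)) (at z)"
  shows "frechet_derivative f (at z) w = (\<Sum>b\<in>Basis. (w \<bullet> b) *\<^sub>R frechet_derivative f (at z) b)"
proof -
  interpret g: bounded_linear "frechet_derivative f (at z)" by (rule has_derivative_bounded_linear[OF assms])
  show ?thesis by (subst euclidean_representation[of w, symmetric], subst g.sum) (simp add: g.scaleR)
qed

lemma smooth_open_derivative_along:
  assumes "smooth_open U f" "smooth_open U v"
  shows "smooth_open U (\<lambda>z. frechet_derivative f (at z) (v z))"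
proof -
  have "smooth_open U (\<lambda>z. \<Sum>b\<in>Basis. (v z \<bullet> b) *\<^sub>R frechet_derivative f (at z) b)"
    using assms smooth_openD by (intro smooth_intros smooth_open_derivative) auto
  then show ?thesis
    by (rule smooth_open_cong)
      (rule frechet_derivative_euclidean_sum[symmetric, OF smooth_open_has_derivative[OF assms(1)]])
qed

lemma smooth_openI_local:
  assumes "open U" "\<And>z. z \<in> U \<Longrightarrow> \<exists>W. z \<in> W \<and> smooth_open W f"
  shows "smooth_open U f"
proof -
  have *: "Ck_on_open k f U" if "\<And>z. z \<in> U \<Longrightarrow> \<exists>W. open W \<and> z \<in> W \<and> Ck_on_open k f W" for k and f :: "'a \<Rightarrow> 'b"
    using that
  proof (induction k arbitrary: f)
    case 0
    have "continuous (at z) f" if z: "z \<in> U" for z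
    proof -
      obtain W where W: "open W" "z \<in> W" "Ck_on_open 0 f W" using 0[OF z] by blast
      then have "continuous_on W f" by simp
      then show ?thesis using continuous_on_eq_continuous_at[OF W(1)] W(2) by blast
    qed
    then show ?case by (auto intro: continuous_at_imp_continuous_on)
  next
    case (Suc k)
    have "Ck_on_open k (\<lambda>z. frechet_derivative f (at z) v) U" for v
    proof (rule Suc.IH)
      fix z assume "z \<in> U"
      from Suc.prems[OF this] obtain W where "open W" "z \<in> W" "Ck_on_open (Suc k) f W" by blast
      then show "\<exists>W. open W \<and> z \<in> W \<and> Ck_on_open k (\<lambda>z. frechet_derivative f (at z) v) W"
        by (intro exI[of _ W]) simp
    qed
    moreover have "f differentiable (at z)" if z: "z \<in> U" for z
    proof -
      from Suc.prems[OF z] obtain W where "open W" "z \<in> W" "Ck_on_open (Suc k) f W" by blast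
      then show ?thesis by simp
    qed
    ultimately show ?case by simp
  qed
  show ?thesis unfolding smooth_open_def
  proof (intro conjI assms(1) allI, rule *)
    fix k z assume "z \<in> U"
    from assms(2)[OF this] obtain W where "z \<in> W" "smooth_open W f" by blast
    then show "\<exists>W. open W \<and> z \<in> W \<and> Ck_on_open k f W" unfolding smooth_open_def by (intro exI[of _ W]) simp
  qed
qed

subsection \<open>Smoothness on arbitrary sets\<close>

lemma smooth_on_iff:
  "smooth_on S f \<longleftrightarrow> (\<forall>z\<in>S. \<exists>U g. z \<in> U \<and> smooth_open U g \<and> (\<forall>y\<in>S \<inter> U. f y = g y))"
  unfolding smooth_on_def smooth_open_def by blast

lemma smooth_open_imp_smooth_on: "smooth_open U f \<Longrightarrow> S \<subseteq> U \<Longrightarrow> smooth_on S f"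
  unfolding smooth_on_iff by (intro ballI exI[of _ U] exI[of _ f]) auto

lemma smooth_on_open:
  assumes U: "open U" shows "smooth_on U f \<longleftrightarrow> smooth_open U f"
proof
  assume f: "smooth_on U f"
  show "smooth_open U f"
  proof (rule smooth_openI_local[OF U])
    fix z assume z: "z \<in> U"
    obtain W g where W: "z \<in> W" "smooth_open W g" "\<forall>y\<in>U \<inter> W. f y = g y"
      using f z unfolding smooth_on_iff by blast
    have "smooth_open (U \<inter> W) g"
      by (rule smooth_open_subset[OF W(2)]) (use U smooth_openD[OF W(2)] in auto)
    then have "smooth_open (U \<inter> W) f" by (rule smooth_open_cong) (use W(3) in simp)
    then show "\<exists>W. z \<in> W \<and> smooth_open W f"
      using z W(1) by (intro exI[of _ "U \<inter> W"]) simp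
  qed
next
  assume "smooth_open U f" then show "smooth_on U f" by (rule smooth_open_imp_smooth_on) simp
qed

lemma smooth_on_subset:
  assumes "smooth_on S f" "T \<subseteq> S" shows "smooth_on T f"
  unfolding smooth_on_iff
proof
  fix z assume "z \<in> T"
  then obtain U g where "z \<in> U" "smooth_open U g" "\<forall>y\<in>S \<inter> U. f y = g y"
    using assms unfolding smooth_on_iff by (meson subsetD)
  then show "\<exists>U g. z \<in> U \<and> smooth_open U g \<and> (\<forall>y\<in>T \<inter> U. f y = g y)"
    using assms(2) by (intro exI[of _ U] exI[of _ g]) auto
qed

lemma smooth_on_cong: "smooth_on S f \<Longrightarrow> (\<And>z. z \<in> S \<Longrightarrow> f z = g z) \<Longrightarrow> smooth_on S g"
  unfolding smooth_on_iff by simp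

text \<open>Local extensions are combined on the intersection of their domains; one rule serves all
  binary operations.\<close>

lemma smooth_on_binop:
  fixes f :: "'e::euclidean_space \<Rightarrow> 'r::real_normed_vector" and g :: "'e \<Rightarrow> 's::real_normed_vector"
  assumes op: "\<And>(U::'e set) f g. smooth_open U f \<Longrightarrow> smooth_open U g \<Longrightarrow> smooth_open U (\<lambda>z. h (f z) (g z))"
  assumes "smooth_on S f" "smooth_on S g"
  shows "smooth_on S (\<lambda>z. h (f z) (g z))"
  unfolding smooth_on_iff
proof
  fix z assume z: "z \<in> S"
  obtain U f' where f: "z \<in> U" "smooth_open U f'" "\<forall>y\<in>S \<inter> U. f y = f' y"
    using assms(2) z unfolding smooth_on_iff by blast
  obtain W g' where g: "z \<in> W" "smooth_open W g'" "\<forall>y\<in>S \<inter> W. g y = g' y"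
    using assms(3) z unfolding smooth_on_iff by blast
  have "smooth_open (U \<inter> W) (\<lambda>z. h (f' z) (g' z))"
    using smooth_openD[OF f(2)] smooth_openD[OF g(2)]
    by (intro op smooth_open_subset[OF f(2)] smooth_open_subset[OF g(2)]) auto
  then show "\<exists>U g'. z \<in> U \<and> smooth_open U g' \<and> (\<forall>y\<in>S \<inter> U. h (f y) (g y) = g' y)"
    using f g by (intro exI[of _ "U \<inter> W"] exI[of _ "\<lambda>z. h (f' z) (g' z)"]) auto
qed

lemma smooth_on_const [smooth_intros]: "smooth_on S (\<lambda>z. c)"
  using smooth_open_imp_smooth_on[OF smooth_open_const[OF open_UNIV]] by blast

lemma smooth_on_id [smooth_intros]: "smooth_on S (\<lambda>z. z)"
  using smooth_open_imp_smooth_on[OF smooth_open_id[OF open_UNIV]] by blast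

lemma smooth_on_add [smooth_intros]: "smooth_on S f \<Longrightarrow> smooth_on S g \<Longrightarrow> smooth_on S (\<lambda>z. f z + g z)"
  by (rule smooth_on_binop) (intro smooth_intros)

lemma smooth_on_mult [smooth_intros]:
  fixes f g :: "'e::euclidean_space \<Rightarrow> real"
  shows "smooth_on S f \<Longrightarrow> smooth_on S g \<Longrightarrow> smooth_on S (\<lambda>z. f z * g z)"
  by (rule smooth_on_binop) (intro smooth_intros)

lemma smooth_on_Pair [smooth_intros]: "smooth_on S f \<Longrightarrow> smooth_on S g \<Longrightarrow> smooth_on S (\<lambda>z. (f z, g z))"
  by (rule smooth_on_binop) (intro smooth_intros)

lemma smooth_on_sum [smooth_intros]:
  assumes "\<And>i. i \<in> I \<Longrightarrow> smooth_on S (f i)"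
  shows "smooth_on S (\<lambda>z. \<Sum>i\<in>I. f i z)"
  using assms by (induction I rule: infinite_finite_induct) (auto intro!: smooth_intros)

lemma smooth_on_compose:
  fixes f :: "'e::euclidean_space \<Rightarrow> 'f::euclidean_space"
  assumes "smooth_on S f" "smooth_on T g" "\<And>z. z \<in> S \<Longrightarrow> f z \<in> T"
  shows "smooth_on S (\<lambda>z. g (f z))"
  unfolding smooth_on_iff
proof
  fix z assume z: "z \<in> S"
  obtain U f' where f: "z \<in> U" "smooth_open U f'" "\<forall>y\<in>S \<inter> U. f y = f' y"
    using assms(1) z unfolding smooth_on_iff by blast
  obtain W g' where g: "f z \<in> W" "smooth_open W g'" "\<forall>y\<in>T \<inter> W. g y = g' y"
    using assms(2) z assms(3) unfolding smooth_on_iff by blast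
  have o: "open (U \<inter> f' -` W)"
    using smooth_open_continuous_on[OF f(2)] smooth_openD[OF f(2)] smooth_openD[OF g(2)] continuous_open_preimage by blast
  have "smooth_open (U \<inter> f' -` W) (\<lambda>z. g' (f' z))"
    by (rule smooth_open_compose[OF smooth_open_subset[OF f(2)] g(2)]) (use o in auto)
  then show "\<exists>U h. z \<in> U \<and> smooth_open U h \<and> (\<forall>y\<in>S \<inter> U. g (f y) = h y)"
  proof (intro exI[of _ "U \<inter> f' -` W"] exI[of _ "\<lambda>z. g' (f' z)"] conjI ballI)
    fix y assume y: "y \<in> S \<inter> (U \<inter> f' -` W)"
    have 1: "f y = f' y" using f y by auto
    have 2: "f y \<in> T" using y by (intro assms(3)) auto
    show "g (f y) = g' (f' y)" using g(3) y 2 unfolding 1 by auto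
  qed (use f g z in auto)
qed

lemma smooth_on_bounded_linear: "bounded_linear L \<Longrightarrow> smooth_on S (L :: 'e::euclidean_space \<Rightarrow> 'r::real_normed_vector)"
  using smooth_open_imp_smooth_on[OF smooth_open_linear_map[OF _ open_UNIV]] by blast

lemma smooth_on_fst [smooth_intros]:
  fixes f :: "'e::euclidean_space \<Rightarrow> 'f::euclidean_space \<times> 'g::euclidean_space"
  shows "smooth_on S f \<Longrightarrow> smooth_on S (\<lambda>z. fst (f z))"
  by (rule smooth_on_compose[OF _ smooth_on_bounded_linear[OF bounded_linear_fst, of UNIV]]) auto

lemma smooth_on_snd [smooth_intros]:
  fixes f :: "'e::euclidean_space \<Rightarrow> 'f::euclidean_space \<times> 'g::euclidean_space"
  shows "smooth_on S f \<Longrightarrow> smooth_on S (\<lambda>z. snd (f z))"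
  by (rule smooth_on_compose[OF _ smooth_on_bounded_linear[OF bounded_linear_snd, of UNIV]]) auto

lemma smooth_on_inverse [smooth_intros]:
  fixes f :: "'e::euclidean_space \<Rightarrow> real"
  assumes "smooth_on S f" "\<And>z. z \<in> S \<Longrightarrow> f z \<noteq> 0"
  shows "smooth_on S (\<lambda>z. inverse (f z))"
proof -
  have "smooth_open (- {0}) (\<lambda>x::real. inverse x)" by (intro smooth_intros) auto
  then have "smooth_on (- {0}) (\<lambda>x::real. inverse x)" by (rule smooth_open_imp_smooth_on) simp
  from smooth_on_compose[OF assms(1) this] assms(2) show ?thesis by simp
qed

lemma smooth_on_local:
  assumes "\<And>z. z \<in> S \<Longrightarrow> \<exists>U. open U \<and> z \<in> U \<and> smooth_on (S \<inter> U) f"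
  shows "smooth_on S f"
  unfolding smooth_on_iff
proof
  fix z assume z: "z \<in> S"
  from assms[OF z] obtain U where U: "open U" "z \<in> U" "smooth_on (S \<inter> U) f" by blast
  then obtain W g where g: "z \<in> W" "smooth_open W g" "\<forall>y\<in>(S \<inter> U) \<inter> W. f y = g y"
    unfolding smooth_on_iff using z by blast
  then show "\<exists>U g. z \<in> U \<and> smooth_open U g \<and> (\<forall>y\<in>S \<inter> U. f y = g y)"
    using U smooth_openD[OF g(2)]
    by (intro exI[of _ "W \<inter> U"] exI[of _ g] conjI smooth_open_subset[OF g(2)] open_Int) auto
qed

subsection \<open>Cut-off functions\<close>

text \<open>The functions x^(-n) exp(-1/x), extended by 0, are closed under differentiation up to
  linear combinations: the derivative of the n-th involves only the next two. Induction on the order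
  of differentiability over all n at once then gives smoothness.\<close>

definition flat_exp :: "nat \<Rightarrow> real \<Rightarrow> real" where
  "flat_exp n x = (if x \<le> 0 then 0 else (1 / x) ^ n * exp (- (1 / x)))"

lemma flat_exp_tendsto: "(flat_exp n \<longlongrightarrow> 0) (at_right 0)"
proof -
  have "((\<lambda>y::real. y ^ n / exp y) \<longlongrightarrow> 0) at_top" by (rule tendsto_power_div_exp_0)
  from filterlim_compose[OF this filterlim_inverse_at_top_right]
  have "((\<lambda>x::real. inverse x ^ n / exp (inverse x)) \<longlongrightarrow> 0) (at_right 0)" .
  then show ?thesis
  proof (rule Lim_transform_eventually)
    show "\<forall>\<^sub>F x in at_right 0. inverse x ^ n / exp (inverse x) = flat_exp n x"
      by (rule eventually_at_right_less[THEN eventually_mono])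
        (auto simp: flat_exp_def exp_minus inverse_eq_divide)
  qed
qed

lemma flat_exp_has_derivative:
  "(flat_exp n has_real_derivative (flat_exp (n + 2) x - real n * flat_exp (n + 1) x)) (at x)"
proof -
  consider "x < 0" | "x = 0" | "x > 0" by linarith
  then show ?thesis
  proof cases
    case 1
    have "((\<lambda>x. 0) has_real_derivative 0) (at x)" by simp
    then have "(flat_exp n has_real_derivative 0) (at x)"
      by (rule has_field_derivative_transform_within_open[of _ _ _ "{..<0}"]) (use 1 in \<open>auto simp: flat_exp_def\<close>)
    then show ?thesis using 1 by (simp add: flat_exp_def)
  next
    case 3
    have "((\<lambda>x. (1 / x) ^ n * exp (- (1 / x))) has_real_derivative
        (flat_exp (n + 2) x - real n * flat_exp (n + 1) x)) (at x)"
    proof (cases n)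
      case 0
      with 3 show ?thesis
        by (auto intro!: derivative_eq_intros simp: flat_exp_def power2_eq_square)
    next
      case (Suc m)
      have "((\<lambda>x. (1 / x) ^ Suc m * exp (- (1 / x))) has_real_derivative
          (real (Suc m) * (1 / x) ^ m * (- ((1 / x) * (1 / x))) * exp (- (1 / x)) +
           (1 / x) ^ Suc m * (exp (- (1 / x)) * ((1 / x) * (1 / x))))) (at x)"
        using 3 by (auto intro!: derivative_eq_intros simp del: power_Suc)
      moreover have "real (Suc m) * (1 / x) ^ m * (- ((1 / x) * (1 / x))) * exp (- (1 / x)) +
           (1 / x) ^ Suc m * (exp (- (1 / x)) * ((1 / x) * (1 / x)))
          = flat_exp (n + 2) x - real n * flat_exp (n + 1) x"
        using 3 Suc by (simp add: flat_exp_def algebra_simps add_divide_distrib)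
      ultimately show ?thesis using Suc by simp
    qed
    then show ?thesis
      by (rule has_field_derivative_transform_within_open[of _ _ _ "{0<..}"]) (use 3 in \<open>auto simp: flat_exp_def\<close>)
  next
    case 2
    \<comment> \<open>At 0 the right difference quotient of the n-th function is the value of the
      next one, which tends to 0; the left quotient is identically 0.\<close>
    have "((\<lambda>h. flat_exp n h / h) \<longlongrightarrow> 0) (at_right 0)"
    proof (rule Lim_transform_eventually[OF flat_exp_tendsto[of "Suc n"]])
      show "\<forall>\<^sub>F x in at_right 0. flat_exp (Suc n) x = flat_exp n x / x"
        by (rule eventually_at_right_less[THEN eventually_mono]) (auto simp: flat_exp_def)
    qed
    moreover have "((\<lambda>h. flat_exp n h / h) \<longlongrightarrow> 0) (at_left 0)"
    proof (rule Lim_transform_eventually[OF tendsto_const])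
      show "\<forall>\<^sub>F x in at_left 0. 0 = flat_exp n x / x"
        by (auto simp: flat_exp_def eventually_at_filter)
    qed
    ultimately have "((\<lambda>h. flat_exp n h / h) \<longlongrightarrow> 0) (at 0)"
      by (simp add: filterlim_split_at)
    moreover have "flat_exp k 0 = 0" for k by (simp add: flat_exp_def)
    ultimately show ?thesis using 2 by (simp add: DERIV_def)
  qed
qed

lemma smooth_flat_exp: "smooth_open UNIV (flat_exp n)"
proof -
  have "Ck_on_open k (flat_exp n) UNIV" for k
  proof (induction k arbitrary: n)
    case 0
    show ?case
      using DERIV_continuous[OF flat_exp_has_derivative] by (simp add: continuous_at_imp_continuous_on)
  next
    case (Suc k)
    show ?case
    proof (rule Ck_on_open_SucI[where f'="\<lambda>x v. v *\<^sub>R (flat_exp (n + 2) x + (- real n) *\<^sub>R flat_exp (n + 1) x)"])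
      show "(flat_exp n has_derivative (\<lambda>v. v *\<^sub>R (flat_exp (n + 2) x + (- real n) *\<^sub>R flat_exp (n + 1) x))) (at x)" for x
        using flat_exp_has_derivative[of n x]
        unfolding has_field_derivative_def by (rule has_derivative_eq_rhs) (auto simp: algebra_simps)
      show "Ck_on_open k (\<lambda>x. v *\<^sub>R (flat_exp (n + 2) x + (- real n) *\<^sub>R flat_exp (n + 1) x)) UNIV" for v :: real
        by (intro Ck_on_open_bounded_linear[OF open_UNIV bounded_linear_scaleR_right] Ck_on_open_add Suc.IH open_UNIV)
    qed simp
  qed
  then show ?thesis by (simp add: smooth_open_def)
qed

text \<open>One of 2 - t and t - 1 is always positive, so the denominator never vanishes.\<close>

definition smooth_step :: "real \<Rightarrow> real" where
  "smooth_step t = flat_exp 0 (2 - t) / (flat_exp 0 (2 - t) + flat_exp 0 (t - 1))"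

lemma flat_exp_0_pos: "x > 0 \<Longrightarrow> flat_exp 0 x > 0" "flat_exp 0 x \<ge> 0"
  by (auto simp: flat_exp_def)

lemma smooth_step_denominator: "flat_exp 0 (2 - t) + flat_exp 0 (t - 1) > 0"
  using flat_exp_0_pos[of "2 - t"] flat_exp_0_pos[of "t - 1"] by linarith

lemma smooth_step_props:
  shows "t \<le> 1 \<Longrightarrow> smooth_step t = 1" and "t \<ge> 2 \<Longrightarrow> smooth_step t = 0"
    and "t < 2 \<Longrightarrow> smooth_step t > 0" and "0 \<le> smooth_step t" and "smooth_step t \<le> 1"
proof -
  note pos = smooth_step_denominator[of t] flat_exp_0_pos[of "2 - t"] flat_exp_0_pos[of "t - 1"]
  show "smooth_step t = 1" if "t \<le> 1"
  proof -
    have "flat_exp 0 (t - 1) = 0" using that by (simp add: flat_exp_def)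
    then show ?thesis using pos(1) by (simp add: smooth_step_def)
  qed
  show "smooth_step t = 0" if "t \<ge> 2" using that by (simp add: smooth_step_def flat_exp_def)
  show "smooth_step t > 0" if "t < 2" unfolding smooth_step_def using pos that by (intro divide_pos_pos) auto
  show "0 \<le> smooth_step t" unfolding smooth_step_def using pos by (intro divide_nonneg_pos) auto
  show "smooth_step t \<le> 1" unfolding smooth_step_def using pos by (subst divide_le_eq_1_pos) auto
qed

lemma smooth_smooth_step: "smooth_open UNIV smooth_step"
proof -
  have "smooth_open UNIV (\<lambda>t. flat_exp 0 (2 - t))"
    by (rule smooth_open_compose[OF _ smooth_flat_exp]) (auto intro!: smooth_intros)
  moreover have "smooth_open UNIV (\<lambda>t. flat_exp 0 (t - 1))"
    by (rule smooth_open_compose[OF _ smooth_flat_exp]) (auto intro!: smooth_intros)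
  ultimately have "smooth_open UNIV (\<lambda>t. flat_exp 0 (2 - t) / (flat_exp 0 (2 - t) + flat_exp 0 (t - 1)))"
    by (intro smooth_intros) (use smooth_step_denominator in \<open>auto simp: less_le\<close>)
  then show ?thesis by (simp add: smooth_step_def[abs_def])
qed

lemma smooth_norm_sq: "smooth_open UNIV (\<lambda>z::'e::euclidean_space. (norm (z - z0))\<^sup>2)"
proof -
  have "smooth_open UNIV (\<lambda>z. \<Sum>b\<in>Basis. ((z - z0) \<bullet> b) * ((z - z0) \<bullet> b))"
    by (intro smooth_intros) auto
  then show ?thesis by (simp add: power2_norm_eq_inner euclidean_inner[symmetric])
qed

text \<open>The argument is the square of 2|z - z0|/e: at most 1 for |z - z0| \<le> e/2, where
  \<open>smooth_step\<close> is 1, and at least 4 for |z - z0| \<ge> e, where it is 0. The squared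
  norm keeps the function smooth at the centre.\<close>

definition bump :: "'e::euclidean_space \<Rightarrow> real \<Rightarrow> 'e \<Rightarrow> real" where
  "bump z0 e z = smooth_step (4 * (norm (z - z0))\<^sup>2 / e\<^sup>2)"

lemma smooth_bump: "smooth_open UNIV (bump z0 e)"
proof -
  have "smooth_open UNIV (\<lambda>z. (4 / e\<^sup>2) * (norm (z - z0))\<^sup>2)"
    by (intro smooth_open_mult smooth_norm_sq smooth_intros) auto
  then have "smooth_open UNIV (\<lambda>z. smooth_step ((4 / e\<^sup>2) * (norm (z - z0))\<^sup>2))"
    by (rule smooth_open_compose[OF _ smooth_smooth_step]) auto
  then show ?thesis by (simp add: bump_def[abs_def])
qed

lemma bump_props:
  assumes "e > 0"
  shows "norm (z - z0) \<le> e / 2 \<Longrightarrow> bump z0 e z = 1" "norm (z - z0) \<ge> e \<Longrightarrow> bump z0 e z = 0"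
    "0 \<le> bump z0 e z"
proof -
  have *: "4 * (norm (z - z0))\<^sup>2 / e\<^sup>2 = (2 * norm (z - z0) / e)\<^sup>2"
    by (simp add: power_divide power_mult_distrib)
  show "norm (z - z0) \<le> e / 2 \<Longrightarrow> bump z0 e z = 1"
    unfolding bump_def * using assms by (intro smooth_step_props) (auto simp: power_le_one_iff abs_square_le_1)
  show "bump z0 e z = 0" if "norm (z - z0) \<ge> e"
  proof -
    have "2\<^sup>2 \<le> (2 * norm (z - z0) / e)\<^sup>2"
      using assms that by (intro power_mono) (auto simp: field_simps)
    then show ?thesis unfolding bump_def * by (intro smooth_step_props) auto
  qed
  show "0 \<le> bump z0 e z" unfolding bump_def by (rule smooth_step_props)
qed

subsection \<open>Hadamard's lemma\<close>

text \<open>The Leibniz rule and the inverse function theorem ask for continuity in operator norm;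
  in finite dimension this follows from continuity on each vector.\<close>

lemma continuous_on_blinfun_derivative:
  fixes f' :: "'e::euclidean_space \<Rightarrow> 'e \<Rightarrow> 'r::euclidean_space"
  assumes "\<And>v. continuous_on U (\<lambda>z. f' z v)" "\<And>z. z \<in> U \<Longrightarrow> bounded_linear (f' z)"
  shows "continuous_on U (\<lambda>z. Blinfun (f' z))"
proof (rule continuous_on_blinfun_componentwise)
  fix i :: 'e
  show "continuous_on U (\<lambda>z. blinfun_apply (Blinfun (f' z)) i)"
    by (rule continuous_on_eq[OF assms(1)[of i]]) (use assms(2) in \<open>simp add: bounded_linear_Blinfun_apply\<close>)
qed

text \<open>Each derivative under the integral sign brings out one more factor t, hence the weight
  t^m, left arbitrary in the induction. Convexity of B keeps the segment from z0 to z inside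
  it.\<close>

lemma Ck_on_open_param_integral:
  fixes F :: "'e::euclidean_space \<Rightarrow> real"
  assumes B: "open B" "convex B" "z0 \<in> B"
  shows "Ck_on_open k F B \<Longrightarrow> Ck_on_open k (\<lambda>z. integral {0..1} (\<lambda>t. t ^ m * F (z0 + t *\<^sub>R (z - z0)))) B"
proof (induction k arbitrary: F m)
  have in_B: "z0 + t *\<^sub>R (z - z0) \<in> B" if "z \<in> B" "t \<in> {0..1}" for z t
  proof -
    have "(1 - t) *\<^sub>R z0 + t *\<^sub>R z \<in> B" using B that by (intro convexD_alt) auto
    then show ?thesis by (simp add: algebra_simps)
  qed
  have cont: "continuous_on (B \<times> cbox 0 1) (\<lambda>(z, t). t ^ m * F (z0 + t *\<^sub>R (z - z0)))"
    if "continuous_on B F" for F and m :: nat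
    unfolding split_beta
    by (intro continuous_intros continuous_on_compose2[OF that]) (use in_B in auto)
  {
    case 0
    then show ?case
      using integral_continuous_on_param[OF cont[of F m]] by (simp add: cbox_interval)
  next
    case (Suc k)
    define D where "D z = frechet_derivative F (at z)" for z
    have D: "(F has_derivative D z) (at z)" if "z \<in> B" for z
      unfolding D_def by (rule Ck_on_open_Suc_derivative(1)[OF Suc.prems that])
    have DC: "Ck_on_open k (\<lambda>z. D z v) B" for v
      unfolding D_def by (rule Ck_on_open_Suc_derivative(2)[OF Suc.prems])
    have cD: "continuous_on B (\<lambda>z. D z v)" for v
    proof -
      have "Ck_on_open 0 (\<lambda>z. D z v) B"
        using DC by (induction k) (auto intro: Ck_on_open_SucD simp del: Ck_on_open.simps)
      then show ?thesis by simp
    qed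
    have bl: "bounded_linear (D z)" if "z \<in> B" for z
      using has_derivative_bounded_linear[OF D[OF that]] .
    have cF: "continuous_on B F"
      by (meson D continuous_at_imp_continuous_on has_derivative_continuous)
    define fx where "fx z t = t ^ Suc m *\<^sub>R Blinfun (D (z0 + t *\<^sub>R (z - z0)))" for z and t :: real
    have cfx: "continuous_on (B \<times> cbox 0 1) (\<lambda>(z, t). fx z t)"
      unfolding split_beta fx_def
      by (intro continuous_intros continuous_on_compose2[OF continuous_on_blinfun_derivative[OF cD bl]])
        (use in_B in auto)
    have der: "((\<lambda>z. integral (cbox 0 1) (\<lambda>t. t ^ m * F (z0 + t *\<^sub>R (z - z0)))) has_derivative
        blinfun_apply (integral (cbox 0 1) (fx z))) (at z within B)" if "z \<in> B" for z
    proof (rule leibniz_rule[OF _ _ cfx that \<open>convex B\<close>])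
      fix z t assume z: "z \<in> B" and t: "t \<in> cbox 0 (1::real)"
      have 1: "((\<lambda>z. z0 + t *\<^sub>R (z - z0)) has_derivative (\<lambda>v. t *\<^sub>R v)) (at z within B)"
        by (auto intro!: derivative_eq_intros)
      have zt: "z0 + t *\<^sub>R (z - z0) \<in> B" using in_B[of z t] z t by simp
      have "((\<lambda>z. F (z0 + t *\<^sub>R (z - z0))) has_derivative (\<lambda>v. D (z0 + t *\<^sub>R (z - z0)) (t *\<^sub>R v))) (at z within B)"
        by (rule has_derivative_compose[OF 1 D[OF zt]])
      then have "((\<lambda>z. t ^ m * F (z0 + t *\<^sub>R (z - z0))) has_derivative
          (\<lambda>v. t ^ m * D (z0 + t *\<^sub>R (z - z0)) (t *\<^sub>R v))) (at z within B)"
        by (rule has_derivative_mult_right)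
      moreover have "blinfun_apply (fx z t) = (\<lambda>v. t ^ m * D (z0 + t *\<^sub>R (z - z0)) (t *\<^sub>R v))"
        using bl[OF zt] linear_simps(5)[OF bl[OF zt]]
        by (auto simp: fx_def fun_eq_iff blinfun.scaleR_left bounded_linear_Blinfun_apply)
      ultimately show "((\<lambda>z. t ^ m * F (z0 + t *\<^sub>R (z - z0))) has_derivative blinfun_apply (fx z t)) (at z within B)"
        by simp
    next
      fix z assume "z \<in> B"
      then show "(\<lambda>t. t ^ m * F (z0 + t *\<^sub>R (z - z0))) integrable_on cbox 0 1"
        by (intro integrable_continuous continuous_intros continuous_on_compose2[OF cF]) (use in_B in auto)
    qed
    have ev: "blinfun_apply (integral (cbox 0 1) (fx z)) v =
        integral {0..1} (\<lambda>t. t ^ Suc m * D (z0 + t *\<^sub>R (z - z0)) v)" if "z \<in> B" for z v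
    proof -
      have "continuous_on (cbox 0 1) (fx z)"
      proof -
        have "continuous_on (cbox 0 1) (\<lambda>t. (\<lambda>(z, t). fx z t) (z, t))"
          by (rule continuous_on_compose2[OF cfx]) (auto intro!: continuous_intros that)
        then show ?thesis by simp
      qed
      then have i: "fx z integrable_on cbox 0 1" by (rule integrable_continuous)
      have "blinfun_apply (integral (cbox 0 1) (fx z)) v = integral (cbox 0 1) (\<lambda>t. blinfun_apply (fx z t) v)"
        using integral_linear[OF i, of "\<lambda>L. blinfun_apply L v"]
        by (simp add: o_def blinfun.bounded_linear_left)
      also have "\<dots> = integral {0..1} (\<lambda>t. t ^ Suc m * D (z0 + t *\<^sub>R (z - z0)) v)"
        unfolding cbox_interval
        by (rule integral_cong) (use bl in_B[OF that] in \<open>auto simp: fx_def blinfun.scaleR_left bounded_linear_Blinfun_apply\<close>)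
      finally show ?thesis .
    qed
    show ?case
    proof (rule Ck_on_open_SucI[OF B(1), where f'="\<lambda>z. blinfun_apply (integral (cbox 0 1) (fx z))"])
      fix z assume z: "z \<in> B"
      show "((\<lambda>z. integral {0..1} (\<lambda>t. t ^ m * F (z0 + t *\<^sub>R (z - z0)))) has_derivative
          blinfun_apply (integral (cbox 0 1) (fx z))) (at z)"
        using der[OF z] unfolding at_within_open[OF z B(1)] cbox_interval .
    next
      fix v
      show "Ck_on_open k (\<lambda>z. blinfun_apply (integral (cbox 0 1) (fx z)) v) B"
        by (rule Ck_on_open_cong[OF B(1) _ Suc.IH[OF DC[of v], of "Suc m"]]) (rule ev[symmetric])
    qed
  }
qed

text \<open>The fundamental theorem of calculus on the segment from z0 to z; \<open>g b\<close> is
  the mean over this segment of the partial derivative in direction b.\<close>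

lemma hadamard:
  fixes f :: "'e::euclidean_space \<Rightarrow> real"
  assumes f: "smooth_open B f" and B: "convex B" "z0 \<in> B"
  obtains g where "\<And>b. smooth_open B (g b)"
    "\<And>z. z \<in> B \<Longrightarrow> f z = f z0 + (\<Sum>b\<in>Basis. ((z - z0) \<bullet> b) * g b z)"
    "\<And>b. g b z0 = frechet_derivative f (at z0) b"
proof
  have oB: "open B" by (rule smooth_openD[OF f])
  let ?D = "\<lambda>z. frechet_derivative f (at z)"
  define g where "g b z = integral {0..1} (\<lambda>t. t ^ 0 * ?D (z0 + t *\<^sub>R (z - z0)) b)" for b z
  show "smooth_open B (g b)" for b
    using Ck_on_open_param_integral[OF oB B, of _ "\<lambda>z. ?D z b" 0] smooth_open_derivative[OF f, of b] oB
    unfolding smooth_open_def g_def by auto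
  show "g b z0 = ?D z0 b" for b unfolding g_def by simp
  show "f z = f z0 + (\<Sum>b\<in>Basis. ((z - z0) \<bullet> b) * g b z)" if z: "z \<in> B" for z
  proof -
    have in_B: "z0 + t *\<^sub>R (z - z0) \<in> B" if "t \<in> {0..1}" for t
    proof -
      have "(1 - t) *\<^sub>R z0 + t *\<^sub>R z \<in> B" using B z that by (intro convexD_alt) auto
      then show ?thesis by (simp add: algebra_simps)
    qed
    have 1: "((\<lambda>t. f (z0 + t *\<^sub>R (z - z0))) has_vector_derivative ?D (z0 + t *\<^sub>R (z - z0)) (z - z0)) (at t within {0..1})"
      if t: "t \<in> {0..1}" for t
    proof -
      have d: "((\<lambda>t. z0 + t *\<^sub>R (z - z0)) has_derivative (\<lambda>h. h *\<^sub>R (z - z0))) (at t within {0..1})"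
        by (auto intro!: derivative_eq_intros)
      note D = smooth_open_has_derivative[OF f in_B[OF t]]
      from has_derivative_compose[OF d D]
      show ?thesis unfolding has_vector_derivative_def
        using linear_simps(5)[OF has_derivative_bounded_linear[OF D]] by simp
    qed
    have "((\<lambda>t. ?D (z0 + t *\<^sub>R (z - z0)) (z - z0)) has_integral (f (z0 + 1 *\<^sub>R (z - z0)) - f (z0 + 0 *\<^sub>R (z - z0)))) {0..1}"
      by (rule fundamental_theorem_of_calculus[OF _ 1]) auto
    then have "f z - f z0 = integral {0..1} (\<lambda>t. ?D (z0 + t *\<^sub>R (z - z0)) (z - z0))"
      by (simp add: integral_unique)
    also have "\<dots> = integral {0..1} (\<lambda>t. \<Sum>b\<in>Basis. ((z - z0) \<bullet> b) * ?D (z0 + t *\<^sub>R (z - z0)) b)"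
    proof (rule integral_cong)
      fix t :: real assume "t \<in> {0..1}"
      from frechet_derivative_euclidean_sum[OF smooth_open_has_derivative[OF f in_B[OF this]], of "z - z0"]
      show "?D (z0 + t *\<^sub>R (z - z0)) (z - z0) = (\<Sum>b\<in>Basis. ((z - z0) \<bullet> b) * ?D (z0 + t *\<^sub>R (z - z0)) b)"
        by simp
    qed
    also have "\<dots> = (\<Sum>b\<in>Basis. ((z - z0) \<bullet> b) * g b z)"
    proof (subst integral_sum)
      fix b
      have "continuous_on B (\<lambda>z. ?D z b)" by (rule smooth_open_continuous_on[OF smooth_open_derivative[OF f]])
      then have "continuous_on {0..1} (\<lambda>t. ((z - z0) \<bullet> b) * ?D (z0 + t *\<^sub>R (z - z0)) b)"
        by (intro continuous_intros continuous_on_compose2[where s="{0..1}" and f="\<lambda>t. z0 + t *\<^sub>R (z - z0)" and t=B]) (use in_B in auto)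
      then show "(\<lambda>t. ((z - z0) \<bullet> b) * ?D (z0 + t *\<^sub>R (z - z0)) b) integrable_on {0..1}"
        by (rule integrable_continuous_real)
    qed (auto simp: g_def)
    finally show ?thesis by simp
  qed
qed

subsection \<open>Solutions of smooth differential equations\<close>

text \<open>Along the curve, the time derivative of G(\<gamma>(t),t) is H(\<gamma>(t),t) with H =
  DG(Y,1), again smooth on \<Omega>. As the statement is for all G at once, the induction on the
  order starts from mere continuity of the curve.\<close>

lemma integral_curve_smooth:
  fixes \<gamma> :: "real \<Rightarrow> 'e::euclidean_space" and Y :: "'e \<times> real \<Rightarrow> 'e"
  assumes J: "open J" and Y: "smooth_open \<Omega> Y"
    and \<gamma>: "\<And>t. t \<in> J \<Longrightarrow> (\<gamma> t, t) \<in> \<Omega>"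
    and ode: "\<And>t. t \<in> J \<Longrightarrow> (\<gamma> has_vector_derivative Y (\<gamma> t, t)) (at t)"
    and G: "smooth_open \<Omega> G"
  shows "smooth_open J (\<lambda>t. G (\<gamma> t, t))"
proof -
  have "Ck_on_open k (\<lambda>t. G (\<gamma> t, t)) J" for k
    using G
  proof (induction k arbitrary: G)
    case 0
    have "continuous_on J \<gamma>"
      by (meson continuous_at_imp_continuous_on has_vector_derivative_continuous ode)
    then have "continuous_on J (\<lambda>t. G (\<gamma> t, t))"
      using \<gamma> by (intro continuous_on_compose2[OF smooth_open_continuous_on[OF 0]] continuous_intros) auto
    then show ?case by simp
  next
    case (Suc k)
    let ?H = "\<lambda>w. frechet_derivative G (at w) (Y w, 1)"
    have H: "smooth_open \<Omega> ?H"
      by (rule smooth_open_derivative_along[OF Suc.prems])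
        (intro smooth_intros Y smooth_openD[OF Y])
    show ?case
    proof (rule Ck_on_open_SucI[OF J, where f'="\<lambda>t v. v *\<^sub>R ?H (\<gamma> t, t)"])
      fix t assume t: "t \<in> J"
      have 1: "((\<lambda>t. (\<gamma> t, t)) has_derivative (\<lambda>v. (v *\<^sub>R Y (\<gamma> t, t), v))) (at t)"
        using ode[OF t] unfolding has_vector_derivative_def by (intro has_derivative_Pair has_derivative_ident)
      note D = smooth_open_has_derivative[OF Suc.prems \<gamma>[OF t]]
      have "((\<lambda>t. G (\<gamma> t, t)) has_derivative (\<lambda>v. frechet_derivative G (at (\<gamma> t, t)) (v *\<^sub>R Y (\<gamma> t, t), v))) (at t)"
        by (rule has_derivative_compose[OF 1 D])
      moreover have "frechet_derivative G (at (\<gamma> t, t)) (v *\<^sub>R Y (\<gamma> t, t), v) = v *\<^sub>R ?H (\<gamma> t, t)" for v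
        using linear_simps(5)[OF has_derivative_bounded_linear[OF D], of v "(Y (\<gamma> t, t), 1)"] by simp
      ultimately show "((\<lambda>t. G (\<gamma> t, t)) has_derivative (\<lambda>v. v *\<^sub>R ?H (\<gamma> t, t))) (at t)" by simp
    next
      fix v :: real
      show "Ck_on_open k (\<lambda>t. v *\<^sub>R ?H (\<gamma> t, t)) J"
        by (rule Ck_on_open_bounded_linear[OF J bounded_linear_scaleR_right Suc.IH[OF H]])
    qed
  qed
  with J show ?thesis by (simp add: smooth_open_def)
qed

text \<open>To the right of t0 the function N(t) exp(-Ct) does not increase, to the left N(t)
  exp(Ct) does not decrease; together with N \<ge> 0 this pins N to 0.\<close>

lemma gronwall_zero:
  fixes N :: "real \<Rightarrow> real"
  assumes der: "\<And>t. t \<in> {a<..<b} \<Longrightarrow> (N has_real_derivative N' t) (at t)"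
    and bound: "\<And>t. t \<in> {a<..<b} \<Longrightarrow> \<bar>N' t\<bar> \<le> C * N t"
    and pos: "\<And>t. t \<in> {a<..<b} \<Longrightarrow> 0 \<le> N t"
    and t0: "t0 \<in> {a<..<b}" "N t0 = 0" and t: "t \<in> {a<..<b}"
  shows "N t = 0"
proof (cases "t0 \<le> t")
  case True
  have "N t * exp (- C * t) \<le> N t0 * exp (- C * t0)"
  proof (rule DERIV_nonpos_imp_nonincreasing[OF True])
    fix s assume "t0 \<le> s" "s \<le> t"
    then have s: "s \<in> {a<..<b}" using t0 t by auto
    have "((\<lambda>s. N s * exp (- C * s)) has_real_derivative (N' s - C * N s) * exp (- C * s)) (at s)"
      by (auto intro!: derivative_eq_intros der[OF s] simp: algebra_simps)
    moreover have "(N' s - C * N s) * exp (- C * s) \<le> 0"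
      using bound[OF s] by (intro mult_nonpos_nonneg) auto
    ultimately show "\<exists>y. ((\<lambda>s. N s * exp (- C * s)) has_real_derivative y) (at s) \<and> y \<le> 0" by blast
  qed
  then show ?thesis using pos[OF t] t0(2) by (simp add: mult_le_0_iff)
next
  case False
  then have le: "t \<le> t0" by simp
  have "N t * exp (C * t) \<le> N t0 * exp (C * t0)"
  proof (rule DERIV_nonneg_imp_nondecreasing[OF le])
    fix s assume "t \<le> s" "s \<le> t0"
    then have s: "s \<in> {a<..<b}" using t0 t by auto
    have "((\<lambda>s. N s * exp (C * s)) has_real_derivative (N' s + C * N s) * exp (C * s)) (at s)"
      by (auto intro!: derivative_eq_intros der[OF s] simp: algebra_simps)
    moreover have "(N' s + C * N s) * exp (C * s) \<ge> 0"
      using bound[OF s] by (intro mult_nonneg_nonneg) auto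
    ultimately show "\<exists>y. ((\<lambda>s. N s * exp (C * s)) has_real_derivative y) (at s) \<and> 0 \<le> y" by blast
  qed
  then show ?thesis using pos[OF t] t0(2) by (simp add: mult_le_0_iff)
qed

subsection \<open>Level sets and immersions\<close>

text \<open>The curve is the image of the line z0 + t w under a local inverse of a map \<Phi> that
  straightens q. Everything is kept inside the subspaces W and W' because charts take values in
  model subspaces.\<close>

lemma level_set_curve:
  fixes q :: "'e::euclidean_space \<Rightarrow> 'f::euclidean_space"
  assumes q: "smooth_open \<Omega> q" "z0 \<in> \<Omega>" "z0 \<in> W" "subspace W" "subspace W'"
    and qW: "\<And>z. z \<in> \<Omega> \<Longrightarrow> q z \<in> W'"
    and D: "D = frechet_derivative q (at z0)" and DW: "D ` W = W'" and Dr: "\<And>z. D z \<in> W'"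
    and w: "w \<in> W" "D w = 0"
  obtains c where "c 0 = z0" "(c has_vector_derivative w) (at 0)"
    "\<forall>\<^sub>F t in nhds 0. c t \<in> \<Omega> \<inter> W \<and> q (c t) = q z0"
proof -
  have Dder: "(q has_derivative D) (at z0)" unfolding D by (rule smooth_open_has_derivative[OF q(1,2)])
  have blD: "bounded_linear D" by (rule has_derivative_bounded_linear[OF Dder])
  then have linD: "linear D" by (rule bounded_linear.linear)
  obtain R where R: "range R \<subseteq> W" "linear R" "\<And>v. v \<in> D ` W \<Longrightarrow> D (R v) = v"
    using linear_exists_right_inverse_on[OF linD q(4)] by blast
  have blR: "bounded_linear R" using R(2) by (rule linear_conv_bounded_linear[THEN iffD1])
  \<comment> \<open>\<open>R\<close> inverts D on W'. The map \<Phi> exchanges the linear part R D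
    (z - z0) for the true increment of q, so its derivative at z0 is the identity and D(\<Phi>(z) -
    z0) = q(z) - q(z0).\<close>
  define \<Phi> where "\<Phi> z = z - R (D (z - z0)) + R (q z - q z0)" for z
  have o: "open \<Omega>" by (rule smooth_openD[OF q(1)])
  have sm: "smooth_open \<Omega> \<Phi>"
    unfolding \<Phi>_def
    by (intro smooth_intros smooth_open_bounded_linear[OF blR] smooth_open_bounded_linear[OF blD] q(1) o)
  define D\<Phi> where "D\<Phi> z = frechet_derivative \<Phi> (at z)" for z
  have d\<Phi>: "(\<Phi> has_derivative D\<Phi> z) (at z)" if "z \<in> \<Omega>" for z
    unfolding D\<Phi>_def by (rule smooth_open_has_derivative[OF sm that])
  have "(\<Phi> has_derivative (\<lambda>v. v - R (D v) + R (D v))) (at z0)"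
    unfolding \<Phi>_def
    by (auto intro!: derivative_eq_intros Dder bounded_linear.has_derivative[OF blR] bounded_linear.has_derivative[OF blD])
  then have D0: "D\<Phi> z0 = (\<lambda>v. v)"
    unfolding D\<Phi>_def by (simp add: frechet_derivative_at[symmetric])
  have bl: "bounded_linear (D\<Phi> z)" if "z \<in> \<Omega>" for z
    using has_derivative_bounded_linear[OF d\<Phi>[OF that]] .
  have 1: "(\<Phi> has_derivative blinfun_apply (Blinfun (D\<Phi> z))) (at z)" if "z \<in> \<Omega>" for z
    using d\<Phi>[OF that] bl[OF that] by (simp add: bounded_linear_Blinfun_apply)
  have 2: "continuous_on \<Omega> (\<lambda>z. Blinfun (D\<Phi> z))"
    using smooth_open_continuous_on[OF smooth_open_derivative[OF sm]]
    by (intro continuous_on_blinfun_derivative bl) (simp_all add: D\<Phi>_def)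
  have 3: "id_blinfun o\<^sub>L Blinfun (D\<Phi> z0) = id_blinfun"
    by (rule blinfun_eqI) (simp add: bounded_linear_Blinfun_apply bl q(2) D0)
  obtain U' V g g' where U': "open U'" "U' \<subseteq> \<Omega>" "z0 \<in> U'" and V: "open V" "\<Phi> z0 \<in> V"
    and h: "homeomorphism U' V \<Phi> g" and dg: "\<And>y. y \<in> V \<Longrightarrow> (g has_derivative g' y) (at y)"
    and g': "\<And>y. y \<in> V \<Longrightarrow> g' y = inv (blinfun_apply (Blinfun (D\<Phi> (g y))))"
    using inverse_function_theorem[OF o 1 2 q(2) 3] by metis
  have \<Phi>0: "\<Phi> z0 = z0" using linear_0[OF linD] linear_0[OF R(2)] by (simp add: \<Phi>_def)
  have g0: "g z0 = z0" using h U'(3) \<Phi>0 unfolding homeomorphism_def by metis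
  have "(g has_derivative (\<lambda>v. v)) (at z0)"
  proof -
    have "g' z0 = inv (\<lambda>v. v)"
      using g'[OF V(2)] D0 bl[OF q(2)] g0 \<Phi>0 by (simp add: bounded_linear_Blinfun_apply)
    then have "g' z0 = (\<lambda>v. v)" using inv_id by (simp add: id_def)
    then show ?thesis using dg[OF V(2)] \<Phi>0 by simp
  qed
  moreover define c where "c t = g (z0 + t *\<^sub>R w)" for t
  moreover have "((\<lambda>t. z0 + t *\<^sub>R w) has_derivative (\<lambda>h. h *\<^sub>R w)) (at 0)"
    by (auto intro!: derivative_eq_intros)
  ultimately have dc: "(c has_vector_derivative w) (at 0)"
    using has_derivative_compose[of "\<lambda>t. z0 + t *\<^sub>R w" "\<lambda>h. h *\<^sub>R w" 0 UNIV g "\<lambda>v. v"]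
    unfolding has_vector_derivative_def c_def by simp
  have "\<forall>\<^sub>F t in nhds 0. z0 + t *\<^sub>R w \<in> V"
  proof -
    have "isCont (\<lambda>t::real. z0 + t *\<^sub>R w) 0" by (intro continuous_intros)
    then have "((\<lambda>t. z0 + t *\<^sub>R w) \<longlongrightarrow> z0) (nhds 0)"
      using tendsto_at_iff_tendsto_nhds[of "\<lambda>t. z0 + t *\<^sub>R w" 0] by (simp add: continuous_within)
    then show ?thesis using V \<Phi>0 by (intro topological_tendstoD) auto
  qed
  then have ev: "\<forall>\<^sub>F t in nhds 0. c t \<in> \<Omega> \<inter> W \<and> q (c t) = q z0"
  proof (rule eventually_mono)
    fix t assume tV: "z0 + t *\<^sub>R w \<in> V"
    have ct: "c t \<in> U'" "\<Phi> (c t) = z0 + t *\<^sub>R w"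
      using h tV unfolding homeomorphism_def c_def by auto
    have cO: "c t \<in> \<Omega>" using ct U' by auto
    have e: "c t - R (D (c t - z0)) + R (q (c t) - q z0) = z0 + t *\<^sub>R w" using ct(2) by (simp add: \<Phi>_def)
    have qd: "q (c t) - q z0 \<in> W'" using qW[OF cO] qW[OF q(2)] q(5) by (simp add: subspace_diff)
    have "c t - z0 - R (D (c t - z0)) + R (q (c t) - q z0) = t *\<^sub>R w"
      using e by (simp add: algebra_simps)
    then have "D (c t - z0 - R (D (c t - z0)) + R (q (c t) - q z0)) = D (t *\<^sub>R w)" by simp
    then have "D (c t - z0) - D (R (D (c t - z0))) + D (R (q (c t) - q z0)) = 0"
      using w(2) by (simp only: linear_add[OF linD] linear_diff[OF linD] linear_scale[OF linD] scaleR_zero_right)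
    then have "q (c t) = q z0"
      using R(3)[of "D (c t - z0)"] R(3)[of "q (c t) - q z0"] qd Dr DW by simp
    moreover have "c t \<in> W"
    proof -
      have "c t = z0 + t *\<^sub>R w + R (D (c t - z0)) - R (q (c t) - q z0)"
        using e by (simp add: algebra_simps)
      moreover have "z0 + t *\<^sub>R w + R (D (c t - z0)) - R (q (c t) - q z0) \<in> W"
        using q(3,4) w(1) R(1) by (intro subspace_add subspace_diff subspace_scale) auto
      ultimately show ?thesis by simp
    qed
    ultimately show "c t \<in> \<Omega> \<inter> W \<and> q (c t) = q z0" using cO by simp
  qed
  have "c 0 = z0" using g0 by (simp add: c_def)
  from that[OF this dc ev] show thesis .
qed

text \<open>A curve that is differentiable in the ambient space and continuous in the source of an immersion
  has Lipschitz coordinates in the source, so its velocity is tangent to the image.\<close>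

lemma immersion_velocity:
  fixes j :: "'e::euclidean_space \<Rightarrow> 'f::euclidean_space" and \<gamma> :: "real \<Rightarrow> 'e"
  assumes j: "(j has_derivative A) (at z0)" and W: "subspace W"
    and inj: "\<And>u. u \<in> W \<Longrightarrow> A u = 0 \<Longrightarrow> u = 0"
    and \<gamma>: "(\<gamma> \<longlongrightarrow> z0) (at 0)" "\<gamma> 0 = z0" "\<forall>\<^sub>F t in at 0. \<gamma> t - z0 \<in> W"
    and w: "((\<lambda>t. j (\<gamma> t)) has_vector_derivative w) (at 0)"
  shows "w \<in> A ` W"
proof -
  have blA: "bounded_linear A" by (rule has_derivative_bounded_linear[OF j])
  have linA: "linear A" by (rule bounded_linear.linear[OF blA])
  obtain e where e: "e > 0" "\<And>u. u \<in> W \<Longrightarrow> norm (A u) \<ge> e * norm u"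
    using injective_imp_isometric[OF closed_subspace[OF W] W blA] inj by blast
  define r where "r t = j (\<gamma> t) - j z0 - A (\<gamma> t - z0)" for t
  have small: "\<forall>\<^sub>F t in at 0. norm (r t) \<le> \<eta> * norm (\<gamma> t - z0)" if \<eta>: "\<eta> > 0" for \<eta>
  proof -
    obtain d where d: "d > 0" "\<And>y. norm (y - z0) < d \<Longrightarrow> norm (j y - j z0 - A (y - z0)) \<le> \<eta> * norm (y - z0)"
      using has_derivative_at_alt[THEN iffD1, OF j] \<eta> by blast
    have "\<forall>\<^sub>F t in at 0. dist (\<gamma> t) z0 < d" using \<gamma>(1) d(1) by (simp add: tendsto_iff)
    then show ?thesis by (rule eventually_mono) (use d(2) in \<open>auto simp: dist_norm r_def\<close>)
  qed
  have q: "((\<lambda>t. (j (\<gamma> t) - j z0) /\<^sub>R t) \<longlongrightarrow> w) (at 0)"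
  proof -
    have "((\<lambda>t. norm (j (\<gamma> t) - j z0 - t *\<^sub>R w) / norm t) \<longlongrightarrow> 0) (at 0)"
      using w \<gamma>(2) by (simp add: has_vector_derivative_def has_derivative_iff_norm)
    then have "((\<lambda>t. norm ((j (\<gamma> t) - j z0) /\<^sub>R t - w)) \<longlongrightarrow> 0) (at 0)"
    proof (rule Lim_transform_eventually)
      show "\<forall>\<^sub>F t in at 0. norm (j (\<gamma> t) - j z0 - t *\<^sub>R w) / norm t = norm ((j (\<gamma> t) - j z0) /\<^sub>R t - w)"
        using eventually_neq_at_within[of 0]
      proof (rule eventually_mono)
        fix t :: real assume t: "t \<noteq> 0"
        then have "(j (\<gamma> t) - j z0) /\<^sub>R t - w = (j (\<gamma> t) - j z0 - t *\<^sub>R w) /\<^sub>R t"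
          by (simp add: scaleR_right_diff_distrib)
        then show "norm (j (\<gamma> t) - j z0 - t *\<^sub>R w) / norm t = norm ((j (\<gamma> t) - j z0) /\<^sub>R t - w)"
          by (simp add: divide_inverse mult.commute)
      qed
    qed
    then show ?thesis using Lim_null tendsto_norm_zero_iff by blast
  qed
  \<comment> \<open>From e|\<gamma>(t) - z0| \<le> |A(\<gamma>(t) - z0)| \<le> (|w| + 1)|t| +
    (e/2)|\<gamma>(t) - z0|; absorbing the last term leaves the constant 2(|w| + 1)/e.\<close>
  have lip: "\<forall>\<^sub>F t in at 0. norm (\<gamma> t - z0) \<le> (2 * (norm w + 1) / e) * \<bar>t\<bar>"
  proof -
    have "\<forall>\<^sub>F t in at 0. dist ((j (\<gamma> t) - j z0) /\<^sub>R t) w < 1" using q by (simp add: tendsto_iff)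
    with small[OF half_gt_zero[OF e(1)]] \<gamma>(3) eventually_neq_at_within[of 0]
    show ?thesis
    proof eventually_elim
      case (elim t)
      have "norm ((j (\<gamma> t) - j z0) /\<^sub>R t) \<le> norm w + 1"
        using elim(4) norm_triangle_ineq2[of "(j (\<gamma> t) - j z0) /\<^sub>R t" w] by (simp add: dist_norm)
      then have 1: "norm (j (\<gamma> t) - j z0) \<le> (norm w + 1) * \<bar>t\<bar>"
      proof -
        have "norm ((j (\<gamma> t) - j z0) /\<^sub>R t) = norm (j (\<gamma> t) - j z0) / \<bar>t\<bar>"
          by (simp add: divide_inverse mult.commute)
        then have "norm (j (\<gamma> t) - j z0) / \<bar>t\<bar> \<le> norm w + 1"
          using \<open>norm ((j (\<gamma> t) - j z0) /\<^sub>R t) \<le> norm w + 1\<close> by simp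
        then show ?thesis using elim(3) by (subst (asm) pos_divide_le_eq) auto
      qed
      have "e * norm (\<gamma> t - z0) \<le> norm (A (\<gamma> t - z0))" using e(2) elim by blast
      also have "A (\<gamma> t - z0) = j (\<gamma> t) - j z0 - r t" by (simp add: r_def)
      also have "norm (j (\<gamma> t) - j z0 - r t) \<le> (norm w + 1) * \<bar>t\<bar> + e / 2 * norm (\<gamma> t - z0)"
        using norm_triangle_ineq4[of "j (\<gamma> t) - j z0" "r t"] 1 elim by linarith
      finally show ?case using e(1) by (simp add: field_simps)
    qed
  qed
  \<comment> \<open>The remainder is o(|\<gamma>(t) - z0|), hence o(t) by the Lipschitz
    bound.\<close>
  have r0: "((\<lambda>t. r t /\<^sub>R t) \<longlongrightarrow> 0) (at 0)"
    unfolding tendsto_iff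
  proof (intro allI impI)
    fix \<epsilon> :: real assume \<epsilon>: "\<epsilon> > 0"
    define K where "K = 2 * (norm w + 1) / e"
    have K: "K > 0" using e(1) by (simp add: K_def add_pos_nonneg add.commute)
    have "\<epsilon> / (2 * K) > 0" using K \<epsilon> by simp
    from small[OF this] show "\<forall>\<^sub>F t in at 0. dist (r t /\<^sub>R t) 0 < \<epsilon>"
      using lip eventually_neq_at_within[of 0]
    proof eventually_elim
      case (elim t)
      have "norm (r t) \<le> \<epsilon> / (2 * K) * (K * \<bar>t\<bar>)"
        using elim(2) K \<epsilon> unfolding K_def[symmetric]
        by (intro order_trans[OF elim(1)] mult_left_mono) auto
      then have "norm (r t) \<le> \<epsilon> / 2 * \<bar>t\<bar>" using K by simp
      then have "norm (r t) / \<bar>t\<bar> \<le> \<epsilon> / 2" using elim(3) by (subst pos_divide_le_eq) auto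
      moreover have "dist (r t /\<^sub>R t) 0 = norm (r t) / \<bar>t\<bar>"
        by (simp add: divide_inverse mult.commute)
      ultimately show ?case using \<epsilon> by linarith
    qed
  qed
  have "((\<lambda>t. A ((\<gamma> t - z0) /\<^sub>R t)) \<longlongrightarrow> w) (at 0)"
  proof -
    have "(j (\<gamma> t) - j z0) /\<^sub>R t - r t /\<^sub>R t = A ((\<gamma> t - z0) /\<^sub>R t)" for t
    proof -
      have "A ((\<gamma> t - z0) /\<^sub>R t) = A (\<gamma> t - z0) /\<^sub>R t" by (rule linear_scale[OF linA])
      then show ?thesis by (simp add: r_def scaleR_right_diff_distrib)
    qed
    then show ?thesis using tendsto_diff[OF q r0] by simp
  qed
  moreover have "\<forall>\<^sub>F t in at 0. A ((\<gamma> t - z0) /\<^sub>R t) \<in> A ` W"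
    using \<gamma>(3) by (rule eventually_mono) (use subspace_scale[OF W] in auto)
  \<comment> \<open>The difference quotients of \<gamma> need not converge, but their images under A
    do, and a finite-dimensional subspace is closed.\<close>
  moreover have "closed (A ` W)"
    by (rule closed_subspace[OF linear_subspace_image[OF linA W]])
  ultimately show ?thesis using Lim_in_closed_set[of "A ` W"] by (metis at_neq_bot)
qed

subsection \<open>Adjugates over a ring of functions\<close>

text \<open>Fraction-free Gaussian elimination. The outcome is a left inverse up to a scalar D,
  built from the entries of the matrix by ring operations alone, so its coefficients stay in the
  ring F; invertibility at the single point x0 only serves to make D nonzero there. The ring is
  abstract because it is instantiated with smooth functions on different open sets.\<close>

lemma adjugate_family:
  fixes a :: "nat \<Rightarrow> nat \<Rightarrow> 'x \<Rightarrow> real"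
  assumes const: "\<And>c. (\<lambda>x. c) \<in> F"
    and add: "\<And>f g. f \<in> F \<Longrightarrow> g \<in> F \<Longrightarrow> (\<lambda>x. f x + g x) \<in> F"
    and mult: "\<And>f g. f \<in> F \<Longrightarrow> g \<in> F \<Longrightarrow> (\<lambda>x. f x * g x) \<in> F"
    and a: "\<And>i j. i < n \<Longrightarrow> j < n \<Longrightarrow> a i j \<in> F"
    and inj: "\<And>c. \<forall>j<n. (\<Sum>i<n. c i * a i j x0) = 0 \<Longrightarrow> \<forall>i<n. c i = 0"
  shows "\<exists>D e. D \<in> F \<and> D x0 \<noteq> 0 \<and> (\<forall>i<n. \<forall>j<n. e i j \<in> F) \<and>
    (\<forall>x. \<forall>i<n. \<forall>j<n. (\<Sum>k<n. e i k x * a k j x) = (if i = j then D x else 0))"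
  using a inj
proof (induction n arbitrary: a)
  case 0
  show ?case by (intro exI[of _ "\<lambda>x. 1"]) (use const in auto)
next
  case (Suc n)
  have minus: "(\<lambda>x. - f x) \<in> F" if "f \<in> F" for f using mult[OF const[of "-1"] that] by simp
  have sum: "(\<lambda>x. \<Sum>i<m. f i x) \<in> F" if "\<And>i. i < m \<Longrightarrow> f i \<in> F" for m :: nat and f
    using that by (induction m) (auto intro: const add)
  \<comment> \<open>If the last row vanished at x0, the coefficients (0,...,0,1) would contradict
    injectivity.\<close>
  have "\<exists>j<Suc n. a n j x0 \<noteq> 0"
  proof (rule ccontr)
    assume "\<not> ?thesis"
    then have "\<forall>j<Suc n. (\<Sum>i<Suc n. (if i = n then 1 else 0) * a i j x0) = 0" by simp
    from Suc.prems(2)[OF this] show False by auto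
  qed
  then obtain j0 where j0: "j0 < Suc n" "a n j0 x0 \<noteq> 0" by blast
  \<comment> \<open>Swapping columns n and j0 moves the pivot to the corner (n,n).\<close>
  define \<sigma> where "\<sigma> = Transposition.transpose n j0"
  have \<sigma>: "\<sigma> j < Suc n" if "j < Suc n" for j using that j0(1) by (auto simp: \<sigma>_def Transposition.transpose_def)
  have \<sigma>\<sigma>: "\<sigma> (\<sigma> j) = j" for j by (simp add: \<sigma>_def)
  define b where "b i j = a i (\<sigma> j)" for i j
  have bF: "b i j \<in> F" if "i < Suc n" "j < Suc n" for i j using Suc.prems(1) \<sigma> that by (simp add: b_def)
  have b_nn: "b n n x0 \<noteq> 0" using j0(2) by (simp add: b_def \<sigma>_def)
  have b_inj: "\<forall>i<Suc n. c i = 0" if c: "\<forall>j<Suc n. (\<Sum>i<Suc n. c i * b i j x0) = 0" for c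
  proof (rule Suc.prems(2), intro allI impI)
    fix j assume "j < Suc n"
    with c \<sigma> have "(\<Sum>i<Suc n. c i * b i (\<sigma> j) x0) = 0" by blast
    then show "(\<Sum>i<Suc n. c i * a i j x0) = 0" by (simp only: b_def \<sigma>\<sigma>)
  qed
  \<comment> \<open>Elimination with the corner pivot without dividing: each entry is the 2 by 2
    minor formed with the last row and column.\<close>
  define a' where "a' i j x = b n n x * b i j x - b i n x * b n j x" for i j x
  have a'F: "a' i j \<in> F" if "i < n" "j < n" for i j
  proof -
    have "(\<lambda>x. b n n x * b i j x + - (b i n x * b n j x)) \<in> F"
      using that by (intro add minus mult bF) auto
    then show ?thesis by (simp add: a'_def[abs_def])
  qed
  have a'_inj: "\<forall>i<n. c i = 0" if c: "\<forall>j<n. (\<Sum>i<n. c i * a' i j x0) = 0" for c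
  proof -
    \<comment> \<open>A relation among the rows of \<open>a'\<close> lifts to one among the rows of
      \<open>b\<close>: scale by the pivot and choose the last coefficient so that column n
      cancels.\<close>
    define c' where "c' i = (if i < n then b n n x0 * c i else - (\<Sum>i<n. c i * b i n x0))" for i
    have z: "(\<Sum>i<Suc n. c' i * b i j x0) = 0" if "j < Suc n" for j
    proof -
      have "(\<Sum>i<Suc n. c' i * b i j x0) = (\<Sum>i<n. c i * a' i j x0)"
        by (simp add: c'_def a'_def sum_subtractf sum_distrib_left sum_distrib_right algebra_simps)
      moreover have "(\<Sum>i<n. c i * a' i n x0) = 0" by (simp add: a'_def algebra_simps)
      ultimately show ?thesis using c that less_Suc_eq by metis
    qed
    have "\<forall>i<Suc n. c' i = 0" by (rule b_inj) (intro allI impI z)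
    then have "c' i = 0" if "i < n" for i using less_SucI[OF that] by blast
    then show ?thesis using b_nn by (simp add: c'_def)
  qed
  obtain D' e' where D': "D' \<in> F" "D' x0 \<noteq> 0" and e'F: "\<And>i j. i < n \<Longrightarrow> j < n \<Longrightarrow> e' i j \<in> F"
    and e': "\<And>x i j. i < n \<Longrightarrow> j < n \<Longrightarrow> (\<Sum>k<n. e' i k x * a' k j x) = (if i = j then D' x else 0)"
  proof -
    have "\<exists>D e. D \<in> F \<and> D x0 \<noteq> 0 \<and> (\<forall>i<n. \<forall>j<n. e i j \<in> F) \<and>
      (\<forall>x. \<forall>i<n. \<forall>j<n. (\<Sum>k<n. e i k x * a' k j x) = (if i = j then D x else 0))"
      by (rule Suc.IH) (use a'F a'_inj in blast)+
    then show thesis using that by blast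
  qed
  \<comment> \<open>Block inversion through the complement \<open>a'\<close>, cleared of
    denominators; the new scalar is the pivot times \<open>D'\<close>.\<close>
  define f where "f i k x =
     (if i < n then (if k < n then b n n x * (b n n x * e' i k x) else - (b n n x * (\<Sum>l<n. e' i l x * b l n x)))
      else (if k < n then - (\<Sum>j<n. b n j x * (b n n x * e' j k x))
            else D' x + (\<Sum>j<n. b n j x * (\<Sum>l<n. e' j l x * b l n x))))" for i k x
  have fF: "f i k \<in> F" for i k
  proof (cases "i < n"; cases "k < n")
    assume "i < n" "k < n"
    then have "f i k = (\<lambda>x. b n n x * (b n n x * e' i k x))" by (intro ext) (simp add: f_def)
    moreover have "\<dots> \<in> F" using \<open>i < n\<close> \<open>k < n\<close> by (intro mult bF e'F) auto
    ultimately show ?thesis by (simp only:)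
  next
    assume "i < n" "\<not> k < n"
    then have "f i k = (\<lambda>x. - (b n n x * (\<Sum>l<n. e' i l x * b l n x)))" by (intro ext) (simp add: f_def)
    moreover have "\<dots> \<in> F" using \<open>i < n\<close> by (intro mult bF e'F minus sum) auto
    ultimately show ?thesis by (simp only:)
  next
    assume "\<not> i < n" "k < n"
    then have "f i k = (\<lambda>x. - (\<Sum>j<n. b n j x * (b n n x * e' j k x)))" by (intro ext) (simp add: f_def)
    moreover have "\<dots> \<in> F" using \<open>k < n\<close> by (intro mult bF e'F minus sum) auto
    ultimately show ?thesis by (simp only:)
  next
    assume "\<not> i < n" "\<not> k < n"
    then have "f i k = (\<lambda>x. D' x + (\<Sum>j<n. b n j x * (\<Sum>l<n. e' j l x * b l n x)))" by (intro ext) (simp add: f_def)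
    moreover have "\<dots> \<in> F" by (intro mult bF e'F add D' sum) auto
    ultimately show ?thesis by (simp only:)
  qed
  have row: "(\<Sum>k<n. e' i k x * (b n n x * b k j x)) - (\<Sum>k<n. e' i k x * b k n x) * b n j x
      = (if i = j then D' x else 0)" if "i < n" "j < Suc n" for i j x
  proof (cases "j < n")
    case True
    have "(\<Sum>k<n. e' i k x * (b n n x * b k j x)) - (\<Sum>k<n. e' i k x * b k n x) * b n j x = (\<Sum>k<n. e' i k x * a' k j x)"
      by (simp add: a'_def sum_subtractf sum_distrib_left sum_distrib_right algebra_simps)
    then show ?thesis using e'[OF that(1) True] by simp
  next
    case False
    then have "j = n" using that by simp
    then show ?thesis using that(1) by (simp add: sum_distrib_left sum_distrib_right algebra_simps)
  qed
  have fb: "(\<Sum>k<Suc n. f i k x * b k j x) = (if i = j then b n n x * D' x else 0)" if "i < Suc n" "j < Suc n" for i j x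
  proof (cases "i < n")
    case True
    have "(\<Sum>k<Suc n. f i k x * b k j x) = b n n x *
        ((\<Sum>k<n. e' i k x * (b n n x * b k j x)) - (\<Sum>k<n. e' i k x * b k n x) * b n j x)"
      using True by (simp add: f_def sum_distrib_left algebra_simps)
    then show ?thesis unfolding row[OF True that(2)] by simp
  next
    case False
    then have i: "i = n" using that by simp
    have "(\<Sum>k<Suc n. f n k x * b k j x) = D' x * b n j x
        - (\<Sum>l<n. b n l x * ((\<Sum>k<n. e' l k x * (b n n x * b k j x)) - (\<Sum>k<n. e' l k x * b k n x) * b n j x))"
    proof -
      have "(\<Sum>k<n. f n k x * b k j x) = - (\<Sum>l<n. b n l x * (\<Sum>k<n. e' l k x * (b n n x * b k j x)))"
        unfolding sum_distrib_left
        by (subst sum.swap) (simp add: f_def sum_distrib_right sum_distrib_left sum_negf algebra_simps)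
      then show ?thesis
        by (simp add: f_def sum_subtractf right_diff_distrib sum_distrib_right distrib_right mult.assoc)
    qed
    also have "\<dots> = D' x * b n j x - (\<Sum>l<n. b n l x * (if l = j then D' x else 0))"
      using row[OF _ that(2)] by (intro arg_cong2[where f=minus] refl sum.cong) auto
    also have "\<dots> = (if n = j then b n n x * D' x else 0)"
      using that(2) by (auto simp: if_distrib[of "\<lambda>t. _ * t"] less_Suc_eq cong: if_cong)
    finally show ?thesis using i by simp
  qed
  show ?case
  \<comment> \<open>The columns of \<open>a\<close> were permuted by \<sigma>, so the rows of the
    left inverse are permuted back.\<close>
  proof (intro exI[of _ "\<lambda>x. b n n x * D' x"] exI[of _ "\<lambda>i k. f (\<sigma> i) k"] conjI allI impI)
    show "(\<lambda>x. b n n x * D' x) \<in> F" by (intro mult bF D') auto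
    show "b n n x0 * D' x0 \<noteq> 0" using b_nn D' by simp
    show "f (\<sigma> i) j \<in> F" for i j by (rule fF)
    fix x i j assume ij: "i < Suc n" "j < Suc n"
    have "(\<Sum>k<Suc n. f (\<sigma> i) k x * a k j x) = (\<Sum>k<Suc n. f (\<sigma> i) k x * b k (\<sigma> j) x)"
      by (simp only: b_def \<sigma>\<sigma>)
    also have "\<dots> = (if \<sigma> i = \<sigma> j then b n n x * D' x else 0)" by (rule fb) (use \<sigma> ij in auto)
    also have "(\<sigma> i = \<sigma> j) = (i = j)" using \<sigma>\<sigma> by metis
    finally show "(\<Sum>k<Suc n. f (\<sigma> i) k x * a k j x) = (if i = j then b n n x * D' x else 0)" .
  qed
qed

section \<open>Charts and smooth functions\<close>

subsection \<open>Orthonormal frames of the model space\<close>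

lemma orthonormal_enumeration:
  fixes W :: "'e::euclidean_space set"
  assumes "subspace W"
  shows "\<exists>b :: nat \<Rightarrow> 'e. (\<forall>i<dim W. b i \<in> W) \<and>
    (\<forall>i<dim W. \<forall>j<dim W. b i \<bullet> b j = (if i = j then 1 else 0)) \<and>
    (\<forall>z\<in>W. z = (\<Sum>i<dim W. (z \<bullet> b i) *\<^sub>R b i))"
proof -
  obtain B where B: "B \<subseteq> W" "pairwise orthogonal B" "\<And>x. x \<in> B \<Longrightarrow> norm x = 1"
    "independent B" "card B = dim W" "span B = W"
    using orthonormal_basis_subspace[OF assms] by metis
  have fin: "finite B" using B(4) by (rule independent_imp_finite)
  obtain b where "bij_betw b {0..<card B} B" using ex_bij_betw_nat_finite[OF fin] by blast
  then have b: "bij_betw b {..<dim W} B" using B(5) by (simp add: atLeast0LessThan)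
  have bB: "b i \<in> B" if "i < dim W" for i using b that by (auto simp: bij_betw_def)
  have on: "b i \<bullet> b j = (if i = j then 1 else 0)" if "i < dim W" "j < dim W" for i j
  proof (cases "i = j")
    case True
    then show ?thesis using B(3)[OF bB[OF that(1)]] by (simp add: norm_eq_1)
  next
    case False
    then have "b i \<noteq> b j" using b that by (auto simp: bij_betw_def inj_on_def)
    then show ?thesis using B(2) bB that False by (auto simp: pairwise_def orthogonal_def)
  qed
  have "z = (\<Sum>i<dim W. (z \<bullet> b i) *\<^sub>R b i)" if "z \<in> W" for z
  proof -
    have "z \<in> span B" using that B(6) by simp
    then obtain u where "z = (\<Sum>x\<in>B. u x *\<^sub>R x)" using span_finite[OF fin] by auto
    then have z: "z = (\<Sum>i<dim W. u (b i) *\<^sub>R b i)"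
      using sum.reindex_bij_betw[OF b, of "\<lambda>x. u x *\<^sub>R x"] by simp
    have "z \<bullet> b j = u (b j)" if "j < dim W" for j
    proof -
      have "z \<bullet> b j = (\<Sum>i<dim W. u (b i) * (b i \<bullet> b j))" by (subst z) (simp add: inner_sum_left)
      also have "\<dots> = (\<Sum>i<dim W. if i = j then u (b i) else 0)" by (rule sum.cong) (use on that in auto)
      finally show ?thesis using that by simp
    qed
    then have "(\<Sum>i<dim W. (z \<bullet> b i) *\<^sub>R b i) = (\<Sum>i<dim W. u (b i) *\<^sub>R b i)" by (intro sum.cong) auto
    then show ?thesis using z by simp
  qed
  then show ?thesis using bB B(1) on by (intro exI[of _ b]) auto
qed

definition model_frame :: "'e::euclidean_space set \<Rightarrow> nat \<Rightarrow> 'e" where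
  "model_frame W = (SOME b. (\<forall>i<dim W. b i \<in> W) \<and>
    (\<forall>i<dim W. \<forall>j<dim W. b i \<bullet> b j = (if i = j then 1 else 0)) \<and>
    (\<forall>z\<in>W. z = (\<Sum>i<dim W. (z \<bullet> b i) *\<^sub>R b i)))"

definition model_proj :: "'e::euclidean_space set \<Rightarrow> 'e \<Rightarrow> 'e" where
  "model_proj W z = (\<Sum>i<dim W. (z \<bullet> model_frame W i) *\<^sub>R model_frame W i)"

lemma model_frame:
  assumes "subspace W"
  shows "i < dim W \<Longrightarrow> model_frame W i \<in> W"
    and "i < dim W \<Longrightarrow> j < dim W \<Longrightarrow> model_frame W i \<bullet> model_frame W j = (if i = j then 1 else 0)"
    and "z \<in> W \<Longrightarrow> model_proj W z = z"
  using someI_ex[OF orthonormal_enumeration[OF assms]]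
  unfolding model_frame_def[symmetric] model_proj_def by simp_all

lemma bounded_linear_model_proj: "bounded_linear (model_proj W)"
  unfolding model_proj_def
  by (intro bounded_linear_sum bounded_linear_scaleR_const bounded_linear_inner_left)

lemma model_proj_in: "subspace W \<Longrightarrow> model_proj W z \<in> W"
  unfolding model_proj_def by (intro subspace_sum subspace_scale) (auto simp: model_frame(1))

lemma model_proj_idem [simp]: "subspace W \<Longrightarrow> model_proj W (model_proj W z) = model_proj W z"
  by (simp add: model_frame(3) model_proj_in)

subsection \<open>Charts\<close>

lemma smooth_manifold_model: "smooth_manifold M \<Longrightarrow> subspace (Model M)"
  by (simp add: smooth_manifold_def)

lemma smooth_fun_onD:
  "smooth_fun_on M A f \<Longrightarrow> (U, \<phi>) \<in> Atlas M \<Longrightarrow> smooth_on (\<phi> ` (U \<inter> A)) (f \<circ> inv_into U \<phi>)"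
  unfolding smooth_fun_on_def by fast

locale mfd_chart =
  fixes M :: "('a, 'e::euclidean_space) mfd" and U :: "'a set" and \<phi> :: "'a \<Rightarrow> 'e"
  assumes M: "smooth_manifold M" and chart: "(U, \<phi>) \<in> Atlas M"
begin

abbreviation "P \<equiv> model_proj (Model M)"

text \<open>Chart images are open only in the model subspace, whereas derivatives need open subsets
  of the ambient space. Precomposition with the orthogonal projection \<open>P\<close> extends a
  coordinate representation to the open set \<open>dom\<close>, constant in the normal
  directions.\<close>

definition dom :: "'a set \<Rightarrow> 'e set" where "dom A = {z. P z \<in> \<phi> ` (U \<inter> A)}"

definition rep :: "('a \<Rightarrow> 'r) \<Rightarrow> 'e \<Rightarrow> 'r" where "rep f z = f (inv_into U \<phi> (P z))"

lemma sub: "subspace (Model M)" using M by (rule smooth_manifold_model)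

lemma openin_U: "openin (Top M) U"
  and openin_image: "openin (top_of_set (Model M)) (\<phi> ` U)"
  and homeo: "homeomorphic_map (subtopology (Top M) U) (top_of_set (\<phi> ` U)) \<phi>"
proof -
  have "\<forall>(U, \<phi>)\<in>Atlas M. openin (Top M) U \<and> openin (top_of_set (Model M)) (\<phi> ` U) \<and>
      homeomorphic_map (subtopology (Top M) U) (top_of_set (\<phi> ` U)) \<phi>"
    using M by (simp add: smooth_manifold_def)
  then show "openin (Top M) U" "openin (top_of_set (Model M)) (\<phi> ` U)"
    "homeomorphic_map (subtopology (Top M) U) (top_of_set (\<phi> ` U)) \<phi>" using chart by fast+
qed

lemma U_pts: "U \<subseteq> pts M" using openin_U by (rule openin_subset)

lemma image_model: "\<phi> ` U \<subseteq> Model M"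
  using openin_subset[OF openin_image] by simp

lemma inj: "inj_on \<phi> U"
  using homeomorphic_imp_injective_map[OF homeo] U_pts by (simp add: Int_absorb1)

lemma inv_chart [simp]: "x \<in> U \<Longrightarrow> inv_into U \<phi> (\<phi> x) = x"
  using inj by simp

lemma chart_inv: "z \<in> \<phi> ` U \<Longrightarrow> \<phi> (inv_into U \<phi> z) = z" "z \<in> \<phi> ` U \<Longrightarrow> inv_into U \<phi> z \<in> U"
  by (auto simp: f_inv_into_f inv_into_into)

lemma P_chart [simp]: "x \<in> U \<Longrightarrow> P (\<phi> x) = \<phi> x"
  using image_model by (intro model_frame(3) sub) auto

lemma P_image: "z \<in> \<phi> ` U \<Longrightarrow> P z = z" by auto

lemma dom_iff: "z \<in> dom A \<longleftrightarrow> P z \<in> \<phi> ` U \<and> inv_into U \<phi> (P z) \<in> A"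
  unfolding dom_def by auto

lemma in_dom [simp]: "x \<in> U \<Longrightarrow> \<phi> x \<in> dom A \<longleftrightarrow> x \<in> A"
  unfolding dom_iff by simp

lemma rep_chart [simp]: "x \<in> U \<Longrightarrow> rep f (\<phi> x) = f x"
  by (simp add: rep_def)

lemma openin_image_Int: "openin (Top M) A \<Longrightarrow> openin (top_of_set (Model M)) (\<phi> ` (U \<inter> A))"
proof -
  assume "openin (Top M) A"
  then have "openin (subtopology (Top M) U) (U \<inter> A)" by (simp add: openin_subtopology_Int2)
  then have "openin (top_of_set (\<phi> ` U)) (\<phi> ` (U \<inter> A))"
    using homeomorphic_imp_open_map[OF homeo] by (auto simp: open_map_def)
  then show ?thesis using openin_image openin_trans by blast
qed

lemma open_dom: assumes "openin (Top M) A" shows "open (dom A)"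
proof -
  obtain T where T: "open T" "\<phi> ` (U \<inter> A) = Model M \<inter> T"
    using openin_image_Int[OF assms] by (auto simp: openin_open)
  have "dom A = P -` T" using T(2) model_proj_in[OF sub] by (auto simp: dom_def)
  moreover have "open (P -` T)"
    using T(1) bounded_linear.continuous_on[OF bounded_linear_model_proj continuous_on_id]
    by (intro open_vimage) (auto simp: continuous_on_def)
  ultimately show ?thesis by simp
qed

lemma openin_preimage: assumes "open T" shows "openin (Top M) {x \<in> U. \<phi> x \<in> T}"
proof -
  have "continuous_map (subtopology (Top M) U) (top_of_set (\<phi> ` U)) \<phi>"
    using homeomorphic_imp_continuous_map[OF homeo] .
  then have "openin (subtopology (Top M) U) {x \<in> topspace (subtopology (Top M) U). \<phi> x \<in> \<phi> ` U \<inter> T}"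
    by (rule openin_continuous_map_preimage[OF _ openin_open_Int[OF assms]])
  moreover have "{x \<in> topspace (subtopology (Top M) U). \<phi> x \<in> \<phi> ` U \<inter> T} = {x \<in> U. \<phi> x \<in> T}"
    using U_pts by auto
  ultimately have "openin (subtopology (Top M) U) {x \<in> U. \<phi> x \<in> T}" by metis
  then show ?thesis by (rule openin_trans_full[OF _ openin_U])
qed

lemma smooth_rep_iff:
  assumes "openin (Top M) A"
  shows "smooth_on (\<phi> ` (U \<inter> A)) (f \<circ> inv_into U \<phi>) \<longleftrightarrow> smooth_open (dom A) (rep f)"
proof
  assume "smooth_on (\<phi> ` (U \<inter> A)) (f \<circ> inv_into U \<phi>)"
  then have "smooth_on (dom A) (\<lambda>z. (f \<circ> inv_into U \<phi>) (P z))"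
    by (rule smooth_on_compose[OF smooth_on_bounded_linear[OF bounded_linear_model_proj]]) (simp add: dom_def)
  then show "smooth_open (dom A) (rep f)"
    unfolding smooth_on_open[OF open_dom[OF assms]] by (simp add: rep_def[abs_def])
next
  assume "smooth_open (dom A) (rep f)"
  then have "smooth_on (\<phi> ` (U \<inter> A)) (rep f)" by (rule smooth_open_imp_smooth_on) auto
  then show "smooth_on (\<phi> ` (U \<inter> A)) (f \<circ> inv_into U \<phi>)"
    by (rule smooth_on_cong) auto
qed

lemma smooth_fun_rep:
  assumes "smooth_fun_on M A f" "openin (Top M) A"
  shows "smooth_open (dom A) (rep f)"
  using smooth_fun_onD[OF assms(1) chart] unfolding smooth_rep_iff[OF assms(2)] .

end

lemma chart_at:
  assumes "smooth_manifold M" "x \<in> pts M"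
  obtains U \<phi> where "mfd_chart M U \<phi>" "x \<in> U"
proof -
  have "(\<Union>(U, \<phi>)\<in>Atlas M. U) = pts M" using assms(1) by (simp add: smooth_manifold_def)
  then have "x \<in> (\<Union>c\<in>Atlas M. fst c)" using assms(2) by (simp add: case_prod_beta')
  then obtain U \<phi> where "(U, \<phi>) \<in> Atlas M" "x \<in> U" by (metis UN_E prod.collapse)
  then show thesis using that assms(1) by (simp add: mfd_chart_def)
qed

lemma smooth_transition:
  assumes "smooth_manifold M" "(U, \<phi>) \<in> Atlas M" "(V, \<psi>) \<in> Atlas M"
  shows "smooth_on (\<phi> ` (U \<inter> V)) (\<psi> \<circ> inv_into U \<phi>)"
proof -
  have "\<forall>(U, \<phi>)\<in>Atlas M. \<forall>(V, \<psi>)\<in>Atlas M. smooth_on (\<phi> ` (U \<inter> V)) (\<psi> \<circ> inv_into U \<phi>)"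
    using assms(1) by (simp add: smooth_manifold_def)
  then show ?thesis using assms(2,3) by fast
qed

subsection \<open>Smooth functions\<close>

lemma smooth_fun_on_subset: "smooth_fun_on M A f \<Longrightarrow> B \<subseteq> A \<Longrightarrow> smooth_fun_on M B f"
  unfolding smooth_fun_on_def
  by (clarify, rule smooth_on_subset, erule (1) smooth_fun_onD[unfolded smooth_fun_on_def], auto)

lemma smooth_fun_on_cong:
  assumes "smooth_fun_on M A f" "\<And>x. x \<in> A \<Longrightarrow> f x = g x" "smooth_manifold M"
  shows "smooth_fun_on M A g"
  unfolding smooth_fun_on_def
proof clarify
  fix U \<phi> assume c: "(U, \<phi>) \<in> Atlas M"
  then interpret mfd_chart M U \<phi> using assms(3) by (simp add: mfd_chart_def)
  have "smooth_on (\<phi> ` (U \<inter> A)) (f \<circ> inv_into U \<phi>)" by (rule smooth_fun_onD[OF assms(1) c])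
  then show "smooth_on (\<phi> ` (U \<inter> A)) (g \<circ> inv_into U \<phi>)"
    by (rule smooth_on_cong) (use assms(2) in auto)
qed

lemma smooth_fun_on_const [smooth_intros]: "smooth_fun_on M A (\<lambda>x. c)"
  unfolding smooth_fun_on_def o_def by (auto intro: smooth_on_const)

lemma smooth_fun_on_add [smooth_intros]:
  "smooth_fun_on M A f \<Longrightarrow> smooth_fun_on M A g \<Longrightarrow> smooth_fun_on M A (\<lambda>x. f x + g x)"
  unfolding smooth_fun_on_def o_def by (auto intro!: smooth_on_add)

lemma smooth_fun_on_mult [smooth_intros]:
  "smooth_fun_on M A f \<Longrightarrow> smooth_fun_on M A g \<Longrightarrow> smooth_fun_on M A (\<lambda>x. f x * g x)"
  unfolding smooth_fun_on_def o_def by (auto intro!: smooth_on_mult)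

lemma smooth_fun_on_minus [smooth_intros]:
  "smooth_fun_on M A f \<Longrightarrow> smooth_fun_on M A (\<lambda>x. - f x)"
  using smooth_fun_on_mult[OF smooth_fun_on_const[of M A "-1"], of f] by simp

lemma smooth_fun_on_diff [smooth_intros]:
  "smooth_fun_on M A f \<Longrightarrow> smooth_fun_on M A g \<Longrightarrow> smooth_fun_on M A (\<lambda>x. f x - g x)"
  using smooth_fun_on_add[OF _ smooth_fun_on_minus, of M A f g] by simp

lemma smooth_fun_on_sum [smooth_intros]:
  "(\<And>i. i \<in> I \<Longrightarrow> smooth_fun_on M A (f i)) \<Longrightarrow> smooth_fun_on M A (\<lambda>x. \<Sum>i\<in>I. f i x)"
  by (induction I rule: infinite_finite_induct) (auto intro!: smooth_intros)

lemma smooth_fun_on_inverse [smooth_intros]: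
  assumes "smooth_fun_on M A f" "\<And>x. x \<in> A \<Longrightarrow> f x \<noteq> 0" "smooth_manifold M"
  shows "smooth_fun_on M A (\<lambda>x. inverse (f x))"
  unfolding smooth_fun_on_def
proof clarify
  fix U \<phi> assume c: "(U, \<phi>) \<in> Atlas M"
  then interpret mfd_chart M U \<phi> using assms(3) by (simp add: mfd_chart_def)
  have "smooth_on (\<phi> ` (U \<inter> A)) (f \<circ> inv_into U \<phi>)" by (rule smooth_fun_onD[OF assms(1) c])
  then have "smooth_on (\<phi> ` (U \<inter> A)) (\<lambda>z. inverse ((f \<circ> inv_into U \<phi>) z))"
    by (rule smooth_on_inverse) (use assms(2) in auto)
  then show "smooth_on (\<phi> ` (U \<inter> A)) ((\<lambda>x. inverse (f x)) \<circ> inv_into U \<phi>)" by (simp add: o_def)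
qed

text \<open>Transition maps carry smoothness near a point from one chart of the atlas to every
  other.\<close>

lemma smooth_fun_onI_local:
  assumes M: "smooth_manifold M"
    and loc: "\<And>x. x \<in> A \<Longrightarrow> \<exists>U \<phi> B. (U, \<phi>) \<in> Atlas M \<and> x \<in> U \<and> openin (Top M) B \<and> x \<in> B \<and>
      smooth_on (\<phi> ` (U \<inter> (A \<inter> B))) (f \<circ> inv_into U \<phi>)"
  shows "smooth_fun_on M A f"
  unfolding smooth_fun_on_def
proof clarify
  fix V \<psi> assume V: "(V, \<psi>) \<in> Atlas M"
  then interpret V: mfd_chart M V \<psi> using M by (simp add: mfd_chart_def)
  show "smooth_on (\<psi> ` (V \<inter> A)) (f \<circ> inv_into V \<psi>)"
  proof (rule smooth_on_local)
    fix z assume "z \<in> \<psi> ` (V \<inter> A)"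
    then obtain x where x: "x \<in> V" "x \<in> A" "z = \<psi> x" by auto
    from loc[OF x(2)] obtain U \<phi> B where U: "(U, \<phi>) \<in> Atlas M" "x \<in> U" "openin (Top M) B" "x \<in> B"
      and sm: "smooth_on (\<phi> ` (U \<inter> (A \<inter> B))) (f \<circ> inv_into U \<phi>)" by blast
    interpret U: mfd_chart M U \<phi> using M U(1) by (simp add: mfd_chart_def)
    let ?T = "V.dom (U \<inter> B)"
    have T: "open ?T" by (intro V.open_dom openin_Int U.openin_U U(3))
    have tr: "smooth_on (\<psi> ` (V \<inter> U)) (\<phi> \<circ> inv_into V \<psi>)"
      by (rule smooth_transition[OF M V U(1)])
    have S: "\<psi> ` (V \<inter> A) \<inter> ?T = \<psi> ` (V \<inter> (A \<inter> (U \<inter> B)))"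
      using V.in_dom[of _ "U \<inter> B"] by auto
    have "smooth_on (\<psi> ` (V \<inter> A) \<inter> ?T) (\<lambda>z. (f \<circ> inv_into U \<phi>) ((\<phi> \<circ> inv_into V \<psi>) z))"
      unfolding S by (rule smooth_on_compose[OF smooth_on_subset[OF tr] sm]) auto
    then have "smooth_on (\<psi> ` (V \<inter> A) \<inter> ?T) (f \<circ> inv_into V \<psi>)"
      by (rule smooth_on_cong) (unfold S, auto)
    then show "\<exists>T. open T \<and> z \<in> T \<and> smooth_on (\<psi> ` (V \<inter> A) \<inter> T) (f \<circ> inv_into V \<psi>)"
      using T x U by (intro exI[of _ ?T]) auto
  qed
qed

lemma smooth_fun_onI_cover:
  assumes M: "smooth_manifold M"
    and loc: "\<And>x. x \<in> A \<Longrightarrow> \<exists>B. openin (Top M) B \<and> x \<in> B \<and> smooth_fun_on M (A \<inter> B) f"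
    and A: "A \<subseteq> pts M"
  shows "smooth_fun_on M A f"
proof (rule smooth_fun_onI_local[OF M])
  fix x assume x: "x \<in> A"
  obtain U \<phi> where U: "mfd_chart M U \<phi>" "x \<in> U" using chart_at[OF M] x A by blast
  obtain B where "openin (Top M) B" "x \<in> B" "smooth_fun_on M (A \<inter> B) f" using loc[OF x] by blast
  then show "\<exists>U \<phi> B. (U, \<phi>) \<in> Atlas M \<and> x \<in> U \<and> openin (Top M) B \<and> x \<in> B \<and>
      smooth_on (\<phi> ` (U \<inter> (A \<inter> B))) (f \<circ> inv_into U \<phi>)"
    using U mfd_chart.chart[OF U(1)]
    by (intro exI[of _ U] exI[of _ \<phi>] exI[of _ B] conjI smooth_fun_onD)
qed

lemma (in mfd_chart) smooth_fun_on_chart: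
  assumes "smooth_on (\<phi> ` (U \<inter> A)) G"
  shows "smooth_fun_on M (U \<inter> A) (\<lambda>x. G (\<phi> x))"
proof (rule smooth_fun_onI_local[OF M])
  fix x assume x: "x \<in> U \<inter> A"
  have "smooth_on (\<phi> ` (U \<inter> (U \<inter> A \<inter> U))) ((\<lambda>x. G (\<phi> x)) \<circ> inv_into U \<phi>)"
    by (rule smooth_on_cong[OF smooth_on_subset[OF assms]]) auto
  then show "\<exists>U' \<phi>' B. (U', \<phi>') \<in> Atlas M \<and> x \<in> U' \<and> openin (Top M) B \<and> x \<in> B \<and>
      smooth_on (\<phi>' ` (U' \<inter> (U \<inter> A \<inter> B))) ((\<lambda>x. G (\<phi> x)) \<circ> inv_into U' \<phi>')"
    using chart openin_U x by (intro exI[of _ U] exI[of _ \<phi>] exI[of _ U]) auto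
qed

lemma smooth_fun_on_openin:
  assumes M: "smooth_manifold M" and f: "smooth_fun_on M A f" "openin (Top M) A" and T: "open T"
  shows "openin (Top M) {x \<in> A. f x \<in> T}"
proof (subst openin_subopen, intro ballI)
  fix x assume "x \<in> {x \<in> A. f x \<in> T}"
  then have x: "x \<in> A" "f x \<in> T" by auto
  obtain U \<phi> where U: "mfd_chart M U \<phi>" "x \<in> U"
    using chart_at[OF M] x(1) openin_subset[OF f(2)] by blast
  interpret mfd_chart M U \<phi> by fact
  let ?S = "dom A \<inter> rep f -` T"
  have "open ?S"
    using smooth_open_continuous_on[OF smooth_fun_rep[OF f]] open_dom[OF f(2)] T
    by (intro continuous_open_preimage) auto
  then have "openin (Top M) {x \<in> U. \<phi> x \<in> ?S}" by (rule openin_preimage)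
  moreover have "{x \<in> U. \<phi> x \<in> ?S} \<subseteq> {x \<in> A. f x \<in> T}" by auto
  moreover have "x \<in> {x \<in> U. \<phi> x \<in> ?S}" using x U by auto
  ultimately show "\<exists>S. openin (Top M) S \<and> x \<in> S \<and> S \<subseteq> {x \<in> A. f x \<in> T}" by blast
qed

lemma CinfI: "smooth_fun_on M (pts M) f \<Longrightarrow> (\<And>x. x \<notin> pts M \<Longrightarrow> f x = 0) \<Longrightarrow> f \<in> Cinf M"
  by (simp add: Cinf_def)

lemma CinfD: "f \<in> Cinf M \<Longrightarrow> smooth_fun_on M (pts M) f" "f \<in> Cinf M \<Longrightarrow> x \<notin> pts M \<Longrightarrow> f x = 0"
  by (auto simp: Cinf_def)

lemma Cinf_restrict:
  assumes "smooth_fun_on M (pts M) f" "smooth_manifold M"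
  shows "(\<lambda>x. if x \<in> pts M then f x else 0) \<in> Cinf M"
  by (rule CinfI) (use assms in \<open>auto elim: smooth_fun_on_cong\<close>)

named_theorems Cinf_intros

lemma Cinf_add [Cinf_intros]: "f \<in> Cinf M \<Longrightarrow> g \<in> Cinf M \<Longrightarrow> (\<lambda>x. f x + g x) \<in> Cinf M"
  by (simp add: Cinf_def smooth_fun_on_add)

lemma Cinf_mult [Cinf_intros]: "f \<in> Cinf M \<Longrightarrow> g \<in> Cinf M \<Longrightarrow> (\<lambda>x. f x * g x) \<in> Cinf M"
  by (simp add: Cinf_def smooth_fun_on_mult)

lemma Cinf_cmult [Cinf_intros]: "f \<in> Cinf M \<Longrightarrow> (\<lambda>x. c * f x) \<in> Cinf M"
  by (simp add: Cinf_def smooth_fun_on_mult smooth_fun_on_const)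

lemma Cinf_minus [Cinf_intros]: "f \<in> Cinf M \<Longrightarrow> (\<lambda>x. - f x) \<in> Cinf M"
  by (simp add: Cinf_def smooth_fun_on_minus)

lemma Cinf_diff [Cinf_intros]: "f \<in> Cinf M \<Longrightarrow> g \<in> Cinf M \<Longrightarrow> (\<lambda>x. f x - g x) \<in> Cinf M"
  by (simp add: Cinf_def smooth_fun_on_diff)

lemma Cinf_zero [Cinf_intros]: "(\<lambda>x. 0) \<in> Cinf M"
  by (simp add: Cinf_def smooth_fun_on_const)

lemma Cinf_sum [Cinf_intros]: "(\<And>i. i \<in> I \<Longrightarrow> f i \<in> Cinf M) \<Longrightarrow> (\<lambda>x. \<Sum>i\<in>I. f i x) \<in> Cinf M"
  by (simp add: Cinf_def smooth_fun_on_sum)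

lemma Cinf_const: "smooth_manifold M \<Longrightarrow> (\<lambda>x. if x \<in> pts M then c else 0) \<in> Cinf M"
  by (intro Cinf_restrict smooth_fun_on_const)

subsection \<open>Bump functions and extension of local functions\<close>

text \<open>A bump in chart coordinates, extended by 0 outside U. The extension is smooth because
  the support lies in a compact set, which is closed in M by the Hausdorff property. On N, where
  \<beta> is 1, multiplication by \<beta> does not alter a function.\<close>

lemma bump_function:
  assumes M: "smooth_manifold M" and A: "openin (Top M) A" "x \<in> A"
  obtains \<beta> N K where "\<beta> \<in> Cinf M" "openin (Top M) N" "x \<in> N" "N \<subseteq> K"
    "\<forall>y\<in>N. \<beta> y = 1" "compactin (Top M) K" "K \<subseteq> A" "{y. \<beta> y \<noteq> 0} \<subseteq> K"
proof -
  obtain U \<phi> where U: "mfd_chart M U \<phi>" "x \<in> U"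
    using chart_at[OF M] A(2) openin_subset[OF A(1)] by blast
  interpret mfd_chart M U \<phi> by fact
  let ?z = "\<phi> x"
  have "?z \<in> dom A" using U A by simp
  then obtain e where e: "e > 0" "cball ?z e \<subseteq> dom A"
    using open_dom[OF A(1)] open_contains_cball by blast
  define \<beta> where "\<beta> y = (if y \<in> U then bump ?z e (\<phi> y) else 0)" for y
  define N where "N = {y \<in> U. \<phi> y \<in> ball ?z (e / 2)}"
  define K where "K = inv_into U \<phi> ` (cball ?z e \<inter> Model M)"
  have sub_im: "cball ?z e \<inter> Model M \<subseteq> \<phi> ` U"
    using e(2) model_frame(3)[OF sub] unfolding dom_iff subset_iff by auto
  have K_eq: "K = {y \<in> U. norm (\<phi> y - ?z) \<le> e}"
  proof (intro set_eqI iffI)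
    fix y assume "y \<in> K"
    then obtain z where z: "z \<in> cball ?z e" "z \<in> Model M" "y = inv_into U \<phi> z" unfolding K_def by auto
    then have "z \<in> \<phi> ` U" using sub_im by auto
    then show "y \<in> {y \<in> U. norm (\<phi> y - ?z) \<le> e}"
      using z chart_inv by (auto simp: dist_norm norm_minus_commute)
  next
    fix y assume y: "y \<in> {y \<in> U. norm (\<phi> y - ?z) \<le> e}"
    then have "\<phi> y \<in> cball ?z e \<inter> Model M" using image_model by (auto simp: dist_norm norm_minus_commute)
    then show "y \<in> K" using y unfolding K_def by (metis (mono_tags, lifting) image_eqI inv_chart mem_Collect_eq)
  qed
  have KA: "K \<subseteq> A"
  proof
    fix y assume "y \<in> K"
    then have "y \<in> U" "\<phi> y \<in> cball ?z e" unfolding K_eq by (auto simp: dist_norm norm_minus_commute)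
    then show "y \<in> A" using e(2) by (metis in_dom subsetD)
  qed
  have K: "compactin (Top M) K"
  proof -
    have "compact (cball ?z e \<inter> Model M)" by (intro compact_Int_closed closed_subspace sub) auto
    then have c: "compactin (top_of_set (\<phi> ` U)) (cball ?z e \<inter> Model M)"
      using sub_im by (simp add: compactin_subtopology)
    have "homeomorphic_map (top_of_set (\<phi> ` U)) (subtopology (Top M) U) (inv_into U \<phi>)"
    proof -
      obtain g where g: "homeomorphic_maps (subtopology (Top M) U) (top_of_set (\<phi> ` U)) \<phi> g"
        using homeo homeomorphic_map_maps by blast
      have "g z = inv_into U \<phi> z" if "z \<in> \<phi> ` U" for z
      proof -
        obtain y where y: "y \<in> U" "z = \<phi> y" using \<open>z \<in> \<phi> ` U\<close> by auto
        have "g (\<phi> y) = y" using g y U_pts unfolding homeomorphic_maps_def by auto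
        then show ?thesis using y by simp
      qed
      then have "homeomorphic_maps (subtopology (Top M) U) (top_of_set (\<phi> ` U)) \<phi> (inv_into U \<phi>)"
        using g by (auto intro: homeomorphic_maps_eq)
      then show ?thesis using homeomorphic_maps_sym homeomorphic_maps_imp_map by blast
    qed
    then have "continuous_map (top_of_set (\<phi> ` U)) (subtopology (Top M) U) (inv_into U \<phi>)"
      by (rule homeomorphic_imp_continuous_map)
    from image_compactin[OF c this] show ?thesis unfolding K_def by (simp add: compactin_subtopology)
  qed
  have Kc: "closedin (Top M) K"
    using M K by (intro compactin_imp_closedin) (auto simp: smooth_manifold_def)
  have \<beta>0: "\<beta> y = 0" if "y \<notin> K" for y
    using that bump_props(2)[OF e(1), of "\<phi> y" ?z] unfolding K_eq \<beta>_def by (cases "y \<in> U") auto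
  have smU: "smooth_fun_on M U \<beta>"
  proof -
    have "smooth_fun_on M (U \<inter> UNIV) (\<lambda>y. bump ?z e (\<phi> y))"
      by (rule smooth_fun_on_chart, rule smooth_open_imp_smooth_on[OF smooth_bump]) simp
    then have "smooth_fun_on M U (\<lambda>y. bump ?z e (\<phi> y))" by simp
    then show ?thesis by (rule smooth_fun_on_cong[OF _ _ M]) (simp add: \<beta>_def)
  qed
  have "smooth_fun_on M (pts M) \<beta>"
  proof (rule smooth_fun_onI_cover[OF M])
    fix y assume y: "y \<in> pts M"
    show "\<exists>B. openin (Top M) B \<and> y \<in> B \<and> smooth_fun_on M (pts M \<inter> B) \<beta>"
    proof (cases "y \<in> U")
      case True
      then show ?thesis using openin_U U_pts smU by (intro exI[of _ U]) (simp add: Int_absorb1)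
    next
      case False
      then have "y \<in> pts M - K" using y unfolding K_eq by auto
      moreover have "openin (Top M) (pts M - K)" using Kc by blast
      moreover have "smooth_fun_on M (pts M \<inter> (pts M - K)) \<beta>"
        by (rule smooth_fun_on_cong[OF smooth_fun_on_const[of _ _ 0] _ M]) (simp add: \<beta>0)
      ultimately show ?thesis by blast
    qed
  qed simp
  moreover have "\<beta> y = 0" if "y \<notin> pts M" for y using that U_pts by (auto simp: \<beta>_def)
  ultimately have 1: "\<beta> \<in> Cinf M" by (rule CinfI)
  have 2: "openin (Top M) N" unfolding N_def by (rule openin_preimage) simp
  have 3: "x \<in> N" using U e by (simp add: N_def)
  have 4: "N \<subseteq> K" unfolding N_def K_eq using e(1) by (auto simp: dist_norm norm_minus_commute)
  have 5: "\<forall>y\<in>N. \<beta> y = 1"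
    using bump_props(1)[OF e(1), of _ ?z] by (auto simp: N_def \<beta>_def dist_norm norm_minus_commute)
  have 6: "{y. \<beta> y \<noteq> 0} \<subseteq> K" using \<beta>0 by blast
  show thesis using that[OF 1 2 3 4 5 K KA 6] .
qed

lemma compactin_closedin: "smooth_manifold M \<Longrightarrow> compactin (Top M) K \<Longrightarrow> closedin (Top M) K"
  by (intro compactin_imp_closedin) (auto simp: smooth_manifold_def)

text \<open>Globalises a locally defined function: the product is smooth on A and 0 off the closed
  set K, and A together with the complement of K covers M.\<close>

lemma cutoff_Cinf:
  assumes M: "smooth_manifold M" and A: "openin (Top M) A" and b: "\<beta> \<in> Cinf M"
    and K: "closedin (Top M) K" "K \<subseteq> A" "{y. \<beta> y \<noteq> 0} \<subseteq> K" and f: "smooth_fun_on M A f"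
  shows "(\<lambda>y. if y \<in> A then \<beta> y * f y else 0) \<in> Cinf M" (is "?g \<in> _")
proof (rule CinfI)
  have Ap: "A \<subseteq> pts M" by (rule openin_subset[OF A])
  have smA: "smooth_fun_on M A ?g"
    by (rule smooth_fun_on_cong[OF smooth_fun_on_mult[OF smooth_fun_on_subset[OF CinfD(1)[OF b] Ap] f] _ M]) simp
  show "smooth_fun_on M (pts M) ?g"
  proof (rule smooth_fun_onI_cover[OF M])
    fix y assume y: "y \<in> pts M"
    show "\<exists>B. openin (Top M) B \<and> y \<in> B \<and> smooth_fun_on M (pts M \<inter> B) ?g"
    proof (cases "y \<in> A")
      case True
      then show ?thesis using A Ap smA by (intro exI[of _ A]) (simp add: Int_absorb1)
    next
      case False
      then have "y \<in> pts M - K" using y K by auto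
      moreover have "openin (Top M) (pts M - K)" using K(1) by blast
      moreover have "smooth_fun_on M (pts M \<inter> (pts M - K)) ?g"
        by (rule smooth_fun_on_cong[OF smooth_fun_on_const[of _ _ 0] _ M]) (use K(3) in auto)
      ultimately show ?thesis by blast
    qed
  qed simp
  show "?g y = 0" if "y \<notin> pts M" for y using that Ap by auto
qed

section \<open>Tangent spaces\<close>

subsection \<open>Derivations\<close>

lemma tangentD:
  assumes "v \<in> tangent M x"
  shows "f \<in> Cinf M \<Longrightarrow> g \<in> Cinf M \<Longrightarrow> v (\<lambda>y. f y + g y) = v f + v g"
    and "f \<in> Cinf M \<Longrightarrow> v (\<lambda>y. c * f y) = c * v f"
    and "f \<in> Cinf M \<Longrightarrow> g \<in> Cinf M \<Longrightarrow> v (\<lambda>y. f y * g y) = f x * v g + g x * v f"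
    and "f \<notin> Cinf M \<Longrightarrow> v f = 0"
  using assms by (auto simp: tangent_def)

lemma tangentI:
  assumes "\<And>f g. f \<in> Cinf M \<Longrightarrow> g \<in> Cinf M \<Longrightarrow> v (\<lambda>y. f y + g y) = v f + v g"
    and "\<And>f c. f \<in> Cinf M \<Longrightarrow> v (\<lambda>y. c * f y) = c * v f"
    and "\<And>f g. f \<in> Cinf M \<Longrightarrow> g \<in> Cinf M \<Longrightarrow> v (\<lambda>y. f y * g y) = f x * v g + g x * v f"
    and "\<And>f. f \<notin> Cinf M \<Longrightarrow> v f = 0"
  shows "v \<in> tangent M x"
  using assms by (auto simp: tangent_def)

lemma tangent_zero [simp]: "(\<lambda>f. 0) \<in> tangent M x" by (rule tangentI) auto

lemma tangent_add: "v \<in> tangent M x \<Longrightarrow> w \<in> tangent M x \<Longrightarrow> (\<lambda>f. v f + w f) \<in> tangent M x"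
  by (rule tangentI) (simp_all add: tangentD[of v] tangentD[of w] algebra_simps)

lemma tangent_cmult: "v \<in> tangent M x \<Longrightarrow> (\<lambda>f. c * v f) \<in> tangent M x"
  by (rule tangentI) (simp_all add: tangentD[of v] algebra_simps)

lemma tangent_sum:
  "(\<And>i. i \<in> I \<Longrightarrow> v i \<in> tangent M x) \<Longrightarrow> (\<lambda>f. \<Sum>i\<in>I. c i * v i f) \<in> tangent M x"
  by (induction I rule: infinite_finite_induct) (auto intro!: tangent_add tangent_cmult)

lemma tangent_fun_zero: assumes "v \<in> tangent M x" shows "v (\<lambda>y. 0) = 0"
  using tangentD(2)[OF assms Cinf_zero, of 0] by simp

lemma tangent_fun_minus: "v \<in> tangent M x \<Longrightarrow> f \<in> Cinf M \<Longrightarrow> v (\<lambda>y. - f y) = - v f"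
  using tangentD(2)[of v M x f "-1"] by simp

lemma tangent_fun_diff:
  "v \<in> tangent M x \<Longrightarrow> f \<in> Cinf M \<Longrightarrow> g \<in> Cinf M \<Longrightarrow> v (\<lambda>y. f y - g y) = v f - v g"
  using tangentD(1)[of v M x f "\<lambda>y. - g y"] tangent_fun_minus[of v M x g] Cinf_minus[of g M] by simp

lemma tangent_fun_sum:
  assumes "v \<in> tangent M x" "\<And>i. i \<in> I \<Longrightarrow> f i \<in> Cinf M"
  shows "v (\<lambda>y. \<Sum>i\<in>I. f i y) = (\<Sum>i\<in>I. v (f i))"
  using assms(2)
proof (induction I rule: infinite_finite_induct)
  case (insert i I)
  then have "v (\<lambda>y. f i y + (\<Sum>i\<in>I. f i y)) = v (f i) + v (\<lambda>y. \<Sum>i\<in>I. f i y)"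
    by (intro tangentD(1)[OF assms(1)] Cinf_sum) auto
  with insert show ?case by simp
qed (simp_all add: tangent_fun_zero[OF assms(1)])

lemma tangent_fun_const:
  assumes M: "smooth_manifold M" and v: "v \<in> tangent M x" "x \<in> pts M"
  shows "v (\<lambda>y. if y \<in> pts M then c else 0) = 0"
proof -
  let ?o = "\<lambda>y. if y \<in> pts M then 1 else (0::real)"
  have o: "?o \<in> Cinf M" by (rule Cinf_const[OF M])
  have "(\<lambda>y. ?o y * ?o y) = ?o" by auto
  then have "v ?o = 0" using tangentD(3)[OF v(1) o o] v(2) by simp
  moreover have "(\<lambda>y. c * ?o y) = (\<lambda>y. if y \<in> pts M then c else 0)" by auto
  ultimately show ?thesis using tangentD(2)[OF v(1) o, of c] by simp
qed

text \<open>With a bump \<beta> supported in N, \<beta>(f - g) is identically 0; the product rule at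
  x, where \<beta> = 1 and f = g, leaves v(f - g) = 0.\<close>

lemma tangent_local:
  assumes M: "smooth_manifold M" and v: "v \<in> tangent M x" and f: "f \<in> Cinf M" and g: "g \<in> Cinf M"
    and N: "openin (Top M) N" "x \<in> N" and eq: "\<And>y. y \<in> N \<Longrightarrow> f y = g y"
  shows "v f = v g"
proof -
  obtain \<beta> N' K where b: "\<beta> \<in> Cinf M" "openin (Top M) N'" "x \<in> N'" "N' \<subseteq> K"
    "\<forall>y\<in>N'. \<beta> y = 1" "compactin (Top M) K" "K \<subseteq> N" "{y. \<beta> y \<noteq> 0} \<subseteq> K"
    using bump_function[OF M N] by blast
  let ?h = "\<lambda>y. f y - g y"
  have h: "?h \<in> Cinf M" by (intro Cinf_intros f g)
  have "\<beta> y * ?h y = 0" for y using b(7,8) eq[of y] by (cases "y \<in> K") auto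
  then have "(\<lambda>y. \<beta> y * ?h y) = (\<lambda>y. 0)" by (rule ext)
  then have "v (\<lambda>y. \<beta> y * ?h y) = 0" using tangent_fun_zero[OF v] by (simp only:)
  moreover have "v (\<lambda>y. \<beta> y * ?h y) = \<beta> x * v ?h + ?h x * v \<beta>" by (rule tangentD(3)[OF v b(1) h])
  ultimately have "v ?h = 0" using b(3,5) eq[OF N(2)] by simp
  then show ?thesis using tangent_fun_diff[OF v f g] by simp
qed

subsection \<open>Local frames\<close>

text \<open>Derivations act on \<open>Cinf M\<close> only, so the coordinates \<open>y\<close> and
  the fields \<open>d\<close> are defined on all of M, being cut off; they behave as a coordinate
  frame only on N.\<close>

locale frame =
  fixes M :: "('a, 'e::euclidean_space) mfd" and N :: "'a set"
    and n :: nat and y :: "nat \<Rightarrow> 'a \<Rightarrow> real" and d :: "nat \<Rightarrow> 'a \<Rightarrow> 'a tvec"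
  assumes M: "smooth_manifold M" and N: "openin (Top M) N"
    and y: "\<And>i. i < n \<Longrightarrow> y i \<in> Cinf M"
    and d_tangent: "\<And>i x. x \<in> pts M \<Longrightarrow> d i x \<in> tangent M x"
    and d_smooth: "\<And>i f. f \<in> Cinf M \<Longrightarrow> (\<lambda>x. if x \<in> pts M then d i x f else 0) \<in> Cinf M"
    and expand: "\<And>x v f. x \<in> N \<Longrightarrow> v \<in> tangent M x \<Longrightarrow> f \<in> Cinf M \<Longrightarrow> v f = (\<Sum>i<n. v (y i) * d i x f)"
    and dual: "\<And>i j x. i < n \<Longrightarrow> j < n \<Longrightarrow> x \<in> N \<Longrightarrow> d i x (y j) = (if i = j then 1 else 0)"
begin

lemma N_pts: "N \<subseteq> pts M" using N by (rule openin_subset)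

lemma expand_vec:
  assumes "x \<in> N" "v \<in> tangent M x" shows "v = (\<lambda>f. \<Sum>i<n. v (y i) * d i x f)"
proof
  fix f
  have "d i x f = 0" if "f \<notin> Cinf M" for i
    using tangentD(4)[OF d_tangent that] assms(1) N_pts by blast
  then show "v f = (\<Sum>i<n. v (y i) * d i x f)"
    using expand[OF assms] tangentD(4)[OF assms(2)] by (cases "f \<in> Cinf M") auto
qed

end

context mfd_chart
begin

definition dirv :: "'a \<Rightarrow> 'e \<Rightarrow> 'a tvec" where
  "dirv x w = (\<lambda>f. if f \<in> Cinf M then frechet_derivative (rep f) (at (\<phi> x)) w else 0)"

lemma Cinf_rep: "f \<in> Cinf M \<Longrightarrow> smooth_open (dom (pts M)) (rep f)"
  by (rule smooth_fun_rep[OF CinfD(1)]) auto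

lemma chart_dom: "x \<in> U \<Longrightarrow> \<phi> x \<in> dom (pts M)" using U_pts by auto

lemma rep_derivative:
  "f \<in> Cinf M \<Longrightarrow> x \<in> U \<Longrightarrow> (rep f has_derivative frechet_derivative (rep f) (at (\<phi> x))) (at (\<phi> x))"
  by (rule smooth_open_has_derivative[OF Cinf_rep chart_dom])

lemma rep_derivative_eq:
  assumes "f \<in> Cinf M" "x \<in> U" "(rep f has_derivative D) (at (\<phi> x))"
  shows "dirv x w f = D w"
  using frechet_derivative_at[OF assms(3)] assms(1) by (simp add: dirv_def)

lemma dirv_tangent: assumes x: "x \<in> U" shows "dirv x w \<in> tangent M x"
proof (rule tangentI)
  fix f g assume f: "f \<in> Cinf M" and g: "g \<in> Cinf M"
  note D = rep_derivative[OF f x] rep_derivative[OF g x]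
  have "(rep (\<lambda>y. f y + g y) has_derivative (\<lambda>w. frechet_derivative (rep f) (at (\<phi> x)) w
      + frechet_derivative (rep g) (at (\<phi> x)) w)) (at (\<phi> x))"
    using has_derivative_add[OF D] by (simp add: rep_def[abs_def])
  from rep_derivative_eq[OF Cinf_add[OF f g] x this] f g
  show "dirv x w (\<lambda>y. f y + g y) = dirv x w f + dirv x w g" by (simp add: dirv_def)
  have "(rep (\<lambda>y. f y * g y) has_derivative (\<lambda>w. rep f (\<phi> x) * frechet_derivative (rep g) (at (\<phi> x)) w
      + frechet_derivative (rep f) (at (\<phi> x)) w * rep g (\<phi> x))) (at (\<phi> x))"
    using has_derivative_mult[OF D] by (simp add: rep_def[abs_def])
  from rep_derivative_eq[OF Cinf_mult[OF f g] x this] f g x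
  show "dirv x w (\<lambda>y. f y * g y) = f x * dirv x w g + g x * dirv x w f" by (simp add: dirv_def)
next
  fix f and c :: real assume f: "f \<in> Cinf M"
  have "(rep (\<lambda>y. c * f y) has_derivative (\<lambda>w. c * frechet_derivative (rep f) (at (\<phi> x)) w)) (at (\<phi> x))"
    using has_derivative_mult_right[OF rep_derivative[OF f x], of c] by (simp add: rep_def[abs_def])
  from rep_derivative_eq[OF Cinf_cmult[OF f] x this] f
  show "dirv x w (\<lambda>y. c * f y) = c * dirv x w f" by (simp add: dirv_def)
qed (simp add: dirv_def)

lemma dirv_linear: assumes x: "x \<in> U"
  shows "dirv x (a *\<^sub>R u + w) f = a * dirv x u f + dirv x w f"
proof (cases "f \<in> Cinf M")
  case True
  interpret bounded_linear "frechet_derivative (rep f) (at (\<phi> x))"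
    by (rule has_derivative_bounded_linear[OF rep_derivative[OF True x]])
  show ?thesis using True by (simp add: dirv_def add scaleR)
qed (simp add: dirv_def)

lemma dirv_smooth:
  assumes "f \<in> Cinf M" shows "smooth_fun_on M U (\<lambda>x. dirv x w f)"
proof -
  have "smooth_on (\<phi> ` (U \<inter> UNIV)) (\<lambda>z. frechet_derivative (rep f) (at z) w)"
    by (rule smooth_open_imp_smooth_on[OF smooth_open_derivative[OF Cinf_rep[OF assms]]]) (use U_pts in auto)
  from smooth_fun_on_chart[OF this] show ?thesis using assms by (simp add: dirv_def)
qed

text \<open>Multiplying coordinates and coordinate fields by one bump function makes them global.
  The expansion of a derivation comes from Hadamard's lemma: v sees only the first-order part of a
  function.\<close>

lemma chart_frame:
  assumes x0: "x0 \<in> U"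
  obtains N y d where "frame M N (dim (Model M)) y d" "x0 \<in> N" "N \<subseteq> U"
    "\<forall>i<dim (Model M). \<forall>x\<in>N. y i x = \<phi> x \<bullet> model_frame (Model M) i"
    "\<forall>i. \<forall>x\<in>N. d i x = dirv x (model_frame (Model M) i)"
proof -
  define n where "n = dim (Model M)"
  define e where "e = model_frame (Model M)"
  obtain \<beta> N K where b: "\<beta> \<in> Cinf M" "openin (Top M) N" "x0 \<in> N" "N \<subseteq> K"
    "\<forall>y\<in>N. \<beta> y = 1" "compactin (Top M) K" "K \<subseteq> U" "{y. \<beta> y \<noteq> 0} \<subseteq> K"
    using bump_function[OF M openin_U x0] by blast
  have NU: "N \<subseteq> U" using b by blast
  note Kc = compactin_closedin[OF M b(6)]
  note cutoff = cutoff_Cinf[OF M openin_U b(1) Kc b(7,8)]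
  define Y where "Y w x = (if x \<in> U then \<beta> x * (\<phi> x \<bullet> w) else 0)" for w x
  have Y: "Y w \<in> Cinf M" for w
  proof -
    have "smooth_on (\<phi> ` (U \<inter> UNIV)) (\<lambda>z. z \<bullet> w)"
      by (rule smooth_open_imp_smooth_on[of UNIV]) (intro smooth_intros, auto)
    from cutoff[OF smooth_fun_on_chart[OF this, simplified]] show ?thesis by (simp add: Y_def[abs_def])
  qed
  define d where "d i x f = (if x \<in> U then \<beta> x * dirv x (e i) f else 0)" for i x f
  have dt: "d i x \<in> tangent M x" for i x
  proof (cases "x \<in> U")
    case True
    then show ?thesis using tangent_cmult[OF dirv_tangent[OF True], of "\<beta> x" "e i"] by (simp add: d_def[abs_def])
  next
    case False
    then have "d i x = (\<lambda>f. 0)" by (simp add: d_def[abs_def])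
    then show ?thesis by simp
  qed
  have ds: "(\<lambda>x. if x \<in> pts M then d i x f else 0) \<in> Cinf M" if f: "f \<in> Cinf M" for i f
  proof -
    have "(\<lambda>x. if x \<in> U then \<beta> x * dirv x (e i) f else 0) \<in> Cinf M"
      by (rule cutoff[OF dirv_smooth[OF f]])
    moreover have "(\<lambda>x. if x \<in> pts M then d i x f else 0) = (\<lambda>x. if x \<in> U then \<beta> x * dirv x (e i) f else 0)"
      using U_pts by (intro ext) (auto simp: d_def)
    ultimately show ?thesis by simp
  qed
  have dN: "d i x f = dirv x (e i) f" if "x \<in> N" for i x f
    using that NU b(5) by (auto simp: d_def)
  have yN: "Y w x = \<phi> x \<bullet> w" if "x \<in> N" for x w using that NU b(5) by (auto simp: Y_def)
  \<comment> \<open>Expansion over the ambient basis, where Hadamard's lemma lives; it is reduced to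
    the frame of the model subspace afterwards.\<close>
  have basis: "v f = (\<Sum>c\<in>Basis. v (Y c) * dirv x c f)"
    if x: "x \<in> N" and v: "v \<in> tangent M x" and f: "f \<in> Cinf M" for x v f
  proof -
    have xU: "x \<in> U" using x NU by blast
    let ?z = "\<phi> x"
    have "?z \<in> dom N" using x xU by simp
    then obtain r where r: "r > 0" "ball ?z r \<subseteq> dom N" using open_dom[OF b(2)] openE by blast
    have rf: "smooth_open (ball ?z r) (rep f)"
    proof (rule smooth_open_subset[OF Cinf_rep[OF f]])
      have "dom N \<subseteq> dom (pts M)" using openin_subset[OF b(2)] by (auto simp: dom_iff)
      with r(2) show "ball ?z r \<subseteq> dom (pts M)" by blast
    qed simp
    obtain g where g: "\<And>c. smooth_open (ball ?z r) (g c)"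
      "\<And>z. z \<in> ball ?z r \<Longrightarrow> rep f z = rep f ?z + (\<Sum>c\<in>Basis. ((z - ?z) \<bullet> c) * g c z)"
      "\<And>c. g c ?z = frechet_derivative (rep f) (at ?z) c"
      using hadamard[OF rf, of ?z] r(1) by auto
    define A where "A = {x' \<in> U. \<phi> x' \<in> ball ?z r}"
    have A: "openin (Top M) A" "x \<in> A"
      unfolding A_def using openin_preimage[of "ball ?z r"] xU r by auto
    have AN: "A \<subseteq> N"
    proof
      fix x' assume "x' \<in> A"
      then have "x' \<in> U" "\<phi> x' \<in> dom N" using r(2) by (auto simp: A_def)
      then show "x' \<in> N" by simp
    qed
    obtain \<beta>' N' K' where b': "\<beta>' \<in> Cinf M" "openin (Top M) N'" "x \<in> N'" "N' \<subseteq> K'"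
      "\<forall>y\<in>N'. \<beta>' y = 1" "compactin (Top M) K'" "K' \<subseteq> A" "{y. \<beta>' y \<noteq> 0} \<subseteq> K'"
      using bump_function[OF M A(1,2)] by blast
    define G where "G c x' = (if x' \<in> A then \<beta>' x' * g c (\<phi> x') else 0)" for c x'
    have G: "G c \<in> Cinf M" for c
    proof -
      have "smooth_on (\<phi> ` (U \<inter> A)) (g c)"
        by (rule smooth_open_imp_smooth_on[OF g(1)]) (auto simp: A_def)
      then have "smooth_fun_on M (U \<inter> A) (\<lambda>x. g c (\<phi> x))" by (rule smooth_fun_on_chart)
      moreover have "U \<inter> A = A" by (auto simp: A_def)
      ultimately show ?thesis
        using cutoff_Cinf[OF M A(1) b'(1) compactin_closedin[OF M b'(6)] b'(7,8), of "\<lambda>x. g c (\<phi> x)"]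
        by (simp add: G_def[abs_def])
    qed
    \<comment> \<open>The Hadamard expression must be a global function: constants are restricted to
      M and the coefficients are multiplied by a second bump.\<close>
    let ?C = "\<lambda>c y. if y \<in> pts M then c else (0::real)"
    let ?R = "\<lambda>y. ?C (f x) y + (\<Sum>c\<in>Basis. (Y c y - ?C (Y c x) y) * G c y)"
    have "v f = v ?R"
    proof (rule tangent_local[OF M v f _ b'(2,3)])
      show "?R \<in> Cinf M" by (intro Cinf_intros Cinf_const[OF M] Y G)
      fix y assume y: "y \<in> N'"
      then have yA: "y \<in> A" using b' by blast
      then have yN': "y \<in> N" "y \<in> U" "y \<in> pts M" "\<phi> y \<in> ball ?z r" using A AN U_pts by (auto simp: A_def)
      have "f y = rep f (\<phi> y)" using yN' by simp
      also have "\<dots> = f x + (\<Sum>c\<in>Basis. ((\<phi> y - ?z) \<bullet> c) * g c (\<phi> y))"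
        using g(2)[OF yN'(4)] xU by simp
      also have "\<dots> = ?R y"
        using yN' yA yN[OF x] yN[OF yN'(1)] b'(5) y by (simp add: G_def inner_diff_left)
      finally show "f y = ?R y" .
    qed
    also have "v ?R = v (?C (f x)) + (\<Sum>c\<in>Basis. v (\<lambda>y. (Y c y - ?C (Y c x) y) * G c y))"
      by (subst tangentD(1)[OF v], intro Cinf_intros Cinf_const[OF M], intro Cinf_intros Cinf_const[OF M] Y G,
          subst tangent_fun_sum[OF v], intro Cinf_intros Cinf_const[OF M] Y G, rule refl)
    also have "v (?C (f x)) = 0" using tangent_fun_const[OF M v] xU U_pts by blast
    also have "(\<Sum>c\<in>Basis. v (\<lambda>y. (Y c y - ?C (Y c x) y) * G c y)) = (\<Sum>c\<in>Basis. v (Y c) * dirv x c f)"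
    proof (rule sum.cong[OF refl])
      fix c :: 'e
      have "v (\<lambda>y. (Y c y - ?C (Y c x) y) * G c y)
        = (Y c x - ?C (Y c x) x) * v (G c) + G c x * v (\<lambda>y. Y c y - ?C (Y c x) y)"
        by (rule tangentD(3)[OF v]) (intro Cinf_intros Cinf_const[OF M] Y G)+
      also have "v (\<lambda>y. Y c y - ?C (Y c x) y) = v (Y c) - v (?C (Y c x))"
        by (rule tangent_fun_diff[OF v Y Cinf_const[OF M]])
      also have "v (?C (Y c x)) = 0" using tangent_fun_const[OF M v] xU U_pts by blast
      also have "G c x = dirv x c f" using A(2) b'(3,5) g(3) f by (simp add: G_def dirv_def)
      finally show "v (\<lambda>y. (Y c y - ?C (Y c x) y) * G c y) = v (Y c) * dirv x c f"
        using xU U_pts by (simp add: subset_iff)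
    qed
    finally show ?thesis by simp
  qed
  \<comment> \<open>The chart takes values in the model subspace, so every ambient coordinate is a
    combination of the frame coordinates with constant coefficients.\<close>
  have Ysum: "Y c = (\<lambda>x. \<Sum>i<n. (e i \<bullet> c) * Y (e i) x)" for c
  proof
    fix x
    show "Y c x = (\<Sum>i<n. (e i \<bullet> c) * Y (e i) x)"
    proof (cases "x \<in> U")
      case True
      have "\<phi> x \<bullet> c = P (\<phi> x) \<bullet> c" using True by simp
      also have "\<dots> = (\<Sum>i<n. (\<phi> x \<bullet> e i) * (e i \<bullet> c))"
        unfolding model_proj_def n_def e_def by (simp add: inner_sum_left)
      finally show ?thesis using True by (simp add: Y_def sum_distrib_left mult_ac)
    qed (simp add: Y_def)
  qed
  have frame: "v f = (\<Sum>i<n. v (Y (e i)) * d i x f)"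
    if x: "x \<in> N" and v: "v \<in> tangent M x" and f: "f \<in> Cinf M" for x v f
  proof -
    have xU: "x \<in> U" using x NU by blast
    have vY: "v (Y c) = (\<Sum>i<n. (e i \<bullet> c) * v (Y (e i)))" for c
    proof -
      have "v (Y c) = v (\<lambda>x. \<Sum>i<n. (e i \<bullet> c) * Y (e i) x)" by (subst Ysum) (rule refl)
      also have "\<dots> = (\<Sum>i<n. v (\<lambda>x. (e i \<bullet> c) * Y (e i) x))"
        by (rule tangent_fun_sum[OF v]) (intro Cinf_intros Y)
      finally show ?thesis by (simp add: tangentD(2)[OF v Y])
    qed
    have De: "dirv x (e i) f = (\<Sum>c\<in>Basis. (e i \<bullet> c) * dirv x c f)" for i
      using frechet_derivative_euclidean_sum[OF rep_derivative[OF f xU], of "e i"] f by (simp add: dirv_def)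
    have "v f = (\<Sum>c\<in>Basis. (\<Sum>i<n. (e i \<bullet> c) * v (Y (e i))) * dirv x c f)"
      unfolding basis[OF x v f] by (rule sum.cong[OF refl], subst vY, rule refl)
    also have "\<dots> = (\<Sum>i<n. \<Sum>c\<in>Basis. v (Y (e i)) * ((e i \<bullet> c) * dirv x c f))"
      unfolding sum_distrib_right by (subst sum.swap) (simp add: mult_ac)
    also have "\<dots> = (\<Sum>i<n. v (Y (e i)) * d i x f)"
      by (simp add: dN[OF x] De sum_distrib_left)
    finally show ?thesis .
  qed
  have delta: "d i x (Y (e j)) = (if i = j then 1 else 0)" if ij: "i < n" "j < n" and x: "x \<in> N" for i j x
  proof -
    have xU: "x \<in> U" using x NU by blast
    have "((\<lambda>z. P z \<bullet> e j) has_derivative (\<lambda>w. P w \<bullet> e j)) (at (\<phi> x))"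
      by (intro bounded_linear_imp_has_derivative bounded_linear_compose[OF bounded_linear_inner_left bounded_linear_model_proj])
    then have "(rep (Y (e j)) has_derivative (\<lambda>w. P w \<bullet> e j)) (at (\<phi> x))"
      by (rule has_derivative_transform_within_open[OF _ open_dom[OF b(2)]])
        (use x xU in \<open>auto simp: rep_def dom_iff yN chart_inv\<close>)
    then have "dirv x (e i) (Y (e j)) = P (e i) \<bullet> e j" by (rule rep_derivative_eq[OF Y xU])
    moreover have "P (e i) = e i" using ij model_frame(1,3)[OF sub] by (simp add: e_def n_def)
    ultimately show ?thesis
      using ij model_frame(2)[OF sub] by (simp add: dN[OF x] e_def n_def)
  qed
  show thesis
  proof (rule that[of N "\<lambda>i. Y (e i)" d])
    show "frame M N (dim (Model M)) (\<lambda>i. Y (e i)) d"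
      unfolding n_def[symmetric] using M b(2) Y dt ds frame delta by unfold_locales
  qed (use b(3) NU yN dN in \<open>auto simp: e_def\<close>)
qed

end

lemma local_frame:
  assumes M: "smooth_manifold M" and x: "x \<in> pts M"
  obtains N y d where "frame M N (dim (Model M)) y d" "x \<in> N"
proof -
  obtain U \<phi> where U: "mfd_chart M U \<phi>" "x \<in> U" by (rule chart_at[OF M x])
  show thesis by (rule mfd_chart.chart_frame[OF U]) (rule that)
qed

subsection \<open>Push-forward\<close>

lemma pullback_Cinf:
  assumes M: "smooth_manifold M" and N: "smooth_manifold N" and p: "smooth_map M N p" and h: "h \<in> Cinf N"
  shows "pullback_fun M p h \<in> Cinf M"
proof (rule CinfI)
  have cont: "continuous_map (Top M) (Top N) p" using p by (simp add: smooth_map_def)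
  show "smooth_fun_on M (pts M) (pullback_fun M p h)"
  proof (rule smooth_fun_onI_local[OF M])
    fix x assume x: "x \<in> pts M"
    obtain U \<phi> where U: "mfd_chart M U \<phi>" "x \<in> U" using chart_at[OF M x] by metis
    have "p x \<in> pts N" using cont x by (auto simp: continuous_map_def)
    then obtain V \<psi> where V: "mfd_chart N V \<psi>" "p x \<in> V" using chart_at[OF N] by metis
    interpret U: mfd_chart M U \<phi> by fact
    interpret V: mfd_chart N V \<psi> by fact
    define B where "B = {x \<in> pts M. p x \<in> V}"
    have B: "openin (Top M) B" unfolding B_def by (rule openin_continuous_map_preimage[OF cont V.openin_U])
    have S: "\<phi> ` (U \<inter> (pts M \<inter> B)) = \<phi> ` {x \<in> U. p x \<in> V}" using U.U_pts by (auto simp: B_def)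
    have "smooth_on (\<phi> ` {x \<in> U. p x \<in> V}) (\<psi> \<circ> p \<circ> inv_into U \<phi>)"
      using p U.chart V.chart unfolding smooth_map_def by fast
    then have "smooth_on (\<phi> ` {x \<in> U. p x \<in> V}) (\<lambda>z. (h \<circ> inv_into V \<psi>) ((\<psi> \<circ> p \<circ> inv_into U \<phi>) z))"
      by (rule smooth_on_compose[OF _ smooth_fun_onD[OF CinfD(1)[OF h] V.chart]]) (use V.U_pts in auto)
    then have "smooth_on (\<phi> ` {x \<in> U. p x \<in> V}) (pullback_fun M p h \<circ> inv_into U \<phi>)"
      by (rule smooth_on_cong) (use U.U_pts in \<open>auto simp: pullback_fun_def\<close>)
    then show "\<exists>U \<phi> B. (U, \<phi>) \<in> Atlas M \<and> x \<in> U \<and> openin (Top M) B \<and> x \<in> B \<and>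
        smooth_on (\<phi> ` (U \<inter> (pts M \<inter> B))) (pullback_fun M p h \<circ> inv_into U \<phi>)"
      using U.chart U(2) V(2) B x S by (intro exI[of _ U] exI[of _ \<phi>] exI[of _ B]) (simp add: B_def)
  qed
qed (simp add: pullback_fun_def)

lemma push_tangent:
  assumes M: "smooth_manifold M" and N: "smooth_manifold N" and p: "smooth_map M N p"
    and v: "v \<in> tangent M x" "x \<in> pts M"
  shows "push M N p v \<in> tangent N (p x)"
proof (rule tangentI)
  fix f g assume f: "f \<in> Cinf N" and g: "g \<in> Cinf N"
  note P = pullback_Cinf[OF M N p f] pullback_Cinf[OF M N p g]
  have "pullback_fun M p (\<lambda>y. f y + g y) = (\<lambda>y. pullback_fun M p f y + pullback_fun M p g y)"
    "pullback_fun M p (\<lambda>y. f y * g y) = (\<lambda>y. pullback_fun M p f y * pullback_fun M p g y)"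
    by (auto simp: pullback_fun_def)
  then show "push M N p v (\<lambda>y. f y + g y) = push M N p v f + push M N p v g"
    "push M N p v (\<lambda>y. f y * g y) = f (p x) * push M N p v g + g (p x) * push M N p v f"
    using f g v(2) tangentD(1,3)[OF v(1) P]
    by (simp_all add: push_def Cinf_add Cinf_mult) (simp_all add: pullback_fun_def)
next
  fix f and c :: real assume f: "f \<in> Cinf N"
  have "pullback_fun M p (\<lambda>y. c * f y) = (\<lambda>y. c * pullback_fun M p f y)" by (auto simp: pullback_fun_def)
  then show "push M N p v (\<lambda>y. c * f y) = c * push M N p v f"
    using f tangentD(2)[OF v(1) pullback_Cinf[OF M N p f]] by (simp add: push_def Cinf_cmult)
qed (simp add: push_def)

lemma push_zero: "push M N p (\<lambda>f. 0) = (\<lambda>h. 0)" by (auto simp: push_def)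

lemma push_add: "push M N p (\<lambda>f. v f + w f) = (\<lambda>h. push M N p v h + push M N p w h)"
  by (auto simp: push_def)

lemma push_cmult: "push M N p (\<lambda>f. c * v f) = (\<lambda>h. c * push M N p v h)"
  by (auto simp: push_def)

locale chart_map = U: mfd_chart M U \<phi> + V: mfd_chart N V \<psi>
  for M :: "('a, 'e::euclidean_space) mfd" and U \<phi> and N :: "('b, 'f::euclidean_space) mfd" and V \<psi> +
  fixes p :: "'a \<Rightarrow> 'b"
  assumes p: "smooth_map M N p"
begin

definition dom2 :: "'e set" where "dom2 = U.dom {x \<in> pts M. p x \<in> V}"

definition crep :: "'e \<Rightarrow> 'f" where "crep z = \<psi> (p (inv_into U \<phi> (U.P z)))"

lemma cont: "continuous_map (Top M) (Top N) p" using p by (simp add: smooth_map_def)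

lemma openin_pre: "openin (Top M) {x \<in> pts M. p x \<in> V}"
  by (rule openin_continuous_map_preimage[OF cont V.openin_U])

lemma open_dom2: "open dom2" unfolding dom2_def by (rule U.open_dom[OF openin_pre])

lemma dom2_iff: "z \<in> dom2 \<longleftrightarrow> U.P z \<in> \<phi> ` U \<and> p (inv_into U \<phi> (U.P z)) \<in> V"
  unfolding dom2_def U.dom_iff using U.chart_inv(2) U.U_pts by blast

lemma crep_chart: "x \<in> U \<Longrightarrow> crep (\<phi> x) = \<psi> (p x)" by (simp add: crep_def)

lemma crep_model: "z \<in> dom2 \<Longrightarrow> crep z \<in> Model N"
  unfolding dom2_iff crep_def using V.image_model by auto

lemma smooth_crep: "smooth_open dom2 crep"
proof -
  have "smooth_on (\<phi> ` {x \<in> U. p x \<in> V}) (\<psi> \<circ> p \<circ> inv_into U \<phi>)"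
    using p U.chart V.chart unfolding smooth_map_def by fast
  then have "smooth_on dom2 (\<lambda>z. (\<psi> \<circ> p \<circ> inv_into U \<phi>) (U.P z))"
  proof (rule smooth_on_compose[OF smooth_on_bounded_linear[OF bounded_linear_model_proj]])
    fix z assume "z \<in> dom2"
    then have "U.P z \<in> \<phi> ` U" "p (inv_into U \<phi> (U.P z)) \<in> V" by (auto simp: dom2_iff)
    then show "U.P z \<in> \<phi> ` {x \<in> U. p x \<in> V}"
      using U.chart_inv[of "U.P z"] by (intro image_eqI[of _ _ "inv_into U \<phi> (U.P z)"]) auto
  qed
  then show ?thesis unfolding smooth_on_open[OF open_dom2] by (simp add: crep_def[abs_def])
qed

lemma push_dirv:
  assumes x: "x \<in> U" "p x \<in> V"
  shows "push M N p (U.dirv x w) = V.dirv (p x) (frechet_derivative crep (at (\<phi> x)) w)"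
proof
  fix h
  show "push M N p (U.dirv x w) h = V.dirv (p x) (frechet_derivative crep (at (\<phi> x)) w) h"
  proof (cases "h \<in> Cinf N")
    case True
    have z: "\<phi> x \<in> dom2" using x by (auto simp: dom2_iff)
    have pb: "pullback_fun M p h \<in> Cinf M" by (rule pullback_Cinf[OF U.M V.M p True])
    have "(crep has_derivative frechet_derivative crep (at (\<phi> x))) (at (\<phi> x))"
      by (rule smooth_open_has_derivative[OF smooth_crep z])
    moreover have "(V.rep h has_derivative frechet_derivative (V.rep h) (at (\<psi> (p x)))) (at (crep (\<phi> x)))"
      using V.rep_derivative[OF True x(2)] x(1) by (simp add: crep_chart)
    ultimately have "((\<lambda>z. V.rep h (crep z)) has_derivative
        (\<lambda>w. frechet_derivative (V.rep h) (at (\<psi> (p x))) (frechet_derivative crep (at (\<phi> x)) w))) (at (\<phi> x))"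
      by (rule has_derivative_compose)
    then have "(U.rep (pullback_fun M p h) has_derivative
        (\<lambda>w. frechet_derivative (V.rep h) (at (\<psi> (p x))) (frechet_derivative crep (at (\<phi> x)) w))) (at (\<phi> x))"
    proof (rule has_derivative_transform_within_open[OF _ open_dom2 z])
      fix z assume "z \<in> dom2"
      then show "V.rep h (crep z) = U.rep (pullback_fun M p h) z"
        using U.chart_inv(2)[of "U.P z"] U.U_pts
        by (simp add: dom2_iff crep_def U.rep_def pullback_fun_def subset_iff)
    qed
    from U.rep_derivative_eq[OF pb x(1) this] show ?thesis
      using True by (simp add: push_def V.dirv_def)
  qed (simp add: push_def V.dirv_def)
qed

end

subsection \<open>Tangent spaces of fibres\<close>

context mfd_chart
begin

lemma dirv_zero: "x \<in> U \<Longrightarrow> dirv x 0 = (\<lambda>f. 0)"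
  using dirv_linear[of x 1 0 0] by (intro ext) simp

lemma dirv_sum:
  assumes x: "x \<in> U" shows "dirv x (\<Sum>i\<in>I. c i *\<^sub>R w i) = (\<lambda>f. \<Sum>i\<in>I. c i * dirv x (w i) f)"
proof (induction I rule: infinite_finite_induct)
  case (insert i I)
  then show ?case using dirv_linear[OF x, of "c i" "w i" "\<Sum>i\<in>I. c i *\<^sub>R w i"] by auto
qed (use dirv_zero[OF x] in auto)

lemma tangent_dirv:
  assumes x: "x \<in> U" and v: "v \<in> tangent M x"
  obtains w where "w \<in> Model M" "v = dirv x w"
proof -
  obtain N y d where fr: "frame M N (dim (Model M)) y d" "x \<in> N"
    and d: "\<forall>i. \<forall>x\<in>N. d i x = dirv x (model_frame (Model M) i)"
    by (rule chart_frame[OF x]) (rule that)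
  interpret frame M N "dim (Model M)" y d by fact
  let ?w = "\<Sum>i<dim (Model M). v (y i) *\<^sub>R model_frame (Model M) i"
  have "v = dirv x ?w" using expand_vec[OF fr(2) v] d fr(2) by (simp add: dirv_sum[OF x])
  moreover have "?w \<in> Model M" using model_frame(1)[OF sub] sub by (intro subspace_sum subspace_scale) auto
  ultimately show thesis using that by blast
qed

lemma dirv_inject:
  assumes x: "x \<in> U" and w: "w \<in> Model M" "w' \<in> Model M" and eq: "dirv x w = dirv x w'"
  shows "w = w'"
proof -
  obtain N y d where fr: "frame M N (dim (Model M)) y d" "x \<in> N"
    and d: "\<forall>i. \<forall>x\<in>N. d i x = dirv x (model_frame (Model M) i)"
    by (rule chart_frame[OF x]) (rule that)
  interpret frame M N "dim (Model M)" y d by fact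
  have co: "dirv x w (y j) = w \<bullet> model_frame (Model M) j" if "w \<in> Model M" "j < dim (Model M)" for w j
  proof -
    have "dirv x w = dirv x (\<Sum>i<dim (Model M). (w \<bullet> model_frame (Model M) i) *\<^sub>R model_frame (Model M) i)"
      using model_frame(3)[OF sub that(1)] by (simp add: model_proj_def)
    also have "\<dots> = (\<lambda>f. \<Sum>i<dim (Model M). (w \<bullet> model_frame (Model M) i) * d i x f)"
      using d fr(2) by (simp add: dirv_sum[OF x])
    finally have "dirv x w (y j) = (\<Sum>i<dim (Model M). (w \<bullet> model_frame (Model M) i) * d i x (y j))" by simp
    also have "\<dots> = (\<Sum>i<dim (Model M). if i = j then w \<bullet> model_frame (Model M) i else 0)"
      using dual[OF _ that(2) fr(2)] by (intro sum.cong) auto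
    finally show ?thesis using that(2) by simp
  qed
  have "model_proj (Model M) w = model_proj (Model M) w'"
    unfolding model_proj_def using co[OF w(1)] co[OF w(2)] eq by (intro sum.cong) auto
  then show ?thesis using model_frame(3)[OF sub] w by simp
qed

end

text \<open>\<open>crep\<close> takes values in a linear subspace, so it is fixed by the projection,
  and hence so is its derivative.\<close>

lemma (in chart_map) crep_derivative_model:
  assumes z: "z \<in> dom2" shows "frechet_derivative crep (at z) w \<in> Model N"
proof -
  have D: "(crep has_derivative frechet_derivative crep (at z)) (at z)"
    by (rule smooth_open_has_derivative[OF smooth_crep z])
  have "((\<lambda>z. V.P (crep z)) has_derivative (\<lambda>w. V.P (frechet_derivative crep (at z) w))) (at z)"
    by (rule bounded_linear.has_derivative[OF bounded_linear_model_proj D])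
  then have "(crep has_derivative (\<lambda>w. V.P (frechet_derivative crep (at z) w))) (at z)"
    by (rule has_derivative_transform_within_open[OF _ open_dom2 z])
      (use crep_model model_frame(3)[OF V.sub] in auto)
  from frechet_derivative_at[OF this] have "V.P (frechet_derivative crep (at z) w) = frechet_derivative crep (at z) w"
    by metis
  then show ?thesis using model_proj_in[OF V.sub] by metis
qed

text \<open>A function h \<circ> p is constant on a fibre, so tangent vectors of the fibre
  annihilate it.\<close>

lemma fibre_tangent_le:
  assumes sub: "submersion S M p" and X: "embedded_submanifold X S" "pts X = fibre S p b"
    and x: "x \<in> pts X" and u: "u \<in> tangent X x"
  shows "push X S id u \<in> vert S M p x"
proof -
  have sm: "smooth_manifold S" "smooth_manifold M" "smooth_map S M p" using sub by (auto simp: submersion_def)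
  have X': "smooth_manifold X" "smooth_map X S id" "pts X \<subseteq> pts S" using X(1) by (auto simp: embedded_submanifold_def)
  have "push X S id u \<in> tangent S x" using push_tangent[OF X'(1) sm(1) X'(2) u x] by simp
  moreover have "push S M p (push X S id u) = (\<lambda>h. 0)"
  proof
    fix h
    show "push S M p (push X S id u) h = 0"
    proof (cases "h \<in> Cinf M")
      case True
      have "pullback_fun X id (pullback_fun S p h) = (\<lambda>y. if y \<in> pts X then h b else 0)"
        using X'(3) X(2) by (auto simp: pullback_fun_def fibre_def)
      then show ?thesis
        using True pullback_Cinf[OF sm True] tangent_fun_const[OF X'(1) u x] by (simp add: push_def)
    qed (simp add: push_def)
  qed
  ultimately show ?thesis by (simp add: vert_def)
qed

text \<open>No dimension count is made: a vertical vector is the velocity of a curve in the level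
  set of p through x. That curve runs in X, is continuous there because X has the subspace topology,
  and the immersion of X then forces its velocity into the image of the tangent space of X.\<close>

lemma fibre_tangent:
  assumes sub: "submersion S M p" and X: "embedded_submanifold X S" "pts X = fibre S p b"
    and x: "x \<in> pts X"
  shows "push X S id ` tangent X x = vert S M p x"
proof (intro equalityI subsetI)
  fix v assume "v \<in> push X S id ` tangent X x"
  then show "v \<in> vert S M p x" using fibre_tangent_le[OF sub X x] by blast
next
  fix v assume v: "v \<in> vert S M p x"
  have sm: "smooth_manifold S" "smooth_manifold M" "smooth_map S M p"
    and onto: "push S M p ` tangent S x = tangent M (p x)" if "x \<in> pts S" for x
    using sub that by (auto simp: submersion_def)
  have X': "smooth_manifold X" "smooth_map X S id" "pts X \<subseteq> pts S"
    and TX: "Top X = subtopology (Top S) (pts X)" and inj: "inj_on (push X S id) (tangent X x)"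
    using X(1) x by (auto simp: embedded_submanifold_def)
  have xS: "x \<in> pts S" "p x = b" using x X(2) by (auto simp: fibre_def)
  note smS = sm[OF xS(1)]
  have pxM: "p x \<in> pts M" using smS(3) xS(1) by (auto simp: smooth_map_def continuous_map_def)
  obtain U \<phi> where U: "mfd_chart S U \<phi>" "x \<in> U" by (rule chart_at[OF smS(1) xS(1)])
  obtain V \<psi> where V: "mfd_chart M V \<psi>" "p x \<in> V" by (rule chart_at[OF smS(2) pxM])
  obtain Q \<theta> where Q: "mfd_chart X Q \<theta>" "x \<in> Q" by (rule chart_at[OF X'(1) x])
  interpret U: mfd_chart S U \<phi> by (rule U(1))
  interpret V: mfd_chart M V \<psi> by (rule V(1))
  interpret Q: mfd_chart X Q \<theta> by (rule Q(1))
  interpret B: chart_map S U \<phi> M V \<psi> p by unfold_locales (rule smS(3))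
  interpret A: chart_map X Q \<theta> S U \<phi> id by unfold_locales (rule X'(2))
  have vT: "v \<in> tangent S x" and pv: "push S M p v = (\<lambda>h. 0)" using v by (auto simp: vert_def)
  obtain w where w: "w \<in> Model S" "v = U.dirv x w" by (rule U.tangent_dirv[OF U(2) vT])
  let ?z = "\<phi> x"
  define D where "D = frechet_derivative B.crep (at ?z)"
  have zB: "?z \<in> B.dom2" using U(2) V(2) by (simp add: B.dom2_iff)
  have push_D: "push S M p (U.dirv x w) = V.dirv (p x) (D w)" for w
    using B.push_dirv[OF U(2) V(2)] by (simp add: D_def)
  have DM: "D w \<in> Model M" for w unfolding D_def by (rule B.crep_derivative_model[OF zB])
  have "D w = 0"
    by (rule V.dirv_inject[OF V(2) DM subspace_0[OF V.sub]])
      (use push_D[of w] pv w(2) V.dirv_zero[OF V(2)] in simp)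
  have DS: "D ` Model S = Model M"
  proof (intro equalityI subsetI)
    fix m assume "m \<in> D ` Model S" then show "m \<in> Model M" using DM by blast
  next
    fix m assume m: "m \<in> Model M"
    have "V.dirv (p x) m \<in> push S M p ` tangent S x" using V.dirv_tangent[OF V(2)] onto[OF xS(1)] by simp
    then obtain v' where v': "v' \<in> tangent S x" "push S M p v' = V.dirv (p x) m" by auto
    obtain w' where w': "w' \<in> Model S" "v' = U.dirv x w'" by (rule U.tangent_dirv[OF U(2) v'(1)])
    have "D w' = m" by (rule V.dirv_inject[OF V(2) DM m]) (use push_D[of w'] v' w' in simp)
    then show "m \<in> D ` Model S" using w' by blast
  qed
  have zS: "?z \<in> Model S" using U.image_model U(2) by blast
  obtain c where c: "c 0 = ?z" "(c has_vector_derivative w) (at 0)"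
    and ev: "\<forall>\<^sub>F t in nhds 0. c t \<in> B.dom2 \<inter> Model S \<and> B.crep (c t) = B.crep ?z"
    by (rule level_set_curve[OF B.smooth_crep zB zS U.sub V.sub B.crep_model D_def DS DM w(1) \<open>D w = 0\<close>]) (assumption, rule that)
  define c' where "c' t = inv_into U \<phi> (c t)" for t
  have c': "c' t \<in> U \<and> c t = \<phi> (c' t) \<and> c' t \<in> pts X" if t: "c t \<in> B.dom2 \<inter> Model S \<and> B.crep (c t) = B.crep ?z" for t
  proof -
    have P: "U.P (c t) = c t" using t model_frame(3)[OF U.sub] by blast
    have im: "c t \<in> \<phi> ` U" and pV: "p (c' t) \<in> V" using t P by (auto simp: B.dom2_iff c'_def)
    have 1: "c' t \<in> U" "c t = \<phi> (c' t)" using U.chart_inv[OF im] by (auto simp: c'_def)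
    have "\<psi> (p (c' t)) = \<psi> (p x)"
      using t P B.crep_chart[OF U(2)] by (simp add: B.crep_def c'_def)
    then have "p (c' t) = p x" by (rule inj_onD[OF V.inj _ pV V(2)])
    then show ?thesis using 1 X(2) xS U.U_pts by (auto simp: fibre_def)
  qed
  define \<gamma> where "\<gamma> t = \<theta> (c' t)" for t
  have c'0: "c' 0 = x" using c(1) U(2) by (simp add: c'_def)
  have contc: "(c \<longlongrightarrow> ?z) (nhds 0)"
    using has_vector_derivative_continuous[OF c(2)] c(1) tendsto_at_iff_tendsto_nhds[of c 0]
    by (simp add: continuous_within)
  \<comment> \<open>Neighbourhoods of x in X are traces of open sets of S, so continuity of c in S
    gives continuity of \<gamma> in the chart of X.\<close>
  have near: "\<forall>\<^sub>F t in nhds 0. c' t \<in> Q \<and> \<gamma> t \<in> T" if T: "open T" "\<theta> x \<in> T" for T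
  proof -
    have "openin (subtopology (Top S) (pts X)) {y \<in> Q. \<theta> y \<in> T}"
      by (subst TX[symmetric]) (rule Q.openin_preimage[OF T(1)])
    then obtain O' where O': "openin (Top S) O'" "{y \<in> Q. \<theta> y \<in> T} = O' \<inter> pts X"
      by (auto simp: openin_subtopology)
    have "x \<in> O'" using O'(2) Q(2) T(2) by auto
    then have "?z \<in> U.dom O'" using U(2) by simp
    then have "\<forall>\<^sub>F t in nhds 0. c t \<in> U.dom O'"
      using contc U.open_dom[OF O'(1)] by (intro topological_tendstoD)
    with ev show ?thesis
    proof eventually_elim
      case (elim t)
      have "c' t \<in> O' \<inter> pts X" using c'[OF elim(1)] elim(2) U.in_dom by auto
      then show ?case using O'(2) by (auto simp: \<gamma>_def)
    qed
  qed
  define A' where "A' = frechet_derivative A.crep (at (\<theta> x))"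
  have zA: "\<theta> x \<in> A.dom2" using U(2) Q(2) by (simp add: A.dom2_iff)
  have dA: "(A.crep has_derivative A') (at (\<theta> x))"
    unfolding A'_def by (rule smooth_open_has_derivative[OF A.smooth_crep zA])
  have push_A: "push X S id (Q.dirv x u) = U.dirv x (A' u)" for u
    using A.push_dirv[OF Q(2), of u] U(2) by (simp add: A'_def)
  have "w \<in> A' ` Model X"
  proof (rule immersion_velocity[OF dA Q.sub])
    fix u assume u: "u \<in> Model X" "A' u = 0"
    have "push X S id (Q.dirv x u) = push X S id (\<lambda>f. 0)"
      unfolding push_A u(2) push_zero by (rule U.dirv_zero[OF U(2)])
    then have "Q.dirv x u = (\<lambda>f. 0)"
      using inj_onD[OF inj _ Q.dirv_tangent[OF Q(2)] tangent_zero] by blast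
    then show "u = 0"
      by (intro Q.dirv_inject[OF Q(2) u(1) subspace_0[OF Q.sub]]) (simp add: Q.dirv_zero[OF Q(2)])
  next
    have "(\<gamma> \<longlongrightarrow> \<theta> x) (nhds 0)"
    proof (rule topological_tendstoI)
      fix T assume "open T" "\<theta> x \<in> T"
      from near[OF this] show "\<forall>\<^sub>F t in nhds 0. \<gamma> t \<in> T" by (rule eventually_mono) simp
    qed
    then show "(\<gamma> \<longlongrightarrow> \<theta> x) (at 0)" by (rule filterlim_mono[OF _ order_refl at_within_le_nhds])
    show "\<gamma> 0 = \<theta> x" by (simp add: \<gamma>_def c'0)
    have nQ: "\<forall>\<^sub>F t in nhds 0. c' t \<in> Q"
      using near[OF open_UNIV UNIV_I] by (rule eventually_mono) simp
    then have "\<forall>\<^sub>F t in nhds 0. \<gamma> t - \<theta> x \<in> Model X"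
      by (rule eventually_mono) (use Q(2) Q.image_model Q.sub in \<open>auto simp: \<gamma>_def intro!: subspace_diff\<close>)
    then show "\<forall>\<^sub>F t in at 0. \<gamma> t - \<theta> x \<in> Model X"
      by (rule filter_leD[OF at_within_le_nhds])
    have e: "\<forall>\<^sub>F t in nhds 0. c t = A.crep (\<gamma> t)"
      using nQ ev
    proof eventually_elim
      case (elim t)
      then show ?case using c'[OF elim(2)] by (simp add: \<gamma>_def A.crep_chart)
    qed
    show "((\<lambda>t. A.crep (\<gamma> t)) has_vector_derivative w) (at 0)"
    proof -
      obtain T where T: "open T" "0 \<in> T" "\<And>t. t \<in> T \<Longrightarrow> c t = A.crep (\<gamma> t)"
        using e unfolding eventually_nhds by blast
      show ?thesis by (rule has_vector_derivative_transform_within_open[OF c(2) T])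
    qed
  qed
  then obtain u where u: "u \<in> Model X" "w = A' u" by blast
  then have "v = push X S id (Q.dirv x u)" using w(2) push_A by simp
  then show "v \<in> push X S id ` tangent X x" using Q.dirv_tangent[OF Q(2)] by blast
qed

section \<open>Covectors and bivectors at a point\<close>

lemma cotangentD:
  assumes "\<xi> \<in> cotangent M x"
  shows "v \<in> tangent M x \<Longrightarrow> w \<in> tangent M x \<Longrightarrow> \<xi> (\<lambda>f. v f + w f) = \<xi> v + \<xi> w"
    and "v \<in> tangent M x \<Longrightarrow> \<xi> (\<lambda>f. c * v f) = c * \<xi> v"
    and "v \<notin> tangent M x \<Longrightarrow> \<xi> v = 0"
  using assms by (auto simp: cotangent_def)

lemma cotangentI:
  assumes "\<And>v w. v \<in> tangent M x \<Longrightarrow> w \<in> tangent M x \<Longrightarrow> \<xi> (\<lambda>f. v f + w f) = \<xi> v + \<xi> w"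
    and "\<And>v c. v \<in> tangent M x \<Longrightarrow> \<xi> (\<lambda>f. c * v f) = c * \<xi> v"
    and "\<And>v. v \<notin> tangent M x \<Longrightarrow> \<xi> v = 0"
  shows "\<xi> \<in> cotangent M x"
  using assms by (auto simp: cotangent_def)

lemma cotangent_vec_zero: "\<xi> \<in> cotangent M x \<Longrightarrow> \<xi> (\<lambda>f. 0) = 0"
  using cotangentD(2)[of \<xi> M x "\<lambda>f. 0" 0] by simp

lemma cotangent_vec_sum:
  assumes "\<xi> \<in> cotangent M x" "\<And>i. i \<in> I \<Longrightarrow> v i \<in> tangent M x"
  shows "\<xi> (\<lambda>f. \<Sum>i\<in>I. c i * v i f) = (\<Sum>i\<in>I. c i * \<xi> (v i))"
  using assms(2)
proof (induction I rule: infinite_finite_induct)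
  case (insert i I)
  have "\<xi> (\<lambda>f. c i * v i f + (\<Sum>i\<in>I. c i * v i f)) = \<xi> (\<lambda>f. c i * v i f) + \<xi> (\<lambda>f. \<Sum>i\<in>I. c i * v i f)"
    using insert by (intro cotangentD(1)[OF assms(1)] tangent_cmult tangent_sum) auto
  with insert cotangentD(2)[OF assms(1)] show ?case by simp
qed (simp_all add: cotangent_vec_zero[OF assms(1)])

lemma cotangent_zero [simp]: "(\<lambda>v. 0) \<in> cotangent M x" by (rule cotangentI) auto

lemma cotangent_add: "\<xi> \<in> cotangent M x \<Longrightarrow> \<eta> \<in> cotangent M x \<Longrightarrow> (\<lambda>v. \<xi> v + \<eta> v) \<in> cotangent M x"
  by (rule cotangentI) (simp_all add: cotangentD[of \<xi>] cotangentD[of \<eta>] algebra_simps)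

lemma cotangent_cmult: "\<xi> \<in> cotangent M x \<Longrightarrow> (\<lambda>v. c * \<xi> v) \<in> cotangent M x"
  by (rule cotangentI) (simp_all add: cotangentD[of \<xi>] algebra_simps)

lemma cotangent_diff: "\<xi> \<in> cotangent M x \<Longrightarrow> \<eta> \<in> cotangent M x \<Longrightarrow> (\<lambda>v. \<xi> v - \<eta> v) \<in> cotangent M x"
  using cotangent_add[OF _ cotangent_cmult[of \<eta> M x "-1"], of \<xi>] by simp

lemma cotangent_sum:
  "(\<And>i. i \<in> I \<Longrightarrow> \<xi> i \<in> cotangent M x) \<Longrightarrow> (\<lambda>v. \<Sum>i\<in>I. c i * \<xi> i v) \<in> cotangent M x"
  by (induction I rule: infinite_finite_induct) (auto intro!: cotangent_add cotangent_cmult)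

lemma dif_cotangent [simp]: "dif M f x \<in> cotangent M x"
  by (rule cotangentI) (auto simp: dif_def tangent_add tangent_cmult)

lemma dif_apply: "v \<in> tangent M x \<Longrightarrow> dif M f x v = v f" by (simp add: dif_def)

lemma dif_add: "f \<in> Cinf M \<Longrightarrow> g \<in> Cinf M \<Longrightarrow> dif M (\<lambda>y. f y + g y) x = (\<lambda>v. dif M f x v + dif M g x v)"
  by (auto simp: dif_def tangentD(1))

lemma dif_cmult: "f \<in> Cinf M \<Longrightarrow> dif M (\<lambda>y. c * f y) x = (\<lambda>v. c * dif M f x v)"
  by (auto simp: dif_def tangentD(2))

lemma dif_sum:
  "(\<And>i. i \<in> I \<Longrightarrow> f i \<in> Cinf M) \<Longrightarrow> dif M (\<lambda>y. \<Sum>i\<in>I. c i * f i y) x = (\<lambda>v. \<Sum>i\<in>I. c i * dif M (f i) x v)"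
proof
  fix v
  assume f: "\<And>i. i \<in> I \<Longrightarrow> f i \<in> Cinf M"
  show "dif M (\<lambda>y. \<Sum>i\<in>I. c i * f i y) x v = (\<Sum>i\<in>I. c i * dif M (f i) x v)"
  proof (cases "v \<in> tangent M x")
    case True
    have "v (\<lambda>y. \<Sum>i\<in>I. c i * f i y) = (\<Sum>i\<in>I. v (\<lambda>y. c i * f i y))"
      by (rule tangent_fun_sum[OF True Cinf_cmult[OF f]])
    then show ?thesis using f by (simp add: dif_apply True tangentD(2)[OF True])
  qed (simp add: dif_def)
qed

context frame
begin

lemma covector_expand:
  assumes x: "x \<in> N" and xi: "\<xi> \<in> cotangent M x"
  shows "\<xi> = (\<lambda>v. \<Sum>i<n. \<xi> (d i x) * dif M (y i) x v)"
proof
  fix v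
  show "\<xi> v = (\<Sum>i<n. \<xi> (d i x) * dif M (y i) x v)"
  proof (cases "v \<in> tangent M x")
    case True
    have "\<xi> v = \<xi> (\<lambda>f. \<Sum>i<n. v (y i) * d i x f)"
      using expand_vec[OF x True] by simp
    also have "\<dots> = (\<Sum>i<n. v (y i) * \<xi> (d i x))"
      using x N_pts d_tangent by (intro cotangent_vec_sum[OF xi]) auto
    finally show ?thesis using True by (simp add: dif_apply mult.commute)
  qed (simp add: dif_def cotangentD(3)[OF xi])
qed

lemma dif_expand:
  assumes "x \<in> N" "f \<in> Cinf M" shows "dif M f x = (\<lambda>v. \<Sum>i<n. d i x f * dif M (y i) x v)"
  using covector_expand[OF assms(1) dif_cotangent, of f] assms(1) N_pts d_tangent
  by (simp add: dif_apply subset_iff)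

end

text \<open>Take the combination of the cut-off coordinates with the constant coefficients
  \<xi>(d_i).\<close>

lemma cotangent_dif:
  assumes M: "smooth_manifold M" and x: "x \<in> pts M" and xi: "\<xi> \<in> cotangent M x"
  obtains f where "f \<in> Cinf M" "\<xi> = dif M f x"
proof -
  obtain N y d where fr: "frame M N (dim (Model M)) y d" "x \<in> N" by (rule local_frame[OF M x])
  interpret frame M N "dim (Model M)" y d by (rule fr(1))
  let ?f = "\<lambda>z. \<Sum>i<dim (Model M). \<xi> (d i x) * y i z"
  have "dif M ?f x = \<xi>"
    using covector_expand[OF fr(2) xi] y by (subst dif_sum) auto
  moreover have "?f \<in> Cinf M" using y by (intro Cinf_sum Cinf_cmult) auto
  ultimately show thesis using that by metis
qed

text \<open>Only the value of \<pi> at the single point x is constrained, so that the lemmas apply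
  to the two parts of \<pi>_S before their smoothness is known.\<close>

locale bivector =
  fixes M :: "('a, 'e::euclidean_space) mfd" and x :: 'a and \<pi> :: "'a bivector"
  assumes M: "smooth_manifold M" and x: "x \<in> pts M" and b: "\<pi> x \<in> wedge2 M x (tangent M x)"
begin

lemma pairs:
  obtains ps where "set ps \<subseteq> tangent M x \<times> tangent M x"
    "\<And>\<xi> \<eta>. \<xi> \<in> cotangent M x \<Longrightarrow> \<eta> \<in> cotangent M x \<Longrightarrow>
      \<pi> x \<xi> \<eta> = (\<Sum>(u, w)\<leftarrow>ps. \<xi> u * \<eta> w - \<xi> w * \<eta> u)"
  using b unfolding wedge2_def by blast

lemma add_left: "\<xi> \<in> cotangent M x \<Longrightarrow> \<xi>' \<in> cotangent M x \<Longrightarrow> \<eta> \<in> cotangent M x \<Longrightarrow>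
    \<pi> x (\<lambda>v. \<xi> v + \<xi>' v) \<eta> = \<pi> x \<xi> \<eta> + \<pi> x \<xi>' \<eta>"
proof (rule pairs)
  fix ps assume ps: "\<And>\<xi> \<eta>. \<xi> \<in> cotangent M x \<Longrightarrow> \<eta> \<in> cotangent M x \<Longrightarrow>
      \<pi> x \<xi> \<eta> = (\<Sum>(u, w)\<leftarrow>ps. \<xi> u * \<eta> w - \<xi> w * \<eta> u)"
  assume xi: "\<xi> \<in> cotangent M x" "\<xi>' \<in> cotangent M x" "\<eta> \<in> cotangent M x"
  have "(\<Sum>(u, w)\<leftarrow>ps. (\<xi> u + \<xi>' u) * \<eta> w - (\<xi> w + \<xi>' w) * \<eta> u) =
      (\<Sum>(u, w)\<leftarrow>ps. \<xi> u * \<eta> w - \<xi> w * \<eta> u) + (\<Sum>(u, w)\<leftarrow>ps. \<xi>' u * \<eta> w - \<xi>' w * \<eta> u)"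
    by (induction ps) (auto simp: algebra_simps)
  then show ?thesis using xi by (simp only: ps cotangent_add)
qed

lemma cmult_left: "\<xi> \<in> cotangent M x \<Longrightarrow> \<eta> \<in> cotangent M x \<Longrightarrow> \<pi> x (\<lambda>v. c * \<xi> v) \<eta> = c * \<pi> x \<xi> \<eta>"
proof (rule pairs)
  fix ps assume ps: "\<And>\<xi> \<eta>. \<xi> \<in> cotangent M x \<Longrightarrow> \<eta> \<in> cotangent M x \<Longrightarrow>
      \<pi> x \<xi> \<eta> = (\<Sum>(u, w)\<leftarrow>ps. \<xi> u * \<eta> w - \<xi> w * \<eta> u)"
  assume xi: "\<xi> \<in> cotangent M x" "\<eta> \<in> cotangent M x"
  have "(\<Sum>(u, w)\<leftarrow>ps. (c * \<xi> u) * \<eta> w - (c * \<xi> w) * \<eta> u) =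
      c * (\<Sum>(u, w)\<leftarrow>ps. \<xi> u * \<eta> w - \<xi> w * \<eta> u)"
    by (induction ps) (auto simp: algebra_simps)
  then show ?thesis using xi by (simp only: ps cotangent_cmult)
qed

lemma skew: "\<xi> \<in> cotangent M x \<Longrightarrow> \<eta> \<in> cotangent M x \<Longrightarrow> \<pi> x \<eta> \<xi> = - \<pi> x \<xi> \<eta>"
proof (rule pairs)
  fix ps assume ps: "\<And>\<xi> \<eta>. \<xi> \<in> cotangent M x \<Longrightarrow> \<eta> \<in> cotangent M x \<Longrightarrow>
      \<pi> x \<xi> \<eta> = (\<Sum>(u, w)\<leftarrow>ps. \<xi> u * \<eta> w - \<xi> w * \<eta> u)"
  assume xi: "\<xi> \<in> cotangent M x" "\<eta> \<in> cotangent M x"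
  have "(\<Sum>(u, w)\<leftarrow>ps. \<eta> u * \<xi> w - \<eta> w * \<xi> u) =
      - (\<Sum>(u, w)\<leftarrow>ps. \<xi> u * \<eta> w - \<xi> w * \<eta> u)"
    by (induction ps) (auto simp: algebra_simps)
  then show ?thesis using xi by (simp only: ps )
qed

lemma zero_left: "\<eta> \<in> cotangent M x \<Longrightarrow> \<pi> x (\<lambda>v. 0) \<eta> = 0"
  using cmult_left[of "\<lambda>v. 0" \<eta> 0] by simp

lemma diff_left: "\<xi> \<in> cotangent M x \<Longrightarrow> \<xi>' \<in> cotangent M x \<Longrightarrow> \<eta> \<in> cotangent M x \<Longrightarrow>
    \<pi> x (\<lambda>v. \<xi> v - \<xi>' v) \<eta> = \<pi> x \<xi> \<eta> - \<pi> x \<xi>' \<eta>"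
  using add_left[of \<xi> "\<lambda>v. - 1 * \<xi>' v" \<eta>] cmult_left[of \<xi>' \<eta> "-1"] cotangent_cmult[of \<xi>' M x "-1"] by simp

lemma sum_left: "(\<And>i. i \<in> I \<Longrightarrow> \<xi> i \<in> cotangent M x) \<Longrightarrow> \<eta> \<in> cotangent M x \<Longrightarrow>
    \<pi> x (\<lambda>v. \<Sum>i\<in>I. c i * \<xi> i v) \<eta> = (\<Sum>i\<in>I. c i * \<pi> x (\<xi> i) \<eta>)"
proof (induction I rule: infinite_finite_induct)
  case (insert i I)
  have "\<pi> x (\<lambda>v. c i * \<xi> i v + (\<Sum>i\<in>I. c i * \<xi> i v)) \<eta> = \<pi> x (\<lambda>v. c i * \<xi> i v) \<eta> + \<pi> x (\<lambda>v. \<Sum>i\<in>I. c i * \<xi> i v) \<eta>"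
    using insert by (intro add_left cotangent_cmult cotangent_sum) auto
  with insert show ?case by (simp add: cmult_left)
qed (auto simp: zero_left)

text \<open>The bivector at x is a finite sum of wedges of vectors of W, so contraction with a
  covector stays in W. Used with W the whole tangent space and with W the vertical space.\<close>

lemma sharp_combination:
  assumes W: "\<pi> x \<in> wedge2 M x W" "W \<subseteq> tangent M x" and xi: "\<xi> \<in> cotangent M x"
    and sub: "(\<lambda>f. 0) \<in> W" "\<And>v w. v \<in> W \<Longrightarrow> w \<in> W \<Longrightarrow> (\<lambda>f. v f + w f) \<in> W"
      "\<And>v c. v \<in> W \<Longrightarrow> (\<lambda>f. c * v f) \<in> W"
  shows "sharp M \<pi> x \<xi> \<in> W"
proof -
  obtain ps where ps: "set ps \<subseteq> W \<times> W" and val: "\<And>\<xi> \<eta>. \<xi> \<in> cotangent M x \<Longrightarrow> \<eta> \<in> cotangent M x \<Longrightarrow>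
      \<pi> x \<xi> \<eta> = (\<Sum>(u, w)\<leftarrow>ps. \<xi> u * \<eta> w - \<xi> w * \<eta> u)"
    using W(1) unfolding wedge2_def by blast
  have "sharp M \<pi> x \<xi> f = (\<Sum>(u, w)\<leftarrow>ps. \<xi> u * w f + (- \<xi> w) * u f)" for f
  proof (cases "f \<in> Cinf M")
    case True
    have "(\<Sum>(u, w)\<leftarrow>ps. \<xi> u * dif M f x w - \<xi> w * dif M f x u) = (\<Sum>(u, w)\<leftarrow>ps. \<xi> u * w f + (- \<xi> w) * u f)"
      using ps W(2) by (intro arg_cong[where f=sum_list] map_cong refl) (auto simp: dif_apply subset_iff)
    then show ?thesis using True xi by (simp add: sharp_def val)
  next
    case False
    have "\<forall>q\<in>set ps. fst q f = 0 \<and> snd q f = 0"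
      using ps W(2) tangentD(4)[OF _ False] by fastforce
    then have "(\<Sum>(u, w)\<leftarrow>ps. \<xi> u * w f + (- \<xi> w) * u f) = 0" by (induction ps) auto
    then show ?thesis using False by (simp add: sharp_def)
  qed
  moreover have "(\<lambda>f. \<Sum>(u, w)\<leftarrow>ps. \<xi> u * w f + (- \<xi> w) * u f) \<in> W"
    using ps
  proof (induction ps)
    case (Cons q ps)
    obtain u w where q: "q = (u, w)" by (cases q)
    have IH: "(\<lambda>f. \<Sum>(u, w)\<leftarrow>ps. \<xi> u * w f + (- \<xi> w) * u f) \<in> W"
      by (rule Cons.IH) (use Cons.prems in simp)
    have "(\<lambda>f. (\<xi> u * w f + (- \<xi> w) * u f) + (\<Sum>(u, w)\<leftarrow>ps. \<xi> u * w f + (- \<xi> w) * u f)) \<in> W"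
      by (intro sub(2) sub(3) IH) (use Cons.prems q in auto)
    then show ?case by (simp add: q)
  qed (simp add: sub(1))
  ultimately show ?thesis by presburger
qed

lemma sharp_tangent: "\<xi> \<in> cotangent M x \<Longrightarrow> sharp M \<pi> x \<xi> \<in> tangent M x"
  by (rule sharp_combination[OF b]) (auto intro: tangent_add tangent_cmult)

lemma eval_sharp:
  assumes "\<xi> \<in> cotangent M x" "\<eta> \<in> cotangent M x" shows "\<eta> (sharp M \<pi> x \<xi>) = \<pi> x \<xi> \<eta>"
proof -
  obtain g where "g \<in> Cinf M" "\<eta> = dif M g x" by (rule cotangent_dif[OF M x assms(2)])
  then show ?thesis using sharp_tangent[OF assms(1)] by (simp add: dif_apply) (simp add: sharp_def)
qed

lemma sharp_diff: "\<xi> \<in> cotangent M x \<Longrightarrow> \<eta> \<in> cotangent M x \<Longrightarrow>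
    sharp M \<pi> x (\<lambda>v. \<xi> v - \<eta> v) = (\<lambda>f. sharp M \<pi> x \<xi> f - sharp M \<pi> x \<eta> f)"
  by (auto simp: sharp_def diff_left)

end

lemma wedge2_mono: "W \<subseteq> W' \<Longrightarrow> wedge2 M x W \<subseteq> wedge2 M x W'"
  unfolding wedge2_def by (intro Collect_mono impI) (meson Sigma_mono order_trans)

lemma wedge2_diff:
  assumes "b \<in> wedge2 M x W" "b' \<in> wedge2 M x W"
  shows "(\<lambda>\<xi> \<eta>. b \<xi> \<eta> - b' \<xi> \<eta>) \<in> wedge2 M x W"
proof -
  obtain ps where ps: "set ps \<subseteq> W \<times> W" "\<forall>\<xi>\<in>cotangent M x. \<forall>\<eta>\<in>cotangent M x.
      b \<xi> \<eta> = (\<Sum>(u, w)\<leftarrow>ps. \<xi> u * \<eta> w - \<xi> w * \<eta> u)" using assms(1) unfolding wedge2_def by blast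
  obtain qs where qs: "set qs \<subseteq> W \<times> W" "\<forall>\<xi>\<in>cotangent M x. \<forall>\<eta>\<in>cotangent M x.
      b' \<xi> \<eta> = (\<Sum>(u, w)\<leftarrow>qs. \<xi> u * \<eta> w - \<xi> w * \<eta> u)" using assms(2) unfolding wedge2_def by blast
  have "(\<Sum>(u, w)\<leftarrow>ps @ map prod.swap qs. \<xi> u * \<eta> w - \<xi> w * \<eta> u) =
      (\<Sum>(u, w)\<leftarrow>ps. \<xi> u * \<eta> w - \<xi> w * \<eta> u) - (\<Sum>(u, w)\<leftarrow>qs. \<xi> u * \<eta> w - \<xi> w * \<eta> u)" for \<xi> \<eta> :: "'a covec"
  proof -
    have "(\<Sum>(u, w)\<leftarrow>map prod.swap qs. \<xi> u * \<eta> w - \<xi> w * \<eta> u) = - (\<Sum>(u, w)\<leftarrow>qs. \<xi> u * \<eta> w - \<xi> w * \<eta> u)"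
      by (induction qs) auto
    then show ?thesis by simp
  qed
  moreover have "set (ps @ map prod.swap qs) \<subseteq> W \<times> W" using ps(1) qs(1) by auto
  ultimately show ?thesis using ps(2) qs(2) unfolding wedge2_def 
    by (intro CollectI exI[of _ "ps @ map prod.swap qs"] conjI ballI) simp_all
qed

lemma smooth_bivector_at:
  "smooth_manifold M \<Longrightarrow> smooth_bivector M \<pi> \<Longrightarrow> x \<in> pts M \<Longrightarrow> bivector M x \<pi>"
  unfolding bivector_def smooth_bivector_def by blast

section \<open>The pointwise decomposition of a Poisson submersion with Poisson fibres\<close>

lemma (in bivector) sharp_sum:
  "(\<And>i. i \<in> I \<Longrightarrow> \<xi> i \<in> cotangent M x) \<Longrightarrow>
    sharp M \<pi> x (\<lambda>v. \<Sum>i\<in>I. c i * \<xi> i v) = (\<lambda>f. \<Sum>i\<in>I. c i * sharp M \<pi> x (\<xi> i) f)"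
  by (auto simp: sharp_def sum_left)

text \<open>The form is well defined: by skewness, changing \<xi> or \<eta> without changing its
  image under \<open>sharp\<close> does not affect \<pi>(\<xi>,\<eta>).\<close>

lemma (in bivector) leaf_form_eq:
  assumes "\<xi> \<in> cotangent M x" "\<eta> \<in> cotangent M x"
  shows "leaf_form M \<pi> x (sharp M \<pi> x \<xi>) (sharp M \<pi> x \<eta>) = \<pi> x \<xi> \<eta>"
  unfolding leaf_form_def
proof (rule the_equality)
  show "\<exists>\<xi>'\<in>cotangent M x. \<exists>\<eta>'\<in>cotangent M x. sharp M \<pi> x \<xi> = sharp M \<pi> x \<xi>' \<and>
      sharp M \<pi> x \<eta> = sharp M \<pi> x \<eta>' \<and> \<pi> x \<xi> \<eta> = \<pi> x \<xi>' \<eta>'"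
    using assms by blast
next
  fix r
  assume "\<exists>\<xi>'\<in>cotangent M x. \<exists>\<eta>'\<in>cotangent M x. sharp M \<pi> x \<xi> = sharp M \<pi> x \<xi>' \<and>
      sharp M \<pi> x \<eta> = sharp M \<pi> x \<eta>' \<and> r = \<pi> x \<xi>' \<eta>'"
  then obtain \<xi>' \<eta>' where c: "\<xi>' \<in> cotangent M x" "\<eta>' \<in> cotangent M x"
    and e: "sharp M \<pi> x \<xi> = sharp M \<pi> x \<xi>'" "sharp M \<pi> x \<eta> = sharp M \<pi> x \<eta>'" "r = \<pi> x \<xi>' \<eta>'"
    by blast
  have "r = \<eta>' (sharp M \<pi> x \<xi>)" using eval_sharp[OF c] e by simp
  also have "\<dots> = - \<xi> (sharp M \<pi> x \<eta>')" using eval_sharp[OF assms(1) c(2)] eval_sharp[OF c(2) assms(1)] skew[OF assms(1) c(2)] by simp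
  also have "\<dots> = \<pi> x \<xi> \<eta>" using eval_sharp[OF assms(2,1)] skew[OF assms] e(2) by simp
  finally show "r = \<pi> x \<xi> \<eta>" .
qed

lemma pull_covec_cotangent:
  assumes M: "smooth_manifold M" "smooth_manifold N" "smooth_map M N p" "x \<in> pts M"
    and xi: "\<xi> \<in> cotangent N (p x)"
  shows "pull_covec M N p x \<xi> \<in> cotangent M x"
  by (rule cotangentI)
    (use push_tangent[OF M(1-3) _ M(4)] in
      \<open>auto simp: pull_covec_def tangent_add tangent_cmult push_add push_cmult cotangentD[OF xi]\<close>)

lemma pull_covec_dif:
  assumes M: "smooth_manifold M" "smooth_manifold N" "smooth_map M N p" "x \<in> pts M" and b: "b \<in> Cinf N"
  shows "pull_covec M N p x (dif N b (p x)) = dif M (pullback_fun M p b) x"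
proof
  fix v
  show "pull_covec M N p x (dif N b (p x)) v = dif M (pullback_fun M p b) x v"
    using push_tangent[OF M(1-3) _ M(4), of v] b
    by (cases "v \<in> tangent M x") (simp_all add: pull_covec_def dif_def, simp add: push_def)
qed

lemma tangent_diff: "v \<in> tangent M x \<Longrightarrow> w \<in> tangent M x \<Longrightarrow> (\<lambda>f. v f - w f) \<in> tangent M x"
  using tangent_add[OF _ tangent_cmult[of w M x "-1"], of v] by simp

lemma Gr_iff: "(u, \<xi>) \<in> Gr M \<pi> x \<longleftrightarrow> \<xi> \<in> cotangent M x \<and> u = sharp M \<pi> x \<xi>"
  by (auto simp: Gr_def)

lemma wedge2_annihilated:
  assumes "b \<in> wedge2 M x W" "\<alpha> \<in> cotangent M x" "\<eta> \<in> cotangent M x" "\<And>v. v \<in> W \<Longrightarrow> \<alpha> v = 0"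
  shows "b \<alpha> \<eta> = 0"
proof -
  obtain ps where ps: "set ps \<subseteq> W \<times> W" "b \<alpha> \<eta> = (\<Sum>(u, w)\<leftarrow>ps. \<alpha> u * \<eta> w - \<alpha> w * \<eta> u)"
    using assms(1-3) unfolding wedge2_def by blast
  have "(\<Sum>(u, w)\<leftarrow>ps. \<alpha> u * \<eta> w - \<alpha> w * \<eta> u) = 0" using ps(1) assms(4) by (induction ps) auto
  then show ?thesis using ps(2) by simp
qed

locale poisson_fib =
  fixes S :: "('a, 'e::euclidean_space) mfd" and \<pi>S :: "'a bivector"
    and M :: "('b, 'f::euclidean_space) mfd" and \<pi>M :: "'b bivector" and p :: "'a \<Rightarrow> 'b"
  assumes PS: "poisson_submersion S \<pi>S M \<pi>M p" and PF: "poisson_fibres S \<pi>S M p"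
begin

abbreviation "V x \<equiv> vert S M p x"
abbreviation "Vo x \<equiv> vert_ann S M p x"
abbreviation "T x \<equiv> tangent S x"
abbreviation "To x \<equiv> cotangent S x"
abbreviation "pb b \<equiv> pullback_fun S p b"

lemma sub: "submersion S M p" and smS: "smooth_manifold S" and smM: "smooth_manifold M"
  and smp: "smooth_map S M p" and onto: "x \<in> pts S \<Longrightarrow> push S M p ` T x = tangent M (p x)"
  and smooth_S: "smooth_bivector S \<pi>S" and jacobi_S: "schouten_vanishes S \<pi>S \<pi>S"
  using PS by (auto simp: poisson_submersion_def submersion_def poisson_manifold_def poisson_structure_def)

lemma p_pts: "x \<in> pts S \<Longrightarrow> p x \<in> pts M"
  using smp by (auto simp: smooth_map_def continuous_map_def)

lemma pb_Cinf: "b \<in> Cinf M \<Longrightarrow> pb b \<in> Cinf S" by (rule pullback_Cinf[OF smS smM smp])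

lemma bS: "x \<in> pts S \<Longrightarrow> bivector S x \<pi>S" by (rule smooth_bivector_at[OF smS smooth_S])

lemma vert_tangent: "v \<in> V x \<Longrightarrow> v \<in> T x" by (simp add: vert_def)

lemma vert_zero: "(\<lambda>f. 0) \<in> V x" by (simp add: vert_def push_zero)

lemma vert_add: "v \<in> V x \<Longrightarrow> w \<in> V x \<Longrightarrow> (\<lambda>f. v f + w f) \<in> V x"
  by (simp add: vert_def push_add tangent_add)

lemma vert_cmult: "v \<in> V x \<Longrightarrow> (\<lambda>f. c * v f) \<in> V x"
  by (simp add: vert_def push_cmult tangent_cmult)

lemma vert_diff: "v \<in> V x \<Longrightarrow> w \<in> V x \<Longrightarrow> (\<lambda>f. v f - w f) \<in> V x"
  using vert_add[OF _ vert_cmult[of w x "-1"], of v] by simp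

lemma vert_pb: "v \<in> V x \<Longrightarrow> b \<in> Cinf M \<Longrightarrow> v (pb b) = 0"
  by (auto simp: vert_def push_def fun_eq_iff split: if_splits)

lemma vertI: "v \<in> T x \<Longrightarrow> (\<And>b. b \<in> Cinf M \<Longrightarrow> v (pb b) = 0) \<Longrightarrow> v \<in> V x"
  by (auto simp: vert_def push_def)

lemma ann_cotangent: "\<alpha> \<in> Vo x \<Longrightarrow> \<alpha> \<in> To x" by (simp add: vert_ann_def)

lemma ann_vert: "\<alpha> \<in> Vo x \<Longrightarrow> v \<in> V x \<Longrightarrow> \<alpha> v = 0" by (simp add: vert_ann_def)

lemma ann_diff: "\<alpha> \<in> Vo x \<Longrightarrow> \<beta> \<in> Vo x \<Longrightarrow> (\<lambda>v. \<alpha> v - \<beta> v) \<in> Vo x"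
  by (simp add: vert_ann_def cotangent_diff)

lemma dif_pb_ann: "b \<in> Cinf M \<Longrightarrow> dif S (pb b) x \<in> Vo x"
  by (auto simp: vert_ann_def dif_apply[OF vert_tangent] vert_pb)

text \<open>A covector vanishing on V factors through the isomorphism from T_x S / V_x to the
  tangent space of M at p(x); the resulting covector of M is the differential of some b. So at a
  point, annihilators of V are differentials of basic functions.\<close>

lemma ann_dif_pb:
  assumes x: "x \<in> pts S" and a: "\<alpha> \<in> Vo x"
  obtains b where "b \<in> Cinf M" "\<alpha> = dif S (pb b) x"
proof -
  have aT: "\<alpha> \<in> To x" using a by (rule ann_cotangent)
  have wd: "\<alpha> v = \<alpha> w" if "v \<in> T x" "w \<in> T x" "push S M p v = push S M p w" for v w
  proof -
    have "push S M p (\<lambda>f. v f - w f) = (\<lambda>h. 0)"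
      using that(3) by (auto simp: push_def fun_eq_iff split: if_splits)
    then have "(\<lambda>f. v f - w f) \<in> V x" using tangent_diff[OF that(1,2)] by (simp add: vert_def)
    then have "\<alpha> (\<lambda>f. v f - w f) = 0" by (rule ann_vert[OF a])
    then show ?thesis
      using cotangentD(1)[OF aT that(1) tangent_cmult[OF that(2), of "-1"]] cotangentD(2)[OF aT that(2), of "-1"] by simp
  qed
  define lift where "lift w = (SOME v. v \<in> T x \<and> push S M p v = w)" for w
  have lift: "lift w \<in> T x \<and> push S M p (lift w) = w" if "w \<in> tangent M (p x)" for w
  proof -
    have "\<exists>v. v \<in> T x \<and> push S M p v = w" using that unfolding onto[OF x, symmetric] by auto
    from someI_ex[OF this] show ?thesis unfolding lift_def .
  qed
  define \<xi> where "\<xi> w = (if w \<in> tangent M (p x) then \<alpha> (lift w) else 0)" for w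
  have \<xi>: "\<xi> (push S M p v) = \<alpha> v" if "v \<in> T x" for v
  proof -
    have "push S M p v \<in> tangent M (p x)" using onto[OF x] that by blast
    then show ?thesis unfolding \<xi>_def using wd[OF _ that] lift by auto
  qed
  have "\<xi> \<in> cotangent M (p x)"
  proof (rule cotangentI)
    fix v w assume v: "v \<in> tangent M (p x)" and w: "w \<in> tangent M (p x)"
    have "\<xi> (push S M p (\<lambda>f. lift v f + lift w f)) = \<alpha> (\<lambda>f. lift v f + lift w f)"
      using lift v w by (intro \<xi> tangent_add) auto
    also have "\<dots> = \<alpha> (lift v) + \<alpha> (lift w)" using lift v w by (intro cotangentD(1)[OF aT]) auto
    finally show "\<xi> (\<lambda>f. v f + w f) = \<xi> v + \<xi> w" using lift[OF v] lift[OF w] v w by (simp add: push_add \<xi>_def)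
  next
    fix v c assume v: "v \<in> tangent M (p x)"
    have "\<xi> (push S M p (\<lambda>f. c * lift v f)) = \<alpha> (\<lambda>f. c * lift v f)"
      using lift v by (intro \<xi> tangent_cmult) auto
    also have "\<dots> = c * \<alpha> (lift v)" using lift v by (intro cotangentD(2)[OF aT]) auto
    finally show "\<xi> (\<lambda>f. c * v f) = c * \<xi> v" using lift[OF v] v by (simp add: push_cmult \<xi>_def)
  qed (simp add: \<xi>_def)
  then obtain b where b: "b \<in> Cinf M" "\<xi> = dif M b (p x)" by (rule cotangent_dif[OF smM p_pts[OF x]])
  have "\<alpha> v = dif S (pb b) x v" for v
  proof (cases "v \<in> T x")
    case True
    have "push S M p v \<in> tangent M (p x)" using onto[OF x] True by blast
    then show ?thesis using \<xi>[OF True] b True by (simp add: dif_apply push_def)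
  qed (simp add: dif_def cotangentD(3)[OF aT])
  then show thesis using that b(1) by blast
qed

lemma bracket_pb:
  assumes "a \<in> Cinf M" "b \<in> Cinf M"
  shows "bracket S \<pi>S (pb a) (pb b) = pb (bracket M \<pi>M a b)"
proof
  fix x
  show "bracket S \<pi>S (pb a) (pb b) x = pb (bracket M \<pi>M a b) x"
  proof (cases "x \<in> pts S")
    case True
    have "\<pi>S x (pull_covec S M p x (dif M a (p x))) (pull_covec S M p x (dif M b (p x))) = \<pi>M (p x) (dif M a (p x)) (dif M b (p x))"
      using PS True unfolding poisson_submersion_def by (meson dif_cotangent)
    moreover have "pb (bracket M \<pi>M a b) x = \<pi>M (p x) (dif M a (p x)) (dif M b (p x))"
      using True p_pts[OF True] by (simp add: bracket_def pullback_fun_def)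
    ultimately show ?thesis
      using True by (simp add: bracket_def[of S] pull_covec_dif[OF smS smM smp True] assms)
  qed (simp add: bracket_def pullback_fun_def)
qed

subsection \<open>Splitting covectors\<close>

definition is_split :: "'a \<Rightarrow> 'a covec \<Rightarrow> 'a covec \<Rightarrow> bool" where
  "is_split x \<xi> \<zeta> \<longleftrightarrow> \<zeta> \<in> To x \<and> sharp S \<pi>S x \<zeta> \<in> V x \<and> (\<lambda>v. \<xi> v - \<zeta> v) \<in> Vo x"

lemma fibre_at:
  assumes "x \<in> pts S"
  obtains X :: "('a, 'e) mfd" and \<pi>X where "pts X = fibre S p (p x)" "poisson_dirac X \<pi>X S \<pi>S" "x \<in> pts X"
proof -
  have "\<exists>(X :: ('a, 'e) mfd) \<pi>X. pts X = fibre S p (p x) \<and> poisson_dirac X \<pi>X S \<pi>S"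
    using PF p_pts[OF assms] unfolding poisson_fibres_def by blast
  then obtain X :: "('a, 'e) mfd" and \<pi>X where X: "pts X = fibre S p (p x)" "poisson_dirac X \<pi>X S \<pi>S" by blast
  then show thesis using that assms by (simp add: fibre_def)
qed

context
  fixes X :: "('a, 'g::euclidean_space) mfd" and \<pi>X b x
  assumes X: "pts X = fibre S p b" "poisson_dirac X \<pi>X S \<pi>S" and x: "x \<in> pts X"
begin

lemma X_emb: "embedded_submanifold X S" and X_biv: "smooth_bivector X \<pi>X"
  and X_Gr: "Gr_restrict X S \<pi>S x = Gr X \<pi>X x" and X_man: "smooth_manifold X" and X_map: "smooth_map X S id"
  using X(2) x by (auto simp: poisson_dirac_def embedded_submanifold_def)

lemma X_xS: "x \<in> pts S" using x X(1) by (simp add: fibre_def)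

lemma X_vert: "push X S id ` tangent X x = V x" by (rule fibre_tangent[OF sub X_emb X(1) x])

lemma bX: "bivector X x \<pi>X" by (rule smooth_bivector_at[OF X_man X_biv x])

lemma X_pull: "\<xi> \<in> To x \<Longrightarrow> pull_covec X S id x \<xi> \<in> cotangent X x"
  using pull_covec_cotangent[OF X_man smS X_map x] by simp

lemma pull_eq_ann:
  assumes "\<xi> \<in> To x" "\<zeta> \<in> To x" "pull_covec X S id x \<xi> = pull_covec X S id x \<zeta>"
  shows "(\<lambda>v. \<xi> v - \<zeta> v) \<in> Vo x"
proof -
  have "\<xi> v = \<zeta> v" if v: "v \<in> V x" for v
  proof -
    obtain u where u: "u \<in> tangent X x" "v = push X S id u" using v unfolding X_vert[symmetric] by blast
    then show ?thesis using fun_cong[OF assms(3), of u] by (simp add: pull_covec_def)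
  qed
  then show ?thesis using assms(1,2) by (simp add: vert_ann_def cotangent_diff)
qed

text \<open>The pair formed from the pullback of \<xi> lies in Gr(\<pi>_X), hence in the restricted
  graph, whose elements come from a covector \<zeta> of S; \<xi> and \<zeta> agree on V because they
  have the same pullback.\<close>

lemma dirac_split:
  assumes xi: "\<xi> \<in> To x"
  obtains \<zeta> where "is_split x \<xi> \<zeta>" "push X S id (sharp X \<pi>X x (pull_covec X S id x \<xi>)) = sharp S \<pi>S x \<zeta>"
proof -
  have "(sharp X \<pi>X x (pull_covec X S id x \<xi>), pull_covec X S id x \<xi>) \<in> Gr X \<pi>X x"
    using X_pull[OF xi] by (simp add: Gr_iff)
  then have "(sharp X \<pi>X x (pull_covec X S id x \<xi>), pull_covec X S id x \<xi>) \<in> Gr_restrict X S \<pi>S x"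
    by (simp only: X_Gr)
  then obtain \<zeta> where z: "\<zeta> \<in> To x" "pull_covec X S id x \<xi> = pull_covec X S id x \<zeta>"
    "push X S id (sharp X \<pi>X x (pull_covec X S id x \<xi>)) = sharp S \<pi>S x \<zeta>"
    and u: "sharp X \<pi>X x (pull_covec X S id x \<xi>) \<in> tangent X x"
    unfolding Gr_restrict_def by blast
  have "is_split x \<xi> \<zeta>"
    unfolding is_split_def using z(1) pull_eq_ann[OF xi z(1,2)] u X_vert z(3) by (metis image_eqI)
  then show thesis using that z(3) by blast
qed

text \<open>A covector annihilating V pulls back to 0 on the fibre, so (u,0) lies in the graph of
  \<pi>_X, and a graph contains no nonzero vector over the zero covector.\<close>

lemma dirac_transversal:
  assumes a: "\<alpha> \<in> Vo x" "sharp S \<pi>S x \<alpha> \<in> V x"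
  shows "sharp S \<pi>S x \<alpha> = (\<lambda>f. 0)"
proof -
  obtain u where u: "u \<in> tangent X x" "push X S id u = sharp S \<pi>S x \<alpha>"
    using a(2) unfolding X_vert[symmetric] by force
  have "pull_covec X S id x \<alpha> = (\<lambda>v. 0)"
  proof
    fix v
    show "pull_covec X S id x \<alpha> v = 0"
      using ann_vert[OF a(1), of "push X S id v"] X_vert by (auto simp: pull_covec_def)
  qed
  then have "(u, \<lambda>v. 0) \<in> Gr_restrict X S \<pi>S x"
    using u ann_cotangent[OF a(1)] unfolding Gr_restrict_def by force
  then have "u = sharp X \<pi>X x (\<lambda>v. 0)" unfolding X_Gr Gr_def by auto
  also have "\<dots> = (\<lambda>f. 0)" using bivector.zero_left[OF bX] by (auto simp: sharp_def)
  finally show ?thesis using u(2) by (simp add: push_zero)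
qed

end

lemma transversal:
  assumes "x \<in> pts S" "\<alpha> \<in> Vo x" "sharp S \<pi>S x \<alpha> \<in> V x"
  shows "sharp S \<pi>S x \<alpha> = (\<lambda>f. 0)"
  by (rule fibre_at[OF assms(1)]) (rule dirac_transversal[OF _ _ _ assms(2,3)])

lemma split_exists:
  assumes "x \<in> pts S" "\<xi> \<in> To x" obtains \<zeta> where "is_split x \<xi> \<zeta>"
proof -
  obtain X :: "('a, 'e) mfd" and \<pi>X where X: "pts X = fibre S p (p x)" "poisson_dirac X \<pi>X S \<pi>S" "x \<in> pts X"
    by (rule fibre_at[OF assms(1)])
  show thesis by (rule dirac_split[OF X assms(2)]) (rule that)
qed

text \<open>The difference of two splittings annihilates V and has vertical image, so transversality
  makes that image 0.\<close>

lemma split_unique: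
  assumes x: "x \<in> pts S" and z: "is_split x \<xi> \<zeta>" "is_split x \<xi> \<zeta>'"
  shows "sharp S \<pi>S x \<zeta> = sharp S \<pi>S x \<zeta>'"
proof -
  interpret bivector S x \<pi>S by (rule bS[OF x])
  have c: "\<zeta> \<in> To x" "\<zeta>' \<in> To x" using z by (auto simp: is_split_def)
  have "(\<lambda>v. (\<xi> v - \<zeta>' v) - (\<xi> v - \<zeta> v)) \<in> Vo x" 
    using z by (intro ann_diff[of "\<lambda>v. \<xi> v - \<zeta>' v" x "\<lambda>v. \<xi> v - \<zeta> v"]) (auto simp: is_split_def)
  then have a: "(\<lambda>v. \<zeta> v - \<zeta>' v) \<in> Vo x" by simp
  have "(\<lambda>f. sharp S \<pi>S x \<zeta> f - sharp S \<pi>S x \<zeta>' f) \<in> V x" using z by (intro vert_diff) (auto simp: is_split_def)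
  then have "sharp S \<pi>S x (\<lambda>v. \<zeta> v - \<zeta>' v) = (\<lambda>f. 0)"
    using sharp_diff[OF c] by (intro transversal[OF x a]) simp
  then have "sharp S \<pi>S x \<zeta> f - sharp S \<pi>S x \<zeta>' f = 0" for f using sharp_diff[OF c] by metis
  then show ?thesis by (intro ext) simp
qed

text \<open>Splittings are not unique, but \<open>piV x\<close> does not depend on the choice, because the fibre through \<open>x\<close>
  is Poisson-Dirac.\<close>

definition piV :: "'a bivector" where
  "piV x \<xi> \<eta> = \<pi>S x (SOME \<zeta>. is_split x \<xi> \<zeta>) \<eta>"

definition piH :: "'a bivector" where
  "piH x \<xi> \<eta> = \<pi>S x \<xi> \<eta> - piV x \<xi> \<eta>"

lemma piV_eq:
  assumes x: "x \<in> pts S" and z: "is_split x \<xi> \<zeta>" and eta: "\<eta> \<in> To x"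
  shows "piV x \<xi> \<eta> = \<pi>S x \<zeta> \<eta>"
proof -
  interpret bivector S x \<pi>S by (rule bS[OF x])
  have s: "is_split x \<xi> (SOME \<zeta>. is_split x \<xi> \<zeta>)" by (rule someI[of "is_split x \<xi>", OF z])
  have c: "(SOME \<zeta>. is_split x \<xi> \<zeta>) \<in> To x" "\<zeta> \<in> To x" using s z unfolding is_split_def by blast+
  show ?thesis
    unfolding piV_def eval_sharp[OF c(1) eta, symmetric] eval_sharp[OF c(2) eta, symmetric]
      split_unique[OF x s z] by (rule refl)
qed

lemma piV_fibre:
  assumes X: "pts X = fibre S p b" "poisson_dirac X \<pi>X S \<pi>S" "x \<in> pts X"
    and xi: "\<xi> \<in> To x" "\<eta> \<in> To x"
  shows "piV x \<xi> \<eta> = \<pi>X x (pull_covec X S id x \<xi>) (pull_covec X S id x \<eta>)"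
proof -
  have x: "x \<in> pts S" by (rule X_xS[OF X])
  interpret X: bivector X x \<pi>X by (rule bX[OF X])
  interpret S: bivector S x \<pi>S by (rule bS[OF x])
  obtain \<zeta> where z: "is_split x \<xi> \<zeta>" "push X S id (sharp X \<pi>X x (pull_covec X S id x \<xi>)) = sharp S \<pi>S x \<zeta>"
    by (rule dirac_split[OF X xi(1)])
  note c = X_pull[OF X xi(1)] X_pull[OF X xi(2)]
  have "\<pi>X x (pull_covec X S id x \<xi>) (pull_covec X S id x \<eta>) =
      pull_covec X S id x \<eta> (sharp X \<pi>X x (pull_covec X S id x \<xi>))"
    by (rule X.eval_sharp[OF c, symmetric])
  also have "\<dots> = \<eta> (sharp S \<pi>S x \<zeta>)" using X.sharp_tangent[OF c(1)] z(2) by (simp add: pull_covec_def)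
  also have "\<dots> = piV x \<xi> \<eta>" using S.eval_sharp[OF _ xi(2)] z(1) piV_eq[OF x z(1) xi(2)] by (simp add: is_split_def)
  finally show ?thesis by simp
qed

text \<open>A wedge decomposition of \<pi>_X is pushed forward along the inclusion of the
  fibre.\<close>

lemma piV_wedge_vert: assumes x: "x \<in> pts S" shows "piV x \<in> wedge2 S x (V x)"
proof -
  obtain X :: "('a, 'e) mfd" and \<pi>X where X: "pts X = fibre S p (p x)" "poisson_dirac X \<pi>X S \<pi>S" "x \<in> pts X"
    by (rule fibre_at[OF x])
  interpret X: bivector X x \<pi>X by (rule bX[OF X])
  obtain ps where ps: "set ps \<subseteq> tangent X x \<times> tangent X x"
    "\<And>\<xi> \<eta>. \<xi> \<in> cotangent X x \<Longrightarrow> \<eta> \<in> cotangent X x \<Longrightarrow> \<pi>X x \<xi> \<eta> = (\<Sum>(u, w)\<leftarrow>ps. \<xi> u * \<eta> w - \<xi> w * \<eta> u)"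
    using X.b unfolding wedge2_def by blast
  define qs where "qs = map (\<lambda>(u, w). (push X S id u, push X S id w)) ps"
  have "set qs \<subseteq> V x \<times> V x" using ps(1) X_vert[OF X] unfolding qs_def by auto
  moreover have "piV x \<xi> \<eta> = (\<Sum>(u, w)\<leftarrow>qs. \<xi> u * \<eta> w - \<xi> w * \<eta> u)" if "\<xi> \<in> To x" "\<eta> \<in> To x" for \<xi> \<eta>
  proof -
    have "(\<Sum>(u, w)\<leftarrow>ps. pull_covec X S id x \<xi> u * pull_covec X S id x \<eta> w - pull_covec X S id x \<xi> w * pull_covec X S id x \<eta> u)
        = (\<Sum>(u, w)\<leftarrow>qs. \<xi> u * \<eta> w - \<xi> w * \<eta> u)"
      using ps(1) unfolding qs_def by (induction ps) (auto simp: pull_covec_def)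
    then show ?thesis using piV_fibre[OF X that] ps(2)[OF X_pull[OF X that(1)] X_pull[OF X that(2)]] by simp
  qed
  ultimately show ?thesis unfolding wedge2_def by (intro CollectI exI[of _ qs]) simp
qed

lemma piV_wedge: "x \<in> pts S \<Longrightarrow> piV x \<in> wedge2 S x (T x)"
  using piV_wedge_vert wedge2_mono[of "V x" "T x"] vert_tangent by blast

lemma piH_wedge: assumes "x \<in> pts S" shows "piH x \<in> wedge2 S x (T x)"
proof -
  have "(\<lambda>\<xi> \<eta>. \<pi>S x \<xi> \<eta> - piV x \<xi> \<eta>) \<in> wedge2 S x (T x)"
    by (rule wedge2_diff[OF bivector.b[OF bS[OF assms]] piV_wedge[OF assms]])
  then show ?thesis by (simp add: piH_def[abs_def])
qed

lemma bV: "x \<in> pts S \<Longrightarrow> bivector S x piV" and bH: "x \<in> pts S \<Longrightarrow> bivector S x piH"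
  by (simp_all add: bivector_def smS piV_wedge piH_wedge)

lemma piV_ann: "x \<in> pts S \<Longrightarrow> \<alpha> \<in> Vo x \<Longrightarrow> \<eta> \<in> To x \<Longrightarrow> piV x \<alpha> \<eta> = 0"
  by (rule wedge2_annihilated[OF piV_wedge_vert]) (auto simp: ann_cotangent ann_vert)

lemma piH_ann: "x \<in> pts S \<Longrightarrow> \<alpha> \<in> Vo x \<Longrightarrow> \<eta> \<in> To x \<Longrightarrow> piH x \<alpha> \<eta> = \<pi>S x \<alpha> \<eta>"
  by (simp add: piH_def piV_ann)

lemma piV_sharp:
  assumes x: "x \<in> pts S" and z: "is_split x \<xi> \<zeta>"
  shows "sharp S piV x \<xi> = sharp S \<pi>S x \<zeta>"
  by (auto simp: sharp_def piV_eq[OF x z])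

lemma piH_sharp:
  assumes x: "x \<in> pts S" and xi: "\<xi> \<in> To x" and z: "is_split x \<xi> \<zeta>"
  shows "sharp S piH x \<xi> = sharp S \<pi>S x (\<lambda>v. \<xi> v - \<zeta> v)"
proof -
  interpret bivector S x \<pi>S by (rule bS[OF x])
  show ?thesis using z unfolding is_split_def
    by (intro ext) (auto simp: sharp_def piH_def piV_eq[OF x z] diff_left xi)
qed

lemma piH_sharp_ann: "x \<in> pts S \<Longrightarrow> \<alpha> \<in> Vo x \<Longrightarrow> sharp S piH x \<alpha> = sharp S \<pi>S x \<alpha>"
  by (auto simp: sharp_def piH_ann)

lemma leaf_tangent_piH: assumes x: "x \<in> pts S" shows "leaf_tangent S piH x = SH_tangent S \<pi>S M p x"
  unfolding leaf_tangent_def SH_tangent_def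
proof (intro equalityI subsetI)
  fix u assume "u \<in> sharp S piH x ` To x"
  then obtain \<xi> where xi: "\<xi> \<in> To x" "u = sharp S piH x \<xi>" by blast
  obtain \<zeta> where z: "is_split x \<xi> \<zeta>" by (rule split_exists[OF x xi(1)])
  then show "u \<in> sharp S \<pi>S x ` Vo x" using piH_sharp[OF x xi(1) z] xi(2) by (auto simp: is_split_def)
next
  fix u assume "u \<in> sharp S \<pi>S x ` Vo x"
  then show "u \<in> sharp S piH x ` To x" using piH_sharp_ann[OF x] ann_cotangent by force
qed

lemma horizontal_trivial: assumes x: "x \<in> pts S" shows "sharp S piH x ` To x \<inter> V x = {\<lambda>f. 0}"
proof (intro equalityI subsetI)
  fix u assume u: "u \<in> sharp S piH x ` To x \<inter> V x"
  then obtain \<alpha> where a: "\<alpha> \<in> Vo x" "u = sharp S \<pi>S x \<alpha>"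
    using leaf_tangent_piH[OF x] unfolding leaf_tangent_def SH_tangent_def by blast
  then show "u \<in> {\<lambda>f. 0}" using transversal[OF x a(1)] u by simp
next
  fix u :: "'a tvec" assume u: "u \<in> {\<lambda>f. 0}"
  have "sharp S piH x (\<lambda>v. 0) = (\<lambda>f. 0)" using bivector.zero_left[OF bH[OF x]] by (auto simp: sharp_def)
  then have "u \<in> sharp S piH x ` To x" using u by (intro image_eqI[of _ _ "\<lambda>v. 0"]) auto
  moreover have "u \<in> V x" using u vert_zero by simp
  ultimately show "u \<in> sharp S piH x ` To x \<inter> V x" by simp
qed

lemma leaf_form_piH:
  assumes x: "x \<in> pts S" and u: "u \<in> SH_tangent S \<pi>S M p x" "w \<in> SH_tangent S \<pi>S M p x"
  shows "leaf_form S piH x u w = leaf_form S \<pi>S x u w"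
proof -
  obtain \<alpha> \<beta> where a: "\<alpha> \<in> Vo x" "u = sharp S \<pi>S x \<alpha>" "\<beta> \<in> Vo x" "w = sharp S \<pi>S x \<beta>"
    using u unfolding SH_tangent_def by blast
  note c = ann_cotangent[OF a(1)] ann_cotangent[OF a(3)]
  show ?thesis
    using bivector.leaf_form_eq[OF bS[OF x] c] bivector.leaf_form_eq[OF bH[OF x] c]
      piH_sharp_ann[OF x a(1)] piH_sharp_ann[OF x a(3)] piH_ann[OF x a(1) c(2)] a(2,4) by simp
qed

subsection \<open>Smoothness of the vertical part\<close>

text \<open>Each of the four assertions of the theorem is equivalent to this one.\<close>

definition smooth_split :: bool where
  "smooth_split \<longleftrightarrow> (\<forall>f\<in>Cinf S. \<forall>g\<in>Cinf S. bracket S piV f g \<in> Cinf S)"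

lemma bracket_S: "f \<in> Cinf S \<Longrightarrow> g \<in> Cinf S \<Longrightarrow> bracket S \<pi>S f g \<in> Cinf S"
  using smooth_S by (simp add: smooth_bivector_def)

lemma bracket_cong:
  assumes "\<And>x \<xi> \<eta>. x \<in> pts S \<Longrightarrow> \<xi> \<in> To x \<Longrightarrow> \<eta> \<in> To x \<Longrightarrow> \<pi> x \<xi> \<eta> = \<pi>' x \<xi> \<eta>"
  shows "bracket S \<pi> f g = bracket S \<pi>' f g"
  by (auto simp: bracket_def assms)

section \<open>Smoothness of the vertical part from each kind of bivector\<close>

lemma smooth_splitI_V:
  assumes "smooth_bivector S \<pi>V"
    "\<And>x \<xi> \<eta>. x \<in> pts S \<Longrightarrow> \<xi> \<in> To x \<Longrightarrow> \<eta> \<in> To x \<Longrightarrow> \<pi>V x \<xi> \<eta> = piV x \<xi> \<eta>"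
  shows smooth_split
  using assms(1) bracket_cong[of \<pi>V piV, OF assms(2)] unfolding smooth_split_def smooth_bivector_def by simp

lemma bracket_diff: "bracket S piH f g = (\<lambda>x. bracket S \<pi>S f g x - bracket S piV f g x)"
  by (auto simp: bracket_def piH_def)

lemma smooth_splitI_H:
  assumes "smooth_bivector S \<pi>H"
    "\<And>x \<xi> \<eta>. x \<in> pts S \<Longrightarrow> \<xi> \<in> To x \<Longrightarrow> \<eta> \<in> To x \<Longrightarrow> \<pi>H x \<xi> \<eta> = piH x \<xi> \<eta>"
  shows smooth_split
  unfolding smooth_split_def
proof (intro ballI)
  fix f g assume f: "f \<in> Cinf S" "g \<in> Cinf S"
  have H: "bracket S \<pi>H f g = bracket S piH f g" by (rule bracket_cong[OF assms(2)])
  have "bracket S \<pi>H f g \<in> Cinf S" using assms(1) f by (simp add: smooth_bivector_def)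
  then have "bracket S piH f g \<in> Cinf S" by (simp add: H)
  then have "(\<lambda>x. bracket S \<pi>S f g x - bracket S piH f g x) \<in> Cinf S"
    by (intro Cinf_diff bracket_S f)
  then show "bracket S piV f g \<in> Cinf S" by (simp add: bracket_diff)
qed

text \<open>For a splitting \<zeta> of \<xi>, the image of \<zeta> under \<pi>_H is vertical as a
  difference of vertical vectors, hence 0; and \<pi>_V annihilates \<xi> - \<zeta>. So
  \<pi>_V(\<xi>,\<eta>) = \<pi>_V(\<zeta>,\<eta>) = \<pi>_S(\<zeta>,\<eta>).\<close>

lemma pencil_imp_smooth_split:
  assumes "orthogonal_pencil S \<pi>S M \<pi>M p" shows smooth_split
proof -
  obtain \<pi>V \<pi>H where V: "smooth_bivector S \<pi>V" "\<And>x. x \<in> pts S \<Longrightarrow> \<pi>V x \<in> wedge2 S x (V x)"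
    and H: "smooth_bivector S \<pi>H"
    and dec: "\<And>x \<xi> \<eta>. x \<in> pts S \<Longrightarrow> \<xi> \<in> To x \<Longrightarrow> \<eta> \<in> To x \<Longrightarrow> \<pi>S x \<xi> \<eta> = \<pi>V x \<xi> \<eta> + \<pi>H x \<xi> \<eta>"
    and trans: "\<And>x. x \<in> pts S \<Longrightarrow> sharp S \<pi>H x ` To x \<inter> V x = {\<lambda>f. 0}"
    using assms unfolding orthogonal_pencil_def vertical_bivector_def poisson_structure_def by blast
  show ?thesis
  proof (rule smooth_splitI_V[OF V(1)])
    fix x \<xi> \<eta> assume x: "x \<in> pts S" and xi: "\<xi> \<in> To x" and eta: "\<eta> \<in> To x"
    interpret V: bivector S x \<pi>V by (rule smooth_bivector_at[OF smS V(1) x])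
    interpret H: bivector S x \<pi>H by (rule smooth_bivector_at[OF smS H x])
    obtain \<zeta> where z: "is_split x \<xi> \<zeta>" by (rule split_exists[OF x xi])
    then have zc: "\<zeta> \<in> To x" "sharp S \<pi>S x \<zeta> \<in> V x" "(\<lambda>v. \<xi> v - \<zeta> v) \<in> Vo x" by (auto simp: is_split_def)
    have "sharp S \<pi>V x \<zeta> \<in> V x"
      by (rule V.sharp_combination[OF V(2)[OF x] _ zc(1) vert_zero vert_add vert_cmult]) (auto simp: vert_tangent)
    then have "(\<lambda>f. sharp S \<pi>S x \<zeta> f - sharp S \<pi>V x \<zeta> f) \<in> V x" by (rule vert_diff[OF zc(2)])
    moreover have "(\<lambda>f. sharp S \<pi>S x \<zeta> f - sharp S \<pi>V x \<zeta> f) = sharp S \<pi>H x \<zeta>"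
      by (auto simp: sharp_def dec[OF x zc(1)])
    ultimately have "sharp S \<pi>H x \<zeta> \<in> {\<lambda>f. 0}" using trans[OF x] zc(1) by auto
    then have "\<pi>H x \<zeta> \<eta> = 0" using H.eval_sharp[OF zc(1) eta] cotangent_vec_zero[OF eta] by simp
    moreover have "\<pi>V x (\<lambda>v. \<xi> v - \<zeta> v) \<eta> = 0"
      by (rule wedge2_annihilated[OF V(2)[OF x] ann_cotangent[OF zc(3)] eta ann_vert[OF zc(3)]])
    ultimately show "\<pi>V x \<xi> \<eta> = piV x \<xi> \<eta>"
      using dec[OF x zc(1) eta] V.diff_left[OF xi zc(1) eta] piV_eq[OF x z eta] by simp
  qed
qed

lemma fibrewise_imp_smooth_split:
  assumes "smooth_bivector S \<pi>V" "restricts_to_fibres S \<pi>S M p \<pi>V" shows smooth_split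
proof (rule smooth_splitI_V[OF assms(1)])
  fix x \<xi> \<eta> assume x: "x \<in> pts S" and xi: "\<xi> \<in> To x" and eta: "\<eta> \<in> To x"
  have "\<exists>(X :: ('a, 'e) mfd) \<pi>X. pts X = fibre S p (p x) \<and> poisson_dirac X \<pi>X S \<pi>S \<and>
        (\<forall>x\<in>pts X. \<forall>\<xi>\<in>cotangent S x. \<forall>\<eta>\<in>cotangent S x.
           \<pi>V x \<xi> \<eta> = \<pi>X x (pull_covec X S id x \<xi>) (pull_covec X S id x \<eta>))"
    using assms(2) p_pts[OF x] unfolding restricts_to_fibres_def by blast
  then obtain X :: "('a, 'e) mfd" and \<pi>X where X: "pts X = fibre S p (p x)" "poisson_dirac X \<pi>X S \<pi>S"
    and eq: "\<forall>x\<in>pts X. \<forall>\<xi>\<in>cotangent S x. \<forall>\<eta>\<in>cotangent S x.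
           \<pi>V x \<xi> \<eta> = \<pi>X x (pull_covec X S id x \<xi>) (pull_covec X S id x \<eta>)" by blast
  have "x \<in> pts X" using X(1) x by (simp add: fibre_def)
  then show "\<pi>V x \<xi> \<eta> = piV x \<xi> \<eta>" using piV_fibre[OF X _ xi eta] eq xi eta by simp
qed

text \<open>Equality of tangent spaces gives \<alpha> annihilating V with the same image under
  \<pi>_S as \<xi> under \<pi>_H. Equality of the forms makes \<xi> and \<alpha> agree on the
  tangent space of the leaf, where \<zeta> vanishes. So \<delta> = \<alpha> - (\<xi> - \<zeta>) is
  \<pi>_S-orthogonal to all annihilators of V, its image is vertical, and transversality makes it
  0.\<close>

lemma leaves_imp_smooth_split:
  assumes H: "smooth_bivector S \<pi>H" and leaves: "leaves_are_SH S \<pi>S M p \<pi>H" shows smooth_split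
proof (rule smooth_splitI_H[OF H])
  fix x \<xi> \<eta> assume x: "x \<in> pts S" and xi: "\<xi> \<in> To x" and eta: "\<eta> \<in> To x"
  interpret S: bivector S x \<pi>S by (rule bS[OF x])
  interpret H: bivector S x \<pi>H by (rule smooth_bivector_at[OF smS H x])
  have tan: "sharp S \<pi>H x ` To x = sharp S \<pi>S x ` Vo x"
    and form: "\<And>u w. u \<in> sharp S \<pi>S x ` Vo x \<Longrightarrow> w \<in> sharp S \<pi>S x ` Vo x \<Longrightarrow>
      leaf_form S \<pi>H x u w = leaf_form S \<pi>S x u w"
    using leaves x unfolding leaves_are_SH_def leaf_tangent_def SH_tangent_def by blast+
  obtain \<zeta> where z: "is_split x \<xi> \<zeta>" by (rule split_exists[OF x xi])
  then have zc: "\<zeta> \<in> To x" "sharp S \<pi>S x \<zeta> \<in> V x" "(\<lambda>v. \<xi> v - \<zeta> v) \<in> Vo x" by (auto simp: is_split_def)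
  obtain \<alpha> where a: "\<alpha> \<in> Vo x" "sharp S \<pi>H x \<xi> = sharp S \<pi>S x \<alpha>" using tan xi by blast
  note aT = ann_cotangent[OF a(1)] and zT = ann_cotangent[OF zc(3)]
  define \<delta> where "\<delta> = (\<lambda>v. \<alpha> v - (\<xi> v - \<zeta> v))"
  have d: "\<delta> \<in> Vo x" unfolding \<delta>_def by (rule ann_diff[OF a(1) zc(3)])
  have "\<pi>S x \<delta> \<beta> = 0" if b: "\<beta> \<in> Vo x" for \<beta>
  proof -
    note bT = ann_cotangent[OF b]
    let ?w = "sharp S \<pi>S x \<beta>"
    have wT: "?w \<in> T x" by (rule S.sharp_tangent[OF bT])
    obtain \<theta> where th: "\<theta> \<in> To x" "?w = sharp S \<pi>H x \<theta>" using tan b by blast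
    have "leaf_form S \<pi>H x (sharp S \<pi>H x \<xi>) ?w = \<pi>H x \<xi> \<theta>" using H.leaf_form_eq[OF xi th(1)] th(2) by simp
    moreover have "leaf_form S \<pi>S x (sharp S \<pi>H x \<xi>) ?w = \<pi>S x \<alpha> \<beta>" using S.leaf_form_eq[OF aT bT] a(2) by simp
    moreover have "leaf_form S \<pi>H x (sharp S \<pi>H x \<xi>) ?w = leaf_form S \<pi>S x (sharp S \<pi>H x \<xi>) ?w"
      using a b by (intro form) auto
    ultimately have "\<pi>H x \<xi> \<theta> = \<pi>S x \<alpha> \<beta>" by simp
    then have 1: "\<xi> ?w = \<alpha> ?w"
      using H.skew[OF xi th(1)] S.skew[OF aT bT] H.eval_sharp[OF th(1) xi] S.eval_sharp[OF bT aT] th(2) by simp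
    have 2: "\<zeta> ?w = 0"
      using S.eval_sharp[OF bT zc(1)] S.skew[OF zc(1) bT] S.eval_sharp[OF zc(1) bT] ann_vert[OF b zc(2)] by simp
    have "\<pi>S x \<delta> \<beta> = - \<delta> ?w"
      using S.eval_sharp[OF bT ann_cotangent[OF d]] S.skew[OF bT ann_cotangent[OF d]] by simp
    then show ?thesis using 1 2 by (simp add: \<delta>_def)
  qed
  then have "sharp S \<pi>S x \<delta> \<in> V x"
    using dif_pb_ann pb_Cinf S.sharp_tangent[OF ann_cotangent[OF d]] by (intro vertI) (auto simp: sharp_def)
  from transversal[OF x d this] have "sharp S \<pi>S x \<delta> = (\<lambda>f. 0)" .
  then have "\<eta> (sharp S \<pi>S x \<delta>) = 0" using cotangent_vec_zero[OF eta] by simp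
  then have "\<pi>S x \<alpha> \<eta> = \<pi>S x (\<lambda>v. \<xi> v - \<zeta> v) \<eta>"
    using S.eval_sharp[OF ann_cotangent[OF d] eta] S.diff_left[OF aT zT eta] by (simp add: \<delta>_def)
  moreover have "\<pi>H x \<xi> \<eta> = \<pi>S x \<alpha> \<eta>"
    using H.eval_sharp[OF xi eta] S.eval_sharp[OF aT eta] a(2) by simp
  ultimately show "\<pi>H x \<xi> \<eta> = piH x \<xi> \<eta>"
    using S.diff_left[OF xi zc(1) eta] piV_eq[OF x z eta] by (simp add: piH_def)
qed

subsection \<open>The linear family of the theorem\<close>

lemma vert_family_eq: assumes x: "x \<in> pts S" shows "vert_family S \<pi>S M p x = Gr S piV x"
proof (intro equalityI subsetI)
  fix q assume "q \<in> vert_family S \<pi>S M p x"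
  then obtain u \<xi> \<alpha> where q: "q = (u, \<lambda>v. \<xi> v + \<alpha> v)" "(u, \<xi>) \<in> Gr S \<pi>S x" "u \<in> V x" "\<xi> \<in> To x" "\<alpha> \<in> Vo x"
    unfolding vert_family_def by blast
  then have u: "u = sharp S \<pi>S x \<xi>" by (simp add: Gr_iff)
  have "is_split x (\<lambda>v. \<xi> v + \<alpha> v) \<xi>" using q u by (simp add: is_split_def)
  from piV_sharp[OF x this] show "q \<in> Gr S piV x"
    using q u cotangent_add[OF q(4) ann_cotangent[OF q(5)]] by (simp add: Gr_iff)
next
  fix q assume "q \<in> Gr S piV x"
  then obtain \<xi> where xi: "\<xi> \<in> To x" "q = (sharp S piV x \<xi>, \<xi>)" by (auto simp: Gr_def)
  obtain \<zeta> where z: "is_split x \<xi> \<zeta>" by (rule split_exists[OF x xi(1)])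
  then have zc: "\<zeta> \<in> To x" "sharp S \<pi>S x \<zeta> \<in> V x" "(\<lambda>v. \<xi> v - \<zeta> v) \<in> Vo x" by (auto simp: is_split_def)
  have "q = (sharp S \<pi>S x \<zeta>, \<lambda>v. \<zeta> v + (\<xi> v - \<zeta> v))" using xi(2) piV_sharp[OF x z] by simp
  moreover have "(sharp S \<pi>S x \<zeta>, \<zeta>) \<in> Gr S \<pi>S x \<inter> (V x \<times> To x)" using zc by (simp add: Gr_iff)
  ultimately show "q \<in> vert_family S \<pi>S M p x" unfolding vert_family_def using zc(3)
    by (intro CollectI exI[of _ "sharp S \<pi>S x \<zeta>"] exI[of _ \<zeta>] exI[of _ "\<lambda>v. \<xi> v - \<zeta> v"] conjI)
qed

lemma bracket_sharp:
  assumes "x \<in> pts S" "g \<in> Cinf S" shows "bracket S \<pi> f g x = sharp S \<pi> x (dif S f x) g"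
  using assms by (simp add: bracket_def sharp_def)

text \<open>Over a coordinate frame the graph of \<open>piV\<close> has the frame formed by the dy_i
  and their images; these images are smooth because the brackets with y_i are.\<close>

lemma smooth_split_imp_subbundle:
  assumes K: smooth_split shows "smooth_subbundle S (vert_family S \<pi>S M p)"
  unfolding smooth_subbundle_def
proof
  fix x0 assume x0: "x0 \<in> pts S"
  obtain N y d where fr: "frame S N (dim (Model S)) y d" "x0 \<in> N" by (rule local_frame[OF smS x0])
  define n where "n = dim (Model S)"
  interpret frame S N n y d unfolding n_def by (rule fr(1))
  define Y where "Y i x = sharp S piV x (dif S (y i) x)" for i x
  have Yv: "smooth_vector_field S N (Y i)" if "i < n" for i
    unfolding smooth_vector_field_def
  proof (intro conjI ballI)
    fix x assume "x \<in> N"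
    then show "Y i x \<in> T x" using N_pts bivector.sharp_tangent[OF bV] by (auto simp: Y_def)
  next
    fix f assume f: "f \<in> Cinf S"
    have "smooth_fun_on S N (bracket S piV (y i) f)"
      using K y[OF that] f N_pts by (intro smooth_fun_on_subset[OF CinfD(1)]) (auto simp: smooth_split_def)
    then show "smooth_fun_on S N (\<lambda>x. Y i x f)"
      by (rule smooth_fun_on_cong[OF _ _ smS]) (use f N_pts in \<open>auto simp: Y_def bracket_sharp subset_iff\<close>)
  qed
  have xiv: "smooth_covector_field S N (dif S (y i))" if "i < n" for i
    unfolding smooth_covector_field_def
  proof (intro conjI ballI allI impI dif_cotangent)
    fix Y' assume Y': "smooth_vector_field S N Y'"
    then have "smooth_fun_on S N (\<lambda>x. Y' x (y i))" using y[OF that] by (simp add: smooth_vector_field_def)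
    then show "smooth_fun_on S N (\<lambda>x. dif S (y i) x (Y' x))"
      by (rule smooth_fun_on_cong[OF _ _ smS]) (use Y' in \<open>simp add: smooth_vector_field_def dif_apply\<close>)
  qed
  have indep: "\<forall>i<n. c i = 0" if x: "x \<in> N" and c: "(\<lambda>v. \<Sum>i<n. c i * dif S (y i) x v) = (\<lambda>v. 0)" for x and c :: "nat \<Rightarrow> real"
  proof (intro allI impI)
    fix j assume j: "j < n"
    have "(\<Sum>i<n. c i * dif S (y i) x (d j x)) = (\<Sum>i<n. if i = j then c i else 0)"
      using dual[OF j _ x] d_tangent[of x j] x N_pts by (intro sum.cong) (auto simp: dif_apply subset_iff)
    then show "c j = 0" using fun_cong[OF c, of "d j x"] j by simp
  qed
  have L: "vert_family S \<pi>S M p x = {((\<lambda>f. \<Sum>i<n. c i * Y i x f), (\<lambda>v. \<Sum>i<n. c i * dif S (y i) x v)) | c :: nat \<Rightarrow> real. True}"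
    if x: "x \<in> N" for x
  proof -
    have xS: "x \<in> pts S" using x N_pts by blast
    interpret V: bivector S x piV by (rule bV[OF xS])
    have sh: "sharp S piV x (\<lambda>v. \<Sum>i<n. c i * dif S (y i) x v) = (\<lambda>f. \<Sum>i<n. c i * Y i x f)" for c :: "nat \<Rightarrow> real"
      unfolding Y_def by (rule V.sharp_sum) simp
    show ?thesis unfolding vert_family_eq[OF xS]
    proof (intro equalityI subsetI)
      fix q assume "q \<in> Gr S piV x"
      then obtain \<xi> where xi: "\<xi> \<in> To x" "q = (sharp S piV x \<xi>, \<xi>)" by (auto simp: Gr_def)
      have e: "\<xi> = (\<lambda>v. \<Sum>i<n. \<xi> (d i x) * dif S (y i) x v)" by (rule covector_expand[OF x xi(1)])
      have "sharp S piV x \<xi> = (\<lambda>f. \<Sum>i<n. \<xi> (d i x) * Y i x f)"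
        using arg_cong[OF e, of "sharp S piV x"] sh[of "\<lambda>i. \<xi> (d i x)"] by (rule trans)
      then have "q = ((\<lambda>f. \<Sum>i<n. \<xi> (d i x) * Y i x f), (\<lambda>v. \<Sum>i<n. \<xi> (d i x) * dif S (y i) x v))"
        by (rule trans[OF xi(2) arg_cong2[where f=Pair, OF _ e]])
      then show "q \<in> {((\<lambda>f. \<Sum>i<n. c i * Y i x f), (\<lambda>v. \<Sum>i<n. c i * dif S (y i) x v)) | c :: nat \<Rightarrow> real. True}"
        by (intro CollectI exI[of _ "\<lambda>i. \<xi> (d i x)"] conjI TrueI)
    next
      fix q assume "q \<in> {((\<lambda>f. \<Sum>i<n. c i * Y i x f), (\<lambda>v. \<Sum>i<n. c i * dif S (y i) x v)) | c :: nat \<Rightarrow> real. True}"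
      then obtain c :: "nat \<Rightarrow> real" where "q = ((\<lambda>f. \<Sum>i<n. c i * Y i x f), (\<lambda>v. \<Sum>i<n. c i * dif S (y i) x v))"
        by (elim CollectE exE conjE) (rule that)
      then show "q \<in> Gr S piV x" by (simp add: Gr_iff sh cotangent_sum)
    qed
  qed
  show "\<exists>U k Y \<xi>. openin (Top S) U \<and> x0 \<in> U \<and>
        (\<forall>i<k::nat. smooth_vector_field S U (Y i) \<and> smooth_covector_field S U (\<xi> i)) \<and>
        (\<forall>x\<in>U.
           (\<forall>c. (\<lambda>f. \<Sum>i<k. c i * Y i x f) = (\<lambda>f. 0) \<and> (\<lambda>v. \<Sum>i<k. c i * \<xi> i x v) = (\<lambda>v. 0)
              \<longrightarrow> (\<forall>i<k. c i = 0)) \<and>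
           vert_family S \<pi>S M p x = {((\<lambda>f. \<Sum>i<k. c i * Y i x f), (\<lambda>v. \<Sum>i<k. c i * \<xi> i x v)) | c :: nat \<Rightarrow> real. True})"
  proof (intro exI[of _ N] exI[of _ n] exI[of _ Y] exI[of _ "\<lambda>i. dif S (y i)"] conjI allI impI ballI)
    show "openin (Top S) N" by (rule N)
    show "x0 \<in> N" by (rule fr(2))
  next
    fix i assume "i < n"
    then show "smooth_vector_field S N (Y i)" "smooth_covector_field S N (dif S (y i))" by (rule Yv, rule xiv)
  next
    fix x c i assume "x \<in> N" "i < n" "(\<lambda>f. \<Sum>i<n. c i * Y i x f) = (\<lambda>f. 0) \<and> (\<lambda>v. \<Sum>i<n. c i * dif S (y i) x v) = (\<lambda>v. 0)"
    then show "c i = 0" using indep by blast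
  next
    fix x assume "x \<in> N"
    then show "vert_family S \<pi>S M p x = {((\<lambda>f. \<Sum>i<n. c i * Y i x f), (\<lambda>v. \<Sum>i<n. c i * dif S (y i) x v)) | c :: nat \<Rightarrow> real. True}"
      by (rule L)
  qed
qed

text \<open>A frame of the graph need not be square against a coordinate frame a priori, so its coefficients
  are recovered through the Gram matrix of the covector parts.\<close>

lemma subbundle_imp_smooth_split:
  assumes "smooth_subbundle S (vert_family S \<pi>S M p)" shows smooth_split
  unfolding smooth_split_def
proof (intro ballI)
  fix f g assume f: "f \<in> Cinf S" and g: "g \<in> Cinf S"
  show "bracket S piV f g \<in> Cinf S"
  proof (rule CinfI)
    show "smooth_fun_on S (pts S) (bracket S piV f g)"
    proof (rule smooth_fun_onI_cover[OF smS])
      fix x0 assume x0: "x0 \<in> pts S"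
      obtain N y d where fr: "frame S N (dim (Model S)) y d" "x0 \<in> N" by (rule local_frame[OF smS x0])
      define n where "n = dim (Model S)"
      interpret frame S N n y d unfolding n_def by (rule fr(1))
      have "\<exists>U k Y \<xi>. openin (Top S) U \<and> x0 \<in> U \<and>
          (\<forall>i<k::nat. smooth_vector_field S U (Y i) \<and> smooth_covector_field S U (\<xi> i)) \<and>
          (\<forall>x\<in>U.
             (\<forall>c. (\<lambda>f. \<Sum>i<k. c i * Y i x f) = (\<lambda>f. 0) \<and> (\<lambda>v. \<Sum>i<k. c i * \<xi> i x v) = (\<lambda>v. 0)
                \<longrightarrow> (\<forall>i<k. c i = 0)) \<and>
             vert_family S \<pi>S M p x = {((\<lambda>f. \<Sum>i<k. c i * Y i x f), (\<lambda>v. \<Sum>i<k. c i * \<xi> i x v)) | c :: nat \<Rightarrow> real. True})"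
        using assms x0 unfolding smooth_subbundle_def by (rule bspec)
      then obtain U and k :: nat and Y \<xi> where U: "openin (Top S) U" "x0 \<in> U"
        and sm': "\<forall>i<k. smooth_vector_field S U (Y i) \<and> smooth_covector_field S U (\<xi> i)"
        and UL: "\<forall>x\<in>U.
             (\<forall>c. (\<lambda>f. \<Sum>i<k. c i * Y i x f) = (\<lambda>f. 0) \<and> (\<lambda>v. \<Sum>i<k. c i * \<xi> i x v) = (\<lambda>v. 0)
                \<longrightarrow> (\<forall>i<k. c i = 0)) \<and>
             vert_family S \<pi>S M p x = {((\<lambda>f. \<Sum>i<k. c i * Y i x f), (\<lambda>v. \<Sum>i<k. c i * \<xi> i x v)) | c :: nat \<Rightarrow> real. True}"
        by (elim exE conjE) (rule that)
      have sm: "smooth_vector_field S U (Y i)" "smooth_covector_field S U (\<xi> i)" if "i < k" for i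
        using sm' that by simp_all
      have ind: "\<forall>i<k. c i = 0" if "x \<in> U" "(\<lambda>f. \<Sum>i<k. c i * Y i x f) = (\<lambda>f. 0)"
          "(\<lambda>v. \<Sum>i<k. c i * \<xi> i x v) = (\<lambda>v. 0)" for x c
        using bspec[OF UL that(1), THEN conjunct1, THEN spec, of c] that(2,3) by (rule mp[OF _ conjI])
      note L = bspec[OF UL, THEN conjunct2]
      have Up: "U \<subseteq> pts S" by (rule openin_subset[OF U(1)])
      define W where "W = U \<inter> N"
      have W: "openin (Top S) W" "x0 \<in> W" "W \<subseteq> U" "W \<subseteq> N" "W \<subseteq> pts S"
        using U N fr(2) Up by (auto simp: W_def)
      have xic: "\<xi> i x \<in> To x" if "i < k" "x \<in> U" for i x
        using sm(2)[OF that(1)] that(2) by (simp add: smooth_covector_field_def)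
      have dT: "d j x \<in> T x" if "x \<in> U" for j x using d_tangent that Up by blast
      have dv: "smooth_vector_field S U (d j)" for j
        unfolding smooth_vector_field_def
      proof (intro conjI ballI dT)
        fix h assume h: "h \<in> Cinf S"
        show "smooth_fun_on S U (\<lambda>x. d j x h)"
          by (rule smooth_fun_on_cong[OF smooth_fun_on_subset[OF CinfD(1)[OF d_smooth[OF h]] Up] _ smS])
            (use Up in auto)
      qed
      define q where "q i j x = \<xi> i x (d j x)" for i j x
      have qs: "smooth_fun_on S W (q i j)" if "i < k" for i j
        using sm(2)[OF that] dv[of j] smooth_fun_on_subset[OF _ W(3)] unfolding smooth_covector_field_def q_def by blast
      define a where "a i l x = (\<Sum>j<n. q i j x * q l j x)" for i l x
      have as: "smooth_fun_on S W (a i l)" if "i < k" "l < k" for i l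
        unfolding a_def by (intro smooth_fun_on_sum smooth_fun_on_mult qs that)
      \<comment> \<open>The quadratic form of the Gram matrix is a sum of squares, so a relation
        kills the covector part. Over the zero covector a graph contains only the zero vector, so
        the vector part dies as well and independence of the frame applies.\<close>
      have inj: "\<forall>i<k. c i = 0" if c: "\<forall>l<k. (\<Sum>i<k. c i * a i l x0) = 0" for c
      proof -
        have "(\<Sum>j<n. (\<Sum>i<k. c i * q i j x0)\<^sup>2) = (\<Sum>l<k. c l * (\<Sum>i<k. c i * a i l x0))"
        proof -
          have "(\<Sum>j<n. (\<Sum>i<k. c i * q i j x0)\<^sup>2) = (\<Sum>j<n. \<Sum>l<k. \<Sum>i<k. c l * (c i * (q i j x0 * q l j x0)))"
            by (simp add: power2_eq_square sum_product algebra_simps)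
          also have "\<dots> = (\<Sum>l<k. \<Sum>i<k. \<Sum>j<n. c l * (c i * (q i j x0 * q l j x0)))"
            by (subst sum.swap) (intro sum.cong refl sum.swap)
          finally show ?thesis by (simp add: a_def sum_distrib_left)
        qed
        also have "\<dots> = 0" using c by simp
        finally have "\<forall>j\<in>{..<n}. (\<Sum>i<k. c i * q i j x0)\<^sup>2 = 0"
          by (subst (asm) sum_nonneg_eq_0_iff) auto
        then have z: "(\<Sum>i<k. c i * q i j x0) = 0" if "j < n" for j using that by simp
        let ?\<xi> = "\<lambda>v. \<Sum>i<k. c i * \<xi> i x0 v"
        have cT: "?\<xi> \<in> To x0" using xic U(2) by (intro cotangent_sum) auto
        have "?\<xi> = (\<lambda>v. \<Sum>j<n. ?\<xi> (d j x0) * dif S (y j) x0 v)" by (rule covector_expand[OF fr(2) cT])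
        then have 1: "?\<xi> = (\<lambda>v. 0)" using z unfolding q_def by simp
        have "((\<lambda>f. \<Sum>i<k. c i * Y i x0 f), ?\<xi>) \<in> Gr S piV x0"
          unfolding vert_family_eq[OF x0, symmetric] L[OF U(2)] by (intro CollectI exI[of _ c] conjI refl TrueI)
        then have "(\<lambda>f. \<Sum>i<k. c i * Y i x0 f) = sharp S piV x0 (\<lambda>v. 0)" unfolding 1 by (simp add: Gr_iff)
        also have "\<dots> = (\<lambda>f. 0)" using bivector.zero_left[OF bV[OF x0]] by (auto simp: sharp_def)
        finally show ?thesis using ind[OF U(2) _ 1] by blast
      qed
      obtain D e where De: "smooth_fun_on S W D" "D x0 \<noteq> 0" "\<And>i j. i < k \<Longrightarrow> j < k \<Longrightarrow> smooth_fun_on S W (e i j)"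
        "\<And>x i j. i < k \<Longrightarrow> j < k \<Longrightarrow> (\<Sum>l<k. e i l x * a l j x) = (if i = j then D x else 0)"
      proof -
        have "\<exists>D e. D \<in> {h. smooth_fun_on S W h} \<and> D x0 \<noteq> 0 \<and> (\<forall>i<k. \<forall>j<k. e i j \<in> {h. smooth_fun_on S W h}) \<and>
          (\<forall>x. \<forall>i<k. \<forall>j<k. (\<Sum>l<k. e i l x * a l j x) = (if i = j then D x else 0))"
          by (rule adjugate_family) (use as inj in \<open>auto intro: smooth_intros\<close>)
        then show thesis using that by blast
      qed
      define W' where "W' = {x \<in> W. D x \<in> - {0}}"
      have W': "openin (Top S) W'" "x0 \<in> W'" "W' \<subseteq> W"
        using smooth_fun_on_openin[OF smS De(1) W(1), of "- {0}"] W(2) De(2) by (auto simp: W'_def)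
      define B where "B l x = (\<Sum>j<n. d j x f * q l j x)" for l x
      have Bs: "smooth_fun_on S W (B l)" if "l < k" for l
      proof -
        have "smooth_fun_on S W (\<lambda>x. d j x f)" for j
          using dv[of j] f smooth_fun_on_subset[OF _ W(3)] by (auto simp: smooth_vector_field_def)
        then show ?thesis unfolding B_def by (intro smooth_fun_on_sum smooth_fun_on_mult qs that)
      qed
      \<comment> \<open>The coefficients c of the graph element over df solve the normal equations a
        c = B, which the adjugate inverts up to D.\<close>
      have val: "bracket S piV f g x = inverse (D x) * (\<Sum>i<k. (\<Sum>l<k. e i l x * B l x) * Y i x g)" if x: "x \<in> W'" for x
      proof -
        have x': "x \<in> U" "x \<in> N" "x \<in> pts S" "D x \<noteq> 0" using x W W'_def by auto
        have "(sharp S piV x (dif S f x), dif S f x) \<in> vert_family S \<pi>S M p x"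
          unfolding vert_family_eq[OF x'(3)] by (simp add: Gr_iff)
        then obtain c where "(sharp S piV x (dif S f x), dif S f x) =
            ((\<lambda>f. \<Sum>i<k. c i * Y i x f), (\<lambda>v. \<Sum>i<k. c i * \<xi> i x v))"
          unfolding L[OF x'(1)] by (elim CollectE exE conjE) (rule that)
        note c = conjunct1[OF this[unfolded prod.inject]] conjunct2[OF this[unfolded prod.inject]]
        have df: "d j x f = (\<Sum>i<k. c i * q i j x)" for j
          using fun_cong[OF c(2), of "d j x"] dT[OF x'(1)] by (simp add: dif_apply q_def)
        have "B l x = (\<Sum>i<k. a l i x * c i)" for l
          unfolding B_def df a_def sum_distrib_right
          by (subst sum.swap) (simp add: mult_ac)
        then have "(\<Sum>l<k. e i l x * B l x) = (\<Sum>m<k. (\<Sum>l<k. e i l x * a l m x) * c m)" for i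
          unfolding sum_distrib_right by (subst sum.swap) (simp add: sum_distrib_left mult_ac)
        then have "(\<Sum>l<k. e i l x * B l x) = D x * c i" if i: "i < k" for i
          using i De(4)[OF i] by (simp add: if_distrib[of "\<lambda>t. t * _"] cong: if_cong)
        then have "(\<Sum>i<k. (\<Sum>l<k. e i l x * B l x) * Y i x g) = D x * (\<Sum>i<k. c i * Y i x g)"
          by (simp add: sum_distrib_left mult.assoc)
        then show ?thesis using bracket_sharp[OF x'(3) g, of piV f] c(1) x'(4) by simp
      qed
      have "smooth_fun_on S W' (bracket S piV f g)"
      proof (rule smooth_fun_on_cong[OF _ _ smS])
        have Yg: "smooth_fun_on S W' (\<lambda>x. Y i x g)" if "i < k" for i
        proof -
          have "smooth_fun_on S U (\<lambda>x. Y i x g)" using sm(1)[OF that] g by (simp add: smooth_vector_field_def)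
          then show ?thesis by (rule smooth_fun_on_subset) (use W(3) W'(3) in auto)
        qed
        note sub' = smooth_fun_on_subset[OF _ W'(3)]
        have eB: "smooth_fun_on S W' (\<lambda>x. \<Sum>l<k. e i l x * B l x)" if "i < k" for i
          by (rule smooth_fun_on_sum, rule smooth_fun_on_mult) (auto intro!: sub'[OF De(3)] sub'[OF Bs] that)
        show "smooth_fun_on S W' (\<lambda>x. inverse (D x) * (\<Sum>i<k. (\<Sum>l<k. e i l x * B l x) * Y i x g))"
          by (intro smooth_fun_on_mult smooth_fun_on_inverse smooth_fun_on_sum sub'[OF De(1)] smS eB Yg) (auto simp: W'_def)
      qed (simp add: val)
      moreover have "pts S \<inter> W' = W'" using W'(3) W(5) by blast
      ultimately show "\<exists>B. openin (Top S) B \<and> x0 \<in> B \<and> smooth_fun_on S (pts S \<inter> B) (bracket S piV f g)"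
        using W' by (intro exI[of _ W']) simp
    qed simp
  qed (simp add: bracket_def)
qed

end

section \<open>Brackets\<close>

locale smooth_biv =
  fixes M :: "('a, 'e::euclidean_space) mfd" and \<pi> :: "'a bivector"
  assumes M: "smooth_manifold M" and \<pi>: "smooth_bivector M \<pi>"
begin

abbreviation "br \<equiv> bracket M \<pi>"

lemma at: "x \<in> pts M \<Longrightarrow> bivector M x \<pi>" by (rule smooth_bivector_at[OF M \<pi>])

lemma br_Cinf: "f \<in> Cinf M \<Longrightarrow> g \<in> Cinf M \<Longrightarrow> br f g \<in> Cinf M"
  using \<pi> by (simp add: smooth_bivector_def)

lemma br_skew: "br g f x = - br f g x"
proof (cases "x \<in> pts M")
  case True
  interpret bivector M x \<pi> by (rule at[OF True])
  show ?thesis using True skew[of "dif M f x" "dif M g x"] by (simp add: bracket_def)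
qed (simp add: bracket_def)

lemma br_add: "f \<in> Cinf M \<Longrightarrow> f' \<in> Cinf M \<Longrightarrow> br (\<lambda>y. f y + f' y) g x = br f g x + br f' g x"
  using bivector.add_left[OF at, of x "dif M f x" "dif M f' x" "dif M g x"]
  by (cases "x \<in> pts M") (simp_all add: bracket_def dif_add)

lemma br_cmult: "f \<in> Cinf M \<Longrightarrow> br (\<lambda>y. c * f y) g x = c * br f g x"
  using bivector.cmult_left[OF at, of x "dif M f x" "dif M g x" c]
  by (cases "x \<in> pts M") (simp_all add: bracket_def dif_cmult)

lemma br_minus: "f \<in> Cinf M \<Longrightarrow> br (\<lambda>y. - f y) g x = - br f g x"
  using br_cmult[of f "-1" g x] by simp

lemma br_zero: "br (\<lambda>y. 0) g x = 0"
  using br_cmult[OF Cinf_zero, of 0 g x] by simp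

lemma br_sum: "(\<And>i. i \<in> I \<Longrightarrow> f i \<in> Cinf M) \<Longrightarrow> br (\<lambda>y. \<Sum>i\<in>I. c i * f i y) g x = (\<Sum>i\<in>I. c i * br (f i) g x)"
proof (induction I rule: infinite_finite_induct)
  case (insert i I)
  have "br (\<lambda>y. c i * f i y + (\<Sum>i\<in>I. c i * f i y)) g x = br (\<lambda>y. c i * f i y) g x + br (\<lambda>y. \<Sum>i\<in>I. c i * f i y) g x"
    using insert by (intro br_add Cinf_intros) auto
  with insert show ?case by (simp add: br_cmult)
qed (simp_all add: br_zero)

lemma br_vec:
  assumes "x \<in> pts M" "g \<in> Cinf M"
  shows "br f g x = sharp M \<pi> x (dif M f x) g" and "sharp M \<pi> x (dif M f x) \<in> tangent M x"
  using assms bivector.sharp_tangent[OF at] by (auto simp: bracket_def sharp_def)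

lemma br_vec_right:
  assumes "x \<in> pts M" "g \<in> Cinf M"
  obtains v where "v \<in> tangent M x" "\<forall>f\<in>Cinf M. br f g x = v f"
proof (rule that[of "\<lambda>f. (-1) * sharp M \<pi> x (dif M g x) f"])
  show "(\<lambda>f. (-1) * sharp M \<pi> x (dif M g x) f) \<in> tangent M x"
    by (rule tangent_cmult[OF br_vec(2)[OF assms]])
  show "\<forall>f\<in>Cinf M. br f g x = (-1) * sharp M \<pi> x (dif M g x) f"
  proof
    fix f assume "f \<in> Cinf M"
    then show "br f g x = (-1) * sharp M \<pi> x (dif M g x) f"
      using br_vec(1)[OF assms(1), of f g] br_skew[of f g x] by simp
  qed
qed

end

text \<open>One half of the Schouten expression; it is not symmetric in P and Q. For P = Q it is the
  Jacobiator.\<close>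

definition jac :: "('a, 'e::euclidean_space) mfd \<Rightarrow> 'a bivector \<Rightarrow> 'a bivector \<Rightarrow>
    ('a \<Rightarrow> real) \<Rightarrow> ('a \<Rightarrow> real) \<Rightarrow> ('a \<Rightarrow> real) \<Rightarrow> 'a \<Rightarrow> real" where
  "jac M P Q f g h x = bracket M P (bracket M Q f g) h x + bracket M P (bracket M Q g h) f x
     + bracket M P (bracket M Q h f) g x"

lemma schouten_jac: "schouten M P Q f g h x = jac M P Q f g h x + jac M Q P f g h x"
  by (simp add: schouten_def jac_def)

lemma jac_cyclic: "jac M P Q f g h x = jac M P Q g h f x"
  by (simp add: jac_def)

text \<open>Linearity in the first slot suffices, since \<open>jac\<close> is cyclic in its three
  arguments.\<close>

lemma jac_linear:
  assumes "smooth_biv M P" "smooth_biv M Q" and f: "f \<in> Cinf M" "f' \<in> Cinf M" "g \<in> Cinf M" "h \<in> Cinf M"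
  shows "jac M P Q (\<lambda>y. f y + c * f' y) g h x = jac M P Q f g h x + c * jac M P Q f' g h x"
proof -
  interpret P: smooth_biv M P by fact
  interpret Q: smooth_biv M Q by fact
  have 1: "Q.br (\<lambda>y. f y + c * f' y) k = (\<lambda>y. Q.br f k y + c * Q.br f' k y)" for k
    using f by (intro ext) (simp add: Q.br_add Q.br_cmult Cinf_cmult)
  have 2: "Q.br k (\<lambda>y. f y + c * f' y) = (\<lambda>y. Q.br k f y + c * Q.br k f' y)" for k
    using 1[of k] by (intro ext) (simp add: Q.br_skew[of k "\<lambda>y. f y + c * f' y"] Q.br_skew[of k f] Q.br_skew[of k f'])
  have 3: "P.br k (\<lambda>y. f y + c * f' y) x = P.br k f x + c * P.br k f' x" for k
    using f by (simp add: P.br_skew[of k "\<lambda>y. f y + c * f' y"] P.br_skew[of k f] P.br_skew[of k f'] P.br_add P.br_cmult Cinf_cmult)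
  show ?thesis
    unfolding jac_def 1 2 3 using f by (simp add: P.br_add P.br_cmult Cinf_cmult Q.br_Cinf algebra_simps)
qed

lemma jac_Cinf:
  assumes "smooth_biv M P" "smooth_biv M Q" "f \<in> Cinf M" "g \<in> Cinf M" "h \<in> Cinf M"
  shows "jac M P Q f g h \<in> Cinf M"
  unfolding jac_def[abs_def] using assms smooth_biv.br_Cinf by (intro Cinf_add) blast+

lemma linear_relation:
  fixes w :: "nat \<Rightarrow> 'e::euclidean_space"
  assumes "\<And>i. i < r \<Longrightarrow> w i \<in> W" "dim W < r"
  shows "\<exists>c. (\<exists>i<r. c i \<noteq> 0) \<and> (\<Sum>i<r. c i *\<^sub>R w i) = 0"
proof (cases "inj_on w {..<r}")
  case True
  have "card (w ` {..<r}) = r" using card_image[OF True] by simp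
  then have "dependent (w ` {..<r})"
    using independent_card_le_dim[of "w ` {..<r}" W] assms by fastforce
  then obtain u where u: "\<exists>v\<in>w ` {..<r}. u v \<noteq> 0" "(\<Sum>v\<in>w ` {..<r}. u v *\<^sub>R v) = 0"
    using dependent_finite[of "w ` {..<r}"] by auto
  then have "(\<Sum>i<r. u (w i) *\<^sub>R w i) = 0" by (simp add: sum.reindex[OF True])
  then show ?thesis using u(1) by (intro exI[of _ "\<lambda>i. u (w i)"]) auto
next
  case False
  then obtain i j where ij: "i < r" "j < r" "i \<noteq> j" "w i = w j" by (auto simp: inj_on_def)
  define c where "c k = (if k = i then 1 else 0) - (if k = j then 1 else (0::real))" for k
  have "(\<Sum>k<r. c k *\<^sub>R w k) = (\<Sum>k<r. if k = i then w k else 0) - (\<Sum>k<r. if k = j then w k else 0)"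
    unfolding sum_subtractf[symmetric] by (rule sum.cong) (auto simp: c_def)
  also have "\<dots> = 0" using ij by simp
  finally show ?thesis using ij by (intro exI[of _ c]) (auto simp: c_def)
qed

section \<open>The vertical and horizontal parts are commuting Poisson structures\<close>

locale smooth_fib = poisson_fib S \<pi>S M \<pi>M p
  for S :: "('a, 'e::euclidean_space) mfd" and \<pi>S :: "'a bivector"
    and M :: "('b, 'f::euclidean_space) mfd" and \<pi>M :: "'b bivector" and p :: "'a \<Rightarrow> 'b" +
  assumes K: smooth_split
begin

lemma smooth_piV: "smooth_bivector S piV"
  using K piV_wedge by (simp add: smooth_bivector_def smooth_split_def)

lemma smooth_piH: "smooth_bivector S piH"
  using K piH_wedge by (auto simp: smooth_bivector_def smooth_split_def bracket_diff intro!: Cinf_diff bracket_S)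

sublocale H: smooth_biv S piH by unfold_locales (rule smS, rule smooth_piH)
sublocale Vb: smooth_biv S piV by unfold_locales (rule smS, rule smooth_piV)
sublocale Sb: smooth_biv S \<pi>S by unfold_locales (rule smS, rule smooth_S)

lemma br_S: "Sb.br f g x = Vb.br f g x + H.br f g x"
  by (simp add: bracket_diff)

lemma br_V_pb: "b \<in> Cinf M \<Longrightarrow> Vb.br (pb b) g = (\<lambda>x. 0)"
  using piV_ann[OF _ dif_pb_ann dif_cotangent] by (auto simp: bracket_def)

lemma br_V_pb': "b \<in> Cinf M \<Longrightarrow> Vb.br g (pb b) = (\<lambda>x. 0)"
  using Vb.br_skew[of "pb b" g] br_V_pb[of b g] by (intro ext) simp

lemma br_H_pb: "b \<in> Cinf M \<Longrightarrow> H.br (pb b) g = Sb.br (pb b) g"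
  by (auto simp: bracket_diff br_V_pb)

text \<open>Basic functions are closed under the bracket because p is a Poisson map, and on them the
  bracket of \<pi>_H is that of \<pi>_S.\<close>

lemma br_H_pb_pb:
  assumes "b \<in> Cinf M" "c \<in> Cinf M"
  obtains e where "e \<in> Cinf M" "H.br (pb b) (pb c) = pb e"
proof -
  have "bracket M \<pi>M b c \<in> Cinf M"
    using PS assms by (auto simp: poisson_submersion_def poisson_manifold_def poisson_structure_def smooth_bivector_def)
  then show thesis using that bracket_pb[OF assms] br_H_pb[OF assms(1)] by metis
qed

text \<open>At a single point, \<xi> - \<zeta> is the differential of a basic function, and
  \<open>piH\<close> sees only this part of \<xi>. The function b depends on the point.\<close>

lemma horizontal_representative:
  assumes x: "x \<in> pts S"
  obtains b where "b \<in> Cinf M" "\<forall>g. H.br f g x = H.br (pb b) g x"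
proof -
  obtain \<zeta> where z: "is_split x (dif S f x) \<zeta>" by (rule split_exists[OF x dif_cotangent])
  then have a: "(\<lambda>v. dif S f x v - \<zeta> v) \<in> Vo x" by (simp add: is_split_def)
  obtain b where b': "b \<in> Cinf M" "(\<lambda>v. dif S f x v - \<zeta> v) = dif S (pb b) x" by (rule ann_dif_pb[OF x a])
  have zT: "\<zeta> \<in> To x" using z by (simp add: is_split_def)
  have "H.br f g x = H.br (pb b) g x" for g
    using x bivector.diff_left[OF bS[OF x] dif_cotangent[of S f x] zT dif_cotangent[of S g x]] b'(2)
      piH_ann[OF x dif_pb_ann[OF b'(1)], of "dif S g x"] piV_eq[OF x z, of "dif S g x"]
    by (simp add: bracket_def piH_def)
  then show thesis using that b'(1) by blast
qed

subsection \<open>Regular points\<close>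

text \<open>The matrix of \<pi>_H-brackets of the basic functions is nondegenerate at x, so the rank
  there is at least r. This is an open condition.\<close>

definition gram_inj :: "nat \<Rightarrow> (nat \<Rightarrow> 'b \<Rightarrow> real) \<Rightarrow> 'a \<Rightarrow> bool" where
  "gram_inj r a x \<longleftrightarrow> (\<forall>c. (\<forall>j<r. (\<Sum>i<r. c i * H.br (pb (a i)) (pb (a j)) x) = 0) \<longrightarrow> (\<forall>i<r. c i = 0))"

text \<open>The r equations {f,a_j} = 0 force df into the kernel of \<pi>_H, so the rank at x is at
  most r. Unlike \<open>gram_inj\<close> this is not an open condition.\<close>

definition spans :: "nat \<Rightarrow> (nat \<Rightarrow> 'b \<Rightarrow> real) \<Rightarrow> 'a \<Rightarrow> bool" where
  "spans r a x \<longleftrightarrow> (\<forall>f\<in>Cinf S. (\<forall>j<r. H.br f (pb (a j)) x = 0) \<longrightarrow> (\<forall>g\<in>Cinf S. H.br f g x = 0))"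

text \<open>The rank of the horizontal part is locally constant at a regular point: it stays equal to \<open>r\<close>.\<close>

definition regular :: "'a \<Rightarrow> bool" where
  "regular x0 \<longleftrightarrow> (\<exists>r a W. openin (Top S) W \<and> x0 \<in> W \<and> (\<forall>i<r. a i \<in> Cinf M) \<and>
     gram_inj r a x0 \<and> (\<forall>x\<in>W. spans r a x))"

section \<open>Nondegenerate Gram matrices of basic functions\<close>

lemma gram_adjugate:
  assumes x0: "x0 \<in> pts S" and a: "\<forall>i<r. a i \<in> Cinf M" and inj: "gram_inj r a x0"
  obtains D e where "D \<in> Cinf S" "D x0 \<noteq> 0" "\<And>i j. i < r \<Longrightarrow> j < r \<Longrightarrow> e i j \<in> Cinf S"
    "\<And>x i j. x \<in> pts S \<Longrightarrow> i < r \<Longrightarrow> j < r \<Longrightarrow> (\<Sum>k<r. e i k x * H.br (pb (a k)) (pb (a j)) x) = (if i = j then D x else 0)"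
proof -
  let ?A = "\<lambda>i j. H.br (pb (a i)) (pb (a j))"
  have "\<exists>D e. D \<in> {h. smooth_fun_on S (pts S) h} \<and> D x0 \<noteq> 0 \<and>
      (\<forall>i<r. \<forall>j<r. e i j \<in> {h. smooth_fun_on S (pts S) h}) \<and>
      (\<forall>x. \<forall>i<r. \<forall>j<r. (\<Sum>k<r. e i k x * ?A k j x) = (if i = j then D x else 0))"
  proof (rule adjugate_family)
    fix i j assume "i < r" "j < r"
    then show "?A i j \<in> {h. smooth_fun_on S (pts S) h}" using a by (auto intro!: CinfD(1) H.br_Cinf pb_Cinf)
  next
    fix c assume "\<forall>j<r. (\<Sum>i<r. c i * ?A i j x0) = 0"
    then show "\<forall>i<r. c i = 0" using inj unfolding gram_inj_def by blast
  qed (auto intro: smooth_intros)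
  then obtain D e where De: "smooth_fun_on S (pts S) D" "D x0 \<noteq> 0" "\<forall>i<r. \<forall>j<r. smooth_fun_on S (pts S) (e i j)"
    "\<forall>x. \<forall>i<r. \<forall>j<r. (\<Sum>k<r. e i k x * ?A k j x) = (if i = j then D x else 0)" by blast
  show thesis
    by (rule that[of "\<lambda>x. if x \<in> pts S then D x else 0" "\<lambda>i j x. if x \<in> pts S then e i j x else 0"])
      (use x0 De in \<open>auto intro!: Cinf_restrict smS\<close>)
qed

text \<open>More than dim S differentials are linearly dependent at x; the dependent combination has
  zero differential, and so gives a relation among the rows of the Gram matrix.\<close>

lemma gram_inj_bound:
  assumes x: "x \<in> pts S" and a: "\<forall>i<r. a i \<in> Cinf M" and inj: "gram_inj r a x"
  shows "r \<le> dim (Model S)"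
proof (rule ccontr)
  assume r: "\<not> r \<le> dim (Model S)"
  obtain N y d where fr: "frame S N (dim (Model S)) y d" "x \<in> N" by (rule local_frame[OF smS x])
  interpret frame S N "dim (Model S)" y d by (rule fr(1))
  define w where "w i = (\<Sum>j<dim (Model S). d j x (pb (a i)) *\<^sub>R model_frame (Model S) j)" for i
  have sub: "subspace (Model S)" by (rule smooth_manifold_model[OF smS])
  have "w i \<in> Model S" for i
    unfolding w_def using model_frame(1)[OF sub] sub by (intro subspace_sum subspace_scale) auto
  then obtain c where c: "\<exists>i<r. c i \<noteq> 0" "(\<Sum>i<r. c i *\<^sub>R w i) = 0"
    using linear_relation[of r w "Model S"] r by auto
  have dc: "(\<Sum>i<r. c i * d j x (pb (a i))) = 0" if j: "j < dim (Model S)" for j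
  proof -
    have wj: "w i \<bullet> model_frame (Model S) j = d j x (pb (a i))" for i
    proof -
      have "w i \<bullet> model_frame (Model S) j = (\<Sum>k<dim (Model S). if k = j then d k x (pb (a i)) else 0)"
        unfolding w_def inner_sum_left using model_frame(2)[OF sub _ j] by (intro sum.cong) auto
      then show ?thesis using j by simp
    qed
    have "(\<Sum>i<r. c i *\<^sub>R w i) \<bullet> model_frame (Model S) j = (\<Sum>i<r. c i * d j x (pb (a i)))"
      by (simp add: inner_sum_left wj)
    then show ?thesis using c(2) by simp
  qed
  let ?F = "\<lambda>z. \<Sum>i<r. c i * pb (a i) z"
  have F: "?F \<in> Cinf S" using a by (intro Cinf_sum Cinf_cmult pb_Cinf) auto
  have "d j x ?F = 0" if "j < dim (Model S)" for j
  proof -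
    have dT: "d j x \<in> T x" using d_tangent x by blast
    have "d j x ?F = (\<Sum>i<r. d j x (\<lambda>z. c i * pb (a i) z))"
      using a by (intro tangent_fun_sum[OF dT] Cinf_cmult pb_Cinf) auto
    also have "\<dots> = (\<Sum>i<r. c i * d j x (pb (a i)))"
      using a by (intro sum.cong refl tangentD(2)[OF dT] pb_Cinf) auto
    finally show ?thesis using dc[OF that] by simp
  qed
  then have "dif S ?F x = (\<lambda>v. 0)" using dif_expand[OF fr(2) F] by simp
  then have z: "H.br ?F g x = 0" for g
    using x bivector.zero_left[OF bH[OF x] dif_cotangent] by (simp add: bracket_def)
  have "(\<Sum>i<r. c i * H.br (pb (a i)) (pb (a j)) x) = 0" for j
  proof -
    have "H.br ?F (pb (a j)) x = (\<Sum>i<r. c i * H.br (pb (a i)) (pb (a j)) x)"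
      using a by (intro H.br_sum pb_Cinf) auto
    then show ?thesis using z by simp
  qed
  then have "\<forall>i<r. c i = 0" using inj unfolding gram_inj_def by blast
  then show False using c(1) by blast
qed

text \<open>A symplectic Gram-Schmidt step: a function f orthogonal to all a_j but not to some g
  contributes a hyperbolic pair, hence the increment 2. Both f and g are replaced by basic functions
  with the same contraction with \<pi>_H at x.\<close>

lemma gram_inj_extend:
  assumes x: "x \<in> pts S" and a: "\<forall>i<r. a i \<in> Cinf M" and inj: "gram_inj r a x" and ns: "\<not> spans r a x"
  obtains a' where "\<forall>i<r+2. a' i \<in> Cinf M" "gram_inj (r+2) a' x"
proof -
  obtain f g where f: "f \<in> Cinf S" "\<forall>j<r. H.br f (pb (a j)) x = 0" and g: "g \<in> Cinf S" "H.br f g x \<noteq> 0"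
    using ns unfolding spans_def by blast
  obtain b where b: "b \<in> Cinf M" "\<forall>h. H.br f h x = H.br (pb b) h x" by (rule horizontal_representative[OF x])
  obtain b' where b': "b' \<in> Cinf M" "\<forall>h. H.br g h x = H.br (pb b') h x" by (rule horizontal_representative[OF x])
  have bb: "H.br (pb b) (pb b') x \<noteq> 0"
    using g(2) b(2)[THEN spec, of g] b'(2)[THEN spec, of "pb b"] H.br_skew[of g "pb b" x] H.br_skew[of "pb b'" "pb b" x] by simp
  have ba: "H.br (pb b) (pb (a j)) x = 0" if "j < r" for j using f(2) b(2) that by simp
  define a' where "a' i = (if i < r then a i else if i = r then b else b')" for i
  have "gram_inj (r+2) a' x"
    unfolding gram_inj_def
  proof (rule allI, rule impI)
    fix c assume c: "\<forall>j<r+2. (\<Sum>i<r+2. c i * H.br (pb (a' i)) (pb (a' j)) x) = 0"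
    have e: "(\<Sum>i<r. c i * H.br (pb (a i)) h x) + c r * H.br (pb b) h x + c (Suc r) * H.br (pb b') h x = 0"
      if "h = pb (a' j)" "j < r + 2" for h j
      using c[rule_format, OF that(2)] that(1) by (simp add: a'_def)
    \<comment> \<open>Pairing the relation with b isolates the coefficient of b', since b is
      orthogonal to the a_i and to itself. The a_j then give the first r coefficients, and b' gives
      that of b.\<close>
    have "c (Suc r) * H.br (pb b') (pb b) x = 0"
    proof -
      have "H.br (pb (a i)) (pb b) x = 0" if "i < r" for i
        using ba[OF that] H.br_skew[of "pb (a i)" "pb b" x] by simp
      moreover have "H.br (pb b) (pb b) x = 0" using H.br_skew[of "pb b" "pb b" x] by simp
      ultimately show ?thesis using e[of "pb b" r] by (simp add: a'_def)
    qed
    then have 1: "c (Suc r) = 0" using bb H.br_skew[of "pb b'" "pb b" x] by simp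
    have "(\<Sum>i<r. c i * H.br (pb (a i)) (pb (a j)) x) = 0" if j: "j < r" for j
      using e[of "pb (a j)" j] 1 ba[OF j] j by (simp add: a'_def)
    then have 2: "\<forall>i<r. c i = 0" using inj unfolding gram_inj_def by blast
    have "c r * H.br (pb b) (pb b') x = 0"
      using e[of "pb b'" "Suc r"] 1 2 by (simp add: a'_def)
    then have 3: "c r = 0" using bb by simp
    show "\<forall>i<r+2. c i = 0" using 1 2 3 by (auto simp: less_Suc_eq)
  qed
  moreover have "\<forall>i<r+2. a' i \<in> Cinf M" using a b(1) b'(1) by (simp add: a'_def)
  ultimately show thesis using that by blast
qed

text \<open>Choose a point of W with a nondegenerate Gram matrix of maximal size r. The matrix stays
  nondegenerate nearby, and wherever the family failed to span it could be enlarged to size r + 2,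
  against maximality.\<close>

lemma regular_dense:
  assumes W: "openin (Top S) W" "W \<noteq> {}"
  shows "\<exists>x\<in>W. regular x"
proof -
  have Wp: "W \<subseteq> pts S" by (rule openin_subset[OF W(1)])
  define R where "R = {r. \<exists>x\<in>W. \<exists>a. (\<forall>i<r. a i \<in> Cinf M) \<and> gram_inj r a x}"
  have bound: "r \<le> dim (Model S)" if "r \<in> R" for r
    using that gram_inj_bound Wp unfolding R_def by blast
  have "0 \<in> R" using W(2) by (auto simp: R_def gram_inj_def)
  then have "R \<noteq> {}" by blast
  have fin: "finite R" using bound by (intro finite_subset[of R "{..dim (Model S)}"]) auto
  define r where "r = Max R"
  have rR: "r \<in> R" and rmax: "\<And>r'. r' \<in> R \<Longrightarrow> r' \<le> r"
    using Max_in[OF fin \<open>R \<noteq> {}\<close>] Max_ge[OF fin] by (auto simp: r_def)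
  then obtain x0 a where x0: "x0 \<in> W" and a: "\<forall>i<r. a i \<in> Cinf M" "gram_inj r a x0" unfolding R_def by blast
  have x0S: "x0 \<in> pts S" using x0 Wp by blast
  obtain D e where D: "D \<in> Cinf S" "D x0 \<noteq> 0"
    and e: "\<And>x i j. x \<in> pts S \<Longrightarrow> i < r \<Longrightarrow> j < r \<Longrightarrow> (\<Sum>k<r. e i k x * H.br (pb (a k)) (pb (a j)) x) = (if i = j then D x else 0)"
    by (rule gram_adjugate[OF x0S a]) blast
  define W' where "W' = W \<inter> {x \<in> pts S. D x \<in> - {0}}"
  have W': "openin (Top S) W'"
    unfolding W'_def
    by (intro openin_Int W(1) smooth_fun_on_openin[OF smS CinfD(1)[OF D(1)]]) (auto simp: open_Compl)
  have "spans r a x" if x: "x \<in> W'" for x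
  proof (rule ccontr)
    assume ns: "\<not> spans r a x"
    have xS: "x \<in> pts S" "x \<in> W" "D x \<noteq> 0" using x by (auto simp: W'_def)
    have "gram_inj r a x"
      unfolding gram_inj_def
    proof (rule allI, rule impI)
      fix c assume c: "\<forall>j<r. (\<Sum>i<r. c i * H.br (pb (a i)) (pb (a j)) x) = 0"
      \<comment> \<open>The adjugate acts on the left, so the relation among the rows is turned into
        a vector in the right kernel by skew-symmetry.\<close>
      have z: "(\<Sum>i<r. H.br (pb (a j)) (pb (a i)) x * c i) = 0" if "j < r" for j
      proof -
        have "(\<Sum>i<r. H.br (pb (a j)) (pb (a i)) x * c i) = - (\<Sum>i<r. c i * H.br (pb (a i)) (pb (a j)) x)"
          unfolding sum_negf[symmetric] using H.br_skew[of "pb (a j)"] by (intro sum.cong) auto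
        then show ?thesis using c that by simp
      qed
      have "D x * c l = 0" if l: "l < r" for l
      proof -
        have "(\<Sum>j<r. e l j x * (\<Sum>i<r. H.br (pb (a j)) (pb (a i)) x * c i)) = 0" using z by simp
        also have "(\<Sum>j<r. e l j x * (\<Sum>i<r. H.br (pb (a j)) (pb (a i)) x * c i))
            = (\<Sum>i<r. (\<Sum>j<r. e l j x * H.br (pb (a j)) (pb (a i)) x) * c i)"
          unfolding sum_distrib_left sum_distrib_right by (subst sum.swap) (simp add: mult.assoc)
        also have "\<dots> = (\<Sum>i<r. if i = l then D x * c i else 0)"
          using e[OF xS(1) l] by (intro sum.cong) auto
        finally show ?thesis using l by simp
      qed
      then show "\<forall>i<r. c i = 0" using xS(3) by simp
    qed
    then obtain a' where "\<forall>i<r+2. a' i \<in> Cinf M" "gram_inj (r+2) a' x"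
      by (rule gram_inj_extend[OF xS(1) a(1) _ ns])
    then have "r + 2 \<in> R" using xS(2) unfolding R_def by blast
    then show False using rmax by fastforce
  qed
  moreover have "x0 \<in> W'" using x0 x0S D(2) by (simp add: W'_def)
  ultimately have "regular x0" unfolding regular_def using W' a by blast
  then show ?thesis using x0 by blast
qed

lemma vanishes_if_regular:
  assumes f: "f \<in> Cinf S" and reg: "\<And>x. x \<in> pts S \<Longrightarrow> regular x \<Longrightarrow> f x = 0" and x: "x \<in> pts S"
  shows "f x = 0"
proof (rule ccontr)
  assume nz: "f x \<noteq> 0"
  have "openin (Top S) {x \<in> pts S. f x \<in> - {0}}"
    by (rule smooth_fun_on_openin[OF smS CinfD(1)[OF f]]) (auto simp: open_Compl)
  moreover have "{x \<in> pts S. f x \<in> - {0}} \<noteq> {}" using nz x by blast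
  ultimately show False using regular_dense reg by blast
qed

text \<open>What regularity gives at x in pointwise form: correction by basic functions into the
  kernel of \<pi>_H, the kernel property itself, and the vanishing of the first derivatives of
  {f,g}_H for f and g with differentials in the kernel. The last clause is where constancy of the
  rank near x enters.\<close>

definition adapted :: "nat \<Rightarrow> (nat \<Rightarrow> 'b \<Rightarrow> real) \<Rightarrow> 'a \<Rightarrow> bool" where
  "adapted r a x \<longleftrightarrow> (\<forall>i<r. a i \<in> Cinf M) \<and>
    (\<forall>f\<in>Cinf S. \<exists>c. \<forall>j<r. H.br (\<lambda>z. f z + (\<Sum>i<r. c i * pb (a i) z)) (pb (a j)) x = 0) \<and>
    (\<forall>f\<in>Cinf S. \<forall>g\<in>Cinf S. (\<forall>j<r. H.br f (pb (a j)) x = 0) \<longrightarrow> H.br f g x = 0) \<and>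
    (\<forall>f\<in>Cinf S. \<forall>g\<in>Cinf S. \<forall>v\<in>T x. (\<forall>j<r. H.br f (pb (a j)) x = 0) \<longrightarrow>
       (\<forall>j<r. H.br g (pb (a j)) x = 0) \<longrightarrow> v (H.br f g) = 0)"

lemma adaptedD:
  assumes "adapted r a x"
  shows "\<forall>i<r. a i \<in> Cinf M"
    and "f \<in> Cinf S \<Longrightarrow> \<exists>c. \<forall>j<r. H.br (\<lambda>z. f z + (\<Sum>i<r. c i * pb (a i) z)) (pb (a j)) x = 0"
    and "f \<in> Cinf S \<Longrightarrow> g \<in> Cinf S \<Longrightarrow> \<forall>j<r. H.br f (pb (a j)) x = 0 \<Longrightarrow> H.br f g x = 0"
    and "f \<in> Cinf S \<Longrightarrow> g \<in> Cinf S \<Longrightarrow> \<forall>j<r. H.br f (pb (a j)) x = 0 \<Longrightarrow>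
       \<forall>j<r. H.br g (pb (a j)) x = 0 \<Longrightarrow> v \<in> T x \<Longrightarrow> v (H.br f g) = 0"
  using assms unfolding adapted_def by simp_all

lemma regular_adapted:
  assumes x0: "x0 \<in> pts S" and reg: "regular x0"
  obtains r a where "adapted r a x0"
proof -
  obtain r a W where W: "openin (Top S) W" "x0 \<in> W" and a: "\<forall>i<r. a i \<in> Cinf M"
    and inj: "gram_inj r a x0" and sp: "\<forall>x\<in>W. spans r a x" using reg unfolding regular_def by blast
  have Wp: "W \<subseteq> pts S" by (rule openin_subset[OF W(1)])
  obtain D e where D: "D \<in> Cinf S" "D x0 \<noteq> 0" and eC: "\<And>i j. i < r \<Longrightarrow> j < r \<Longrightarrow> e i j \<in> Cinf S"
    and e: "\<And>x i j. x \<in> pts S \<Longrightarrow> i < r \<Longrightarrow> j < r \<Longrightarrow> (\<Sum>k<r. e i k x * H.br (pb (a k)) (pb (a j)) x) = (if i = j then D x else 0)"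
    by (rule gram_adjugate[OF x0 a inj]) blast
  \<comment> \<open>Cramer numerators: u_i / D are the coefficients with which the differentials of
    the basic functions \<open>pb (a i)\<close> represent the horizontal part of df.\<close>
  define u where "u f i x = (\<Sum>k<r. H.br f (pb (a k)) x * e k i x)" for f i x
  have uC: "u f i \<in> Cinf S" if "f \<in> Cinf S" "i < r" for f i
    unfolding u_def using that a by (intro Cinf_sum Cinf_mult H.br_Cinf eC pb_Cinf) auto
  have u: "(\<Sum>i<r. u f i x * H.br (pb (a i)) (pb (a j)) x) = D x * H.br f (pb (a j)) x"
    if "x \<in> pts S" "j < r" for f x j
  proof -
    have "(\<Sum>i<r. u f i x * H.br (pb (a i)) (pb (a j)) x)
        = (\<Sum>k<r. H.br f (pb (a k)) x * (\<Sum>i<r. e k i x * H.br (pb (a i)) (pb (a j)) x))"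
      unfolding u_def sum_distrib_left sum_distrib_right by (subst sum.swap) (simp add: mult.assoc)
    also have "\<dots> = (\<Sum>k<r. if k = j then D x * H.br f (pb (a k)) x else 0)"
      using e[OF that(1) _ that(2)] by (intro sum.cong) auto
    finally show ?thesis using that(2) by simp
  qed
  have aC: "pb (a i) \<in> Cinf S" if "i < r" for i using a that pb_Cinf by blast
  \<comment> \<open>Proved with coefficients frozen at x, but for every x in the neighbourhood W, so
    the identity may be differentiated at x0.\<close>
  have expand: "D x * H.br f g x = (\<Sum>i<r. u f i x * H.br (pb (a i)) g x)"
    if x: "x \<in> W" and f: "f \<in> Cinf S" and g: "g \<in> Cinf S" for x f g
  proof -
    have xS: "x \<in> pts S" using x Wp by blast
    let ?F = "\<lambda>z. D x * f z + (\<Sum>i<r. (- u f i x) * pb (a i) z)"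
    have Fb: "H.br ?F h x = D x * H.br f h x + (\<Sum>i<r. (- u f i x) * H.br (pb (a i)) h x)" for h
    proof -
      have "H.br ?F h x = H.br (\<lambda>z. D x * f z) h x + H.br (\<lambda>z. \<Sum>i<r. (- u f i x) * pb (a i) z) h x"
        using f aC by (intro H.br_add Cinf_sum Cinf_cmult) auto
      moreover have "H.br (\<lambda>z. \<Sum>i<r. (- u f i x) * pb (a i) z) h x = (\<Sum>i<r. (- u f i x) * H.br (pb (a i)) h x)"
        using aC by (intro H.br_sum) auto
      ultimately show ?thesis using H.br_cmult[OF f] by simp
    qed
    have "\<forall>j<r. H.br ?F (pb (a j)) x = 0" using u[OF xS] Fb by (simp add: sum_negf)
    moreover have "?F \<in> Cinf S" using f aC by (intro Cinf_add Cinf_sum Cinf_cmult) auto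
    ultimately have "H.br ?F g x = 0" using sp x g unfolding spans_def by blast
    then show ?thesis using Fb by (simp add: sum_negf)
  qed
  have ker: "H.br f g x0 = 0" if "f \<in> Cinf S" "g \<in> Cinf S" "\<forall>j<r. H.br f (pb (a j)) x0 = 0" for f g
    using sp W(2) that unfolding spans_def by blast
  have hat: "\<exists>c. \<forall>j<r. H.br (\<lambda>z. f z + (\<Sum>i<r. c i * pb (a i) z)) (pb (a j)) x0 = 0" if f: "f \<in> Cinf S" for f
  proof -
    show "\<exists>c. \<forall>j<r. H.br (\<lambda>z. f z + (\<Sum>i<r. c i * pb (a i) z)) (pb (a j)) x0 = 0"
    proof (intro exI[of _ "\<lambda>i. - u f i x0 / D x0"] allI impI)
      fix j assume j: "j < r"
      have "H.br (\<lambda>z. f z + (\<Sum>i<r. (- u f i x0 / D x0) * pb (a i) z)) (pb (a j)) x0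
        = H.br f (pb (a j)) x0 + H.br (\<lambda>z. \<Sum>i<r. (- u f i x0 / D x0) * pb (a i) z) (pb (a j)) x0"
        using f aC by (intro H.br_add Cinf_sum Cinf_cmult) auto
      also have "H.br (\<lambda>z. \<Sum>i<r. (- u f i x0 / D x0) * pb (a i) z) (pb (a j)) x0
        = (\<Sum>i<r. (- u f i x0 / D x0) * H.br (pb (a i)) (pb (a j)) x0)"
        using aC by (intro H.br_sum) auto
      also have "\<dots> = - (\<Sum>i<r. u f i x0 * H.br (pb (a i)) (pb (a j)) x0) / D x0"
        by (simp add: sum_negf sum_divide_distrib)
      finally show "H.br (\<lambda>z. f z + (\<Sum>i<r. (- u f i x0 / D x0) * pb (a i) z)) (pb (a j)) x0 = 0"
        using u[OF x0 j, of f] D(2) by simp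
    qed
  qed
  \<comment> \<open>In each summand of the expansion both factors, u_i and the bracket of a_i with
    g, vanish at x0, so the product rule leaves nothing. As {f,g} itself vanishes at x0, the factor
    D can be removed.\<close>
  have flat: "v (H.br f g) = 0" if f: "f \<in> Cinf S" "\<forall>j<r. H.br f (pb (a j)) x0 = 0"
      and g: "g \<in> Cinf S" "\<forall>j<r. H.br g (pb (a j)) x0 = 0" and v: "v \<in> T x0" for f g v
  proof -
    note fg = H.br_Cinf[OF f(1) g(1)]
    have P: "(\<lambda>x. u f i x * H.br (pb (a i)) g x) \<in> Cinf S" if "i < r" for i
      using that aC by (intro Cinf_mult uC H.br_Cinf f g) auto
    have "v (\<lambda>x. D x * H.br f g x) = v (\<lambda>x. \<Sum>i<r. u f i x * H.br (pb (a i)) g x)"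
      by (rule tangent_local[OF smS v Cinf_mult[OF D(1) fg] Cinf_sum[OF P] W]) (use expand f g in auto)
    also have "\<dots> = (\<Sum>i<r. v (\<lambda>x. u f i x * H.br (pb (a i)) g x))"
      by (rule tangent_fun_sum[OF v]) (use P in auto)
    also have "\<dots> = 0"
    proof (rule sum.neutral, rule ballI)
      fix i assume i: "i \<in> {..<r}"
      have "u f i x0 = 0" using f(2) by (simp add: u_def)
      moreover have "H.br (pb (a i)) g x0 = 0" using g(2) i H.br_skew[of "pb (a i)" g x0] by simp
      moreover have "v (\<lambda>x. u f i x * H.br (pb (a i)) g x) = u f i x0 * v (H.br (pb (a i)) g) + H.br (pb (a i)) g x0 * v (u f i)"
        using i aC by (intro tangentD(3)[OF v] uC H.br_Cinf f g) auto
      ultimately show "v (\<lambda>x. u f i x * H.br (pb (a i)) g x) = 0" by simp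
    qed
    finally have "D x0 * v (H.br f g) + H.br f g x0 * v D = 0" using tangentD(3)[OF v D(1) fg] by simp
    then show "v (H.br f g) = 0" using ker[OF f(1) g(1) f(2)] D(2) by simp
  qed
  have "adapted r a x0" unfolding adapted_def using a hat ker flat by (intro conjI ballI impI) auto
  then show thesis by (rule that)
qed

text \<open>At a regular point every function is, up to basic functions, one whose differential is annihilated
  by the horizontal part; \<open>Q\<close> is this last property.\<close>

lemma regular_cyclic_zero:
  fixes J :: "('a \<Rightarrow> real) \<Rightarrow> ('a \<Rightarrow> real) \<Rightarrow> ('a \<Rightarrow> real) \<Rightarrow> real" and r :: nat
  assumes hat: "\<And>f. f \<in> Cinf S \<Longrightarrow> \<exists>c. Q (\<lambda>z. f z + (\<Sum>i<r. c i * pb (a i) z))"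
    and a: "\<forall>i<r. a i \<in> Cinf M"
    and cyc: "\<And>f g h. J f g h = J g h f"
    and lin: "\<And>f f' g h c. f \<in> Cinf S \<Longrightarrow> f' \<in> Cinf S \<Longrightarrow> g \<in> Cinf S \<Longrightarrow> h \<in> Cinf S \<Longrightarrow>
      J (\<lambda>y. f y + c * f' y) g h = J f g h + c * J f' g h"
    and basic: "\<And>b g h. b \<in> Cinf M \<Longrightarrow> g \<in> Cinf S \<Longrightarrow> h \<in> Cinf S \<Longrightarrow> J (pb b) g h = 0"
    and zero: "\<And>f g h. f \<in> Cinf S \<Longrightarrow> g \<in> Cinf S \<Longrightarrow> h \<in> Cinf S \<Longrightarrow> Q f \<Longrightarrow> Q g \<Longrightarrow> Q h \<Longrightarrow> J f g h = 0"
    and f: "f \<in> Cinf S" "g \<in> Cinf S" "h \<in> Cinf S"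
  shows "J f g h = 0"
proof -
  have red: "\<exists>f'\<in>Cinf S. Q f' \<and> (\<forall>g\<in>Cinf S. \<forall>h\<in>Cinf S. J f' g h = J f g h)" if f: "f \<in> Cinf S" for f
  proof -
    obtain c where c: "Q (\<lambda>z. f z + (\<Sum>i<r. c i * pb (a i) z))" using hat[OF f] by blast
    have "(\<lambda>z. f z + (\<Sum>i<m. c i * pb (a i) z)) \<in> Cinf S \<and>
        J (\<lambda>z. f z + (\<Sum>i<m. c i * pb (a i) z)) g h = J f g h" if "m \<le> r" "g \<in> Cinf S" "h \<in> Cinf S" for g h m
      using that(1)
    proof (induction m)
      case (Suc m)
      let ?F = "\<lambda>z. f z + (\<Sum>i<m. c i * pb (a i) z)"
      have F: "?F \<in> Cinf S" "J ?F g h = J f g h" using Suc by auto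
      have am: "a m \<in> Cinf M" using Suc.prems a by auto
      have "(\<lambda>z. ?F z + c m * pb (a m) z) \<in> Cinf S" by (rule Cinf_add[OF F(1) Cinf_cmult[OF pb_Cinf[OF am]]])
      moreover have "J (\<lambda>z. ?F z + c m * pb (a m) z) g h = J f g h"
        using lin[OF F(1) pb_Cinf[OF am] that(2,3)] basic[OF am that(2,3)] F(2) by simp
      ultimately show ?case by (simp add: add.assoc)
    qed (simp add: f)
    from this[of r f f] this[of r] show ?thesis using c f
      by (intro bexI[of _ "\<lambda>z. f z + (\<Sum>i<r. c i * pb (a i) z)"]) auto
  qed
  obtain f' where f': "f' \<in> Cinf S" "Q f'" "\<And>g h. g \<in> Cinf S \<Longrightarrow> h \<in> Cinf S \<Longrightarrow> J f' g h = J f g h" using red[OF f(1)] by blast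
  obtain g' where g': "g' \<in> Cinf S" "Q g'" "\<And>f h. f \<in> Cinf S \<Longrightarrow> h \<in> Cinf S \<Longrightarrow> J g' f h = J g f h" using red[OF f(2)] by blast
  obtain h' where h': "h' \<in> Cinf S" "Q h'" "\<And>f g. f \<in> Cinf S \<Longrightarrow> g \<in> Cinf S \<Longrightarrow> J h' f g = J h f g" using red[OF f(3)] by blast
  \<comment> \<open>Cyclicity moves each slot to the front in turn, so replacement in the first slot
    is enough.\<close>
  have "J f g h = J f' g h" using f'(3) f by simp
  also have "\<dots> = J g h f'" by (rule cyc)
  also have "\<dots> = J g' h f'" using g'(3) f f' by simp
  also have "\<dots> = J h f' g'" by (rule cyc)
  also have "\<dots> = J h' f' g'" using h'(3) f' g' by simp
  also have "\<dots> = 0" using f' g' h' by (intro zero) auto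
  finally show ?thesis .
qed

subsection \<open>Basic Hamiltonian vector fields preserve both parts\<close>

lemma jac_S: "f \<in> Cinf S \<Longrightarrow> g \<in> Cinf S \<Longrightarrow> h \<in> Cinf S \<Longrightarrow> x \<in> pts S \<Longrightarrow> jac S \<pi>S \<pi>S f g h x = 0"
  using jacobi_S schouten_jac[of S \<pi>S \<pi>S f g h x] unfolding schouten_vanishes_def by fastforce

text \<open>The value of the Lie derivative of \<pi> along X_b on (df,dg), where X_b is the
  Hamiltonian vector field of the basic function b with respect to \<pi>_S.\<close>

definition defect :: "'a bivector \<Rightarrow> ('b \<Rightarrow> real) \<Rightarrow> ('a \<Rightarrow> real) \<Rightarrow> ('a \<Rightarrow> real) \<Rightarrow> 'a \<Rightarrow> real" where
  "defect \<pi> b f g x = Sb.br (pb b) (bracket S \<pi> f g) x - bracket S \<pi> (Sb.br (pb b) f) g x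
     - bracket S \<pi> f (Sb.br (pb b) g) x"

text \<open>By the Jacobi identity, X_b is a derivation of the bracket of \<pi>_S, and that bracket
  is the sum of the two parts.\<close>

lemma defect_sum:
  assumes b: "b \<in> Cinf M" and f: "f \<in> Cinf S" "g \<in> Cinf S" and x: "x \<in> pts S"
  shows "defect piV b f g x + defect piH b f g x = 0"
proof -
  note B = pb_Cinf[OF b]
  have e: "Sb.br (pb b) (Sb.br f g) x = Sb.br (pb b) (Vb.br f g) x + Sb.br (pb b) (H.br f g) x"
  proof -
    have "Sb.br f g = (\<lambda>y. Vb.br f g y + H.br f g y)" by (rule ext) (rule br_S)
    moreover have "Sb.br (\<lambda>y. Vb.br f g y + H.br f g y) (pb b) x = Sb.br (Vb.br f g) (pb b) x + Sb.br (H.br f g) (pb b) x"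
      by (intro Sb.br_add Vb.br_Cinf H.br_Cinf f)
    ultimately show ?thesis
      using Sb.br_skew[of "pb b" "Sb.br f g" x] Sb.br_skew[of "pb b" "Vb.br f g" x] Sb.br_skew[of "pb b" "H.br f g" x]
      by simp
  qed
  have m: "Sb.br (\<lambda>y. - Sb.br (pb b) g y) f x = Sb.br f (Sb.br (pb b) g) x"
    using Sb.br_minus[OF Sb.br_Cinf[OF B f(2)], of f x] Sb.br_skew[of f "Sb.br (pb b) g" x] by simp
  have gb: "Sb.br g (pb b) = (\<lambda>y. - Sb.br (pb b) g y)" by (rule ext) (rule Sb.br_skew)
  have "jac S \<pi>S \<pi>S (pb b) f g x = 0" by (rule jac_S[OF B f x])
  then have "Sb.br (pb b) (Sb.br f g) x = Sb.br (Sb.br (pb b) f) g x + Sb.br f (Sb.br (pb b) g) x"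
    unfolding jac_def gb m using Sb.br_skew[of "Sb.br f g" "pb b" x] by simp
  then show ?thesis
    unfolding defect_def e using br_S[of "Sb.br (pb b) f" g x] br_S[of f "Sb.br (pb b) g" x] by simp
qed

text \<open>Basic functions are Casimirs of \<pi>_V, and {b,c} is basic again.\<close>

lemma defect_V_basic:
  assumes b: "b \<in> Cinf M" "c \<in> Cinf M"
  shows "defect piV b (pb c) g x = 0"
proof -
  obtain e where e: "e \<in> Cinf M" "H.br (pb b) (pb c) = pb e" by (rule br_H_pb_pb[OF b])
  have "Sb.br (pb b) (pb c) = pb e" using e(2) br_H_pb[OF b(1)] by metis
  then show ?thesis
    using Sb.br_skew[of "pb b" "\<lambda>x. 0" x] Sb.br_zero by (simp add: defect_def br_V_pb[OF b(2)] br_V_pb[OF e(1)])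
qed

lemma defect_linear:
  assumes "smooth_biv S \<pi>" and b: "b \<in> Cinf M" and f: "f \<in> Cinf S" "f' \<in> Cinf S" "g \<in> Cinf S"
  shows "defect \<pi> b (\<lambda>y. f y + c * f' y) g x = defect \<pi> b f g x + c * defect \<pi> b f' g x"
proof -
  interpret P: smooth_biv S \<pi> by fact
  note B = pb_Cinf[OF b]
  have 1: "P.br (\<lambda>y. f y + c * f' y) k = (\<lambda>y. P.br f k y + c * P.br f' k y)" for k
    using f by (intro ext) (simp add: P.br_add P.br_cmult Cinf_cmult)
  have 2: "Sb.br k (\<lambda>y. h y + c * h' y) z = Sb.br k h z + c * Sb.br k h' z" if "h \<in> Cinf S" "h' \<in> Cinf S" for k h h' z
    using that Sb.br_add[OF that(1) Cinf_cmult[OF that(2), of c], of k z] Sb.br_cmult[OF that(2), of c k z]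
    by (simp add: Sb.br_skew[of k "\<lambda>y. h y + c * h' y"] Sb.br_skew[of k h] Sb.br_skew[of k h'])
  have 3: "Sb.br (pb b) (\<lambda>y. f y + c * f' y) = (\<lambda>z. Sb.br (pb b) f z + c * Sb.br (pb b) f' z)"
    by (rule ext) (rule 2[OF f(1,2)])
  have 4: "P.br (\<lambda>z. Sb.br (pb b) f z + c * Sb.br (pb b) f' z) g x = P.br (Sb.br (pb b) f) g x + c * P.br (Sb.br (pb b) f') g x"
    using f by (simp add: P.br_add P.br_cmult Cinf_cmult Sb.br_Cinf[OF B])
  show ?thesis
    unfolding defect_def 3 4 unfolding 1 using f
    by (subst 2) (auto simp: P.br_Cinf algebra_simps)
qed

lemma defect_skew:
  assumes P: "smooth_biv S \<pi>" and b: "b \<in> Cinf M" and f: "f \<in> Cinf S" "g \<in> Cinf S"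
  shows "defect \<pi> b g f x = - defect \<pi> b f g x"
proof -
  interpret P: smooth_biv S \<pi> by fact
  have e: "P.br g f = (\<lambda>y. - P.br f g y)" by (rule ext) (rule P.br_skew)
  have "Sb.br (pb b) (P.br g f) x = - Sb.br (pb b) (P.br f g) x"
    unfolding e using Sb.br_minus[OF P.br_Cinf[OF f], of "pb b" x]
      Sb.br_skew[of "pb b" "\<lambda>y. - P.br f g y" x] Sb.br_skew[of "pb b" "P.br f g" x] by simp
  then show ?thesis
    unfolding defect_def using P.br_skew[of "Sb.br (pb b) g" f x] P.br_skew[of g "Sb.br (pb b) f" x] by simp
qed

lemma defect_Cinf:
  assumes P: "smooth_biv S \<pi>" and b: "b \<in> Cinf M" and f: "f \<in> Cinf S" "g \<in> Cinf S"
  shows "defect \<pi> b f g \<in> Cinf S"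
  unfolding defect_def[abs_def] using smooth_biv.br_Cinf[OF P] Sb.br_Cinf pb_Cinf[OF b] f
  by (intro Cinf_diff) simp_all

text \<open>Tested at a regular point. If one argument is basic, the defect of \<pi>_H is minus that
  of \<pi>_V, which is 0; so both arguments may be replaced by functions whose differentials lie in
  the kernel of \<pi>_H.\<close>

lemma defect_H_zero:
  assumes b: "b \<in> Cinf M" and f: "f \<in> Cinf S" "g \<in> Cinf S" and x: "x \<in> pts S"
  shows "defect piH b f g x = 0"
proof (rule vanishes_if_regular[OF defect_Cinf[OF H.smooth_biv_axioms b f] _ x])
  fix x assume x: "x \<in> pts S" and reg: "regular x"
  note B = pb_Cinf[OF b]
  obtain r a where ad: "adapted r a x" by (rule regular_adapted[OF x reg])
  note a = adaptedD(1)[OF ad] and hat = adaptedD(2)[OF ad] and ker = adaptedD(3)[OF ad] and flat = adaptedD(4)[OF ad]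
  define Q where "Q f \<longleftrightarrow> (\<forall>j<r. H.br f (pb (a j)) x = 0)" for f
  have bas: "defect piH b (pb c) g x = 0" if "c \<in> Cinf M" "g \<in> Cinf S" for c g
    using defect_sum[OF b pb_Cinf[OF that(1)] that(2) x] defect_V_basic[OF b that(1)] by simp
  have red: "\<exists>f'\<in>Cinf S. Q f' \<and> (\<forall>g\<in>Cinf S. defect piH b f' g x = defect piH b f g x)" if f: "f \<in> Cinf S" for f
  proof -
    obtain c where c: "\<forall>j<r. H.br (\<lambda>z. f z + (\<Sum>i<r. c i * pb (a i) z)) (pb (a j)) x = 0" using hat[OF f] by blast
    have "(\<lambda>z. f z + (\<Sum>i<m. c i * pb (a i) z)) \<in> Cinf S \<and>
        defect piH b (\<lambda>z. f z + (\<Sum>i<m. c i * pb (a i) z)) g x = defect piH b f g x" if "m \<le> r" "g \<in> Cinf S" for g m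
      using that(1)
    proof (induction m)
      case (Suc m)
      let ?F = "\<lambda>z. f z + (\<Sum>i<m. c i * pb (a i) z)"
      have F: "?F \<in> Cinf S" "defect piH b ?F g x = defect piH b f g x" using Suc by auto
      have am: "a m \<in> Cinf M" using Suc.prems a by auto
      have "(\<lambda>z. ?F z + c m * pb (a m) z) \<in> Cinf S" by (rule Cinf_add[OF F(1) Cinf_cmult[OF pb_Cinf[OF am]]])
      moreover have "defect piH b (\<lambda>z. ?F z + c m * pb (a m) z) g x = defect piH b f g x"
        using defect_linear[OF H.smooth_biv_axioms b F(1) pb_Cinf[OF am] that(2)] bas[OF am that(2)] F(2) by simp
      ultimately show ?case by (simp add: add.assoc)
    qed (simp add: f)
    from this[of r f] this[of r] show ?thesis using c f unfolding Q_def
      by (intro bexI[of _ "\<lambda>z. f z + (\<Sum>i<r. c i * pb (a i) z)"]) auto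
  qed
  obtain f' where f': "f' \<in> Cinf S" "Q f'" "\<And>g. g \<in> Cinf S \<Longrightarrow> defect piH b f' g x = defect piH b f g x" using red[OF f(1)] by blast
  obtain g' where g': "g' \<in> Cinf S" "Q g'" "\<And>f. f \<in> Cinf S \<Longrightarrow> defect piH b g' f x = defect piH b g f x" using red[OF f(2)] by blast
  have "defect piH b f g x = defect piH b f' g x" using f'(3) f by simp
  also have "\<dots> = - defect piH b g f' x" by (rule defect_skew[OF H.smooth_biv_axioms b f(2) f'(1)])
  also have "\<dots> = - defect piH b g' f' x" using g'(3) f'(1) by simp
  \<comment> \<open>For kernel functions the first term is a derivative of {g',f'}_H, which vanishes
    to second order; each of the other two is a bracket with a kernel function.\<close>
  also have "defect piH b g' f' x = 0"
  proof -
    have "Sb.br (pb b) (H.br g' f') x = 0"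
      using Sb.br_vec[OF x H.br_Cinf[OF g'(1) f'(1)], of "pb b"] flat[OF g'(1) f'(1)] g'(2) f'(2) unfolding Q_def by simp
    moreover have "H.br (Sb.br (pb b) g') f' x = 0"
      using H.br_skew[of "Sb.br (pb b) g'" f' x] ker[OF f'(1) Sb.br_Cinf[OF B g'(1)]] f'(2) unfolding Q_def by simp
    moreover have "H.br g' (Sb.br (pb b) f') x = 0"
      using ker[OF g'(1) Sb.br_Cinf[OF B f'(1)]] g'(2) unfolding Q_def by simp
    ultimately show ?thesis by (simp add: defect_def)
  qed
  finally show "defect piH b f g x = 0" by simp
qed

lemma defect_V_zero:
  assumes "b \<in> Cinf M" "f \<in> Cinf S" "g \<in> Cinf S" "x \<in> pts S"
  shows "defect piV b f g x = 0"
  using defect_sum[OF assms] defect_H_zero[OF assms] by simp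

section \<open>Jacobi identities and compatibility of the two parts\<close>

lemma jac_HH_basic:
  assumes b: "b \<in> Cinf M" and f: "f \<in> Cinf S" "g \<in> Cinf S" and x: "x \<in> pts S"
  shows "jac S piH piH (pb b) f g x = 0"
proof -
  note B = pb_Cinf[OF b]
  have e: "H.br (pb b) h = Sb.br (pb b) h" for h by (rule br_H_pb[OF b])
  have gb: "H.br g (pb b) = (\<lambda>y. - Sb.br (pb b) g y)" by (rule ext) (use H.br_skew[of g "pb b"] in \<open>simp add: e\<close>)
  have m: "H.br (\<lambda>y. - Sb.br (pb b) g y) f x = H.br f (Sb.br (pb b) g) x"
    using H.br_minus[OF Sb.br_Cinf[OF B f(2)], of f x] H.br_skew[of f "Sb.br (pb b) g" x] by simp
  show ?thesis
    unfolding jac_def gb m unfolding e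
    using defect_H_zero[OF b f x] H.br_skew[of "H.br f g" "pb b" x] unfolding defect_def e by simp
qed

text \<open>The first summand reduces to -X_b{f,g}_V and the second to {X_b f,g}_V + {f,X_b g}_V;
  together they are minus the defect of \<pi>_V.\<close>

lemma jac_mixed_basic:
  assumes b: "b \<in> Cinf M" and f: "f \<in> Cinf S" "g \<in> Cinf S" and x: "x \<in> pts S"
  shows "jac S piH piV (pb b) f g x + jac S piV piH (pb b) f g x = 0"
proof -
  note B = pb_Cinf[OF b]
  have e: "H.br (pb b) h = Sb.br (pb b) h" for h by (rule br_H_pb[OF b])
  have gb: "H.br g (pb b) = (\<lambda>y. - Sb.br (pb b) g y)" by (rule ext) (use H.br_skew[of g "pb b"] in \<open>simp add: e\<close>)
  have m: "Vb.br (\<lambda>y. - Sb.br (pb b) g y) f x = Vb.br f (Sb.br (pb b) g) x"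
    using Vb.br_minus[OF Sb.br_Cinf[OF B f(2)], of f x] Vb.br_skew[of f "Sb.br (pb b) g" x] by simp
  have "jac S piH piV (pb b) f g x = - Sb.br (pb b) (Vb.br f g) x"
    unfolding jac_def br_V_pb[OF b] br_V_pb'[OF b] H.br_zero
    using H.br_skew[of "Vb.br f g" "pb b" x] by (simp add: e)
  moreover have "jac S piV piH (pb b) f g x = Vb.br (Sb.br (pb b) f) g x + Vb.br f (Sb.br (pb b) g) x"
    unfolding jac_def gb m unfolding e br_V_pb'[OF b] by simp
  ultimately show ?thesis using defect_V_zero[OF b f x] by (simp add: defect_def)
qed

text \<open>At a regular point all three arguments may be taken with differential in the kernel, and
  then the outer bracket of each term contains a kernel function.\<close>

lemma jac_HH_zero:
  assumes f: "f \<in> Cinf S" "g \<in> Cinf S" "h \<in> Cinf S" and x: "x \<in> pts S"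
  shows "jac S piH piH f g h x = 0"
proof (rule vanishes_if_regular[OF jac_Cinf[OF H.smooth_biv_axioms H.smooth_biv_axioms f] _ x])
  fix x assume x: "x \<in> pts S" and reg: "regular x"
  obtain r a where ad: "adapted r a x" by (rule regular_adapted[OF x reg])
  note a = adaptedD(1)[OF ad] and hat = adaptedD(2)[OF ad] and ker = adaptedD(3)[OF ad] and flat = adaptedD(4)[OF ad]
  show "jac S piH piH f g h x = 0"
  proof (rule regular_cyclic_zero[where J="\<lambda>f g h. jac S piH piH f g h x" and Q="\<lambda>f. \<forall>j<r. H.br f (pb (a j)) x = 0", OF hat a _ _ _ _ f])
    fix f g h assume f: "f \<in> Cinf S" "g \<in> Cinf S" "h \<in> Cinf S"
      and q: "\<forall>j<r. H.br f (pb (a j)) x = 0" "\<forall>j<r. H.br g (pb (a j)) x = 0" "\<forall>j<r. H.br h (pb (a j)) x = 0"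
    have "H.br (H.br u v) w x = 0" if "u \<in> Cinf S" "v \<in> Cinf S" "w \<in> Cinf S" "\<forall>j<r. H.br w (pb (a j)) x = 0" for u v w
      using ker[OF that(3) H.br_Cinf[OF that(1,2)] that(4)] H.br_skew[of "H.br u v" w x] by simp
    then show "jac S piH piH f g h x = 0" using f q by (simp add: jac_def)
  qed (auto simp: jac_HH_basic x jac_linear[OF H.smooth_biv_axioms H.smooth_biv_axioms] intro: jac_cyclic)
qed

text \<open>On kernel functions at a regular point, {{u,v}_V,w}_H vanishes because w is a kernel
  function, and {{u,v}_H,w}_V because it is a derivative of a function vanishing to second
  order.\<close>

lemma jac_mixed_zero:
  assumes f: "f \<in> Cinf S" "g \<in> Cinf S" "h \<in> Cinf S" and x: "x \<in> pts S"
  shows "jac S piH piV f g h x + jac S piV piH f g h x = 0"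
proof (rule vanishes_if_regular[where f="\<lambda>x. jac S piH piV f g h x + jac S piV piH f g h x", OF _ _ x])
  show "(\<lambda>x. jac S piH piV f g h x + jac S piV piH f g h x) \<in> Cinf S"
    by (intro Cinf_add jac_Cinf H.smooth_biv_axioms Vb.smooth_biv_axioms f)
  fix x assume x: "x \<in> pts S" and reg: "regular x"
  obtain r a where ad: "adapted r a x" by (rule regular_adapted[OF x reg])
  note a = adaptedD(1)[OF ad] and hat = adaptedD(2)[OF ad] and ker = adaptedD(3)[OF ad] and flat = adaptedD(4)[OF ad]
  show "jac S piH piV f g h x + jac S piV piH f g h x = 0"
  proof (rule regular_cyclic_zero[where J="\<lambda>f g h. jac S piH piV f g h x + jac S piV piH f g h x"
        and Q="\<lambda>f. \<forall>j<r. H.br f (pb (a j)) x = 0", OF hat a _ _ _ _ f])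
    fix f g h assume f: "f \<in> Cinf S" "g \<in> Cinf S" "h \<in> Cinf S"
      and q: "\<forall>j<r. H.br f (pb (a j)) x = 0" "\<forall>j<r. H.br g (pb (a j)) x = 0" "\<forall>j<r. H.br h (pb (a j)) x = 0"
    have "H.br (Vb.br u v) w x = 0" if "u \<in> Cinf S" "v \<in> Cinf S" "w \<in> Cinf S" "\<forall>j<r. H.br w (pb (a j)) x = 0" for u v w
      using ker[OF that(3) Vb.br_Cinf[OF that(1,2)] that(4)] H.br_skew[of "Vb.br u v" w x] by simp
    moreover have "Vb.br (H.br u v) w x = 0"
      if uvw: "u \<in> Cinf S" "v \<in> Cinf S" "w \<in> Cinf S" "\<forall>j<r. H.br u (pb (a j)) x = 0" "\<forall>j<r. H.br v (pb (a j)) x = 0" for u v w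
    proof -
      obtain V where V: "V \<in> T x" "\<forall>f\<in>Cinf S. Vb.br f w x = V f" by (rule Vb.br_vec_right[OF x uvw(3)])
      show ?thesis using V(2)[rule_format, OF H.br_Cinf[OF uvw(1,2)]] flat[OF uvw(1,2,4,5) V(1)] by simp
    qed
    ultimately show "jac S piH piV f g h x + jac S piV piH f g h x = 0" using f q by (simp add: jac_def)
  next
    fix f g h
    show "jac S piH piV f g h x + jac S piV piH f g h x = jac S piH piV g h f x + jac S piV piH g h f x"
      using jac_cyclic[of S piH piV f g h x] jac_cyclic[of S piV piH f g h x] by simp
  next
    fix f f' g h c assume "f \<in> Cinf S" "f' \<in> Cinf S" "g \<in> Cinf S" "h \<in> Cinf S"
    then show "jac S piH piV (\<lambda>y. f y + c * f' y) g h x + jac S piV piH (\<lambda>y. f y + c * f' y) g h x =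
        jac S piH piV f g h x + jac S piV piH f g h x + c * (jac S piH piV f' g h x + jac S piV piH f' g h x)"
      by (simp add: jac_linear[OF H.smooth_biv_axioms Vb.smooth_biv_axioms]
          jac_linear[OF Vb.smooth_biv_axioms H.smooth_biv_axioms] algebra_simps)
  qed (auto simp: jac_mixed_basic x)
qed

text \<open>The Jacobiator of \<pi>_S is the sum of the Jacobiators of the two parts and the mixed
  term, so this one vanishes with the others.\<close>

lemma jac_VV_zero:
  assumes f: "f \<in> Cinf S" "g \<in> Cinf S" "h \<in> Cinf S" and x: "x \<in> pts S"
  shows "jac S piV piV f g h x = 0"
proof -
  have split: "Sb.br (Sb.br u v) w x = Vb.br (Vb.br u v) w x + Vb.br (H.br u v) w x + H.br (Vb.br u v) w x + H.br (H.br u v) w x"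
    if "u \<in> Cinf S" "v \<in> Cinf S" for u v w
  proof -
    have "Sb.br u v = (\<lambda>y. Vb.br u v y + H.br u v y)" by (rule ext) (rule br_S)
    then have "Sb.br (Sb.br u v) w x = Sb.br (Vb.br u v) w x + Sb.br (H.br u v) w x"
      using Sb.br_add[OF Vb.br_Cinf[OF that] H.br_Cinf[OF that]] by simp
    then show ?thesis by (simp add: br_S[of "Vb.br u v"] br_S[of "H.br u v"])
  qed
  have "jac S \<pi>S \<pi>S f g h x = jac S piV piV f g h x + (jac S piH piV f g h x + jac S piV piH f g h x) + jac S piH piH f g h x"
    unfolding jac_def using split f by simp
  then show ?thesis using jac_S[OF f x] jac_HH_zero[OF f x] jac_mixed_zero[OF f x] by simp
qed

lemma poisson_piH: "poisson_structure S piH"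
  unfolding poisson_structure_def schouten_vanishes_def using smooth_piH jac_HH_zero by (simp add: schouten_jac)

lemma poisson_piV: "poisson_structure S piV"
  unfolding poisson_structure_def schouten_vanishes_def using smooth_piV jac_VV_zero by (simp add: schouten_jac)

lemma commuting: "schouten_vanishes S piV piH"
  unfolding schouten_vanishes_def using jac_mixed_zero by (simp add: schouten_jac add.commute)

lemma vertical_piV: "vertical_bivector S M p piV"
  using smooth_piV piV_wedge_vert by (simp add: vertical_bivector_def)

lemma piV_restricts: "restricts_to_fibres S \<pi>S M p piV"
  unfolding restricts_to_fibres_def
proof
  fix b assume "b \<in> pts M"
  then have "\<exists>(X :: ('a, 'e) mfd) \<pi>X. pts X = fibre S p b \<and> poisson_dirac X \<pi>X S \<pi>S"
    using PF by (simp add: poisson_fibres_def)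
  then obtain X :: "('a, 'e) mfd" and \<pi>X where X: "pts X = fibre S p b" "poisson_dirac X \<pi>X S \<pi>S" by blast
  then show "\<exists>(X :: ('a, 'e) mfd) \<pi>X. pts X = fibre S p b \<and> poisson_dirac X \<pi>X S \<pi>S \<and>
        (\<forall>x\<in>pts X. \<forall>\<xi>\<in>cotangent S x. \<forall>\<eta>\<in>cotangent S x.
           piV x \<xi> \<eta> = \<pi>X x (pull_covec X S id x \<xi>) (pull_covec X S id x \<eta>))"
    using piV_fibre[OF X] X by (intro exI[of _ X] exI[of _ \<pi>X] conjI ballI)
qed

lemma pencil: "orthogonal_pencil S \<pi>S M \<pi>M p"
  unfolding orthogonal_pencil_def
  apply (rule conjI[OF PS], rule exI[of _ piV], rule exI[of _ piH])
  apply (intro conjI ballI poisson_piV poisson_piH commuting vertical_piV horizontal_trivial)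
  apply (simp_all add: piH_def)
  done

end

section \<open>Hamiltonian curves\<close>

text \<open>A piece of a Hamiltonian curve inside a coordinate frame. The time set J is open and the
  Hamiltonian G is defined for all real times, so derivatives are two-sided; G is smooth jointly in
  the chart coordinates and in time.\<close>

locale curve_frame = B: smooth_biv S \<pi> + ch: mfd_chart S U \<phi> + fr: frame S N "dim (Model S)" y d
  for S :: "('a, 'e::euclidean_space) mfd" and \<pi> :: "'a bivector" and U :: "'a set" and \<phi> :: "'a \<Rightarrow> 'e"
    and N :: "'a set" and y :: "nat \<Rightarrow> 'a \<Rightarrow> real" and d :: "nat \<Rightarrow> 'a \<Rightarrow> 'a tvec" +
  fixes J :: "real set" and c :: "real \<Rightarrow> 'a" and G :: "real \<Rightarrow> 'a \<Rightarrow> real"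
  assumes NU: "N \<subseteq> U"
    and y_chart: "\<And>i x. i < dim (Model S) \<Longrightarrow> x \<in> N \<Longrightarrow> y i x = \<phi> x \<bullet> model_frame (Model S) i"
    and d_chart: "\<And>i x. x \<in> N \<Longrightarrow> d i x = ch.dirv x (model_frame (Model S) i)"
    and jacobi: "\<And>f g h x. f \<in> Cinf S \<Longrightarrow> g \<in> Cinf S \<Longrightarrow> h \<in> Cinf S \<Longrightarrow> x \<in> pts S \<Longrightarrow> jac S \<pi> \<pi> f g h x = 0"
    and J: "open J" and cN: "\<And>t. t \<in> J \<Longrightarrow> c t \<in> N"
    and G: "\<And>t. G t \<in> Cinf S" and G_smooth: "smooth_open (ch.dom N \<times> UNIV) (\<lambda>(z, t). ch.rep (G t) z)"
    and flow: "\<And>t h. t \<in> J \<Longrightarrow> h \<in> Cinf S \<Longrightarrow> ((\<lambda>s. h (c s)) has_real_derivative B.br (G t) h (c t)) (at t)"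
begin

abbreviation "n \<equiv> dim (Model S)"
abbreviation "e \<equiv> model_frame (Model S)"

text \<open>Joint smoothness in position and time, expressed in the chart; smoothness for each fixed
  time would not allow the family to be followed along the curve.\<close>

definition tfam :: "(real \<Rightarrow> 'a \<Rightarrow> real) \<Rightarrow> bool" where
  "tfam K \<longleftrightarrow> (\<forall>t. K t \<in> Cinf S) \<and> smooth_open (ch.dom N \<times> UNIV) (\<lambda>(z, t). ch.rep (K t) z)"

lemma open_N: "open (ch.dom N \<times> (UNIV :: real set))"
  by (intro open_Times ch.open_dom fr.N open_UNIV)

lemma tfam_const: assumes "h \<in> Cinf S" shows "tfam (\<lambda>t. h)"
proof -
  have "smooth_open (ch.dom N) (ch.rep h)"
    by (rule smooth_open_subset[OF ch.Cinf_rep[OF assms]])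
      (use fr.N_pts ch.open_dom[OF fr.N] in \<open>auto simp: ch.dom_iff\<close>)
  then have "smooth_open (ch.dom N \<times> UNIV) (\<lambda>w::'e \<times> real. ch.rep h (fst w))"
    by (rule smooth_open_compose[rotated]) (auto intro!: smooth_intros open_N)
  then show ?thesis using assms by (simp add: tfam_def case_prod_beta')
qed

lemma tfam_G: "tfam G" using G G_smooth by (simp add: tfam_def)

lemma partial_derivative:
  assumes K: "tfam K" and z: "w \<in> ch.dom N"
  shows "frechet_derivative (\<lambda>(z, t). ch.rep (K t) z) (at (w, t)) (v, 0) = frechet_derivative (ch.rep (K t)) (at w) v"
proof -
  let ?R = "\<lambda>(z, t). ch.rep (K t) z"
  have "(?R has_derivative frechet_derivative ?R (at (w, t))) (at (w, t))"
    by (rule smooth_open_has_derivative[of "ch.dom N \<times> UNIV"]) (use K z in \<open>auto simp: tfam_def\<close>)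
  moreover have "((\<lambda>z. (z, t)) has_derivative (\<lambda>v. (v, 0))) (at w)"
    by (auto intro!: derivative_eq_intros)
  ultimately have "((\<lambda>z. ?R (z, t)) has_derivative (\<lambda>v. frechet_derivative ?R (at (w, t)) (v, 0))) (at w)"
    using has_derivative_compose[of "\<lambda>z. (z, t)" "\<lambda>v. (v, 0)" w UNIV ?R] by simp
  from frechet_derivative_at[OF this] show ?thesis by (simp add: fun_eq_iff)
qed

lemma tfam_d:
  assumes K: "tfam K"
  shows "smooth_open (ch.dom N \<times> UNIV) (\<lambda>(z, t). ch.rep (\<lambda>x. d i x (K t)) z)"
proof -
  let ?R = "\<lambda>(z, t). ch.rep (K t) z"
  have "smooth_open (ch.dom N \<times> UNIV) (\<lambda>w. frechet_derivative ?R (at w) (e i, 0))"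
    by (rule smooth_open_derivative) (use K in \<open>simp add: tfam_def\<close>)
  \<comment> \<open>\<open>ch.rep\<close> evaluates at the point with coordinates P z, so the
    partial derivative is taken at P z and not at z.\<close>
  moreover have "smooth_open (ch.dom N \<times> (UNIV :: real set)) (\<lambda>w. (ch.P (fst w), snd w))"
    by (intro smooth_intros smooth_open_bounded_linear[OF bounded_linear_model_proj] open_N)
  moreover have "(ch.P (fst w), snd w) \<in> ch.dom N \<times> UNIV" if "w \<in> ch.dom N \<times> UNIV" for w :: "'e \<times> real"
    using that by (auto simp: ch.dom_iff ch.sub)
  ultimately have "smooth_open (ch.dom N \<times> UNIV) (\<lambda>w. frechet_derivative ?R (at (ch.P (fst w), snd w)) (e i, 0))"
    by - (rule smooth_open_compose[where W="ch.dom N \<times> UNIV" and g="\<lambda>w. frechet_derivative ?R (at w) (e i, 0)"])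
  then show ?thesis
  proof (rule smooth_open_cong)
    fix w :: "'e \<times> real" assume w: "w \<in> ch.dom N \<times> UNIV"
    obtain z t where [simp]: "w = (z, t)" by (cases w)
    define x where "x = inv_into U \<phi> (ch.P z)"
    have x: "x \<in> N" "x \<in> U" "\<phi> x = ch.P z" using w NU by (auto simp: ch.dom_iff x_def ch.chart_inv)
    have "\<phi> x \<in> ch.dom N" using x(1,2) ch.in_dom by blast
    from partial_derivative[OF K this, of t "e i"]
    show "frechet_derivative ?R (at (ch.P (fst w), snd w)) (e i, 0) = (case w of (z, t) \<Rightarrow> ch.rep (\<lambda>x. d i x (K t)) z)"
      using K x d_chart[OF x(1)] by (simp add: ch.dirv_def tfam_def ch.rep_def x_def[symmetric])
  qed
qed

lemma br_expand:
  assumes x: "x \<in> N" and f: "f \<in> Cinf S" shows "B.br f g x = (\<Sum>i<n. d i x f * B.br (y i) g x)"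
proof -
  have xS: "x \<in> pts S" using x fr.N_pts by blast
  show ?thesis
    using bivector.sum_left[OF B.at[OF xS], of "{..<n}" "\<lambda>i. dif S (y i) x" "dif S g x" "\<lambda>i. d i x f"] xS
    by (simp add: bracket_def fr.dif_expand[OF x f])
qed

lemma br_expand_right:
  assumes x: "x \<in> N" and f: "g \<in> Cinf S" shows "B.br f g x = (\<Sum>i<n. d i x g * B.br f (y i) x)"
proof -
  have "B.br f g x = - (\<Sum>i<n. d i x g * B.br (y i) f x)"
    using br_expand[OF assms, of f] B.br_skew[of f g x] by simp
  also have "\<dots> = (\<Sum>i<n. d i x g * (- B.br (y i) f x))" by (simp add: sum_negf)
  also have "\<dots> = (\<Sum>i<n. d i x g * B.br f (y i) x)"
    by (intro sum.cong refl arg_cong2[where f=times] B.br_skew[symmetric])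
  finally show ?thesis .
qed

lemma tfam_br:
  assumes K: "tfam K" and h: "h \<in> Cinf S" shows "tfam (\<lambda>t. B.br (K t) h)"
proof -
  have Kt: "K t \<in> Cinf S" for t using K by (simp add: tfam_def)
  have y: "smooth_open (ch.dom N \<times> UNIV) (\<lambda>(z, t::real). ch.rep (B.br (y i) h) z)" if "i < n" for i
    using tfam_const[OF B.br_Cinf[OF fr.y[OF that] h]] by (simp add: tfam_def)
  have "smooth_open (ch.dom N \<times> UNIV) (\<lambda>w. \<Sum>i<n. (case w of (z, t) \<Rightarrow> ch.rep (\<lambda>x. d i x (K t)) z) *
      (case w of (z, t) \<Rightarrow> ch.rep (B.br (y i) h) z))"
    using y by (intro smooth_open_sum smooth_open_mult tfam_d K open_N) auto
  then have "smooth_open (ch.dom N \<times> UNIV) (\<lambda>(z, t). ch.rep (B.br (K t) h) z)"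
  proof (rule smooth_open_cong)
    fix w :: "'e \<times> real" assume w: "w \<in> ch.dom N \<times> UNIV"
    obtain z t where [simp]: "w = (z, t)" by (cases w)
    show "(\<Sum>i<n. (case w of (z, t) \<Rightarrow> ch.rep (\<lambda>x. d i x (K t)) z) * (case w of (z, t) \<Rightarrow> ch.rep (B.br (y i) h) z))
        = (case w of (z, t) \<Rightarrow> ch.rep (B.br (K t) h) z)"
      using w br_expand[of "inv_into U \<phi> (ch.P z)" "K t" h] Kt by (simp add: ch.rep_def ch.dom_iff)
  qed
  then show ?thesis using Kt h by (simp add: tfam_def B.br_Cinf)
qed

lemma cU: "t \<in> J \<Longrightarrow> c t \<in> U" using cN NU by blast

text \<open>In coordinates the curve solves a differential equation whose right-hand side is smooth
  in position and time, so smooth functions along it are smooth in time.\<close>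

lemma smooth_along:
  assumes R: "smooth_open (ch.dom N \<times> UNIV) R"
  shows "smooth_open J (\<lambda>t. R (\<phi> (c t), t))"
proof (rule integral_curve_smooth[OF J _ _ _ R])
  let ?Y = "\<lambda>w. \<Sum>k<n. (case w of (z, t) \<Rightarrow> ch.rep (B.br (G t) (y k)) z) *\<^sub>R e k"
  show "smooth_open (ch.dom N \<times> UNIV) ?Y"
  proof (intro smooth_open_sum smooth_open_scaleR open_N smooth_open_const)
    fix k assume "k \<in> {..<n}"
    then have "tfam (\<lambda>t. B.br (G t) (y k))" by (intro tfam_br tfam_G fr.y) auto
    then show "smooth_open (ch.dom N \<times> UNIV) (\<lambda>w. case w of (z, t) \<Rightarrow> ch.rep (B.br (G t) (y k)) z)"
      by (simp add: tfam_def)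
  qed
  fix t assume t: "t \<in> J"
  show "(\<phi> (c t), t) \<in> ch.dom N \<times> UNIV" using cN[OF t] cU[OF t] by simp
  have "((\<lambda>s. \<Sum>k<n. y k (c s) *\<^sub>R e k) has_vector_derivative (\<Sum>k<n. B.br (G t) (y k) (c t) *\<^sub>R e k)) (at t)"
  proof (intro has_vector_derivative_sum)
    fix k assume "k \<in> {..<n}"
    then have "((\<lambda>s. y k (c s)) has_real_derivative B.br (G t) (y k) (c t)) (at t)" by (intro flow t fr.y) auto
    then show "((\<lambda>s. y k (c s) *\<^sub>R e k) has_vector_derivative B.br (G t) (y k) (c t) *\<^sub>R e k) (at t)"
      unfolding has_vector_derivative_def has_field_derivative_def
      by (auto intro!: derivative_eq_intros simp: mult.commute)
  qed
  moreover have "(\<Sum>k<n. y k (c s) *\<^sub>R e k) = \<phi> (c s)" if s: "s \<in> J" for s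
  proof -
    have "(\<Sum>k<n. y k (c s) *\<^sub>R e k) = ch.P (\<phi> (c s))"
      unfolding model_proj_def using y_chart[OF _ cN[OF s]] by (intro sum.cong) auto
    then show ?thesis using cU[OF s] by simp
  qed
  ultimately have "((\<lambda>s. \<phi> (c s)) has_vector_derivative (\<Sum>k<n. B.br (G t) (y k) (c t) *\<^sub>R e k)) (at t)"
    by (rule has_vector_derivative_transform_within_open[OF _ J t])
  then show "((\<lambda>s. \<phi> (c s)) has_vector_derivative ?Y (\<phi> (c t), t)) (at t)"
    using cU[OF t] by simp
qed

lemma tfam_along:
  assumes "tfam K" shows "smooth_open J (\<lambda>t. K t (c t))"
proof -
  have "smooth_open J (\<lambda>t. (case (\<phi> (c t), t) of (z, t) \<Rightarrow> ch.rep (K t) z))"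
    using assms by (intro smooth_along) (simp add: tfam_def)
  then show ?thesis by (rule smooth_open_cong) (use cN cU in auto)
qed

lemma tfam_d_along:
  assumes "tfam K" shows "smooth_open J (\<lambda>t. d i (c t) (K t))"
proof -
  have "smooth_open J (\<lambda>t. (case (\<phi> (c t), t) of (z, t) \<Rightarrow> ch.rep (\<lambda>x. d i x (K t)) z))"
    by (rule smooth_along[OF tfam_d[OF assms]])
  then show ?thesis by (rule smooth_open_cong) (use cN cU in auto)
qed

end

section \<open>Constancy of the rank along a Hamiltonian curve\<close>

locale rank_frame = curve_frame +
  fixes r :: nat and a :: "nat \<Rightarrow> 'a \<Rightarrow> real" and D :: "real \<Rightarrow> real" and E :: "nat \<Rightarrow> nat \<Rightarrow> real \<Rightarrow> real"
    and t0 :: real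
  assumes a: "\<And>i. i < r \<Longrightarrow> a i \<in> Cinf S"
    and D: "smooth_open J D" "\<And>t. t \<in> J \<Longrightarrow> D t \<noteq> 0"
    and E: "\<And>i j. i < r \<Longrightarrow> j < r \<Longrightarrow> smooth_open J (E i j)"
    and ED: "\<And>i j t. i < r \<Longrightarrow> j < r \<Longrightarrow> (\<Sum>k<r. E i k t * B.br (a k) (a j) (c t)) = (if i = j then D t else 0)"
    and t0: "t0 \<in> J"
    and span: "\<And>f g. f \<in> Cinf S \<Longrightarrow> (\<forall>j<r. B.br f (a j) (c t0) = 0) \<Longrightarrow> g \<in> Cinf S \<Longrightarrow> B.br f g (c t0) = 0"
begin

text \<open>\<open>E\<close> is a left inverse, up to the scalar \<open>D\<close>, of the Gram
  matrix along the curve, so the u_i are the coefficients of the projection of dg to the span of the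
  da_i. The matrix is invertible at all times in J, whereas \<open>span\<close> speaks of t0
  only.\<close>

definition u :: "('a \<Rightarrow> real) \<Rightarrow> nat \<Rightarrow> real \<Rightarrow> real" where
  "u g i t = (\<Sum>k<r. B.br g (a k) (c t) * E k i t) / D t"

text \<open>The coefficients are frozen: for fixed t this is one smooth function on S, orthogonal to
  all a_j at the point c(t). Brackets with it can therefore be differentiated along the
  curve.\<close>

definition hat :: "('a \<Rightarrow> real) \<Rightarrow> real \<Rightarrow> 'a \<Rightarrow> real" where
  "hat g t = (\<lambda>x. g x + (\<Sum>i<r. (- u g i t) * a i x))"

text \<open>The Schur complement of the Gram matrix of the \<open>a i\<close>, evaluated along the curve. The rank of the
  Poisson structure at a point of the curve is \<open>r\<close> if and only if it vanishes there.\<close>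

definition \<rho> :: "('a \<Rightarrow> real) \<Rightarrow> ('a \<Rightarrow> real) \<Rightarrow> real \<Rightarrow> real" where
  "\<rho> g h t = B.br g h (c t) - (\<Sum>i<r. u g i t * B.br (a i) h (c t))"

lemma cS: "t \<in> J \<Longrightarrow> c t \<in> pts S" using cN fr.N_pts by blast

lemma hat_Cinf: "g \<in> Cinf S \<Longrightarrow> hat g t \<in> Cinf S"
  unfolding hat_def by (intro Cinf_add Cinf_sum Cinf_cmult a) auto

lemma br_smooth: "g \<in> Cinf S \<Longrightarrow> h \<in> Cinf S \<Longrightarrow> smooth_open J (\<lambda>t. B.br g h (c t))"
  using tfam_along[OF tfam_const[OF B.br_Cinf]] by simp

lemma u_smooth: "g \<in> Cinf S \<Longrightarrow> i < r \<Longrightarrow> smooth_open J (u g i)"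
  unfolding u_def[abs_def]
  by (intro smooth_open_divide smooth_open_sum smooth_open_mult br_smooth a E D J) auto

lemma u_gram:
  assumes "t \<in> J" "j < r" shows "(\<Sum>i<r. u g i t * B.br (a i) (a j) (c t)) = B.br g (a j) (c t)"
proof -
  have "(\<Sum>i<r. (\<Sum>k<r. B.br g (a k) (c t) * E k i t) * B.br (a i) (a j) (c t))
      = (\<Sum>k<r. B.br g (a k) (c t) * (\<Sum>i<r. E k i t * B.br (a i) (a j) (c t)))"
    unfolding sum_distrib_left sum_distrib_right by (subst sum.swap) (simp add: mult.assoc)
  also have "\<dots> = (\<Sum>k<r. if k = j then B.br g (a k) (c t) * D t else 0)"
    using ED[OF _ assms(2)] by (intro sum.cong) auto
  also have "\<dots> = B.br g (a j) (c t) * D t" using assms(2) by simp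
  finally show ?thesis
    using D(2)[OF assms(1)] by (simp add: u_def sum_divide_distrib[symmetric])
qed

lemma br_hat: assumes g: "g \<in> Cinf S" shows "B.br (hat g t) h x = B.br g h x - (\<Sum>i<r. u g i t * B.br (a i) h x)"
proof -
  have "B.br (hat g t) h x = B.br g h x + B.br (\<lambda>x. \<Sum>i<r. (- u g i t) * a i x) h x"
    unfolding hat_def by (intro B.br_add Cinf_sum Cinf_cmult a g) auto
  also have "B.br (\<lambda>x. \<Sum>i<r. (- u g i t) * a i x) h x = (\<Sum>i<r. (- u g i t) * B.br (a i) h x)"
    by (intro B.br_sum a) auto
  finally show ?thesis by (simp add: sum_negf)
qed

lemma \<rho>_hat: "g \<in> Cinf S \<Longrightarrow> B.br (hat g t) h (c t) = \<rho> g h t"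
  by (simp add: br_hat \<rho>_def)

lemma \<rho>_a: "t \<in> J \<Longrightarrow> j < r \<Longrightarrow> \<rho> g (a j) t = 0"
  by (simp add: \<rho>_def u_gram)

lemma \<rho>_hat_hat:
  assumes g: "g \<in> Cinf S" and h: "h \<in> Cinf S" and t: "t \<in> J"
  shows "B.br (hat g t) (hat h t) (c t) = \<rho> g h t"
proof -
  have "B.br (a i) (hat g t) (c t) = 0" if "i < r" for i
    using B.br_skew[of "a i" "hat g t" "c t"] \<rho>_hat[OF g, of t "a i"] \<rho>_a[OF t that] by simp
  then have "B.br (hat h t) (hat g t) (c t) = B.br h (hat g t) (c t)"
    using br_hat[OF h, of t "hat g t" "c t"] by simp
  then show ?thesis
    using B.br_skew[of "hat g t" "hat h t" "c t"] B.br_skew[of "hat g t" h "c t"] \<rho>_hat[OF g, of t h] by simp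
qed

lemma \<rho>_skew:
  assumes g: "g \<in> Cinf S" and h: "h \<in> Cinf S" and t: "t \<in> J"
  shows "\<rho> h g t = - \<rho> g h t"
  using \<rho>_hat_hat[OF g h t] \<rho>_hat_hat[OF h g t] B.br_skew[of "hat h t" "hat g t" "c t"] by simp

lemma \<rho>_expand:
  assumes g: "g \<in> Cinf S" and h: "h \<in> Cinf S" and t: "t \<in> J"
  shows "\<rho> g h t = (\<Sum>m<n. d m (c t) h * \<rho> g (y m) t)"
  using br_expand_right[OF cN[OF t] h, of "hat g t"] \<rho>_hat[OF g] by simp

text \<open>\<rho> does not see multiples of the a_j, so it is unchanged at every time s, even when
  the hat is frozen at a different time t.\<close>

lemma \<rho>_hat_left:
  assumes g: "g \<in> Cinf S" and h: "h \<in> Cinf S" and s: "s \<in> J"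
  shows "\<rho> (hat g t) h s = \<rho> g h s"
proof -
  have z: "\<rho> (a j) h s = 0" if "j < r" for j
    using \<rho>_skew[OF h a[OF that] s] \<rho>_a[OF s that, of h] by simp
  have lin: "\<rho> (\<lambda>x. f x + w * f' x) h s = \<rho> f h s + w * \<rho> f' h s" if f: "f \<in> Cinf S" "f' \<in> Cinf S" for f f' w
  proof -
    have 1: "B.br (\<lambda>x. f x + w * f' x) k z = B.br f k z + w * B.br f' k z" for k z
      using f by (simp add: B.br_add B.br_cmult Cinf_cmult)
    have 2: "u (\<lambda>x. f x + w * f' x) i s = u f i s + w * u f' i s" for i
      unfolding u_def 1 by (simp add: sum.distrib sum_distrib_left add_divide_distrib algebra_simps)
    show ?thesis unfolding \<rho>_def 1 2 by (simp add: sum.distrib sum_distrib_left algebra_simps)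
  qed
  have "(\<lambda>x. g x + (\<Sum>i<m. (- u g i t) * a i x)) \<in> Cinf S \<and> \<rho> (\<lambda>x. g x + (\<Sum>i<m. (- u g i t) * a i x)) h s = \<rho> g h s"
    if "m \<le> r" for m
    using that
  proof (induction m)
    case (Suc m)
    let ?F = "\<lambda>x. g x + (\<Sum>i<m. (- u g i t) * a i x)"
    have F: "?F \<in> Cinf S" "\<rho> ?F h s = \<rho> g h s" using Suc by auto
    have m: "m < r" using Suc.prems by simp
    have "(\<lambda>x. ?F x + (- u g m t) * a m x) \<in> Cinf S" by (rule Cinf_add[OF F(1) Cinf_cmult[OF a[OF m]]])
    moreover have "\<rho> (\<lambda>x. ?F x + (- u g m t) * a m x) h s = \<rho> g h s"
      using lin[OF F(1) a[OF m], of "- u g m t"] z[OF m] F(2) by simp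
    ultimately show ?case unfolding sum.lessThan_Suc add.assoc by blast
  qed (simp add: g)
  from this[of r] show ?thesis by (simp add: hat_def)
qed

lemma \<rho>_hats:
  assumes g: "g \<in> Cinf S" and h: "h \<in> Cinf S" and s: "s \<in> J"
  shows "\<rho> (hat g t) (hat h t) s = \<rho> g h s"
  using \<rho>_hat_left[OF g hat_Cinf[OF h] s, of t t] \<rho>_skew[OF hat_Cinf[OF h] g s, of t]
    \<rho>_hat_left[OF h g s, of t] \<rho>_skew[OF h g s] by simp

text \<open>The components, in the coordinate frame, of the differential at c(t) of the bracket of G
  with the hat of g; they become the coefficients of the differential equation for \<rho>.\<close>

definition W :: "('a \<Rightarrow> real) \<Rightarrow> nat \<Rightarrow> real \<Rightarrow> real" where
  "W g m t = d m (c t) (B.br (G t) (hat g t))"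

lemma W_eq:
  assumes g: "g \<in> Cinf S" and t: "t \<in> J"
  shows "W g m t = d m (c t) (B.br (G t) g) - (\<Sum>i<r. u g i t * d m (c t) (B.br (G t) (a i)))"
proof -
  have dT: "d m (c t) \<in> tangent S (c t)" by (rule fr.d_tangent[OF cS[OF t]])
  have "B.br (G t) (hat g t) = (\<lambda>x. B.br (G t) g x + (\<Sum>i<r. (- u g i t) * B.br (G t) (a i) x))"
  proof
    fix x
    have "(\<Sum>i<r. u g i t * B.br (a i) (G t) x) = (\<Sum>i<r. (- u g i t) * B.br (G t) (a i) x)"
      using B.br_skew[of "a _" "G t"] by (intro sum.cong refl) simp
    then show "B.br (G t) (hat g t) x = B.br (G t) g x + (\<Sum>i<r. (- u g i t) * B.br (G t) (a i) x)"
      using br_hat[OF g, of t "G t" x] B.br_skew[of "G t" "hat g t" x] B.br_skew[of "G t" g x] by simp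
  qed
  then have "W g m t = d m (c t) (B.br (G t) g) + d m (c t) (\<lambda>x. \<Sum>i<r. (- u g i t) * B.br (G t) (a i) x)"
    unfolding W_def by (simp only:) (intro tangentD(1)[OF dT] B.br_Cinf G g Cinf_sum Cinf_cmult a, auto)
  also have "d m (c t) (\<lambda>x. \<Sum>i<r. (- u g i t) * B.br (G t) (a i) x)
      = (\<Sum>i<r. d m (c t) (\<lambda>x. (- u g i t) * B.br (G t) (a i) x))"
    by (intro tangent_fun_sum[OF dT] Cinf_cmult B.br_Cinf G a) auto
  also have "\<dots> = (\<Sum>i<r. (- u g i t) * d m (c t) (B.br (G t) (a i)))"
    by (intro sum.cong refl tangentD(2)[OF dT] B.br_Cinf G a) auto
  finally show ?thesis by (simp add: sum_negf)
qed

lemma W_smooth: assumes g: "g \<in> Cinf S" shows "smooth_open J (W g m)"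
proof -
  have "smooth_open J (\<lambda>t. d m (c t) (B.br (G t) g) - (\<Sum>i<r. u g i t * d m (c t) (B.br (G t) (a i))))"
    by (intro smooth_open_diff smooth_open_sum smooth_open_mult J tfam_d_along tfam_br tfam_G u_smooth g a) auto
  then show ?thesis by (rule smooth_open_cong) (simp add: W_eq[OF g])
qed

text \<open>Replacing g and h by their hats frozen at t leaves \<rho> unchanged at all times in J.
  Each correction term is then a product of two factors vanishing at t and has derivative 0 there;
  only {G,{g',h'}} survives, and the Jacobi identity turns it into a linear expression in
  \<rho>.\<close>

lemma \<rho>_derivative:
  assumes g: "g \<in> Cinf S" and h: "h \<in> Cinf S" and t: "t \<in> J"
  shows "((\<lambda>s. \<rho> g h s) has_real_derivative
    (\<Sum>m<n. W h m t * \<rho> g (y m) t) - (\<Sum>m<n. W g m t * \<rho> h (y m) t)) (at t)"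
proof -
  define g' h' where "g' = hat g t" and "h' = hat h t"
  have g': "g' \<in> Cinf S" and h': "h' \<in> Cinf S" by (simp_all add: g'_def h'_def hat_Cinf g h)
  have z: "B.br (a i) h' (c t) = 0" if "i < r" for i
    using B.br_skew[of "a i" h' "c t"] \<rho>_hat[OF h, of t "a i"] \<rho>_a[OF t that] by (simp add: h'_def)
  have uz: "u g' i t = 0" for i
    unfolding u_def g'_def using \<rho>_hat[OF g, of t "a _"] \<rho>_a[OF t] by simp
  have "((\<lambda>s. B.br g' h' (c s) - (\<Sum>i<r. u g' i s * B.br (a i) h' (c s))) has_real_derivative
     B.br (G t) (B.br g' h') (c t) - (\<Sum>i<r. 0)) (at t)"
  proof (intro DERIV_diff DERIV_sum flow[OF t] B.br_Cinf g' h')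
    fix i assume i: "i \<in> {..<r}"
    have "(u g' i has_derivative frechet_derivative (u g' i) (at t)) (at t)"
      by (rule smooth_open_has_derivative[OF u_smooth[OF g'] t]) (use i in auto)
    then obtain w where "(u g' i has_real_derivative w) (at t)"
      by (metis differentiable_def real_differentiable_def)
    moreover have "((\<lambda>s. B.br (a i) h' (c s)) has_real_derivative B.br (G t) (B.br (a i) h') (c t)) (at t)"
      using i by (intro flow[OF t] B.br_Cinf h' a) auto
    ultimately have "((\<lambda>s. u g' i s * B.br (a i) h' (c s)) has_real_derivative
        w * B.br (a i) h' (c t) + B.br (G t) (B.br (a i) h') (c t) * u g' i t) (at t)"
      by (rule DERIV_mult)
    then show "((\<lambda>s. u g' i s * B.br (a i) h' (c s)) has_real_derivative 0) (at t)"
      using z uz i by simp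
  qed
  then have "((\<lambda>s. \<rho> g' h' s) has_real_derivative B.br (G t) (B.br g' h') (c t)) (at t)"
    by (simp add: \<rho>_def)
  then have der: "((\<lambda>s. \<rho> g h s) has_real_derivative B.br (G t) (B.br g' h') (c t)) (at t)"
    by (rule has_field_derivative_transform_within_open[OF _ J t]) (simp add: g'_def h'_def \<rho>_hats g h)
  have e: "B.br (hat k t) (B.br (G t) (hat l t)) (c t) = (\<Sum>m<n. W l m t * \<rho> k (y m) t)"
    if "k \<in> Cinf S" "l \<in> Cinf S" for k l
    using \<rho>_expand[OF that(1) B.br_Cinf[OF G hat_Cinf[OF that(2)]] t] \<rho>_hat[OF that(1)] by (simp add: W_def)
  have "jac S \<pi> \<pi> g' h' (G t) (c t) = 0" by (intro jacobi g' h' G cS t)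
  moreover have "B.br h' (G t) = (\<lambda>x. - B.br (G t) h' x)" by (rule ext) (rule B.br_skew)
  ultimately have "B.br (G t) (B.br g' h') (c t) = B.br g' (B.br (G t) h') (c t) - B.br h' (B.br (G t) g') (c t)"
    unfolding jac_def
    using B.br_skew[of "B.br g' h'" "G t" "c t"] B.br_minus[OF B.br_Cinf[OF G h'], of t g' "c t"]
      B.br_skew[of g' "B.br (G t) h'" "c t"] B.br_skew[of h' "B.br (G t) g'" "c t"] by simp
  then show ?thesis using der e[OF g h] e[OF h g] by (simp add: g'_def h'_def)
qed

text \<open>The squares of \<rho> on pairs of coordinate functions sum to a function
  \<open>Nf\<close> with |Nf'| \<le> C Nf, because the equation for \<rho> is linear and
  homogeneous. It vanishes at t0 by the spanning hypothesis, so Gronwall's inequality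
  applies.\<close>

lemma \<rho>_vanishes:
  obtains \<epsilon> where "\<epsilon> > 0" "{t0 - \<epsilon><..<t0 + \<epsilon>} \<subseteq> J"
    "\<forall>t\<in>{t0 - \<epsilon><..<t0 + \<epsilon>}. \<forall>k<n. \<forall>l<n. \<rho> (y k) (y l) t = 0"
proof -
  \<comment> \<open>A closed ball inside J is compact, so the coefficients \<open>W\<close> are
    bounded on it.\<close>
  obtain \<epsilon> where eps: "\<epsilon> > 0" "cball t0 \<epsilon> \<subseteq> J" using open_contains_cball J t0 by blast
  let ?I = "{t0 - \<epsilon><..<t0 + \<epsilon>}"
  have IJ: "?I \<subseteq> cball t0 \<epsilon>" by (auto simp: dist_real_def)
  have "\<exists>b. \<forall>t\<in>cball t0 \<epsilon>. \<bar>W (y k) m t\<bar> \<le> b" if "k < n" for k m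
  proof -
    have "continuous_on (cball t0 \<epsilon>) (W (y k) m)"
      using continuous_on_subset[OF smooth_open_continuous_on[OF W_smooth[OF fr.y[OF that]]] eps(2)] .
    then have "bounded (W (y k) m ` cball t0 \<epsilon>)"
      by (intro compact_imp_bounded compact_continuous_image) auto
    then show ?thesis by (auto simp: bounded_iff)
  qed
  then have "\<forall>k m. \<exists>b. k < n \<longrightarrow> (\<forall>t\<in>cball t0 \<epsilon>. \<bar>W (y k) m t\<bar> \<le> b)" by blast
  then obtain b where b: "\<And>k m t. k < n \<Longrightarrow> t \<in> cball t0 \<epsilon> \<Longrightarrow> \<bar>W (y k) m t\<bar> \<le> b k m" by metis
  \<comment> \<open>Summing the individual bounds gives one bound for all indices, without a maximum
    over a possibly empty set.\<close>
  define b' where "b' = (\<Sum>k<n. \<Sum>m<n. \<bar>b k m\<bar>)"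
  have b'0: "b' \<ge> 0" unfolding b'_def by (intro sum_nonneg) auto
  have b': "\<bar>W (y k) m t\<bar> \<le> b'" if "k < n" "m < n" "t \<in> cball t0 \<epsilon>" for k m t
  proof -
    have "\<bar>W (y k) m t\<bar> \<le> \<bar>b k m\<bar>" using b[OF that(1,3), of m] by linarith
    also have "\<dots> \<le> (\<Sum>m<n. \<bar>b k m\<bar>)" using that by (intro member_le_sum) auto
    also have "\<dots> \<le> b'" unfolding b'_def using that
      by (intro member_le_sum[of k "{..<n}" "\<lambda>k. \<Sum>m<n. \<bar>b k m\<bar>"] sum_nonneg) auto
    finally show ?thesis .
  qed
  define Nf where "Nf t = (\<Sum>k<n. \<Sum>l<n. (\<rho> (y k) (y l) t)\<^sup>2)" for t
  have sq: "(\<rho> (y k) (y l) t)\<^sup>2 \<le> Nf t" if "k < n" "l < n" for k l t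
  proof -
    have "(\<rho> (y k) (y l) t)\<^sup>2 \<le> (\<Sum>l<n. (\<rho> (y k) (y l) t)\<^sup>2)" using that by (intro member_le_sum) auto
    also have "\<dots> \<le> Nf t" unfolding Nf_def using that
      by (intro member_le_sum[of k "{..<n}" "\<lambda>k. \<Sum>l<n. (\<rho> (y k) (y l) t)\<^sup>2"] sum_nonneg) auto
    finally show ?thesis .
  qed
  have pr: "\<bar>w * (\<rho> (y k) (y l) t * \<rho> (y i) (y j) t)\<bar> \<le> b' * Nf t"
    if "k < n" "l < n" "i < n" "j < n" "\<bar>w\<bar> \<le> b'" for w k l i j t
  proof -
    have "\<bar>\<rho> (y k) (y l) t * \<rho> (y i) (y j) t\<bar> \<le> ((\<rho> (y k) (y l) t)\<^sup>2 + (\<rho> (y i) (y j) t)\<^sup>2) / 2"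
      using sum_squares_bound[of "\<bar>\<rho> (y k) (y l) t\<bar>" "\<bar>\<rho> (y i) (y j) t\<bar>"] by (simp add: abs_mult)
    also have "\<dots> \<le> Nf t" using sq[OF that(1,2), of t] sq[OF that(3,4), of t] by simp
    finally have "\<bar>\<rho> (y k) (y l) t * \<rho> (y i) (y j) t\<bar> \<le> Nf t" .
    then show ?thesis unfolding abs_mult[of w] using that(5) by (intro mult_mono) auto
  qed
  define \<rho>' where "\<rho>' k l t = (\<Sum>m<n. W (y l) m t * \<rho> (y k) (y m) t) - (\<Sum>m<n. W (y k) m t * \<rho> (y l) (y m) t)" for k l t
  define N' where "N' t = (\<Sum>k<n. \<Sum>l<n. 2 * (\<rho>' k l t * \<rho> (y k) (y l) t))" for t
  have Nd: "(Nf has_real_derivative N' t) (at t)" if "t \<in> ?I" for t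
    unfolding Nf_def[abs_def] N'_def
  proof (intro DERIV_sum)
    fix k l assume kl: "k \<in> {..<n}" "l \<in> {..<n}"
    have tJ: "t \<in> J" using that IJ eps by blast
    have "((\<lambda>s. \<rho> (y k) (y l) s) has_real_derivative \<rho>' k l t) (at t)"
      unfolding \<rho>'_def using kl by (intro \<rho>_derivative fr.y tJ) auto
    from DERIV_power[OF this, of 2]
    show "((\<lambda>s. (\<rho> (y k) (y l) s)\<^sup>2) has_real_derivative 2 * (\<rho>' k l t * \<rho> (y k) (y l) t)) (at t)"
      by (simp add: mult_ac)
  qed
  \<comment> \<open>\<rho>' consists of two sums of n terms, each at most b' Nf after multiplication
    by \<rho>; the remaining factor 2 comes from differentiating the square.\<close>
  have summand: "\<bar>2 * (\<rho>' k l t * \<rho> (y k) (y l) t)\<bar> \<le> 4 * real n * b' * Nf t"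
    if kl: "k < n" "l < n" and t: "t \<in> cball t0 \<epsilon>" for k l t
  proof -
    have "\<bar>\<Sum>m<n. W (y l) m t * (\<rho> (y k) (y m) t * \<rho> (y k) (y l) t)\<bar> \<le> (\<Sum>m<n. b' * Nf t)"
      using kl b' t by (intro order_trans[OF sum_abs] sum_mono pr) auto
    moreover have "\<bar>\<Sum>m<n. W (y k) m t * (\<rho> (y l) (y m) t * \<rho> (y k) (y l) t)\<bar> \<le> (\<Sum>m<n. b' * Nf t)"
      using kl b' t by (intro order_trans[OF sum_abs] sum_mono pr) auto
    moreover have "\<rho>' k l t * \<rho> (y k) (y l) t = (\<Sum>m<n. W (y l) m t * (\<rho> (y k) (y m) t * \<rho> (y k) (y l) t))
       - (\<Sum>m<n. W (y k) m t * (\<rho> (y l) (y m) t * \<rho> (y k) (y l) t))"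
      unfolding \<rho>'_def by (simp add: sum_distrib_right left_diff_distrib mult.assoc)
    ultimately have "\<bar>\<rho>' k l t * \<rho> (y k) (y l) t\<bar> \<le> 2 * (real n * (b' * Nf t))" by simp
    then show ?thesis by (simp add: abs_mult mult_ac)
  qed
  have bound: "\<bar>N' t\<bar> \<le> (real n * real n * (4 * real n * b')) * Nf t" if "t \<in> ?I" for t
  proof -
    have "\<bar>N' t\<bar> \<le> (\<Sum>k<n. \<bar>\<Sum>l<n. 2 * (\<rho>' k l t * \<rho> (y k) (y l) t)\<bar>)" unfolding N'_def by (rule sum_abs)
    also have "\<dots> \<le> (\<Sum>k<n. \<Sum>l<n. \<bar>2 * (\<rho>' k l t * \<rho> (y k) (y l) t)\<bar>)" by (intro sum_mono sum_abs)
    also have "\<dots> \<le> (\<Sum>k<n. \<Sum>l<n. 4 * real n * b' * Nf t)" using that IJ by (intro sum_mono summand) auto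
    finally show ?thesis by (simp add: mult.assoc)
  qed
  have N0: "Nf t0 = 0"
  proof -
    have "\<rho> (y k) (y l) t0 = 0" if "k < n" "l < n" for k l
    proof -
      have "\<forall>j<r. B.br (hat (y k) t0) (a j) (c t0) = 0" using \<rho>_hat[OF fr.y[OF that(1)]] \<rho>_a[OF t0] by simp
      from span[OF hat_Cinf[OF fr.y[OF that(1)]] this fr.y[OF that(2)]]
      show ?thesis using \<rho>_hat[OF fr.y[OF that(1)]] by simp
    qed
    then show ?thesis by (simp add: Nf_def)
  qed
  have "\<rho> (y k) (y l) t = 0" if t: "t \<in> ?I" and "k < n" "l < n" for k l t
  proof -
    have "Nf t = 0"
    proof (rule gronwall_zero[OF Nd bound _ _ N0 t])
      show "0 \<le> Nf t" for t unfolding Nf_def by (intro sum_nonneg) auto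
      show "t0 \<in> ?I" using eps by simp
    qed
    then show ?thesis using sq[OF that(2,3), of t] by simp
  qed
  then show thesis using that[OF eps(1)] IJ eps(2) by blast
qed

text \<open>Where \<rho> vanishes, {y_k,h} is the combination of the {a_i,h} with coefficients u_i
  of y_k; expanding dG in the coordinates gives \<mu>.\<close>

lemma hamiltonian_combination:
  obtains \<epsilon> \<mu> where "\<epsilon> > 0" "ball t0 \<epsilon> \<subseteq> J" "\<forall>i<r. smooth_open (ball t0 \<epsilon>) (\<mu> i)"
    "\<forall>t\<in>ball t0 \<epsilon>. \<forall>h\<in>Cinf S. B.br (G t) h (c t) = (\<Sum>i<r. \<mu> i t * B.br (a i) h (c t))"
proof -
  obtain \<epsilon> where eps: "\<epsilon> > 0" "{t0 - \<epsilon><..<t0 + \<epsilon>} \<subseteq> J"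
    and z: "\<forall>t\<in>{t0 - \<epsilon><..<t0 + \<epsilon>}. \<forall>k<n. \<forall>l<n. \<rho> (y k) (y l) t = 0" by (rule \<rho>_vanishes) blast
  have I: "{t0 - \<epsilon><..<t0 + \<epsilon>} = ball t0 \<epsilon>" by (auto simp: dist_real_def)
  define \<mu> where "\<mu> i t = (\<Sum>k<n. d k (c t) (G t) * u (y k) i t)" for i t
  show thesis
  proof (rule that[of \<epsilon> \<mu>])
    show "\<epsilon> > 0" "ball t0 \<epsilon> \<subseteq> J" using eps I by auto
    show "\<forall>i<r. smooth_open (ball t0 \<epsilon>) (\<mu> i)"
    proof (intro allI impI)
      fix i assume "i < r"
      then have "smooth_open J (\<mu> i)" unfolding \<mu>_def[abs_def]
        by (intro smooth_open_sum smooth_open_mult tfam_d_along tfam_G u_smooth fr.y J) auto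
      then show "smooth_open (ball t0 \<epsilon>) (\<mu> i)" by (rule smooth_open_subset) (use eps I in auto)
    qed
    show "\<forall>t\<in>ball t0 \<epsilon>. \<forall>h\<in>Cinf S. B.br (G t) h (c t) = (\<Sum>i<r. \<mu> i t * B.br (a i) h (c t))"
    proof (intro ballI)
      fix t h assume t: "t \<in> ball t0 \<epsilon>" and h: "h \<in> Cinf S"
      have tJ: "t \<in> J" using t eps I by auto
      have "\<rho> (y k) h t = 0" if "k < n" for k
        using \<rho>_expand[OF fr.y[OF that] h tJ] z t I that by simp
      then have yk: "B.br (y k) h (c t) = (\<Sum>i<r. u (y k) i t * B.br (a i) h (c t))" if "k < n" for k
        using that by (simp add: \<rho>_def)
      have "B.br (G t) h (c t) = (\<Sum>k<n. d k (c t) (G t) * (\<Sum>i<r. u (y k) i t * B.br (a i) h (c t)))"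
        using br_expand[OF cN[OF tJ] G, of t h] yk by simp
      also have "\<dots> = (\<Sum>i<r. \<mu> i t * B.br (a i) h (c t))"
        unfolding \<mu>_def sum_distrib_left sum_distrib_right by (subst sum.swap) (simp add: mult.assoc)
      finally show "B.br (G t) h (c t) = (\<Sum>i<r. \<mu> i t * B.br (a i) h (c t))" .
    qed
  qed
qed

end

section \<open>Time-dependent functions with compact support\<close>

lemma Cc_timeD:
  "f \<in> Cc_time M \<Longrightarrow> (U, \<phi>) \<in> Atlas M \<Longrightarrow> smooth_on (\<phi> ` U \<times> {0..1}) (\<lambda>(z, t). f (inv_into U \<phi> z) t)"
  unfolding Cc_time_def by fast

text \<open>K \<times> [0,1] is compact, and closed by the Hausdorff property, so it contains the
  closure of the set where f is nonzero.\<close>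

lemma Cc_timeI:
  assumes M: "smooth_manifold M"
    and f: "\<And>U \<phi>. (U, \<phi>) \<in> Atlas M \<Longrightarrow> smooth_on (\<phi> ` U \<times> {0..1}) (\<lambda>(z, t). f (inv_into U \<phi> z) t)"
    and K: "compactin (Top M) K" "\<And>x t. x \<in> pts M \<Longrightarrow> t \<in> {0..1} \<Longrightarrow> f x t \<noteq> 0 \<Longrightarrow> x \<in> K"
  shows "f \<in> Cc_time M"
proof -
  let ?I = "top_of_set {0..1::real}"
  let ?P = "prod_topology (Top M) ?I"
  have c: "compactin ?P (K \<times> {0..1})"
    by (auto simp: compactin_Times K(1) compactin_subtopology)
  have "Hausdorff_space ?P"
    using M by (auto simp: Hausdorff_space_prod_topology smooth_manifold_def intro: Hausdorff_space_subtopology)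
  then have cl: "closedin ?P (K \<times> {0..1})" using compactin_imp_closedin c by blast
  have "?P closure_of {(x, t). x \<in> pts M \<and> t \<in> {0..1} \<and> f x t \<noteq> 0} \<subseteq> K \<times> {0..1}"
    by (rule closure_of_minimal[OF _ cl]) (use K(2) in auto)
  then have "compactin ?P (?P closure_of {(x, t). x \<in> pts M \<and> t \<in> {0..1} \<and> f x t \<noteq> 0})"
    by (rule closed_compactin[OF c]) simp
  then show ?thesis unfolding Cc_time_def using f by fast
qed

lemma Cc_time_slice:
  assumes M: "smooth_manifold M" and f: "f \<in> Cc_time M" and t: "t \<in> {0..1}"
  shows "pullback_fun M id (\<lambda>y. f y t) \<in> Cinf M"
proof -
  have "smooth_fun_on M (pts M) (\<lambda>y. f y t)"
    unfolding smooth_fun_on_def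
  proof clarify
    fix U \<phi> assume ch: "(U, \<phi>) \<in> Atlas M"
    have "smooth_on (\<phi> ` U) (\<lambda>z. (\<lambda>(z, t). f (inv_into U \<phi> z) t) (z, t))"
      by (rule smooth_on_compose[OF _ Cc_timeD[OF f ch]]) (use t in \<open>auto intro!: smooth_intros\<close>)
    then show "smooth_on (\<phi> ` (U \<inter> pts M)) ((\<lambda>y. f y t) \<circ> inv_into U \<phi>)"
      by (auto simp: o_def intro: smooth_on_subset)
  qed
  from Cinf_restrict[OF this M] show ?thesis unfolding pullback_fun_def id_apply .
qed

text \<open>Finitely many bump functions cover C. Two of them are merged by 1 - (1 - \<beta>)(1 -
  \<gamma>), which is 1 wherever one of them is, so no division is involved.\<close>

lemma cutoff_compact:
  assumes M: "smooth_manifold M" and C: "compactin (Top M) C"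
  obtains \<beta> W K where "\<beta> \<in> Cinf M" "openin (Top M) W" "C \<subseteq> W" "\<forall>y\<in>W. \<beta> y = 1"
    "compactin (Top M) K" "{y. \<beta> y \<noteq> 0} \<subseteq> K"
proof -
  define good where "good N \<longleftrightarrow> openin (Top M) N \<and>
    (\<exists>\<beta> K. \<beta> \<in> Cinf M \<and> (\<forall>y\<in>N. \<beta> y = 1) \<and> compactin (Top M) K \<and> {y. \<beta> y \<noteq> 0} \<subseteq> K)" for N
  have "\<exists>N. good N \<and> x \<in> N" if x: "x \<in> pts M" for x
  proof -
    obtain \<beta> N K where b: "\<beta> \<in> Cinf M" "openin (Top M) N" "x \<in> N" "N \<subseteq> K"
      "\<forall>y\<in>N. \<beta> y = 1" "compactin (Top M) K" "K \<subseteq> pts M" "{y. \<beta> y \<noteq> 0} \<subseteq> K"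
      using bump_function[OF M openin_topspace x] by blast
    then have "good N" unfolding good_def by (intro conjI exI[of _ \<beta>] exI[of _ K])
    with b(3) show ?thesis by blast
  qed
  then have cov: "C \<subseteq> \<Union>(Collect good)" using compactin_subset_topspace[OF C] by blast
  have "\<forall>N\<in>Collect good. openin (Top M) N" by (simp add: good_def)
  then obtain \<F> where F: "finite \<F>" "\<F> \<subseteq> Collect good" "C \<subseteq> \<Union>\<F>"
    using C cov unfolding compactin_def by meson
  have "good (\<Union>\<F>)" using F(1,2)
  proof (induction \<F> rule: finite_induct)
    case empty
    show ?case unfolding good_def by (intro conjI exI[of _ "\<lambda>x. 0"] exI[of _ "{}"]) (auto simp: Cinf_zero)
  next
    case (insert N \<F>)
    obtain \<beta> K where b: "openin (Top M) N" "\<beta> \<in> Cinf M" "\<forall>y\<in>N. \<beta> y = 1" "compactin (Top M) K" "{y. \<beta> y \<noteq> 0} \<subseteq> K"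
      using insert.prems unfolding good_def by auto
    obtain \<gamma> L where g: "openin (Top M) (\<Union>\<F>)" "\<gamma> \<in> Cinf M" "\<forall>y\<in>\<Union>\<F>. \<gamma> y = 1" "compactin (Top M) L" "{y. \<gamma> y \<noteq> 0} \<subseteq> L"
      using insert.IH insert.prems unfolding good_def by auto
    have "(\<lambda>x. \<beta> x + \<gamma> x - \<beta> x * \<gamma> x) \<in> Cinf M" by (intro Cinf_intros b g)
    moreover have "\<forall>y\<in>\<Union>(insert N \<F>). \<beta> y + \<gamma> y - \<beta> y * \<gamma> y = 1" using b(3) g(3) by auto
    moreover have "compactin (Top M) (K \<union> L)" by (rule compactin_Un[OF b(4) g(4)])
    moreover have "{y. \<beta> y + \<gamma> y - \<beta> y * \<gamma> y \<noteq> 0} \<subseteq> K \<union> L" using b(5) g(5) by force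
    moreover have "openin (Top M) (\<Union>(insert N \<F>))" using b(1) g(1) by auto
    ultimately show ?case unfolding good_def
      by (intro conjI exI[of _ "\<lambda>x. \<beta> x + \<gamma> x - \<beta> x * \<gamma> x"] exI[of _ "K \<union> L"])
  qed
  then show thesis
    unfolding good_def by (elim conjE exE) (rule that[OF _ _ F(3)])
qed

text \<open>Checked on the preimages of charts of M. The pullback need not have compact support, so
  it is in general no element of \<open>Cc_time S\<close>.\<close>

lemma smooth_time_pullback:
  assumes S: "smooth_manifold S" and M: "smooth_manifold M" and p: "smooth_map S M p"
    and f: "f \<in> Cc_time M" and ch: "(U, \<phi>) \<in> Atlas S"
  shows "smooth_on (\<phi> ` U \<times> {0..1}) (\<lambda>(z, t). f (p (inv_into U \<phi> z)) t)"
proof (rule smooth_on_local)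
  interpret U: mfd_chart S U \<phi> using S ch by unfold_locales
  fix w :: "_ \<times> real" assume w: "w \<in> \<phi> ` U \<times> {0..1}"
  then obtain x0 t0 where x0: "x0 \<in> U" "w = (\<phi> x0, t0)" by auto
  have "p x0 \<in> pts M" using p x0(1) U.U_pts by (auto simp: smooth_map_def continuous_map_def)
  then obtain V \<psi> where V: "mfd_chart M V \<psi>" "p x0 \<in> V" by (rule chart_at[OF M])
  interpret cm: chart_map S U \<phi> M V \<psi> p
    by (intro chart_map.intro chart_map_axioms.intro V(1) p U.mfd_chart_axioms)
  let ?A = "{x \<in> pts S. p x \<in> V}"
  let ?O = "U.dom ?A \<times> (UNIV :: real set)"
  have O: "open ?O" by (intro open_Times U.open_dom cm.openin_pre open_UNIV)
  have wO: "w \<in> ?O" using x0 V(2) U.U_pts by auto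
  have sub: "\<phi> ` U \<times> {0..1} \<inter> ?O \<subseteq> \<phi> ` {x \<in> U. p x \<in> V} \<times> {0..1}"
    using U.P_image by (auto simp: U.dom_iff)
  have "smooth_on (\<phi> ` {x \<in> U. p x \<in> V}) (\<psi> \<circ> p \<circ> inv_into U \<phi>)"
    using p ch cm.V.chart unfolding smooth_map_def by fast
  then have 1: "smooth_on (\<phi> ` {x \<in> U. p x \<in> V} \<times> {0..1}) (\<lambda>w. (\<psi> (p (inv_into U \<phi> (fst w))), snd w))"
    by (intro smooth_intros smooth_on_compose[where f=fst and g="\<lambda>z. \<psi> (p (inv_into U \<phi> z))" and T="\<phi> ` {x \<in> U. p x \<in> V}"])
      (auto simp: o_def)
  have "smooth_on (\<phi> ` {x \<in> U. p x \<in> V} \<times> {0..1})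
      (\<lambda>w. (\<lambda>(z, t). f (inv_into V \<psi> z) t) (\<psi> (p (inv_into U \<phi> (fst w))), snd w))"
    by (rule smooth_on_compose[OF 1 Cc_timeD[OF f cm.V.chart]]) auto
  then have "smooth_on (\<phi> ` {x \<in> U. p x \<in> V} \<times> {0..1}) (\<lambda>(z, t). f (p (inv_into U \<phi> z)) t)"
    by (rule smooth_on_cong) auto
  then show "\<exists>W. open W \<and> w \<in> W \<and> smooth_on (\<phi> ` U \<times> {0..1} \<inter> W) (\<lambda>(z, t). f (p (inv_into U \<phi> z)) t)"
    using O wO smooth_on_subset[OF _ sub] by blast
qed

text \<open>Reparametrising by \<open>ramp\<close> extends a Hamiltonian curve on $[0,1]$ to all of \<open>\<real>\<close>, so that no one-sided
  derivatives occur.\<close>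

definition ramp :: "real \<Rightarrow> real" where "ramp t = smooth_step (2 - t)"

lemma ramp: "ramp 0 = 0" "ramp 1 = 1" "ramp t \<in> {0..1}"
  using smooth_step_props[of "2 - t"] smooth_step_props[of 2] smooth_step_props[of 1] by (auto simp: ramp_def)

lemma smooth_ramp: "smooth_open UNIV ramp"
  unfolding ramp_def[abs_def]
  by (rule smooth_open_compose[OF _ smooth_smooth_step]) (auto intro!: smooth_intros)

definition ramp' :: "real \<Rightarrow> real" where "ramp' t = frechet_derivative ramp (at t) 1"

lemma smooth_ramp': "smooth_open UNIV ramp'"
  unfolding ramp'_def[abs_def] by (rule smooth_open_derivative[OF smooth_ramp])

lemma ramp_derivative: "(ramp has_real_derivative ramp' t) (at t)"
proof -
  have d: "(ramp has_derivative frechet_derivative ramp (at t)) (at t)"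
    by (rule smooth_open_has_derivative[OF smooth_ramp]) simp
  then obtain w where w: "(ramp has_real_derivative w) (at t)"
    by (metis differentiable_def real_differentiable_def)
  then have "frechet_derivative ramp (at t) = times w"
    using frechet_derivative_at[of ramp "times w" t] by (simp add: has_field_derivative_def)
  with w show ?thesis by (simp add: ramp'_def)
qed

text \<open>Balls of radius \<epsilon>/4 cover [0,1], and the bump of radius \<epsilon>/2 is 1 on
  them. The sum is only made positive; the normalisation is left to the place of use.\<close>

lemma partition_of_unity_real:
  fixes \<epsilon> :: "real \<Rightarrow> real"
  assumes "\<And>s. \<epsilon> s > 0"
  obtains T and \<theta> :: "real \<Rightarrow> real \<Rightarrow> real" where "finite T" "\<And>s. smooth_open UNIV (\<theta> s)" "\<And>s t. \<bar>t - s\<bar> \<ge> \<epsilon> s / 2 \<Longrightarrow> \<theta> s t = 0"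
    "\<And>t. t \<in> {0..1} \<Longrightarrow> (\<Sum>s\<in>T. \<theta> s t) > 0"
proof -
  have cov: "{0..1} \<subseteq> (\<Union>s\<in>UNIV. ball s (\<epsilon> s / 4))"
  proof
    fix s :: real
    have "s \<in> ball s (\<epsilon> s / 4)" using assms[of s] by simp
    then show "s \<in> (\<Union>s\<in>UNIV. ball s (\<epsilon> s / 4))" by blast
  qed
  obtain T where T: "finite T" "{0..1} \<subseteq> (\<Union>s\<in>T. ball s (\<epsilon> s / 4))"
    by (rule compactE_image[OF compact_Icc _ cov]) auto
  show thesis
  proof (rule that[OF T(1), of "\<lambda>s. bump s (\<epsilon> s / 2)"])
    show "smooth_open UNIV (bump s (\<epsilon> s / 2))" for s by (rule smooth_bump)
    show "bump s (\<epsilon> s / 2) t = 0" if "\<bar>t - s\<bar> \<ge> \<epsilon> s / 2" for s t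
      using that assms[of s] by (intro bump_props(2)) auto
    fix t :: real assume "t \<in> {0..1}"
    then obtain s where s: "s \<in> T" "t \<in> ball s (\<epsilon> s / 4)" using T by blast
    have "bump s (\<epsilon> s / 2) t = 1"
      using s(2) assms[of s] by (intro bump_props(1)) (auto simp: dist_real_def abs_minus_commute)
    then have "0 < bump s (\<epsilon> s / 2) t" by simp
    also have "\<dots> \<le> (\<Sum>s\<in>T. bump s (\<epsilon> s / 2) t)"
      using s(1) T(1) assms by (intro member_le_sum bump_props(3)) auto
    finally show "(\<Sum>s\<in>T. bump s (\<epsilon> s / 2) t) > 0" .
  qed
qed

text \<open>Beyond distance \<epsilon>/2 from s the factor \<theta> is 0; the gap between
  \<epsilon>/2 and \<epsilon> makes the two open sets that cover the line overlap.\<close>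

lemma smooth_extend_by_zero:
  fixes \<theta> \<mu> :: "real \<Rightarrow> real"
  assumes e: "\<epsilon> > 0" and th: "smooth_open UNIV \<theta>" "\<And>t. \<bar>t - s\<bar> \<ge> \<epsilon> / 2 \<Longrightarrow> \<theta> t = 0" and mu: "smooth_open (ball s \<epsilon>) \<mu>"
  shows "smooth_open UNIV (\<lambda>t. if t \<in> ball s \<epsilon> then \<theta> t * \<mu> t else 0)" (is "smooth_open _ ?w")
proof (rule smooth_openI_local[OF open_UNIV])
  fix t :: real
  show "\<exists>W. t \<in> W \<and> smooth_open W ?w"
  proof (cases "t \<in> ball s \<epsilon>")
    case True
    have "smooth_open (ball s \<epsilon>) (\<lambda>t. \<theta> t * \<mu> t)"
      by (intro smooth_open_mult mu smooth_open_subset[OF th(1)]) auto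
    then have "smooth_open (ball s \<epsilon>) ?w" by (rule smooth_open_cong) simp
    with True show ?thesis by blast
  next
    case False
    have "smooth_open (- cball s (\<epsilon> / 2)) (\<lambda>t::real. 0 :: real)" by (intro smooth_intros) auto
    then have "smooth_open (- cball s (\<epsilon> / 2)) ?w"
      by (rule smooth_open_cong) (use th(2) in \<open>auto simp: dist_real_def abs_minus_commute\<close>)
    moreover have "t \<in> - cball s (\<epsilon> / 2)" using False e by auto
    ultimately show ?thesis by blast
  qed
qed

section \<open>The leaves of the horizontal part\<close>

lemma (in smooth_biv) br_local:
  assumes "f \<in> Cinf M" "f' \<in> Cinf M" "openin (Top M) N" "x \<in> N" "\<And>y. y \<in> N \<Longrightarrow> f y = f' y"
  shows "br f g x = br f' g x"
proof -
  have "dif M f x = dif M f' x"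
    using tangent_local[OF M _ assms] by (auto simp: dif_def)
  then show ?thesis by (simp add: bracket_def)
qed

context smooth_fib
begin

text \<open>Repeated extension by hyperbolic pairs must stop, since the size is bounded by the
  dimension. This works at every point, regular or not.\<close>

lemma spanning_family:
  assumes x: "x \<in> pts S"
  obtains r a where "\<forall>i<r. a i \<in> Cinf M" "gram_inj r a x" "spans r a x"
proof (rule ccontr)
  assume no: "\<not> thesis"
  have "\<exists>a. (\<forall>i<2*k. a i \<in> Cinf M) \<and> gram_inj (2*k) a x" for k
  proof (induction k)
    case 0 then show ?case by (auto simp: gram_inj_def)
  next
    case (Suc k)
    then obtain a where a: "\<forall>i<2*k. a i \<in> Cinf M" "gram_inj (2*k) a x" by blast
    have "\<not> spans (2*k) a x" using no that a by blast
    from gram_inj_extend[OF x a this] show ?case by (metis add_2_eq_Suc' mult_Suc_right add.commute)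
  qed
  from this[of "Suc (dim (Model S))"] obtain a where
    "\<forall>i<2 * Suc (dim (Model S)). a i \<in> Cinf M" "gram_inj (2 * Suc (dim (Model S))) a x" by (elim exE conjE)
  from gram_inj_bound[OF x this] show False by simp
qed

lemma pb_time:
  assumes f: "f \<in> Cc_time M" and t: "t \<in> {0..1}" shows "pb (\<lambda>b. f b t) \<in> Cinf S"
proof -
  have "pb (\<lambda>b. f b t) = pb (pullback_fun M id (\<lambda>b. f b t))"
    using p_pts by (auto simp: pullback_fun_def)
  then show ?thesis using pb_Cinf[OF Cc_time_slice[OF smM f t]] by simp
qed

lemma br_H_pb_time:
  assumes f: "f \<in> Cc_time M" and t: "t \<in> {0..1}"
  shows "H.br (pb (\<lambda>b. f b t)) g = Sb.br (pb (\<lambda>b. f b t)) g"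
proof -
  have "pb (\<lambda>b. f b t) = pb (pullback_fun M id (\<lambda>b. f b t))"
    using p_pts by (auto simp: pullback_fun_def)
  then show ?thesis using br_H_pb[OF Cc_time_slice[OF smM f t]] by simp
qed

text \<open>f \<circ> p is in general not compactly supported on S. The image of the curve is
  compact, and a cut-off that is 1 near it leaves the Hamiltonian vector field along the curve
  unchanged.\<close>

lemma SH_leaf_le: "SH_leaf S \<pi>S M p x0 \<subseteq> symplectic_leaf S piH x0"
proof
  fix x1 assume "x1 \<in> SH_leaf S \<pi>S M p x0"
  then obtain f c where f: "f \<in> Cc_time M" and c: "pathin (Top S) c" "c 0 = x0" "c 1 = x1"
    and d: "\<forall>t\<in>{0..1}. \<forall>h\<in>Cinf S. ((\<lambda>s. h (c s)) has_real_derivative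
      ham S \<pi>S (pb (\<lambda>b. f b t)) (c t) h) (at t within {0..1})"
    unfolding SH_leaf_def flows_to_def by blast
  have cI: "compactin (Top S) (c ` {0..1})"
    using c(1) image_compactin[of "top_of_set {0..1}" "{0..1}" "Top S" c] by (auto simp: pathin_def compactin_subtopology)
  obtain \<beta> W K where b: "\<beta> \<in> Cinf S" "openin (Top S) W" "c ` {0..1} \<subseteq> W" "\<forall>y\<in>W. \<beta> y = 1"
    "compactin (Top S) K" "{y. \<beta> y \<noteq> 0} \<subseteq> K" by (rule cutoff_compact[OF smS cI])
  define F where "F y t = \<beta> y * f (p y) t" for y t
  have F: "F \<in> Cc_time S"
  proof (rule Cc_timeI[OF smS _ b(5)])
    fix U \<phi> assume ch: "(U, \<phi>) \<in> Atlas S"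
    have "smooth_on (\<phi> ` (U \<inter> pts S)) (\<beta> \<circ> inv_into U \<phi>)" by (rule smooth_fun_onD[OF CinfD(1)[OF b(1)] ch])
    moreover have "U \<inter> pts S = U" using ch smS mfd_chart.U_pts[of S U \<phi>] by (auto simp: mfd_chart_def)
    ultimately have "smooth_on (\<phi> ` U) (\<lambda>z. \<beta> (inv_into U \<phi> z))" by (simp add: o_def)
    then have "smooth_on (\<phi> ` U \<times> {0..1}) (\<lambda>w::_ \<times> real. \<beta> (inv_into U \<phi> (fst w)))"
      by (rule smooth_on_compose[rotated]) (auto intro!: smooth_intros)
    then have "smooth_on (\<phi> ` U \<times> {0..1}) (\<lambda>w. \<beta> (inv_into U \<phi> (fst w)) * (case w of (z, t) \<Rightarrow> f (p (inv_into U \<phi> z)) t))"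
      by (rule smooth_on_mult[OF _ smooth_time_pullback[OF smS smM smp f ch]])
    then show "smooth_on (\<phi> ` U \<times> {0..1}) (\<lambda>(z, t). F (inv_into U \<phi> z) t)"
      by (rule smooth_on_cong) (auto simp: F_def)
  next
    fix x t assume "F x t \<noteq> 0" then show "x \<in> K" using b(6) by (auto simp: F_def)
  qed
  have "((\<lambda>s. h (c s)) has_real_derivative ham S piH (pullback_fun S id (\<lambda>y. F y t)) (c t) h) (at t within {0..1})"
    if t: "t \<in> {0..1}" and h: "h \<in> Cinf S" for t h
  proof -
    have cW: "c t \<in> W" using b(3) t by blast
    then have cS: "c t \<in> pts S" using openin_subset[OF b(2)] by blast
    have eq: "pullback_fun S id (\<lambda>y. F y t) y = pb (\<lambda>b. f b t) y" if "y \<in> W" for y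
      using that b(4) by (simp add: pullback_fun_def F_def)
    have "H.br (pullback_fun S id (\<lambda>y. F y t)) h (c t) = H.br (pb (\<lambda>b. f b t)) h (c t)"
      by (rule H.br_local[OF Cc_time_slice[OF smS F t] pb_time[OF f t] b(2) cW eq])
    also have "\<dots> = Sb.br (pb (\<lambda>b. f b t)) h (c t)" by (simp add: br_H_pb_time[OF f t])
    finally show ?thesis using d t h cS by (simp add: ham_def bracket_def sharp_def)
  qed
  then show "x1 \<in> symplectic_leaf S piH x0"
    unfolding symplectic_leaf_def flows_to_def using F c by blast
qed

text \<open>A family of basic functions that is nondegenerate and spanning at c(t0) stays
  nondegenerate along a piece of the curve, and constancy of the rank keeps it spanning there. So
  the velocity is a combination of basic Hamiltonian vector fields with coefficients smooth in
  time.\<close>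

lemma flow_combination:
  fixes c :: "real \<Rightarrow> 'a" and G :: "real \<Rightarrow> 'a \<Rightarrow> real" and t0 :: real
  assumes c: "continuous_map euclideanreal (Top S) c"
    and G: "\<And>t. G t \<in> Cinf S"
    and G_smooth: "\<And>U \<phi>. (U, \<phi>) \<in> Atlas S \<Longrightarrow> smooth_on (\<phi> ` U \<times> UNIV) (\<lambda>(z, t). G t (inv_into U \<phi> z))"
    and flow: "\<And>t h. h \<in> Cinf S \<Longrightarrow> ((\<lambda>s. h (c s)) has_real_derivative H.br (G t) h (c t)) (at t)"
  obtains \<epsilon> and r :: nat and b K \<mu> where "\<epsilon> > 0" "\<forall>i<r. b i \<in> Cinf M" "compactin (Top M) K" "\<forall>i<r. \<forall>y. b i y \<noteq> 0 \<longrightarrow> y \<in> K"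
    "\<forall>i<r. smooth_open (ball t0 \<epsilon>) (\<mu> i)"
    "\<forall>t\<in>ball t0 \<epsilon>. \<forall>h\<in>Cinf S. H.br (G t) h (c t) = (\<Sum>i<r. \<mu> i t * H.br (pb (b i)) h (c t))"
proof -
  have cS: "c t \<in> pts S" for t using c by (auto simp: continuous_map_def)
  obtain r a where aC: "\<forall>i<r. a i \<in> Cinf M" and inj: "gram_inj r a (c t0)" and sp: "spans r a (c t0)"
    by (rule spanning_family[OF cS[of t0]])
  obtain D e where D: "D \<in> Cinf S" "D (c t0) \<noteq> 0" and eC: "\<And>i j. i < r \<Longrightarrow> j < r \<Longrightarrow> e i j \<in> Cinf S"
    and e: "\<And>x i j. x \<in> pts S \<Longrightarrow> i < r \<Longrightarrow> j < r \<Longrightarrow> (\<Sum>k<r. e i k x * H.br (pb (a k)) (pb (a j)) x) = (if i = j then D x else 0)"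
    by (rule gram_adjugate[OF cS aC inj]) blast
  obtain U \<phi> where U: "mfd_chart S U \<phi>" "c t0 \<in> U" by (rule chart_at[OF smS cS[of t0]])
  interpret U: mfd_chart S U \<phi> by (rule U(1))
  obtain N y d where N: "frame S N (dim (Model S)) y d" "c t0 \<in> N" "N \<subseteq> U"
    "\<forall>i<dim (Model S). \<forall>x\<in>N. y i x = \<phi> x \<bullet> model_frame (Model S) i"
    "\<forall>i. \<forall>x\<in>N. d i x = U.dirv x (model_frame (Model S) i)" by (rule U.chart_frame[OF U(2)])
  have oN: "openin (Top S) N" using N(1) by (rule frame.N)
  \<comment> \<open>Cuts the basic functions down to compact support in M without changing them near
    p(c(t0)).\<close>
  obtain \<beta> B K where b: "\<beta> \<in> Cinf M" "openin (Top M) B" "p (c t0) \<in> B" "B \<subseteq> K"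
    "\<forall>y\<in>B. \<beta> y = 1" "compactin (Top M) K" "K \<subseteq> pts M" "{y. \<beta> y \<noteq> 0} \<subseteq> K"
    by (rule bump_function[OF smM openin_topspace p_pts[OF cS[of t0]]])
  define pB where "pB = {x \<in> pts S. p x \<in> B}"
  have pB: "openin (Top S) pB"
    unfolding pB_def using smp b(2) by (intro openin_continuous_map_preimage[of "Top S" "Top M"]) (auto simp: smooth_map_def)
  \<comment> \<open>The region where the frame is valid, the Gram matrix is invertible and the
    cut-off pulled back from M is 1.\<close>
  define N0 where "N0 = N \<inter> {x \<in> pts S. D x \<in> - {0}} \<inter> pB"
  have N0: "openin (Top S) N0"
    unfolding N0_def
    by (intro openin_Int oN pB smooth_fun_on_openin[OF smS CinfD(1)[OF D(1)]]) (auto simp: open_Compl)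
  define J where "J = {t. c t \<in> N0}"
  have J: "open J" using openin_continuous_map_preimage[OF c N0] by (simp add: J_def)
  have t0: "t0 \<in> J" using N(2) D(2) b(3) cS by (simp add: J_def N0_def pB_def)
  have domN: "open (U.dom N \<times> (UNIV :: real set))" by (intro open_Times U.open_dom oN open_UNIV)
  interpret curve_frame S piH U \<phi> N y d J c G
  proof (intro curve_frame.intro curve_frame_axioms.intro H.smooth_biv_axioms U(1) N(1) N(3) J G flow)
    show "y i x = \<phi> x \<bullet> model_frame (Model S) i" if "i < dim (Model S)" "x \<in> N" for i x using N(4) that by blast
    show "d i x = U.dirv x (model_frame (Model S) i)" if "x \<in> N" for i x using N(5) that by blast
    show "jac S piH piH f g h x = 0" if "f \<in> Cinf S" "g \<in> Cinf S" "h \<in> Cinf S" "x \<in> pts S" for f g h x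
      by (rule jac_HH_zero[OF that])
    show "c t \<in> N" if "t \<in> J" for t using that by (simp add: J_def N0_def)
    have "smooth_on (U.dom N \<times> UNIV) (\<lambda>w::'e \<times> real. (\<lambda>(z, t). G t (inv_into U \<phi> z)) (U.P (fst w), snd w))"
      by (rule smooth_on_compose[OF _ G_smooth[OF U.chart]])
        (auto simp: U.dom_iff intro!: smooth_on_Pair smooth_on_snd smooth_on_id
          smooth_on_compose[OF smooth_on_fst[OF smooth_on_id] smooth_on_bounded_linear[OF bounded_linear_model_proj, of UNIV]])
    then show "smooth_open (U.dom N \<times> UNIV) (\<lambda>(z, t). U.rep (G t) z)"
      unfolding smooth_on_open[OF domN] by (rule smooth_open_cong) (auto simp: U.rep_def)
  qed
  have along: "smooth_open J (\<lambda>t. h (c t))" if "h \<in> Cinf S" for h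
    by (rule tfam_along[OF tfam_const[OF that]])
  interpret rank_frame S piH U \<phi> N y d J c G r "\<lambda>i. pb (a i)" "\<lambda>t. D (c t)" "\<lambda>i j t. e i j (c t)" t0
  proof (intro rank_frame.intro rank_frame_axioms.intro curve_frame_axioms t0 along D(1))
    show "pb (a i) \<in> Cinf S" if "i < r" for i using aC that pb_Cinf by blast
    show "D (c t) \<noteq> 0" if "t \<in> J" for t using that by (simp add: J_def N0_def)
    show "e i j \<in> Cinf S" if "i < r" "j < r" for i j by (rule eC[OF that])
    show "(\<Sum>k<r. e i k (c t) * H.br (pb (a k)) (pb (a j)) (c t)) = (if i = j then D (c t) else 0)"
      if "i < r" "j < r" for i j t by (rule e[OF cS that])
    show "H.br f g (c t0) = 0" if "f \<in> Cinf S" "\<forall>j<r. H.br f (pb (a j)) (c t0) = 0" "g \<in> Cinf S" for f g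
      using sp that unfolding spans_def by blast
  qed
  obtain \<epsilon> \<mu> where eps: "\<epsilon> > 0" "ball t0 \<epsilon> \<subseteq> J" "\<forall>i<r. smooth_open (ball t0 \<epsilon>) (\<mu> i)"
    and comb: "\<forall>t\<in>ball t0 \<epsilon>. \<forall>h\<in>Cinf S. H.br (G t) h (c t) = (\<Sum>i<r. \<mu> i t * H.br (pb (a i)) h (c t))"
    by (rule hamiltonian_combination)
  define b' where "b' i = (\<lambda>z. \<beta> z * a i z)" for i
  have b'C: "\<forall>i<r. b' i \<in> Cinf M" unfolding b'_def using aC b(1) by (auto intro!: Cinf_mult)
  have "H.br (pb (a i)) h (c t) = H.br (pb (b' i)) h (c t)" if i: "i < r" and t: "t \<in> ball t0 \<epsilon>" for i h t
  proof (rule H.br_local[OF pb_Cinf pb_Cinf pB])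
    show "a i \<in> Cinf M" "b' i \<in> Cinf M" using aC b'C i by auto
    show "c t \<in> pB" using t eps(2) by (auto simp: J_def N0_def)
    show "pb (a i) z = pb (b' i) z" if "z \<in> pB" for z
      using that b(5) by (simp add: pB_def pullback_fun_def b'_def)
  qed
  then have comb': "\<forall>t\<in>ball t0 \<epsilon>. \<forall>h\<in>Cinf S. H.br (G t) h (c t) = (\<Sum>i<r. \<mu> i t * H.br (pb (b' i)) h (c t))"
    using comb by simp
  have "\<forall>i<r. \<forall>z. b' i z \<noteq> 0 \<longrightarrow> z \<in> K" using b(8) by (auto simp: b'_def)
  from that[OF eps(1) b'C b(6) this eps(3) comb'] show thesis .
qed

text \<open>The local combinations depend on time only through their coefficients, so a partition of
  unity in t glues them to one time-dependent function on M, whose support lies over a finite union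
  of compact sets.\<close>

lemma flow_basic:
  fixes c :: "real \<Rightarrow> 'a" and G :: "real \<Rightarrow> 'a \<Rightarrow> real"
  assumes c: "continuous_map euclideanreal (Top S) c"
    and G: "\<And>t. G t \<in> Cinf S"
    and G_smooth: "\<And>U \<phi>. (U, \<phi>) \<in> Atlas S \<Longrightarrow> smooth_on (\<phi> ` U \<times> UNIV) (\<lambda>(z, t). G t (inv_into U \<phi> z))"
    and flow: "\<And>t h. h \<in> Cinf S \<Longrightarrow> ((\<lambda>s. h (c s)) has_real_derivative H.br (G t) h (c t)) (at t)"
  obtains f where "f \<in> Cc_time M"
    "\<forall>t\<in>{0..1}. \<forall>h\<in>Cinf S. H.br (G t) h (c t) = H.br (pb (\<lambda>b. f b t)) h (c t)"
proof -
  define P where "P s \<epsilon> r b K \<mu> \<longleftrightarrow> \<epsilon> > 0 \<and> (\<forall>i<r. b i \<in> Cinf M) \<and> compactin (Top M) K \<and>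
     (\<forall>i<r. \<forall>y. b i y \<noteq> 0 \<longrightarrow> y \<in> K) \<and> (\<forall>i<r. smooth_open (ball s \<epsilon>) (\<mu> i)) \<and>
     (\<forall>t\<in>ball s \<epsilon>. \<forall>h\<in>Cinf S. H.br (G t) h (c t) = (\<Sum>i<r. \<mu> i t * H.br (pb (b i)) h (c t)))"
    for s \<epsilon> :: real and r :: nat and b K and \<mu> :: "nat \<Rightarrow> real \<Rightarrow> real"
  have "\<forall>s. \<exists>q. case q of (\<epsilon>, r, b, K, \<mu>) \<Rightarrow> P s \<epsilon> r b K \<mu>"
  proof
    fix s
    show "\<exists>q. case q of (\<epsilon>, r, b, K, \<mu>) \<Rightarrow> P s \<epsilon> r b K \<mu>"
    proof (rule flow_combination[OF c G G_smooth flow, of s])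
      fix \<epsilon> and r :: nat and b K \<mu> assume "\<epsilon> > 0" "\<forall>i<r. b i \<in> Cinf M" "compactin (Top M) K" "\<forall>i<r. \<forall>y. b i y \<noteq> 0 \<longrightarrow> y \<in> K"
        "\<forall>i<r. smooth_open (ball s \<epsilon>) (\<mu> i)"
        "\<forall>t\<in>ball s \<epsilon>. \<forall>h\<in>Cinf S. H.br (G t) h (c t) = (\<Sum>i<r. \<mu> i t * H.br (pb (b i)) h (c t))"
      then have "P s \<epsilon> r b K \<mu>" unfolding P_def by blast
      then show ?thesis by (intro exI[of _ "(\<epsilon>, r, b, K, \<mu>)"]) simp
    qed auto
  qed
  then obtain q where q: "\<forall>s. case q s of (\<epsilon>, r, b, K, \<mu>) \<Rightarrow> P s \<epsilon> r b K \<mu>" by (rule choice[THEN exE])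
  define \<epsilon> r b K \<mu> where "\<epsilon> s = fst (q s)" and "r s = fst (snd (q s))" and "b s = fst (snd (snd (q s)))"
    and "K s = fst (snd (snd (snd (q s))))" and "\<mu> s = snd (snd (snd (snd (q s))))" for s
  have P: "P s (\<epsilon> s) (r s) (b s) (K s) (\<mu> s)" for s
    using q[THEN spec, of s] by (simp add: \<epsilon>_def r_def b_def K_def \<mu>_def split: prod.splits)
  have eps: "\<epsilon> s > 0" and bC: "i < r s \<Longrightarrow> b s i \<in> Cinf M" and K: "compactin (Top M) (K s)"
    and bK: "i < r s \<Longrightarrow> b s i z \<noteq> 0 \<Longrightarrow> z \<in> K s" and \<mu>: "i < r s \<Longrightarrow> smooth_open (ball s (\<epsilon> s)) (\<mu> s i)"
    and comb: "t \<in> ball s (\<epsilon> s) \<Longrightarrow> h \<in> Cinf S \<Longrightarrow> H.br (G t) h (c t) = (\<Sum>i<r s. \<mu> s i t * H.br (pb (b s i)) h (c t))"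
    for s i z t h using P[of s] unfolding P_def by blast+
  obtain T and \<theta> :: "real \<Rightarrow> real \<Rightarrow> real" where T: "finite T" and \<theta>: "\<And>s. smooth_open UNIV (\<theta> s)"
    "\<And>s t. \<bar>t - s\<bar> \<ge> \<epsilon> s / 2 \<Longrightarrow> \<theta> s t = 0" and pos: "\<And>t. t \<in> {0..1} \<Longrightarrow> (\<Sum>s\<in>T. \<theta> s t) > 0"
    by (rule partition_of_unity_real[of \<epsilon>, OF eps]) blast
  define \<Theta> where "\<Theta> t = (\<Sum>s\<in>T. \<theta> s t)" for t
  define w where "w s i t = (if t \<in> ball s (\<epsilon> s) then \<theta> s t * \<mu> s i t else 0)" for s i t
  have w: "smooth_open UNIV (w s i)" if "i < r s" for s i
    unfolding w_def[abs_def] by (rule smooth_extend_by_zero[OF eps \<theta> \<mu>[OF that]])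
  have Th: "smooth_open UNIV \<Theta>" unfolding \<Theta>_def[abs_def] by (intro smooth_open_sum \<theta>(1)) auto
  have Th0: "\<Theta> t \<noteq> 0" if "0 \<le> t" "t \<le> 1" for t using pos[of t] that by (simp add: \<Theta>_def)
  \<comment> \<open>Division by \<Theta> normalises the weights; \<Theta> is known to be positive on
    [0,1], which are the times seen by \<open>Cc_time\<close>.\<close>
  define f where "f z t = (\<Sum>s\<in>T. \<Sum>i<r s. (w s i t * inverse (\<Theta> t)) * b s i z)" for z t
  have snd: "smooth_on (A \<times> {0..1}) (\<lambda>w. g (snd w))" if "smooth_open UNIV g"
    for g :: "real \<Rightarrow> real" and A :: "'f set"
    by (rule smooth_on_compose[OF smooth_on_snd[OF smooth_on_id] smooth_open_imp_smooth_on[OF that]]) auto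
  have fC: "f \<in> Cc_time M"
  proof (rule Cc_timeI[OF smM])
    show "compactin (Top M) (\<Union>(K ` T))" by (rule compactin_Union) (use T K in auto)
    show "x \<in> \<Union>(K ` T)" if "f x t \<noteq> 0" for x t
    proof (rule ccontr)
      assume "x \<notin> \<Union>(K ` T)"
      then have "f x t = 0" unfolding f_def using bK by (intro sum.neutral ballI) fastforce
      with that show False by simp
    qed
    fix U \<phi> assume ch: "(U, \<phi>) \<in> Atlas M"
    have UM: "U \<inter> pts M = U" using ch smM mfd_chart.U_pts[of M U \<phi>] by (auto simp: mfd_chart_def)
    have bs: "smooth_on (\<phi> ` U \<times> {0..1}) (\<lambda>w::'f \<times> real. b s i (inv_into U \<phi> (fst w)))" if "i < r s" for s i
    proof -
      have "smooth_on (\<phi> ` U) (\<lambda>z. b s i (inv_into U \<phi> z))"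
        using smooth_fun_onD[OF CinfD(1)[OF bC[OF that]] ch] UM by (simp add: o_def)
      then show ?thesis by (rule smooth_on_compose[rotated]) (auto intro!: smooth_intros)
    qed
    have "smooth_on (\<phi> ` U \<times> {0..1}) (\<lambda>v::'f \<times> real. \<Sum>s\<in>T. \<Sum>i<r s.
        (w s i (snd v) * inverse (\<Theta> (snd v))) * b s i (inv_into U \<phi> (fst v)))"
      by (intro smooth_on_sum smooth_on_mult smooth_on_inverse snd w Th bs) (auto simp: Th0)
    then show "smooth_on (\<phi> ` U \<times> {0..1}) (\<lambda>(z, t). f (inv_into U \<phi> z) t)"
      by (rule smooth_on_cong) (auto simp: f_def)
  qed
  moreover have "H.br (G t) h (c t) = H.br (pb (\<lambda>b. f b t)) h (c t)" if t: "t \<in> {0..1}" and h: "h \<in> Cinf S" for t h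
  proof -
    have pbC: "pb (b s i) \<in> Cinf S" if "i < r s" for s i using pb_Cinf bC that by blast
    \<comment> \<open>The factor 1 brings the outer sum into the shape expected by
      \<open>br_sum\<close>.\<close>
    have e: "pb (\<lambda>b. f b t) = (\<lambda>x. \<Sum>s\<in>T. 1 * (\<Sum>i<r s. (w s i t * inverse (\<Theta> t)) * pb (b s i) x))"
      by (auto simp: pullback_fun_def f_def)
    have "H.br (pb (\<lambda>b. f b t)) h (c t) = (\<Sum>s\<in>T. 1 * H.br (\<lambda>x. \<Sum>i<r s. (w s i t * inverse (\<Theta> t)) * pb (b s i) x) h (c t))"
      unfolding e by (intro H.br_sum Cinf_sum Cinf_cmult pbC) auto
    also have "\<dots> = (\<Sum>s\<in>T. \<theta> s t * inverse (\<Theta> t) * H.br (G t) h (c t))"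
    proof (rule sum.cong)
      fix s assume "s \<in> T"
      have "H.br (\<lambda>x. \<Sum>i<r s. (w s i t * inverse (\<Theta> t)) * pb (b s i) x) h (c t)
          = (\<Sum>i<r s. (w s i t * inverse (\<Theta> t)) * H.br (pb (b s i)) h (c t))"
        by (intro H.br_sum pbC) auto
      also have "\<dots> = \<theta> s t * inverse (\<Theta> t) * H.br (G t) h (c t)"
      proof (cases "t \<in> ball s (\<epsilon> s)")
        case True
        then show ?thesis unfolding comb[OF True h] by (simp add: w_def sum_distrib_left mult_ac)
      next
        case False
        then have "\<theta> s t = 0" using eps[of s] by (intro \<theta>(2)) (auto simp: dist_real_def abs_minus_commute)
        with False show ?thesis by (simp add: w_def)
      qed
      finally show "1 * H.br (\<lambda>x. \<Sum>i<r s. (w s i t * inverse (\<Theta> t)) * pb (b s i) x) h (c t)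
          = \<theta> s t * inverse (\<Theta> t) * H.br (G t) h (c t)" by simp
    qed simp
    also have "\<dots> = \<Theta> t * inverse (\<Theta> t) * H.br (G t) h (c t)"
      by (simp add: \<Theta>_def sum_distrib_right)
    also have "\<dots> = H.br (G t) h (c t)" using Th0[of t] t by simp
    finally show ?thesis by simp
  qed
  ultimately show thesis using that by blast
qed

text \<open>The curve reparametrised by \<open>ramp\<close> has the same endpoints and is an
  integral curve on the whole line. Its Hamiltonian can be replaced by a basic one, for which
  \<pi>_H and \<pi>_S have the same Hamiltonian vector field.\<close>

lemma symplectic_leaf_le: "symplectic_leaf S piH x0 \<subseteq> SH_leaf S \<pi>S M p x0"
proof
  fix x1 assume "x1 \<in> symplectic_leaf S piH x0"
  then obtain f c where f: "f \<in> Cc_time S" and c: "pathin (Top S) c" "c 0 = x0" "c 1 = x1"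
    and d: "\<forall>t\<in>{0..1}. \<forall>h\<in>Cinf S. ((\<lambda>s. h (c s)) has_real_derivative
      ham S piH (pullback_fun S id (\<lambda>y. f y t)) (c t) h) (at t within {0..1})"
    unfolding symplectic_leaf_def flows_to_def by blast
  have cS: "c t \<in> pts S" if "t \<in> {0..1}" for t
    using c(1) that by (auto simp: pathin_def continuous_map_def)
  define c' where "c' t = c (ramp t)" for t
  define F where "F t = pullback_fun S id (\<lambda>y. f y t)" for t
  \<comment> \<open>The factor \<open>ramp'\<close> comes from the chain rule: c \<circ> ramp is an
    integral curve of the reparametrised and rescaled Hamiltonian.\<close>
  define G where "G t = (\<lambda>x. ramp' t * F (ramp t) x)" for t
  have FC: "F t \<in> Cinf S" if "t \<in> {0..1}" for t unfolding F_def by (rule Cc_time_slice[OF smS f that])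
  have GC: "G t \<in> Cinf S" for t unfolding G_def by (intro Cinf_cmult FC ramp(3))
  have rc: "continuous_on UNIV ramp" by (rule smooth_open_continuous_on[OF smooth_ramp])
  have c'C: "continuous_map euclideanreal (Top S) c'"
  proof -
    have "continuous_map euclideanreal (top_of_set {0..1}) ramp"
      using rc ramp(3) by (auto simp: continuous_map_in_subtopology)
    from continuous_map_compose[OF this c(1)[unfolded pathin_def]] show ?thesis by (simp add: c'_def[abs_def] o_def)
  qed
  have flow: "((\<lambda>s. h (c' s)) has_real_derivative H.br (G t) h (c' t)) (at t)" if h: "h \<in> Cinf S" for t h
  proof -
    have t: "ramp t \<in> {0..1}" by (rule ramp(3))
    have "ham S piH (F (ramp t)) (c (ramp t)) h = H.br (F (ramp t)) h (c (ramp t))"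
      using h cS[OF t] by (simp add: ham_def bracket_def sharp_def)
    then have "((\<lambda>s. h (c s)) has_real_derivative H.br (F (ramp t)) h (c (ramp t))) (at (ramp t) within {0..1})"
      using d[rule_format, OF t h] unfolding F_def by (simp only:)
    \<comment> \<open>The derivative of h \<circ> c is one-sided at 0 and 1, but \<open>ramp\<close>
      takes values in [0,1], so the chain rule within its range yields a two-sided
      derivative.\<close>
    then have "((\<lambda>s. h (c s)) has_real_derivative H.br (F (ramp t)) h (c (ramp t))) (at (ramp t) within ramp ` UNIV)"
      by (rule has_field_derivative_subset) (use ramp(3) in auto)
    from DERIV_image_chain[OF this ramp_derivative]
    have "((\<lambda>s. h (c (ramp s))) has_real_derivative H.br (F (ramp t)) h (c (ramp t)) * ramp' t) (at t)"
      by (simp add: o_def)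
    moreover have "H.br (G t) h (c' t) = ramp' t * H.br (F (ramp t)) h (c (ramp t))"
      unfolding G_def c'_def by (rule H.br_cmult[OF FC[OF t]])
    ultimately show ?thesis by (simp add: c'_def mult.commute)
  qed
  have Gs: "smooth_on (\<phi> ` U \<times> UNIV) (\<lambda>(z, t). G t (inv_into U \<phi> z))" if ch: "(U, \<phi>) \<in> Atlas S" for U \<phi>
  proof -
    have iS: "inv_into U \<phi> (\<phi> x) \<in> pts S" if "x \<in> U" for x
      using ch smS mfd_chart.U_pts[of S U \<phi>] inv_into_into[of "\<phi> x" \<phi> U] that by (auto simp: mfd_chart_def)
    have r: "smooth_on (\<phi> ` U \<times> UNIV) (\<lambda>w. g (snd w))" if "smooth_open UNIV g" for g :: "real \<Rightarrow> real"
      by (rule smooth_on_compose[OF smooth_on_snd[OF smooth_on_id] smooth_open_imp_smooth_on[OF that]]) auto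
    have "smooth_on (\<phi> ` U \<times> UNIV) (\<lambda>w::'e \<times> real. (\<lambda>(z, t). f (inv_into U \<phi> z) t) (fst w, ramp (snd w)))"
      by (rule smooth_on_compose[OF _ Cc_timeD[OF f ch]])
        (use ramp(3) in \<open>auto intro!: smooth_on_Pair smooth_on_fst smooth_on_id r smooth_ramp\<close>)
    then have "smooth_on (\<phi> ` U \<times> UNIV) (\<lambda>w::'e \<times> real. ramp' (snd w) *
        (\<lambda>(z, t). f (inv_into U \<phi> z) t) (fst w, ramp (snd w)))"
      by (intro smooth_on_mult r smooth_ramp')
    then show ?thesis
      by (rule smooth_on_cong) (use iS in \<open>auto simp: G_def F_def pullback_fun_def\<close>)
  qed
  obtain g where g: "g \<in> Cc_time M"
    "\<forall>t\<in>{0..1}. \<forall>h\<in>Cinf S. H.br (G t) h (c' t) = H.br (pb (\<lambda>b. g b t)) h (c' t)"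
    by (rule flow_basic[OF c'C GC Gs flow])
  have "((\<lambda>s. h (c' s)) has_real_derivative ham S \<pi>S (pb (\<lambda>b. g b t)) (c' t) h) (at t within {0..1})"
    if t: "t \<in> {0..1}" and h: "h \<in> Cinf S" for t h
  proof -
    have "H.br (G t) h (c' t) = Sb.br (pb (\<lambda>b. g b t)) h (c' t)"
      using g(2) t h br_H_pb_time[OF g(1) t] by simp
    also have "\<dots> = ham S \<pi>S (pb (\<lambda>b. g b t)) (c' t) h"
      using cS[OF ramp(3)] h by (simp add: ham_def bracket_def sharp_def c'_def)
    finally show ?thesis using has_field_derivative_at_within[OF flow[OF h]] by metis
  qed
  moreover have "pathin (Top S) c'"
    unfolding pathin_def by (rule continuous_map_from_subtopology[OF c'C])
  moreover have "c' 0 = x0" "c' 1 = x1" using c ramp by (simp_all add: c'_def)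
  ultimately show "x1 \<in> SH_leaf S \<pi>S M p x0"
    unfolding SH_leaf_def flows_to_def using g(1) by blast
qed

lemma leaves_piH: "leaves_are_SH S \<pi>S M p piH"
  unfolding leaves_are_SH_def
  using symplectic_leaf_le SH_leaf_le leaf_tangent_piH leaf_form_piH by blast

end

theorem theorem3p18:
  fixes S :: "('a, 'e::euclidean_space) mfd" and \<pi>S :: "'a bivector"
    and M :: "('b, 'f::euclidean_space) mfd" and \<pi>M :: "'b bivector"
    and p :: "'a \<Rightarrow> 'b"
  assumes "poisson_submersion S \<pi>S M \<pi>M p"
    and "poisson_fibres S \<pi>S M p"
  shows
    "(orthogonal_pencil S \<pi>S M \<pi>M p \<longleftrightarrow>
        (\<exists>\<pi>H. poisson_structure S \<pi>H \<and> leaves_are_SH S \<pi>S M p \<pi>H)) \<and>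
     ((\<exists>\<pi>H. poisson_structure S \<pi>H \<and> leaves_are_SH S \<pi>S M p \<pi>H) \<longleftrightarrow>
        (\<exists>\<pi>V. poisson_structure S \<pi>V \<and> vertical_bivector S M p \<pi>V \<and>
           restricts_to_fibres S \<pi>S M p \<pi>V)) \<and>
     ((\<exists>\<pi>V. poisson_structure S \<pi>V \<and> vertical_bivector S M p \<pi>V \<and>
           restricts_to_fibres S \<pi>S M p \<pi>V) \<longleftrightarrow>
        smooth_subbundle S (vert_family S \<pi>S M p))"
proof -
  interpret poisson_fib S \<pi>S M \<pi>M p by unfold_locales (rule assms)+
  have sf: "smooth_fib S \<pi>S M \<pi>M p" if smooth_split
    using that by unfold_locales
  have "orthogonal_pencil S \<pi>S M \<pi>M p \<longleftrightarrow> smooth_split"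
    using pencil_imp_smooth_split smooth_fib.pencil[OF sf] by blast
  moreover have "(\<exists>\<pi>H. poisson_structure S \<pi>H \<and> leaves_are_SH S \<pi>S M p \<pi>H) \<longleftrightarrow> smooth_split"
    using leaves_imp_smooth_split smooth_fib.poisson_piH[OF sf] smooth_fib.leaves_piH[OF sf]
    unfolding poisson_structure_def by blast
  moreover have "(\<exists>\<pi>V. poisson_structure S \<pi>V \<and> vertical_bivector S M p \<pi>V \<and> restricts_to_fibres S \<pi>S M p \<pi>V) \<longleftrightarrow> smooth_split"
    using fibrewise_imp_smooth_split smooth_fib.poisson_piV[OF sf] smooth_fib.vertical_piV[OF sf]
      smooth_fib.piV_restricts[OF sf] unfolding poisson_structure_def by blast
  moreover have "smooth_subbundle S (vert_family S \<pi>S M p) \<longleftrightarrow> smooth_split"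
    using smooth_split_imp_subbundle subbundle_imp_smooth_split by blast
  ultimately show ?thesis by simp
qed

end
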